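(* Let $d\ge 3$ be odd, $0<a_0<a_1$, $b\in\mathbb{R}^{d-1}$ with positive entries, and $r\ge 0$. Let $\Psi\in L_1(\mathbb{R}^d)\cap L_2(\mathbb{R}^d)$ be an admissible shearlet which is a Schwartz function with $\operatorname{supp}\hat\Psi\subseteq([-a_1,-a_0]\cup[a_0,a_1])\times\prod_{i=1}^{d-1}[-b_i,b_i]$. Let $\Phi\in L_1(\mathbb{R}^d)\cap L_2(\mathbb{R}^d)$ be given by $$\hat\Phi(\xi)=\xi_1^{\frac{d-1}{2}}\Bigl(\int_{\mathbb{R}\setminus[-|\xi_1|,|\xi_1|]}\frac{|\hat\Psi(\omega_1,\tilde\xi)|^2}{|\omega_1|^d}\,d\omega_1\Bigr)^{1/2},\qquad \xi=(\xi_1,\tilde\xi),$$ such that $$\int_{\mathbb{R}^{d-1}}\frac{|\hat\Phi(y,\sigma)|^2}{|y|^{d-1}}\,d\sigma+\int_{\mathbb{R}^{d-1}}\int_{-|y|}^{|y|}\frac{|\hat\Psi(\xi_1,\tilde\xi)|^2}{|\xi_1|^d}\,d\xi_1\,d\tilde\xi=1\quad\text{for almost every }y\in\mathbb{R},$$ and assume $\hat\Phi\in C_0^\infty(\mathbb{R}^d)$. Let $\mathfrak{F}=\{\psi_x\}_{x\in X}$ be the inhomogeneous shearlet frame generated by $\Phi,\Psi$. Let $1\le p<\infty$ and $1<\sigma,\tau\le 2$ with $p<\sigma'$ and $p<\tau'$. Then $$\mathcal{SC}^r_{\mathfrak{F},\tau,p}=\mathcal{SC}^r_{\mathfrak{F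},\sigma,p}.$$
   Context: Fourier transform: $\hat f(\omega)=\int_{\mathbb{R}^d}f(x)e^{-2\pi i\omega\cdot x}\,dx$. A function $\Psi\in L_2(\mathbb{R}^d)$ is an admissible shearlet if $\int_{\mathbb{R}^d}|\hat\Psi(\omega)|^2|\omega_1|^{-d}\,d\omega<\infty$. $\tau'=\tau/(\tau-1)$ is the Hölder dual exponent. For $a\in\mathbb{R}\setminus\{0\}$ let $A_a=\begin{pmatrix}a&0\\0&\operatorname{sign}(a)|a|^{1/d}I_{d-1}\end{pmatrix}$ and for $s\in\mathbb{R}^{d-1}$ let $S_s=\begin{pmatrix}1&s^T\\0&I_{d-1}\end{pmatrix}$. Parameter space: $X=(\{\infty\}\times\mathbb{R}^{d-1}\times\mathbb{R}^d)\cup([-1,1]^*\times\mathbb{R}^{d-1}\times\mathbb{R}^d)$, where $[-1,1]^*=[-1,1]\setminus\{0\}$ and $\infty$ is an isolated point, with the Borel measure $\mu$ given by $$\int_XF\,d\mu=\int_{\mathbb{R}^d}\int_{\mathbb{R}^{d-1}}F(\infty,s,t)\,ds\,dt+\int_{\mathbb{R}^d}\int_{\mathbb{R}^{d-1}}\int_{-1}^1F(a,s,t)\,\frac{da}{|a|^{d+1}}\,ds\,dt.$$ The system generated by $\Phi,\Psi$: $\psi_{(\infty,s,t)}=\Phi(S_s^{-1}(\cdot-t))$ and $\psi_{(a,s,t)}=|\det A_a|^{-1/2}\Psi(A_a^{-1}S_s^{-1}(\cdot-t))$ for $a\in[-1,1]^*$. Weight: $v_r(\infty,s,t)=1$, $v_r(a,s,t)=|a|^{-r}$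 for $a\in[-1,1]^*$. $L_{p,v}(X,\mu)$ has norm $\|F\|_{L_{p,v}}=\|Fv\|_{L_p(X,\mu)}$. Shearlet transform: $\mathcal{SH}_{\mathfrak{F}}f(x)=\langle f,\psi_x\rangle$ for $f\in L_2(\mathbb{R}^d)$. Test functions: $\mathcal{H}_{\tau,v}=\{f\in L_2(\mathbb{R}^d):\mathcal{SH}_{\mathfrak{F}}f\in L_{\tau,v}(X,\mu)\}$ with norm $\|\mathcal{SH}_{\mathfrak{F}}f\|_{L_{\tau,v}}$. $(\mathcal{H}_{\tau,v})^\sim$ is its anti-dual (continuous conjugate-linear functionals); for $f\in(\mathcal{H}_{\tau,v})^\sim$, $\mathcal{SH}_{\mathfrak{F},\tau}f(x)=f(\psi_x)$. Shearlet coorbit spaces: $\mathcal{SC}^r_{\mathfrak{F},\tau,p}=\{f\in(\mathcal{H}_{\tau,v_r})^\sim:\mathcal{SH}_{\mathfrak{F},\tau}f\in L_{p,v_r}(X,\mu)\}$ with norm $\|\mathcal{SH}_{\mathfrak{F},\tau}f\|_{L_{p,v_r}}$. Convention: elements of anti-duals for different $\tau$ are identified when they have the same transform $x\mapsto f(\psi_x)$ on $X$; equality of the spaces is understood under this identification. *)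

theory Defs
  imports "HOL-Analysis.Analysis"
begin

text \<open>
  With \<open>d = CARD('n option)\<close>, the space of \<open>d\<close>-dimensional real vectors is
  \<open>real ^ 'n option\<close>: the index \<open>None\<close> is the distinguished first coordinate and the indices
  \<open>Some i\<close> with \<open>i :: 'n\<close> are the remaining \<open>d - 1 = CARD('n)\<close> ones. Elements of function
  spaces are represented by functions, not by classes modulo null sets.
\<close>

definition vcons :: "real \<Rightarrow> real ^ 'n \<Rightarrow> real ^ 'n option" where
  "vcons a v = (\<chi> i. case i of None \<Rightarrow> a | Some j \<Rightarrow> v $ j)"

definition vtail :: "real ^ 'n option \<Rightarrow> real ^ 'n" where
  "vtail x = (\<chi> j. x $ Some j)"


subsection \<open>Functions on Euclidean space\<close>

definition L1_fun :: "('a::euclidean_space \<Rightarrow> complex) set" where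
  "L1_fun = {f. integrable lborel f}"

definition L2_fun :: "('a::euclidean_space \<Rightarrow> complex) set" where
  "L2_fun = {f. f \<in> borel_measurable lborel \<and> integrable lborel (\<lambda>x. (cmod (f x))\<^sup>2)}"

definition L2_inner :: "('a::euclidean_space \<Rightarrow> complex) \<Rightarrow> ('a \<Rightarrow> complex) \<Rightarrow> complex" where
  "L2_inner f g = (\<integral>x. f x * cnj (g x) \<partial>lborel)"

definition fourier :: "('a::euclidean_space \<Rightarrow> complex) \<Rightarrow> 'a \<Rightarrow> complex" where
  "fourier f \<omega> = (\<integral>x. f x * exp (- (2 * of_real pi * \<i> * of_real (\<omega> \<bullet> x))) \<partial>lborel)"

definition supp :: "('a::topological_space \<Rightarrow> complex) \<Rightarrow> 'a set" where
  "supp f = closure {x. f x \<noteq> 0}"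

definition partial_deriv :: "'m::finite \<Rightarrow> (real ^ 'm \<Rightarrow> complex) \<Rightarrow> real ^ 'm \<Rightarrow> complex" where
  "partial_deriv i f x = frechet_derivative f (at x) (axis i 1)"

primrec iter_partial :: "'m::finite list \<Rightarrow> (real ^ 'm \<Rightarrow> complex) \<Rightarrow> real ^ 'm \<Rightarrow> complex" where
  "iter_partial [] f = f"
| "iter_partial (i # is) f = partial_deriv i (iter_partial is f)"

text \<open>
  Total differentiability of every iterated partial derivative makes all of them continuous, so
  this is the usual class of infinitely differentiable functions.
\<close>

definition smooth_fun :: "(real ^ 'm::finite \<Rightarrow> complex) \<Rightarrow> bool" where
  "smooth_fun f \<longleftrightarrow> (\<forall>is x. iter_partial is f differentiable (at x))"

definition schwartz_fun :: "(real ^ 'm::finite \<Rightarrow> complex) \<Rightarrow> bool" where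
  "schwartz_fun f \<longleftrightarrow> smooth_fun f \<and>
     (\<forall>(k::nat) is. \<exists>C. \<forall>x. norm x ^ k * cmod (iter_partial is f x) \<le> C)"

definition test_fun :: "(real ^ 'm::finite \<Rightarrow> complex) \<Rightarrow> bool" where
  "test_fun f \<longleftrightarrow> smooth_fun f \<and> compact (supp f)"

definition hoelder_dual :: "real \<Rightarrow> real" where
  "hoelder_dual \<tau> = \<tau> / (\<tau> - 1)"


subsection \<open>Shearlets\<close>

text \<open>
  The Fourier transform is given by its integral, hence admissibility is only defined for
  functions that are also integrable.
\<close>

definition admissible_shearlet :: "(real ^ 'n::finite option \<Rightarrow> complex) \<Rightarrow> bool" where
  "admissible_shearlet \<Psi> \<longleftrightarrow> \<Psi> \<in> L1_fun \<inter> L2_fun \<and>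
     (\<integral>\<^sup>+\<omega>. ennreal ((cmod (fourier \<Psi> \<omega>))\<^sup>2 / \<bar>\<omega> $ None\<bar> ^ CARD('n option)) \<partial>lborel) < \<infinity>"

definition dilation :: "real \<Rightarrow> real ^ 'n::finite option ^ 'n option" where
  "dilation a = (\<chi> i j. if i \<noteq> j then 0
     else if i = None then a else sgn a * \<bar>a\<bar> powr (1 / real CARD('n option)))"

definition shear :: "real ^ 'n::finite \<Rightarrow> real ^ 'n option ^ 'n option" where
  "shear s = (\<chi> i j. if i = j then 1
     else (case (i, j) of (None, Some k) \<Rightarrow> s $ k | _ \<Rightarrow> 0))"

text \<open>
  The scale ranges over the subset \<open>[-1,1] - {0}\<close> together with \<open>\<infinity>\<close> of the extended reals, in which
  \<open>\<infinity>\<close> is isolated; so the Borel sets of the parameter space are those of the subspace topology.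
\<close>

type_synonym 'n param = "ereal \<times> (real ^ 'n) \<times> (real ^ 'n option)"

definition param_space :: "'n::finite param set" where
  "param_space = ({\<infinity>} \<union> ereal ` ({-1..1} - {0})) \<times> UNIV \<times> UNIV"

definition param_integral :: "('n::finite param \<Rightarrow> ennreal) \<Rightarrow> ennreal" where
  "param_integral F =
     (\<integral>\<^sup>+t. (\<integral>\<^sup>+s. F (\<infinity>, s, t) \<partial>lborel) \<partial>lborel) +
     (\<integral>\<^sup>+t. (\<integral>\<^sup>+s. (\<integral>\<^sup>+a. F (ereal a, s, t) * ennreal (1 / \<bar>a\<bar> ^ (CARD('n option) + 1))
        * indicator ({-1..1} - {0}) a \<partial>lborel) \<partial>lborel) \<partial>lborel)"

definition param_measure :: "'n::finite param measure" where
  "param_measure = measure_of param_space (sets (restrict_space borel param_space))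
     (\<lambda>E. param_integral (indicator E))"

definition shearlet ::
  "(real ^ 'n::finite option \<Rightarrow> complex) \<Rightarrow> (real ^ 'n option \<Rightarrow> complex) \<Rightarrow>
   'n param \<Rightarrow> real ^ 'n option \<Rightarrow> complex" where
  "shearlet \<Phi> \<Psi> = (\<lambda>(a, s, t) y.
     if a = \<infinity> then \<Phi> (matrix_inv (shear s) *v (y - t))
     else let A = dilation (real_of_ereal a) in
       of_real (\<bar>det A\<bar> powr (- (1 / 2))) *
         \<Psi> (matrix_inv A *v (matrix_inv (shear s) *v (y - t))))"

definition weight :: "real \<Rightarrow> 'n::finite param \<Rightarrow> real" where
  "weight r = (\<lambda>(a, s, t). if a = \<infinity> then 1 else \<bar>real_of_ereal a\<bar> powr (- r))"


subsection \<open>Shearlet coorbit spaces\<close>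

definition Lpv :: "real \<Rightarrow> ('n::finite param \<Rightarrow> real) \<Rightarrow> ('n param \<Rightarrow> complex) set" where
  "Lpv p v = {F. F \<in> borel_measurable param_measure \<and>
     (\<integral>\<^sup>+x. ennreal ((cmod (F x) * v x) powr p) \<partial>param_measure) < \<infinity>}"

definition Lpv_norm :: "real \<Rightarrow> ('n::finite param \<Rightarrow> real) \<Rightarrow> ('n param \<Rightarrow> complex) \<Rightarrow> real" where
  "Lpv_norm p v F =
     enn2real (\<integral>\<^sup>+x. ennreal ((cmod (F x) * v x) powr p) \<partial>param_measure) powr (1 / p)"

definition shearlet_transform ::
  "('n::finite param \<Rightarrow> real ^ 'n option \<Rightarrow> complex) \<Rightarrow> (real ^ 'n option \<Rightarrow> complex) \<Rightarrow>
   'n param \<Rightarrow> complex" where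
  "shearlet_transform \<psi> f x = L2_inner f (\<psi> x)"

definition test_space ::
  "('n::finite param \<Rightarrow> real ^ 'n option \<Rightarrow> complex) \<Rightarrow> real \<Rightarrow> ('n param \<Rightarrow> real) \<Rightarrow>
   (real ^ 'n option \<Rightarrow> complex) set" where
  "test_space \<psi> \<tau> v = {f \<in> L2_fun. shearlet_transform \<psi> f \<in> Lpv \<tau> v}"

definition test_norm ::
  "('n::finite param \<Rightarrow> real ^ 'n option \<Rightarrow> complex) \<Rightarrow> real \<Rightarrow> ('n param \<Rightarrow> real) \<Rightarrow>
   (real ^ 'n option \<Rightarrow> complex) \<Rightarrow> real" where
  "test_norm \<psi> \<tau> v f = Lpv_norm \<tau> v (shearlet_transform \<psi> f)"

text \<open>
  Boundedness forces a functional to agree on functions that are equal almost everywhere, so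
  these are exactly the continuous conjugate-linear functionals on the space of classes.
  Extensionality makes a functional determined by its values on the test space.
\<close>

definition anti_dual ::
  "('n::finite param \<Rightarrow> real ^ 'n option \<Rightarrow> complex) \<Rightarrow> real \<Rightarrow> ('n param \<Rightarrow> real) \<Rightarrow>
   ((real ^ 'n option \<Rightarrow> complex) \<Rightarrow> complex) set" where
  "anti_dual \<psi> \<tau> v = {f \<in> extensional (test_space \<psi> \<tau> v).
     (\<forall>g\<in>test_space \<psi> \<tau> v. \<forall>h\<in>test_space \<psi> \<tau> v. f (\<lambda>y. g y + h y) = f g + f h) \<and>
     (\<forall>c. \<forall>g\<in>test_space \<psi> \<tau> v. f (\<lambda>y. c * g y) = cnj c * f g) \<and>
     (\<exists>C. \<forall>g\<in>test_space \<psi> \<tau> v. cmod (f g) \<le> C * test_norm \<psi> \<tau> v g)}"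

definition dual_transform ::
  "('n::finite param \<Rightarrow> real ^ 'n option \<Rightarrow> complex) \<Rightarrow>
   ((real ^ 'n option \<Rightarrow> complex) \<Rightarrow> complex) \<Rightarrow> 'n param \<Rightarrow> complex" where
  "dual_transform \<psi> f = (\<lambda>x\<in>param_space. f (\<psi> x))"

definition coorbit ::
  "('n::finite param \<Rightarrow> real ^ 'n option \<Rightarrow> complex) \<Rightarrow> real \<Rightarrow> real \<Rightarrow> real \<Rightarrow>
   ((real ^ 'n option \<Rightarrow> complex) \<Rightarrow> complex) set" where
  "coorbit \<psi> r \<tau> p =
     {f \<in> anti_dual \<psi> \<tau> (weight r). dual_transform \<psi> f \<in> Lpv p (weight r)}"

text \<open>
  Elements of different anti-duals are identified if they have the same transform; two sets
  of functionals are equal under this identification iff their images under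
  \<open>dual_transform\<close> coincide.
\<close>

definition equal_under_transform ::
  "('n::finite param \<Rightarrow> real ^ 'n option \<Rightarrow> complex) \<Rightarrow>
   ((real ^ 'n option \<Rightarrow> complex) \<Rightarrow> complex) set \<Rightarrow>
   ((real ^ 'n option \<Rightarrow> complex) \<Rightarrow> complex) set \<Rightarrow> bool" where
  "equal_under_transform \<psi> S T \<longleftrightarrow> dual_transform \<psi> ` S = dual_transform \<psi> ` T"

end

theory Submission
  imports Defs "HOL-Probability.Probability"
begin

text \<open>
  The kernel \<open>K x y = \<langle>\<psi>\<^sub>x, \<psi>\<^sub>y\<rangle>\<close> reproduces itself, and its rows are bounded in \<open>L\<^sub>q(\<mu>)\<close> for every
  \<open>q > 1\<close>. Indeed, on the Fourier side two elements interact only if their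
  scales and shears are comparable, apart from pairs of low-pass elements. Since the Fourier
  transform of \<open>\<Phi>\<close> vanishes to order \<open>(d - 1) / 2\<close> at \<open>\<xi>\<^sub>1 = 0\<close>, the latter decay in the difference of
  the shears just fast enough for every \<open>q > 1\<close>.

  A functional \<open>f\<close> in the anti-dual of the test space for \<open>\<tau>\<close> is a limit of integrals against
  densities that are bounded in \<open>L\<^bsub>\<tau>'\<^esub>\<close>, so its transform \<open>F\<close> satisfies \<open>F x = \<integral>F(y) K(y, x) d\<mu>(y)\<close>
  as soon as \<open>F \<in> L\<^sub>p\<close> with \<open>p < \<tau>'\<close>. The kernel bounds then make \<open>F\<close> bounded, hence a member
  of \<open>L\<^bsub>\<sigma>'\<^esub>\<close>, and integration against \<open>F\<close> is a functional on the test space for \<open>\<sigma>\<close> with the same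
  transform.
\<close>

section \<open>The Fourier transform\<close>

text \<open>The obstacle is the exponent 1. For two low-pass elements whose shears differ by u, the
  product of their Fourier transforms has a zero of order d - 1 in the first frequency and lives
  where that frequency is O(1/|u|). This gives a supremum over translations of order |u|^(-d) and an
  L_1 norm in the translation of order |u|^(-(d-1)), hence |u|^(-d(q-1)-(d-1)) for the q-th powers.
  Over R^(d-1) this is integrable for q > 1, while at q = 1 the bound diverges logarithmically. The
  limit in the reproducing formula is therefore taken on the set where |K| exceeds a threshold; off
  that set a small surplus power of |K| makes the contribution uniformly small. Odd d makes (d - 1)
  / 2 an integer m with 2m equal to the number of shear parameters.\<close>

definition wave :: "real \<Rightarrow> complex" where
  "wave t = cis (2 * pi * t)"

lemma norm_wave [simp]: "cmod (wave t) = 1"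
  by (simp add: wave_def)

lemma wave_0 [simp]: "wave 0 = 1"
  by (simp add: wave_def)

lemma wave_add: "wave (s + t) = wave s * wave t"
  by (simp add: wave_def cis_mult distrib_left)

lemma wave_minus: "wave (- t) = cnj (wave t)"
  by (simp add: wave_def cis_cnj)

lemma wave_diff: "wave (s - t) = wave s * cnj (wave t)"
  using wave_add[of s "- t"] by (simp add: wave_minus)

lemma wave_cancel [simp]: "cnj (wave t) * wave t = 1"
  by (simp add: wave_def cis_cnj cis_mult)

lemma continuous_wave [continuous_intros]:
  "continuous_on A f \<Longrightarrow> continuous_on A (\<lambda>x. wave (f x))"
  unfolding wave_def cis_conv_exp by (intro continuous_intros)

lemma borel_measurable_wave [measurable]:
  "f \<in> borel_measurable M \<Longrightarrow> (\<lambda>x. wave (f x)) \<in> borel_measurable M"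
  by (rule measurable_compose[of f M borel])
     (auto intro!: borel_measurable_continuous_onI continuous_intros)

lemma fourier_wave: "fourier f \<omega> = (\<integral>x. f x * wave (- (\<omega> \<bullet> x)) \<partial>lborel)"
  unfolding fourier_def wave_def cis_conv_exp by (simp add: algebra_simps)

section \<open>Integrability criteria and affine changes of variable\<close>

lemma integrable_norm_bound:
  fixes f :: "'a \<Rightarrow> complex" and g :: "'a \<Rightarrow> complex"
  assumes "integrable M g" "f \<in> borel_measurable M" "\<And>x. x \<in> space M \<Longrightarrow> cmod (f x) \<le> cmod (g x)"
  shows "integrable M f"
  using assms(1,2) by (rule Bochner_Integration.integrable_bound) (simp add: assms(3))

lemma integrable_mult_bounded:
  fixes f g :: "'a \<Rightarrow> complex"
  assumes f: "integrable M f" and g: "g \<in> borel_measurable M" "\<And>x. x \<in> space M \<Longrightarrow> cmod (g x) \<le> B"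
  shows "integrable M (\<lambda>x. f x * g x)"
proof (rule integrable_norm_bound[where g="\<lambda>x. f x * of_real B"])
  show "integrable M (\<lambda>x. f x * of_real B)" using f by simp
  show "(\<lambda>x. f x * g x) \<in> borel_measurable M" using f g by measurable
  show "cmod (f x * g x) \<le> cmod (f x * of_real B)" if "x \<in> space M" for x
    unfolding norm_mult using g(2)[OF that] by (auto intro!: mult_left_mono)
qed

lemma integrable_mult_wave:
  fixes f :: "'a \<Rightarrow> complex"
  assumes "integrable M f" "g \<in> borel_measurable M"
  shows "integrable M (\<lambda>x. f x * wave (g x))"
  using assms by (intro integrable_mult_bounded[where B=1]) auto

lemma (in pair_sigma_finite) integrable_tensor:
  fixes f :: "'a \<Rightarrow> complex" and g :: "'b \<Rightarrow> complex"
  assumes [measurable]: "integrable M1 f" "integrable M2 g"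
  shows "integrable (M1 \<Otimes>\<^sub>M M2) (\<lambda>(x, y). f x * g y)"
proof (rule Fubini_integrable)
  show "(\<lambda>(x, y). f x * g y) \<in> borel_measurable (M1 \<Otimes>\<^sub>M M2)" by measurable
  show "integrable M1 (\<lambda>x. LINT y|M2. norm (case (x, y) of (x, y) \<Rightarrow> f x * g y))"
    by (simp add: norm_mult assms)
  show "AE x in M1. integrable M2 (\<lambda>y. case (x, y) of (x, y) \<Rightarrow> f x * g y)"
    by (simp add: assms)
qed

text \<open>Keeping the Jacobian on the side of the substituted integral frees the identity from any
  integrability hypothesis: the first claim shows that both integrands are integrable together, and
  otherwise both integrals have the default value 0. The converse in the first claim is the forward
  direction for the inverse affine map.\<close>

lemma lborel_integral_affine:
  fixes f :: "'a::euclidean_space \<Rightarrow> complex" and t :: 'a and c :: real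
  assumes "c \<noteq> 0"
  shows "integrable lborel (\<lambda>x. f (t + c *\<^sub>R x)) \<longleftrightarrow> integrable lborel f"
    and "\<bar>c\<bar> ^ DIM('a) * (\<integral>x. f (t + c *\<^sub>R x) \<partial>lborel) = (\<integral>x. f x \<partial>lborel)"
proof -
  have *: "integrable lborel f \<Longrightarrow> c \<noteq> 0 \<Longrightarrow> integrable lborel (\<lambda>x. f (t + c *\<^sub>R x))"
    for f :: "'a \<Rightarrow> complex" and t c
  proof -
    assume f: "integrable lborel f" and c: "c \<noteq> 0"
    then have [measurable]: "f \<in> borel_measurable borel" by auto
    have "integrable (density (distr lborel borel (\<lambda>x. t + c *\<^sub>R x)) (\<lambda>_. \<bar>c\<bar> ^ DIM('a))) f"
      using f lborel_affine[OF c, of t] by simp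
    then have "integrable lborel (\<lambda>x. (\<bar>c\<bar> ^ DIM('a)) *\<^sub>R f (t + c *\<^sub>R x))"
      by (simp add: integrable_density integrable_distr_eq)
    from integrable_scaleR_right[OF this, of "1 / \<bar>c\<bar> ^ DIM('a)"] show ?thesis
      using c by simp
  qed
  show 1: "integrable lborel (\<lambda>x. f (t + c *\<^sub>R x)) \<longleftrightarrow> integrable lborel f"
    using *[of f c t] *[of "\<lambda>x. f (t + c *\<^sub>R x)" "1/c" "- (1/c) *\<^sub>R t"] assms
    by (auto simp: scaleR_right_diff_distrib)
  show "\<bar>c\<bar> ^ DIM('a) * (\<integral>x. f (t + c *\<^sub>R x) \<partial>lborel) = (\<integral>x. f x \<partial>lborel)"
  proof (cases "integrable lborel f")
    case True
    then have [measurable]: "f \<in> borel_measurable borel" by auto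
    show ?thesis using assms
      by (subst (2) lborel_affine[where c=c and t=t])
         (auto simp: integral_density integral_distr scaleR_conv_of_real)
  next
    case False then show ?thesis using 1 by (simp add: not_integrable_integral_eq)
  qed
qed

lemma lborel_translate:
  fixes f :: "'a::euclidean_space \<Rightarrow> complex"
  shows "integrable lborel (\<lambda>x. f (x - t)) \<longleftrightarrow> integrable lborel f"
    and "(\<integral>x. f (x - t) \<partial>lborel) = (\<integral>x. f x \<partial>lborel)"
  using lborel_integral_affine[of 1 f "-t"] by simp_all

lemma lborel_reflect:
  fixes f :: "'a::euclidean_space \<Rightarrow> complex"
  shows "integrable lborel (\<lambda>x. f (t - x)) \<longleftrightarrow> integrable lborel f"
    and "(\<integral>x. f (t - x) \<partial>lborel) = (\<integral>x. f x \<partial>lborel)"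
  using lborel_integral_affine[of "-1" f "t"] by simp_all

text \<open>\<open>lborel\<close> is by definition the image of a finite product of one-dimensional
  measures under the coordinate map, so this is Fubini for finitely many factors. It serves to build
  a Gaussian in any dimension.\<close>

lemma lborel_integral_prod_Basis:
  fixes f :: "'a::euclidean_space \<Rightarrow> real \<Rightarrow> complex"
  assumes f: "\<And>b. b \<in> Basis \<Longrightarrow> integrable lborel (f b)"
  shows "integrable lborel (\<lambda>x. \<Prod>b\<in>Basis. f b (x \<bullet> b))"
    and "(\<integral>x. (\<Prod>b\<in>Basis. f b (x \<bullet> b)) \<partial>lborel) = (\<Prod>b\<in>Basis. \<integral>x. f b x \<partial>lborel)"
proof -
  interpret product_sigma_finite "\<lambda>_::'a. lborel :: real measure"
    by standard
  have eq: "lborel = distr (Pi\<^sub>M Basis (\<lambda>_. lborel :: real measure)) borel (\<lambda>f. \<Sum>b\<in>Basis. f b *\<^sub>R (b::'a))"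
    by (simp add: lborel_def[where 'a='a] lborel_eq_real)
  have fm: "b \<in> Basis \<Longrightarrow> f b \<in> borel_measurable borel" for b
    using f[of b] by auto
  have m: "(\<lambda>x. \<Prod>b\<in>Basis. f b (x \<bullet> b)) \<in> borel_measurable borel"
    by (intro borel_measurable_prod measurable_compose[OF _ fm]) auto
  have s: "(\<Sum>b\<in>Basis. g b *\<^sub>R b) \<bullet> c = g c" if "c \<in> Basis" for g :: "'a \<Rightarrow> real" and c
    using that by (simp add: inner_sum_left_Basis)
  have T: "(\<lambda>f. \<Sum>b\<in>Basis. f b *\<^sub>R (b::'a)) \<in> (Pi\<^sub>M Basis (\<lambda>_. lborel :: real measure)) \<rightarrow>\<^sub>M borel"
    by measurable
  show "integrable lborel (\<lambda>x. \<Prod>b\<in>Basis. f b (x \<bullet> b))"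
    using product_integrable_prod[of Basis f, OF finite_Basis f]
    by (subst eq) (simp add: integrable_distr_eq[OF T m] s cong: prod.cong)
  show "(\<integral>x. (\<Prod>b\<in>Basis. f b (x \<bullet> b)) \<partial>lborel) = (\<Prod>b\<in>Basis. \<integral>x. f b x \<partial>lborel)"
    using product_integral_prod[of Basis f, OF finite_Basis f]
    by (subst eq) (simp add: integral_distr[OF T m] s cong: prod.cong)
qed

text \<open>The transform is read off from the characteristic function of the standard normal
  distribution at 2 pi z. Up to the factor 2 pi, \<open>G\<close> is the normal density at 2 pi z,
  which is why its integral is exactly 1.\<close>

lemma gaussian_real:
  fixes z :: real
  defines "G \<equiv> \<lambda>z::real. complex_of_real (sqrt (2 * pi) * exp (- ((2 * pi * z)\<^sup>2) / 2))"
  shows "integrable lborel (\<lambda>x::real. complex_of_real (exp (- x\<^sup>2 / 2)))"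
    and "(\<integral>x. complex_of_real (exp (- (x::real)\<^sup>2 / 2)) * wave (x * z) \<partial>lborel) = G z"
    and "integrable lborel G" and "(\<integral>z. G z \<partial>lborel) = 1"
proof -
  have d: "std_normal_density x = exp (- x\<^sup>2 / 2) / sqrt (2 * pi)" for x
    by (simp add: normal_density_def)
  have i: "integrable lborel (\<lambda>x. complex_of_real (std_normal_density x))"
    by (simp add: complex_of_real_integrable_eq integrable_normal_density)
  have e: "complex_of_real (exp (- x\<^sup>2 / 2)) = of_real (sqrt (2*pi)) * of_real (std_normal_density x)" for x
    unfolding d by simp
  show 1: "integrable lborel (\<lambda>x::real. complex_of_real (exp (- x\<^sup>2 / 2)))"
    unfolding e using i by simp
  have "char std_normal_distribution (2 * pi * z) =
      (\<integral>x. std_normal_density x *\<^sub>R wave (x * z) \<partial>lborel)"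
    unfolding char_def by (subst integral_density) (auto simp: wave_def cis_conv_exp mult_ac normal_density_nonneg)
  then have "(\<integral>x. std_normal_density x *\<^sub>R wave (x * z) \<partial>lborel) = of_real (exp (- ((2 * pi * z)\<^sup>2) / 2))"
    by (simp add: char_std_normal_distribution)
  moreover have "(\<integral>x. complex_of_real (exp (- (x::real)\<^sup>2 / 2)) * wave (x * z) \<partial>lborel) =
      of_real (sqrt (2 * pi)) * (\<integral>x. std_normal_density x *\<^sub>R wave (x * z) \<partial>lborel)"
    unfolding e by (simp only: scaleR_conv_of_real mult.assoc integral_mult_right_zero)
  ultimately show "(\<integral>x. complex_of_real (exp (- (x::real)\<^sup>2 / 2)) * wave (x * z) \<partial>lborel) = G z"
    by (simp only: G_def of_real_mult)
  have G: "G = (\<lambda>z. of_real (2 * pi) * (of_real (std_normal_density (0 + (2 * pi) *\<^sub>R z))))"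
    unfolding G_def d using real_sqrt_mult_self[of "2*pi"] by (auto simp: fun_eq_iff field_simps simp flip: of_real_mult)
  show "integrable lborel G"
    unfolding G using lborel_integral_affine(1)[of "2*pi" "\<lambda>z. complex_of_real (std_normal_density z)" 0] i by simp
  have "(\<integral>z. complex_of_real (std_normal_density z) \<partial>lborel) = 1"
    using integral_normal_density[of 1 0] by (simp add: integral_complex_of_real)
  then show "(\<integral>z. G z \<partial>lborel) = 1"
    unfolding G using lborel_integral_affine(2)[of "2*pi" "\<lambda>z. complex_of_real (std_normal_density z)" 0]
    by simp
qed

text \<open>A summability kernel: \<Gamma> is an integrable damping factor equal to 1 at the origin,
  and its transform \<open>G\<close> has total mass 1, so that the L_1-normalised dilates of
  \<open>G\<close> form an approximate identity. Both are tensor products of the one-dimensional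
  pair.\<close>

lemma gaussian_kernel:
  obtains \<Gamma> G :: "'a::euclidean_space \<Rightarrow> complex"
  where "continuous_on UNIV \<Gamma>" "\<Gamma> 0 = 1" "\<And>x. cmod (\<Gamma> x) \<le> 1" "integrable lborel \<Gamma>"
    "\<And>z. (\<integral>x. \<Gamma> x * wave (x \<bullet> z) \<partial>lborel) = G z" "integrable lborel G" "(\<integral>z. G z \<partial>lborel) = 1"
proof
  let ?g = "\<lambda>x::real. complex_of_real (exp (- x\<^sup>2 / 2))"
  let ?G = "\<lambda>z::real. complex_of_real (sqrt (2 * pi) * exp (- ((2 * pi * z)\<^sup>2) / 2))"
  let ?\<Gamma> = "\<lambda>x::'a. \<Prod>b\<in>Basis. ?g (x \<bullet> b)"
  show "continuous_on UNIV ?\<Gamma>" by (intro continuous_intros) auto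
  show "?\<Gamma> 0 = 1" by simp
  show "cmod (?\<Gamma> x) \<le> 1" for x by (auto simp: prod_norm[symmetric] intro!: prod_le_1)
  show "integrable lborel ?\<Gamma>" by (rule lborel_integral_prod_Basis) (rule gaussian_real)
  show "(\<integral>x. ?\<Gamma> x * wave (x \<bullet> z) \<partial>lborel) = (\<Prod>b\<in>Basis. ?G (z \<bullet> b))" for z
  proof -
    have w: "wave (\<Sum>b\<in>B. h b) = (\<Prod>b\<in>B. wave (h b))" if "finite B" for B and h :: "'a \<Rightarrow> real"
      using that by induction (auto simp: wave_add)
    have "?\<Gamma> x * wave (x \<bullet> z) = (\<Prod>b\<in>Basis. ?g (x \<bullet> b) * wave ((x \<bullet> b) * (z \<bullet> b)))" for x
      by (subst euclidean_inner) (simp add: w prod.distrib)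
    then have "(\<integral>x. ?\<Gamma> x * wave (x \<bullet> z) \<partial>lborel) =
        (\<Prod>b\<in>Basis. \<integral>x. ?g x * wave (x * (z \<bullet> b)) \<partial>lborel)"
      by (simp only:, intro lborel_integral_prod_Basis(2)) (intro integrable_mult_wave gaussian_real, auto)
    then show ?thesis by (simp only: gaussian_real(2))
  qed
  show "integrable lborel (\<lambda>z::'a. \<Prod>b\<in>Basis. ?G (z \<bullet> b))"
    by (rule lborel_integral_prod_Basis) (rule gaussian_real)
  show "(\<integral>z. (\<Prod>b\<in>Basis. ?G ((z::'a) \<bullet> b)) \<partial>lborel) = 1"
    by (subst lborel_integral_prod_Basis(2)) (use gaussian_real in auto)
qed

lemma borel_measurable_cnj [measurable]:
  "f \<in> borel_measurable M \<Longrightarrow> (\<lambda>x. cnj (f x)) \<in> borel_measurable M"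
  by (rule measurable_compose[of f M borel]) (auto intro!: borel_measurable_continuous_onI continuous_intros)

text \<open>Tonelli with the second variable first: by translation and reflection invariance the
  inner integral of the modulus is |f x| times the L_1 norm of \<open>g\<close>.\<close>

lemma integrable_shifted_product:
  fixes f g :: "'a::euclidean_space \<Rightarrow> complex"
  assumes f: "integrable lborel f" and g: "integrable lborel g"
  shows "integrable (lborel \<Otimes>\<^sub>M lborel) (\<lambda>(x, y). f x * g (x - y))"
proof (rule lborel_pair.Fubini_integrable)
  have [measurable]: "f \<in> borel_measurable borel" "g \<in> borel_measurable borel"
    using f g by auto
  show "(\<lambda>(x, y). f x * g (x - y)) \<in> borel_measurable (lborel \<Otimes>\<^sub>M lborel)" by measurable
  have "(\<integral>y. norm (f x * g (x - y)) \<partial>lborel) = norm (f x) * (\<integral>y. norm (g y) \<partial>lborel)" for x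
  proof -
    \<comment> \<open>The reflection lemma is stated for complex functions, so the real integral is
      embedded into the complex numbers and taken back.\<close>
    have "complex_of_real (\<integral>y. norm (f x * g (x - y)) \<partial>lborel) =
        of_real (norm (f x)) * (\<integral>y. of_real (norm (g (x - y))) \<partial>lborel)"
      by (simp add: norm_mult flip: integral_complex_of_real)
    also have "\<dots> = of_real (norm (f x)) * (\<integral>y. of_real (norm (g y)) \<partial>lborel)"
      using lborel_reflect(2)[of "\<lambda>y. complex_of_real (norm (g y))"] by simp
    finally show ?thesis by (simp add: integral_complex_of_real flip: of_real_mult)
  qed
  then show "integrable lborel (\<lambda>x. \<integral>y. norm (case (x, y) of (x, y) \<Rightarrow> f x * g (x - y)) \<partial>lborel)"
    using f by simp
  show "AE x in lborel. integrable lborel (\<lambda>y. case (x, y) of (x, y) \<Rightarrow> f x * g (x - y))"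
    using g by (simp add: lborel_reflect)
qed

text \<open>Equality of integrals passes from test functions to open subsets of a ball by pointwise
  approximation of indicators, from open sets to Borel sets by the pi-lambda theorem, and equal set
  integrals of two integrable functions force equality almost everywhere. The localisation to balls
  reflects that only local integrability is assumed.\<close>

lemma AE_eq_of_continuous_tests:
  fixes f k :: "'a::euclidean_space \<Rightarrow> complex"
  assumes f: "\<And>R. set_integrable lborel (ball 0 R) f" "\<And>R. set_integrable lborel (ball 0 R) k"
    and eq: "\<And>\<phi>. continuous_on UNIV \<phi> \<Longrightarrow> (\<And>x. cmod (\<phi> x) \<le> 1) \<Longrightarrow> compact (closure {x. \<phi> x \<noteq> 0}) \<Longrightarrow>
      (\<integral>x. f x * \<phi> x \<partial>lborel) = (\<integral>x. k x * \<phi> x \<partial>lborel)"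
  shows "AE x in lborel. f x = k x"
proof -
  have ball: "AE x in lborel. indicator (ball 0 R) x *\<^sub>R f x = indicator (ball 0 R) x *\<^sub>R k x" for R
  proof (rule sigma_finite_measure.density_unique_banach[OF sigma_finite_lborel])
    let ?f = "\<lambda>x. indicator (ball 0 R) x *\<^sub>R f x" and ?k = "\<lambda>x. indicator (ball 0 R) x *\<^sub>R k x"
    show i: "integrable lborel ?f" "integrable lborel ?k"
      using f by (simp_all add: set_integrable_def)
    have op: "(\<integral>x\<in>U. ?f x \<partial>lborel) = (\<integral>x\<in>U. ?k x \<partial>lborel)" if U: "open U" for U
    proof -
      define V where "V = U \<inter> ball 0 R"
      have V: "open V" "V \<subseteq> ball 0 R" using U by (auto simp: V_def)
      show ?thesis
      \<comment> \<open>\<open>infdist\<close> to the empty set is 0 by convention, so the ramps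
        below would vanish for this \<open>V\<close>. The case is contradictory, since a subset of a
        ball is not the whole space.\<close>
      proof (cases "V = UNIV")
        case True
        then have "bounded (UNIV :: 'a set)" using V bounded_subset bounded_ball by blast
        then have "(UNIV :: 'a set) \<subseteq> {}" using not_bounded_UNIV by blast
        then show ?thesis by auto
      next
        case False
        \<comment> \<open>Ramps that vanish off \<open>V\<close> and equal 1 as soon as the distance
          to the complement is at least 1/n; they tend pointwise to the indicator because
          \<open>V\<close> is open.\<close>
        define \<phi> where "\<phi> n x = complex_of_real (min 1 (real n * infdist x (-V)))" for n x
        have n: "cmod (\<phi> n x) \<le> indicator V x" for n x
          by (auto simp: \<phi>_def indicator_def infdist_nonneg)
        have n1: "cmod (\<phi> n x) \<le> 1" for n x
          by (auto simp: \<phi>_def infdist_nonneg)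
        have lim: "(\<lambda>n. \<phi> n x) \<longlonglongrightarrow> indicator V x" for x
        proof (cases "x \<in> V")
          case True
          then have "infdist x (- V) > 0"
            using V False by (metis ComplD Compl_eq_Diff_UNIV Diff_eq_empty_iff UNIV_eq_I closed_Compl double_complement
                in_closed_iff_infdist_zero infdist_nonneg less_eq_real_def compl_bot_eq)
          then obtain N :: nat where N: "1 \<le> real N * infdist x (- V)"
            by (metis less_imp_le reals_Archimedean3)
          have "\<forall>n\<ge>N. \<phi> n x = 1"
          proof safe
            fix n assume "n \<ge> N"
            then have "real N * infdist x (- V) \<le> real n * infdist x (- V)"
              by (intro mult_right_mono) (auto simp: infdist_nonneg)
            with N show "\<phi> n x = 1" by (simp add: \<phi>_def)
          qed
          then show ?thesis using True
            by (intro tendsto_eventually) (auto simp: eventually_sequentially)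
        qed (simp add: \<phi>_def)
        have cont: "continuous_on UNIV (\<phi> n)" for n
          unfolding \<phi>_def by (intro continuous_intros)
        have supp: "compact (closure {x. \<phi> n x \<noteq> 0})" for n
        proof -
          have "{x. \<phi> n x \<noteq> 0} \<subseteq> ball 0 R"
          proof safe
            fix x assume "\<phi> n x \<noteq> 0"
            with n[of n x] have "x \<in> V" by (cases "x \<in> V") auto
            with V show "x \<in> ball 0 R" by auto
          qed
          then show ?thesis using bounded_subset[OF bounded_ball] by (auto simp: compact_closure)
        qed
        have conv: "(\<lambda>n. \<integral>x. h x * \<phi> n x \<partial>lborel) \<longlonglongrightarrow> (\<integral>x. h x * indicator V x \<partial>lborel)"
          if h: "set_integrable lborel (ball 0 R) h" for h :: "'a \<Rightarrow> complex"
        proof -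
          have iv: "integrable lborel (\<lambda>x. indicator V x *\<^sub>R h x)"
            using set_integrable_subset[OF h _ V(2)] V(1) by (auto simp: set_integrable_def)
          have e: "h x * \<phi> n x = indicator V x *\<^sub>R h x * \<phi> n x" for x n
            using n[of n x] by (auto simp: indicator_def)
          have [measurable]: "\<phi> n \<in> borel_measurable borel" for n
            using cont by (rule borel_measurable_continuous_onI)
          have [measurable]: "V \<in> sets borel" using V by auto
          have [measurable]: "(\<lambda>x. indicator V x *\<^sub>R h x) \<in> borel_measurable borel"
            using iv by auto
          have "(\<lambda>n. \<integral>x. indicator V x *\<^sub>R h x * \<phi> n x \<partial>lborel) \<longlonglongrightarrow> (\<integral>x. indicator V x *\<^sub>R h x * indicator V x \<partial>lborel)"
          proof (rule integral_dominated_convergence[where w="\<lambda>x. norm (indicator V x *\<^sub>R h x)"])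
            show "integrable lborel (\<lambda>x. norm (indicator V x *\<^sub>R h x))" using iv by (rule integrable_norm)
            show "AE x in lborel. (\<lambda>n. indicator V x *\<^sub>R h x * \<phi> n x) \<longlonglongrightarrow> indicator V x *\<^sub>R h x * indicator V x"
              by (intro always_eventually allI tendsto_mult tendsto_const lim)
            show "AE x in lborel. norm (indicator V x *\<^sub>R h x * \<phi> n x) \<le> norm (indicator V x *\<^sub>R h x)" for n
              using n1 by (auto simp: norm_mult indicator_def mult_left_le)
          qed measurable
          also have "(\<integral>x. indicator V x *\<^sub>R h x * indicator V x \<partial>lborel) = (\<integral>x. h x * indicator V x \<partial>lborel)"
            by (intro Bochner_Integration.integral_cong) (auto simp: indicator_def)
          finally show ?thesis by (simp only: e)
        qed
        have "(\<integral>x. f x * indicator V x \<partial>lborel) = (\<integral>x. k x * indicator V x \<partial>lborel)"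
          using LIMSEQ_unique[OF conv[OF f(1)]] conv[OF f(2)] eq[OF cont n1 supp] by simp
        moreover have "(\<integral>x\<in>U. indicator (ball 0 R) x *\<^sub>R h x \<partial>lborel) = (\<integral>x. h x * indicator V x \<partial>lborel)"
          for h :: "'a \<Rightarrow> complex"
          unfolding set_lebesgue_integral_def
          by (intro Bochner_Integration.integral_cong) (auto simp: V_def indicator_def)
        ultimately show ?thesis by simp
      qed
    qed
    fix A :: "'a set" assume "A \<in> sets lborel"
    then have "A \<in> sigma_sets UNIV {S. open S}" by (simp add: borel_def)
    then show "(\<integral>x\<in>A. ?f x \<partial>lborel) = (\<integral>x\<in>A. ?k x \<partial>lborel)"
    proof (induction rule: sigma_sets_induct_disjoint[rotated 2, consumes 1, case_names basic empty compl union stable closed])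
      case stable show ?case by (auto intro!: Int_stableI)
    next
      case closed show ?case by auto
    next
      case (basic A) then show ?case using op by simp
    next
      case empty then show ?case by (simp add: set_lebesgue_integral_def)
    next
      case (compl A)
      then have A: "A \<in> sets lborel" by (simp add: borel_def)
      have "(\<integral>x\<in>UNIV - A. h x \<partial>lborel) = (\<integral>x. h x \<partial>lborel) - (\<integral>x\<in>A. h x \<partial>lborel)"
        if "integrable lborel h" for h :: "'a \<Rightarrow> complex"
      proof -
        have "(\<integral>x\<in>UNIV - A. h x \<partial>lborel) = (\<integral>x. h x - indicator A x *\<^sub>R h x \<partial>lborel)"
          unfolding set_lebesgue_integral_def
          by (intro Bochner_Integration.integral_cong) (auto simp: indicator_def)
        also have "\<dots> = (\<integral>x. h x \<partial>lborel) - (\<integral>x\<in>A. h x \<partial>lborel)"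
          unfolding set_lebesgue_integral_def
          using that A by (intro Bochner_Integration.integral_diff) (auto intro!: integrable_mult_indicator)
        finally show ?thesis .
      qed
      from this[OF i(1)] this[OF i(2)] compl op[OF open_UNIV] show ?case
        by (simp add: set_lebesgue_integral_def)
    next
      case (union A)
      then have A: "A n \<in> sets lborel" for n by (auto simp: borel_def)
      have s: "set_integrable lborel (\<Union>n. A n) h" if "integrable lborel h" for h :: "'a \<Rightarrow> complex"
        unfolding set_integrable_def using that A by (intro integrable_mult_indicator) auto
      have "(\<integral>x\<in>(\<Union>n. A n). h x \<partial>lborel) = (\<Sum>n. \<integral>x\<in>A n. h x \<partial>lborel)"
        if "integrable lborel h" for h :: "'a \<Rightarrow> complex"
        using union A s[OF that]
        by (intro lebesgue_integral_countable_add) (auto simp: disjoint_family_on_def)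
      from this[OF i(1)] this[OF i(2)] union show ?case by simp
    qed
  qed
  have "AE x in lborel. \<forall>n::nat. indicator (ball 0 (real n)) x *\<^sub>R f x = indicator (ball 0 (real n)) x *\<^sub>R k x"
    using ball by (subst AE_all_countable) auto
  then show ?thesis
  proof eventually_elim
    case (elim x)
    obtain n :: nat where "norm x < real n" using reals_Archimedean2 by blast
    with elim[rule_format, of n] show ?case by simp
  qed
qed

section \<open>Fourier transform, inversion and Parseval for integrable functions\<close>

lemma borel_measurable_fourier [measurable]:
  fixes f :: "'a::euclidean_space \<Rightarrow> complex"
  assumes [measurable]: "f \<in> borel_measurable borel"
  shows "fourier f \<in> borel_measurable borel"
proof -
  have "(\<lambda>\<omega>. \<integral>x. f x * wave (- (\<omega> \<bullet> x)) \<partial>lborel) \<in> borel_measurable borel"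
    by measurable
  then show ?thesis by (simp add: fourier_wave[abs_def])
qed

lemma norm_fourier_le: "cmod (fourier f \<omega>) \<le> (\<integral>x. cmod (f x) \<partial>lborel)"
  unfolding fourier_wave
  by (rule order_trans[OF integral_norm_bound]) (simp add: norm_mult)

definition inv_fourier :: "('a::euclidean_space \<Rightarrow> complex) \<Rightarrow> 'a \<Rightarrow> complex" where
  "inv_fourier h x = (\<integral>\<omega>. h \<omega> * wave (\<omega> \<bullet> x) \<partial>lborel)"

lemma borel_measurable_inv_fourier [measurable]:
  fixes h :: "'a::euclidean_space \<Rightarrow> complex"
  assumes [measurable]: "h \<in> borel_measurable borel"
  shows "inv_fourier h \<in> borel_measurable borel"
proof -
  have "(\<lambda>x. \<integral>\<omega>. h \<omega> * wave (\<omega> \<bullet> x) \<partial>lborel) \<in> borel_measurable borel"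
    by measurable
  then show ?thesis by (simp add: inv_fourier_def[abs_def])
qed

lemma norm_inv_fourier_le: "cmod (inv_fourier h x) \<le> (\<integral>\<omega>. cmod (h \<omega>) \<partial>lborel)"
  unfolding inv_fourier_def
  by (rule order_trans[OF integral_norm_bound]) (simp add: norm_mult)

text \<open>Gaussian regularisation: the frequency integral is damped by \<Gamma>(c n \<omega>) and
  the pairing with \<phi> is evaluated in two ways. Letting the damping disappear gives the
  right-hand side. Fubini turns the damped pairing into \<open>f\<close> against averages of \<phi>
  over shrinking Gaussians, which tends to the left-hand side.\<close>

lemma fourier_inversion_weak:
  fixes f \<phi> :: "'a::euclidean_space \<Rightarrow> complex"
  assumes f: "integrable lborel f" and Ff: "integrable lborel (fourier f)"
    and \<phi>: "continuous_on UNIV \<phi>" "\<And>x. cmod (\<phi> x) \<le> B" "integrable lborel \<phi>"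
  shows "(\<integral>x. f x * \<phi> x \<partial>lborel) = (\<integral>x. inv_fourier (fourier f) x * \<phi> x \<partial>lborel)"
proof -
  obtain \<Gamma> G :: "'a \<Rightarrow> complex" where
    \<Gamma>: "continuous_on UNIV \<Gamma>" "\<Gamma> 0 = 1" "\<And>x. cmod (\<Gamma> x) \<le> 1" "integrable lborel \<Gamma>"
    and G: "\<And>z. (\<integral>x. \<Gamma> x * wave (x \<bullet> z) \<partial>lborel) = G z" "integrable lborel G" "(\<integral>z. G z \<partial>lborel) = 1"
    using gaussian_kernel[where ?'a='a] by blast
  define c :: "nat \<Rightarrow> real" where "c n = 1 / real (Suc n)" for n
  have c0: "c n > 0" for n by (simp add: c_def)
  have c: "c \<longlonglongrightarrow> 0" unfolding c_def by (rule LIMSEQ_Suc[OF lim_1_over_n])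
  have [measurable]: "f \<in> borel_measurable borel" "\<phi> \<in> borel_measurable borel" "\<Gamma> \<in> borel_measurable borel"
    "G \<in> borel_measurable borel"
    using f \<phi> \<Gamma> G by auto
  define Gn where "Gn n z = (\<integral>\<omega>. \<Gamma> (c n *\<^sub>R \<omega>) * wave (\<omega> \<bullet> z) \<partial>lborel)" for n z
  have \<Gamma>n: "integrable lborel (\<lambda>\<omega>. \<Gamma> (c n *\<^sub>R \<omega>))" for n
    using lborel_integral_affine(1)[of "c n" \<Gamma> 0] c0[of n] \<Gamma>(4) by simp
  \<comment> \<open>The transform of the damping factor is \<open>G\<close> dilated by
    \<open>c n\<close> and normalised in L_1. Evaluating at \<open>c n *\<^sub>R z\<close> keeps the
    identity free of division.\<close>
  have Gn: "of_real (c n ^ DIM('a)) * Gn n (c n *\<^sub>R z) = G z" for n z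
  proof -
    have "Gn n (c n *\<^sub>R z) = (\<integral>\<omega>. \<Gamma> (0 + c n *\<^sub>R \<omega>) * wave ((0 + c n *\<^sub>R \<omega>) \<bullet> z) \<partial>lborel)"
      unfolding Gn_def by simp
    then show ?thesis
      using lborel_integral_affine(2)[of "c n" "\<lambda>\<omega>. \<Gamma> \<omega> * wave (\<omega> \<bullet> z)" 0] c0[of n] G(1) by simp
  qed
  have Gni: "integrable lborel (Gn n)" for n
  proof -
    have "integrable lborel (\<lambda>z. Gn n (0 + c n *\<^sub>R z))"
    proof -
      have "(\<lambda>z. Gn n (0 + c n *\<^sub>R z)) = (\<lambda>z. of_real (1 / c n ^ DIM('a)) * G z)"
        using Gn[of n, symmetric] c0[of n] by (simp add: fun_eq_iff)
      then show ?thesis using G(2) by simp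
    qed
    then show ?thesis using lborel_integral_affine(1)[of "c n" "Gn n" 0] c0[of n] by simp
  qed
  define I where "I n = (\<integral>x. (\<integral>\<omega>. fourier f \<omega> * wave (\<omega> \<bullet> x) * \<Gamma> (c n *\<^sub>R \<omega>) \<partial>lborel) * \<phi> x \<partial>lborel)" for n
  have 1: "I \<longlonglongrightarrow> (\<integral>x. inv_fourier (fourier f) x * \<phi> x \<partial>lborel)"
    unfolding I_def
  proof (rule integral_dominated_convergence[where w="\<lambda>x. (\<integral>\<omega>. cmod (fourier f \<omega>) \<partial>lborel) * cmod (\<phi> x)"])
    show "integrable lborel (\<lambda>x. (\<integral>\<omega>. cmod (fourier f \<omega>) \<partial>lborel) * cmod (\<phi> x))" using \<phi> by simp
    have in1: "(\<lambda>n. \<integral>\<omega>. fourier f \<omega> * wave (\<omega> \<bullet> x) * \<Gamma> (c n *\<^sub>R \<omega>) \<partial>lborel) \<longlonglongrightarrow> inv_fourier (fourier f) x" for x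
      unfolding inv_fourier_def
    proof (rule integral_dominated_convergence[where w="\<lambda>\<omega>. cmod (fourier f \<omega>)"])
      show "AE \<omega> in lborel. (\<lambda>n. fourier f \<omega> * wave (\<omega> \<bullet> x) * \<Gamma> (c n *\<^sub>R \<omega>)) \<longlonglongrightarrow> fourier f \<omega> * wave (\<omega> \<bullet> x)"
      proof (intro always_eventually allI)
        fix \<omega>
        have "(\<lambda>n. \<Gamma> (c n *\<^sub>R \<omega>)) \<longlonglongrightarrow> \<Gamma> (0 *\<^sub>R \<omega>)"
          using \<Gamma>(1) by (intro isCont_tendsto_compose[of _ \<Gamma>] tendsto_intros c) (auto simp: continuous_on_eq_continuous_at)
        from tendsto_mult[OF tendsto_const this, of "fourier f \<omega> * wave (\<omega> \<bullet> x)"] show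
          "(\<lambda>n. fourier f \<omega> * wave (\<omega> \<bullet> x) * \<Gamma> (c n *\<^sub>R \<omega>)) \<longlonglongrightarrow> fourier f \<omega> * wave (\<omega> \<bullet> x)"
          using \<Gamma>(2) by simp
      qed
      show "AE \<omega> in lborel. norm (fourier f \<omega> * wave (\<omega> \<bullet> x) * \<Gamma> (c n *\<^sub>R \<omega>)) \<le> cmod (fourier f \<omega>)" for n
        using \<Gamma>(3) by (auto simp: norm_mult intro!: mult_left_le)
    qed (use Ff in \<open>auto intro!: integrable_norm\<close>)
    show "AE x in lborel. (\<lambda>n. (\<integral>\<omega>. fourier f \<omega> * wave (\<omega> \<bullet> x) * \<Gamma> (c n *\<^sub>R \<omega>) \<partial>lborel) * \<phi> x) \<longlonglongrightarrow> inv_fourier (fourier f) x * \<phi> x"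
      by (intro always_eventually allI tendsto_mult in1 tendsto_const)
    have "norm (\<integral>\<omega>. fourier f \<omega> * wave (\<omega> \<bullet> x) * \<Gamma> (c n *\<^sub>R \<omega>) \<partial>lborel) \<le> (\<integral>\<omega>. cmod (fourier f \<omega>) \<partial>lborel)" for n x
    proof (rule order_trans[OF integral_norm_bound integral_mono])
      show "integrable lborel (\<lambda>\<omega>. cmod (fourier f \<omega> * wave (\<omega> \<bullet> x) * \<Gamma> (c n *\<^sub>R \<omega>)))"
        using Ff \<Gamma>(3) by (intro integrable_norm integrable_mult_bounded[where B=1] integrable_mult_wave) auto
      show "cmod (fourier f \<omega> * wave (\<omega> \<bullet> x) * \<Gamma> (c n *\<^sub>R \<omega>)) \<le> cmod (fourier f \<omega>)" for \<omega>
        using \<Gamma>(3) by (auto simp: norm_mult intro!: mult_left_le)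
    qed (use Ff in \<open>auto intro!: integrable_norm\<close>)
    then show "AE x in lborel. norm ((\<integral>\<omega>. fourier f \<omega> * wave (\<omega> \<bullet> x) * \<Gamma> (c n *\<^sub>R \<omega>) \<partial>lborel) * \<phi> x)
        \<le> (\<integral>\<omega>. cmod (fourier f \<omega>) \<partial>lborel) * cmod (\<phi> x)" for n
      by (auto simp: norm_mult intro!: mult_right_mono)
  qed measurable
  have inner: "(\<integral>\<omega>. fourier f \<omega> * wave (\<omega> \<bullet> x) * \<Gamma> (c n *\<^sub>R \<omega>) \<partial>lborel) = (\<integral>y. f y * Gn n (x - y) \<partial>lborel)" for n x
  proof -
    have "integrable (lborel \<Otimes>\<^sub>M lborel) (\<lambda>z. (case z of (y, \<omega>) \<Rightarrow> f y * \<Gamma> (c n *\<^sub>R \<omega>)) * wave (case z of (y, \<omega>) \<Rightarrow> \<omega> \<bullet> (x - y)))"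
      using lborel_pair.integrable_tensor[OF f \<Gamma>n[of n]] by (rule integrable_mult_wave) measurable
    then have i: "integrable (lborel \<Otimes>\<^sub>M lborel) (\<lambda>(y, \<omega>). f y * \<Gamma> (c n *\<^sub>R \<omega>) * wave (\<omega> \<bullet> (x - y)))"
      by (simp add: case_prod_unfold)
    have "(\<integral>\<omega>. fourier f \<omega> * wave (\<omega> \<bullet> x) * \<Gamma> (c n *\<^sub>R \<omega>) \<partial>lborel)
        = (\<integral>\<omega>. (\<integral>y. f y * \<Gamma> (c n *\<^sub>R \<omega>) * wave (\<omega> \<bullet> (x - y)) \<partial>lborel) \<partial>lborel)"
    proof (intro Bochner_Integration.integral_cong refl)
      fix \<omega>
      have e: "f y * wave (- (\<omega> \<bullet> y)) * (wave (\<omega> \<bullet> x) * \<Gamma> (c n *\<^sub>R \<omega>)) = f y * \<Gamma> (c n *\<^sub>R \<omega>) * wave (\<omega> \<bullet> (x - y))" for y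
        using wave_add[of "\<omega> \<bullet> x" "- (\<omega> \<bullet> y)"] by (simp add: inner_diff_right mult_ac)
      show "fourier f \<omega> * wave (\<omega> \<bullet> x) * \<Gamma> (c n *\<^sub>R \<omega>) = (\<integral>y. f y * \<Gamma> (c n *\<^sub>R \<omega>) * wave (\<omega> \<bullet> (x - y)) \<partial>lborel)"
        unfolding fourier_wave mult.assoc[of _ "wave (\<omega> \<bullet> x)"]
        by (subst integral_mult_left_zero[symmetric]) (simp only: e)
    qed
    also have "\<dots> = (\<integral>y. (\<integral>\<omega>. f y * \<Gamma> (c n *\<^sub>R \<omega>) * wave (\<omega> \<bullet> (x - y)) \<partial>lborel) \<partial>lborel)"
      by (rule lborel_pair.Fubini_integral[OF i])
    finally show ?thesis unfolding Gn_def by (simp add: mult.assoc)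
  qed
  \<comment> \<open>The substitution x = y + c n z lets the average of \<phi> be taken against the
    undilated \<open>G\<close>; the Jacobian cancels the normalisation of \<open>Gn\<close>.\<close>
  have I: "I n = (\<integral>y. f y * (\<integral>z. \<phi> (y + c n *\<^sub>R z) * G z \<partial>lborel) \<partial>lborel)" for n
  proof -
    have "integrable (lborel \<Otimes>\<^sub>M lborel) (\<lambda>(y, x). f y * Gn n (- (y - x)))"
      using lborel_reflect(1)[of "Gn n" 0] Gni[of n]
      by (intro integrable_shifted_product[of f "\<lambda>z. Gn n (- z)"] f) simp
    then have "integrable (lborel \<Otimes>\<^sub>M lborel) (\<lambda>z. (case z of (y, x) \<Rightarrow> f y * Gn n (- (y - x))) * \<phi> (snd z))"
      by (rule integrable_mult_bounded) (use \<phi> in auto)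
    then have i: "integrable (lborel \<Otimes>\<^sub>M lborel) (\<lambda>(y, x). f y * Gn n (x - y) * \<phi> x)"
      by (simp add: case_prod_unfold)
    have "I n = (\<integral>x. (\<integral>y. f y * Gn n (x - y) * \<phi> x \<partial>lborel) \<partial>lborel)"
      unfolding I_def inner by (simp add: integral_mult_left_zero)
    also have "\<dots> = (\<integral>y. (\<integral>x. f y * Gn n (x - y) * \<phi> x \<partial>lborel) \<partial>lborel)"
      by (rule lborel_pair.Fubini_integral[OF i])
    also have "(\<lambda>y. \<integral>x. f y * Gn n (x - y) * \<phi> x \<partial>lborel) = (\<lambda>y. f y * (\<integral>z. \<phi> (y + c n *\<^sub>R z) * G z \<partial>lborel))"
    proof
      fix y
      have "(\<integral>x. f y * Gn n (x - y) * \<phi> x \<partial>lborel) = f y * (\<integral>x. Gn n (x - y) * \<phi> x \<partial>lborel)"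
        by (simp add: mult.assoc)
      also have "(\<integral>x. Gn n (x - y) * \<phi> x \<partial>lborel) =
          \<bar>c n\<bar> ^ DIM('a) * (\<integral>z. Gn n ((y + c n *\<^sub>R z) - y) * \<phi> (y + c n *\<^sub>R z) \<partial>lborel)"
        using lborel_integral_affine(2)[of "c n" "\<lambda>x. Gn n (x - y) * \<phi> x" y] c0[of n] by simp
      also have "\<dots> = (\<integral>z. \<phi> (y + c n *\<^sub>R z) * G z \<partial>lborel)"
        unfolding Gn[of n, symmetric] using c0[of n]
        by (subst integral_mult_right_zero[symmetric]) (simp add: mult_ac)
      finally show "(\<integral>x. f y * Gn n (x - y) * \<phi> x \<partial>lborel) = f y * (\<integral>z. \<phi> (y + c n *\<^sub>R z) * G z \<partial>lborel)" .
    qed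
    finally show ?thesis .
  qed
  have "(\<lambda>n. \<integral>y. f y * (\<integral>z. \<phi> (y + c n *\<^sub>R z) * G z \<partial>lborel) \<partial>lborel) \<longlonglongrightarrow> (\<integral>y. f y * \<phi> y \<partial>lborel)"
  proof (rule integral_dominated_convergence[where w="\<lambda>y. cmod (f y) * (B * (\<integral>z. cmod (G z) \<partial>lborel))"])
    have B: "B \<ge> 0" using \<phi>(2)[of 0] norm_ge_zero order_trans by blast
    have "(\<lambda>n. \<integral>z. \<phi> (y + c n *\<^sub>R z) * G z \<partial>lborel) \<longlonglongrightarrow> (\<integral>z. \<phi> y * G z \<partial>lborel)" for y
    proof (rule integral_dominated_convergence[where w="\<lambda>z. B * cmod (G z)"])
      show "AE z in lborel. (\<lambda>n. \<phi> (y + c n *\<^sub>R z) * G z) \<longlonglongrightarrow> \<phi> y * G z"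
      proof (intro always_eventually allI)
        fix z
        have "(\<lambda>n. \<phi> (y + c n *\<^sub>R z)) \<longlonglongrightarrow> \<phi> (y + 0 *\<^sub>R z)"
          using \<phi>(1) by (intro isCont_tendsto_compose[of _ \<phi>] tendsto_intros c) (auto simp: continuous_on_eq_continuous_at)
        then show "(\<lambda>n. \<phi> (y + c n *\<^sub>R z) * G z) \<longlonglongrightarrow> \<phi> y * G z" by (intro tendsto_mult) auto
      qed
      show "AE z in lborel. norm (\<phi> (y + c n *\<^sub>R z) * G z) \<le> B * cmod (G z)" for n
        using \<phi>(2) by (auto simp: norm_mult intro!: mult_right_mono)
    qed (use G in auto)
    then show "AE y in lborel. (\<lambda>n. f y * (\<integral>z. \<phi> (y + c n *\<^sub>R z) * G z \<partial>lborel)) \<longlonglongrightarrow> f y * \<phi> y"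
      using G(3) by (auto intro!: tendsto_mult)
    have "norm (\<integral>z. \<phi> (y + c n *\<^sub>R z) * G z \<partial>lborel) \<le> B * (\<integral>z. cmod (G z) \<partial>lborel)" for n y
    proof -
      have "norm (\<integral>z. \<phi> (y + c n *\<^sub>R z) * G z \<partial>lborel) \<le> (\<integral>z. B * cmod (G z) \<partial>lborel)"
      proof (rule order_trans[OF integral_norm_bound integral_mono])
        have "integrable lborel (\<lambda>z. G z * \<phi> (y + c n *\<^sub>R z))"
          using G(2) \<phi>(2) by (intro integrable_mult_bounded[where B=B]) auto
        then show "integrable lborel (\<lambda>z. cmod (\<phi> (y + c n *\<^sub>R z) * G z))"
          by (intro integrable_norm) (simp add: mult.commute)
        show "cmod (\<phi> (y + c n *\<^sub>R z) * G z) \<le> B * cmod (G z)" for z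
          using \<phi>(2) by (auto simp: norm_mult intro!: mult_right_mono)
      qed (use G in auto)
      then show ?thesis by simp
    qed
    then show "AE y in lborel. norm (f y * (\<integral>z. \<phi> (y + c n *\<^sub>R z) * G z \<partial>lborel)) \<le> cmod (f y) * (B * (\<integral>z. cmod (G z) \<partial>lborel))" for n
      by (auto simp: norm_mult intro!: mult_left_mono)
    show "integrable lborel (\<lambda>y. cmod (f y) * (B * (\<integral>z. cmod (G z) \<partial>lborel)))"
      using f by (intro integrable_mult_left) (rule integrable_norm)
  qed measurable
  then have "I \<longlonglongrightarrow> (\<integral>y. f y * \<phi> y \<partial>lborel)" by (simp add: I[abs_def])
  from LIMSEQ_unique[OF this 1] show ?thesis .
qed

text \<open>The inverse transform is bounded, hence locally integrable, so it may be compared with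
  \<open>f\<close> by testing against compactly supported continuous functions.\<close>

theorem fourier_inversion:
  fixes f :: "'a::euclidean_space \<Rightarrow> complex"
  assumes f: "integrable lborel f" and Ff: "integrable lborel (fourier f)"
  shows "AE x in lborel. f x = inv_fourier (fourier f) x"
proof (rule AE_eq_of_continuous_tests)
  have [measurable]: "f \<in> borel_measurable borel" using f by auto
  show "set_integrable lborel (ball 0 R) f" for R
    using f unfolding set_integrable_def by (intro integrable_mult_indicator) auto
  show "set_integrable lborel (ball 0 R) (inv_fourier (fourier f))" for R
    unfolding set_integrable_def
  proof (rule integrableI_bounded_set[where A="ball 0 R" and B="\<integral>\<omega>. cmod (fourier f \<omega>) \<partial>lborel"])
    show "AE x\<in>ball 0 R in lborel. norm (indicat_real (ball 0 R) x *\<^sub>R inv_fourier (fourier f) x) \<le> (\<integral>\<omega>. cmod (fourier f \<omega>) \<partial>lborel)"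
      using norm_inv_fourier_le[of "fourier f"] by (auto simp: indicator_def)
    show "(\<lambda>x. indicat_real (ball 0 R) x *\<^sub>R inv_fourier (fourier f) x) \<in> borel_measurable lborel"
      by (intro borel_measurable_scaleR borel_measurable_indicator) auto
    show "emeasure lborel (ball (0::'a) R) < \<infinity>" using emeasure_lborel_ball_finite by auto
  qed auto
  fix \<phi> :: "'a \<Rightarrow> complex"
  assume \<phi>: "continuous_on UNIV \<phi>" "\<And>x. cmod (\<phi> x) \<le> 1" "compact (closure {x. \<phi> x \<noteq> 0})"
  have "integrable lborel (\<lambda>x. indicator (closure {x. \<phi> x \<noteq> 0}) x *\<^sub>R \<phi> x)"
    using \<phi> by (intro borel_integrable_compact) (auto intro: continuous_on_subset)
  also have "(\<lambda>x. indicator (closure {x. \<phi> x \<noteq> 0}) x *\<^sub>R \<phi> x) = \<phi>"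
    using closure_subset[of "{x. \<phi> x \<noteq> 0}"] by (auto simp: indicator_def fun_eq_iff)
  finally show "(\<integral>x. f x * \<phi> x \<partial>lborel) = (\<integral>x. inv_fourier (fourier f) x * \<phi> x \<partial>lborel)"
    using fourier_inversion_weak[OF f Ff \<phi>(1,2)] by simp
qed

text \<open>Inversion is inserted for \<open>f\<close> and the integrals are exchanged;
  integrability of the transform of \<open>f\<close> and of \<open>g\<close> makes the double
  integral absolutely convergent.\<close>

theorem parseval:
  fixes f g :: "'a::euclidean_space \<Rightarrow> complex"
  assumes f: "integrable lborel f" and Ff: "integrable lborel (fourier f)" and g: "integrable lborel g"
  shows "(\<integral>x. f x * cnj (g x) \<partial>lborel) = (\<integral>\<omega>. fourier f \<omega> * cnj (fourier g \<omega>) \<partial>lborel)"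
proof -
  have [measurable]: "f \<in> borel_measurable borel" "g \<in> borel_measurable borel" using f g by auto
  have gc: "integrable lborel (\<lambda>x. cnj (g x))" using g by simp
  have "(\<integral>x. f x * cnj (g x) \<partial>lborel) = (\<integral>x. inv_fourier (fourier f) x * cnj (g x) \<partial>lborel)"
    using fourier_inversion[OF f Ff] by (intro integral_cong_AE) auto
  also have "\<dots> = (\<integral>x. (\<integral>\<omega>. fourier f \<omega> * cnj (g x) * wave (\<omega> \<bullet> x) \<partial>lborel) \<partial>lborel)"
    unfolding inv_fourier_def by (subst integral_mult_left_zero[symmetric]) (simp add: mult_ac)
  also have "\<dots> = (\<integral>\<omega>. (\<integral>x. fourier f \<omega> * cnj (g x) * wave (\<omega> \<bullet> x) \<partial>lborel) \<partial>lborel)"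
  proof -
    have "integrable (lborel \<Otimes>\<^sub>M lborel) (\<lambda>z. (case z of (\<omega>, x) \<Rightarrow> fourier f \<omega> * cnj (g x)) * wave (fst z \<bullet> snd z))"
      using lborel_pair.integrable_tensor[OF Ff gc] by (rule integrable_mult_wave) measurable
    then show ?thesis by (intro lborel_pair.Fubini_integral) (simp add: case_prod_unfold)
  qed
  also have "\<dots> = (\<integral>\<omega>. fourier f \<omega> * cnj (fourier g \<omega>) \<partial>lborel)"
  proof (intro Bochner_Integration.integral_cong refl)
    fix \<omega>
    have "cnj (fourier g \<omega>) = (\<integral>x. cnj (g x) * wave (\<omega> \<bullet> x) \<partial>lborel)"
      unfolding fourier_wave by (subst Bochner_Integration.integral_cnj[symmetric]) (simp add: wave_minus)
    then show "(\<integral>x. fourier f \<omega> * cnj (g x) * wave (\<omega> \<bullet> x) \<partial>lborel) = fourier f \<omega> * cnj (fourier g \<omega>)"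
      by (simp add: mult.assoc)
  qed
  finally show ?thesis .
qed

section \<open>Bounded functionals and reproducing kernels\<close>

text \<open>A one-sided first-order expansion of the t-th power of the modulus at \<open>z\<close>,
  with a remainder of order |w|^t. If |w| < |z|, concavity of the power t/2 reduces it to the exact
  expansion of the square, and |z|^(t-2) \<le> |w|^(t-2) converts the quadratic remainder. Otherwise
  crude bounds do: the left side is at most 2^t |w|^t \<le> 4 |w|^t and the linear term at least -2
  |w|^t, which together give the constant 6.\<close>

lemma powr_norm_add_le:
  fixes z w :: complex
  assumes t: "1 < t" "t \<le> 2"
  shows "cmod (z + w) powr t \<le> cmod z powr t + t * (cmod z powr (t - 2) * Re (cnj z * w)) + 6 * cmod w powr t"
proof (cases "cmod w < cmod z")
  case False
  have R: "cmod z powr (t - 2) * \<bar>Re (cnj z * w)\<bar> \<le> cmod w powr t"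
  proof (cases "z = 0")
    case z: False
    have "cmod z powr (t - 2) * \<bar>Re (cnj z * w)\<bar> \<le> cmod z powr (t - 2) * (cmod z * cmod w)"
      using abs_Re_le_cmod[of "cnj z * w"] by (intro mult_left_mono) (auto simp: norm_mult)
    also have "\<dots> = cmod z powr (t - 1) * cmod w"
      using z powr_add[of "cmod z" "t - 2" 1] by simp
    also have "\<dots> \<le> cmod w powr (t - 1) * cmod w"
      using False t by (intro mult_right_mono powr_mono2) auto
    also have "\<dots> = cmod w powr t"
      using z False powr_add[of "cmod w" "t - 1" 1] by (cases "w = 0") auto
    finally show ?thesis .
  qed auto
  have "cmod (z + w) powr t \<le> (2 * cmod w) powr t"
    using False t norm_triangle_ineq[of z w] by (intro powr_mono2) auto
  also have "\<dots> = 2 powr t * cmod w powr t" by (simp add: powr_mult)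
  also have "\<dots> \<le> 4 * cmod w powr t"
    using t powr_mono[of t 2 2] by (intro mult_right_mono) auto
  finally have 1: "cmod (z + w) powr t \<le> 4 * cmod w powr t" .
  have "t * (cmod z powr (t - 2) * \<bar>Re (cnj z * w)\<bar>) \<le> 2 * cmod w powr t"
    using R t by (intro mult_mono) auto
  moreover have "- (t * (cmod z powr (t - 2) * \<bar>Re (cnj z * w)\<bar>)) \<le> t * (cmod z powr (t - 2) * Re (cnj z * w))"
  proof -
    have "t * cmod z powr (t - 2) * (- \<bar>Re (cnj z * w)\<bar>) \<le> t * cmod z powr (t - 2) * Re (cnj z * w)"
      using t by (intro mult_left_mono) auto
    then show ?thesis by (simp add: mult.assoc)
  qed
  moreover have "0 \<le> cmod z powr t" by simp
  ultimately show ?thesis using 1 by linarith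
next
  case True
  then have z: "cmod z > 0" using norm_ge_zero[of w] by linarith
  define R where "R = Re (cnj z * w)"
  have sq: "(cmod (z + w))\<^sup>2 = (cmod z)\<^sup>2 + 2 * R + (cmod w)\<^sup>2"
    unfolding cmod_power2 R_def by (simp add: power2_eq_square algebra_simps)
  \<comment> \<open>Weighted arithmetic-geometric mean of |z + w|^2 and |z|^2 with weights t/2 and 1
    - t/2, in other words the tangent to the concave power t/2 at |z|^2.\<close>
  have "cmod (z + w) powr t * cmod z powr (2 - t) \<le> t / 2 * (cmod (z + w))\<^sup>2 + (1 - t / 2) * (cmod z)\<^sup>2"
  proof (cases "z + w = 0")
    case True then show ?thesis using t by auto
  next
    case False
    have "((cmod (z + w))\<^sup>2) powr (t / 2) * ((cmod z)\<^sup>2) powr (1 - t / 2)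
        \<le> t / 2 * (cmod (z + w))\<^sup>2 + (1 - t / 2) * (cmod z)\<^sup>2"
      using t z False by (intro Youngs_inequality_0) auto
    moreover have "((cmod (z + w))\<^sup>2) powr (t / 2) = cmod (z + w) powr t"
      using False by (simp add: powr_powr flip: powr_numeral)
    moreover have "((cmod z)\<^sup>2) powr (1 - t / 2) = cmod z powr (2 - t)"
      using z by (simp add: powr_powr algebra_simps flip: powr_numeral)
    ultimately show ?thesis by simp
  qed
  also have "\<dots> = (cmod z)\<^sup>2 + t * R + t / 2 * (cmod w)\<^sup>2"
    unfolding sq by (simp add: field_simps)
  finally have "cmod z powr (t - 2) * (cmod (z + w) powr t * cmod z powr (2 - t))
      \<le> cmod z powr (t - 2) * ((cmod z)\<^sup>2 + t * R + t / 2 * (cmod w)\<^sup>2)"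
    by (rule mult_left_mono) simp
  moreover have "cmod z powr (t - 2) * (cmod (z + w) powr t * cmod z powr (2 - t)) = cmod (z + w) powr t"
    using z by (simp add: mult.left_commute flip: powr_add)
  moreover have "cmod z powr (t - 2) * (cmod z)\<^sup>2 = cmod z powr t"
    using z by (simp flip: powr_numeral powr_add)
  moreover have "cmod z powr (t - 2) * (t / 2 * (cmod w)\<^sup>2) \<le> 6 * cmod w powr t"
  proof (cases "w = 0")
    case False
    have "cmod z powr (t - 2) \<le> cmod w powr (t - 2)"
      using True t False by (intro powr_mono2') auto
    then have "cmod z powr (t - 2) * (t / 2 * (cmod w)\<^sup>2) \<le> cmod w powr (t - 2) * (6 * (cmod w)\<^sup>2)"
      using t by (intro mult_mono mult_right_mono) auto
    also have "\<dots> = 6 * cmod w powr t" using False by (simp flip: powr_numeral powr_add)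
    finally show ?thesis .
  qed simp
  moreover have "cmod z powr (t - 2) * ((cmod z)\<^sup>2 + t * R + t / 2 * (cmod w)\<^sup>2) =
      cmod z powr (t - 2) * (cmod z)\<^sup>2 + t * (cmod z powr (t - 2) * R) + cmod z powr (t - 2) * (t / 2 * (cmod w)\<^sup>2)"
    by (simp add: algebra_simps)
  ultimately show ?thesis unfolding R_def[symmetric] by linarith
qed

lemma mult_le_powr_conj:
  fixes a b :: real
  assumes "1 < t" "a \<ge> 0" "b \<ge> 0"
  shows "a * b \<le> a powr t + b powr (t / (t - 1))"
proof -
  have 1: "1 / t + 1 / (t / (t - 1)) = 1" using assms by (simp add: field_simps)
  have 2: "t / (t - 1) > 1" using assms by simp
  have "a * b \<le> a powr t / t + b powr (t / (t - 1)) / (t / (t - 1))"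
    by (rule Youngs_inequality) (use assms 1 2 in auto)
  moreover have "a powr t / t \<le> a powr t / 1" using assms by (intro divide_left_mono) auto
  moreover have "b powr (t / (t - 1)) / (t / (t - 1)) \<le> b powr (t / (t - 1)) / 1"
    using 2 by (intro divide_left_mono) auto
  ultimately show ?thesis by simp
qed

lemma integrable_mult_conj_powr:
  fixes f g :: "'x \<Rightarrow> complex"
  assumes t: "1 < t" and [measurable]: "f \<in> borel_measurable M" "g \<in> borel_measurable M"
    and f: "integrable M (\<lambda>x. cmod (f x) powr t)" and g: "integrable M (\<lambda>x. cmod (g x) powr (t / (t - 1)))"
  shows "integrable M (\<lambda>x. f x * g x)"
  using Bochner_Integration.integrable_add[OF f g]
  by (rule Bochner_Integration.integrable_bound)
     (use mult_le_powr_conj[OF t] in \<open>auto simp: norm_mult\<close>)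

text \<open>
  The densities \<open>G n\<close> are the derivatives of \<open>g \<mapsto> (\<integral>\<bar>T g\<bar>\<^sup>\<tau>) / \<tau>\<close> along a minimising sequence of
  \<open>g \<mapsto> \<integral>\<bar>T g\<bar>\<^sup>\<tau> - \<tau> Re (f g)\<close>. This replaces the Hahn-Banach and Riesz theorems, which would
  provide a single density.
\<close>

lemma approximate_Riesz_representation:
  fixes T :: "('b \<Rightarrow> complex) \<Rightarrow> 'x \<Rightarrow> complex" and f :: "('b \<Rightarrow> complex) \<Rightarrow> complex"
  assumes t: "1 < \<tau>" "\<tau> \<le> 2" and V: "V \<noteq> {}"
    and V_add: "\<And>g h. g \<in> V \<Longrightarrow> h \<in> V \<Longrightarrow> (\<lambda>y. g y + h y) \<in> V"
    and V_scale: "\<And>c g. g \<in> V \<Longrightarrow> (\<lambda>y. c * g y) \<in> V"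
    and T_add: "\<And>g h x. g \<in> V \<Longrightarrow> h \<in> V \<Longrightarrow> x \<in> space M \<Longrightarrow> T (\<lambda>y. g y + h y) x = T g x + T h x"
    and T_scale: "\<And>c g x. g \<in> V \<Longrightarrow> x \<in> space M \<Longrightarrow> T (\<lambda>y. c * g y) x = c * T g x"
    and T_meas: "\<And>g. g \<in> V \<Longrightarrow> T g \<in> borel_measurable M"
    and T_int: "\<And>g. g \<in> V \<Longrightarrow> integrable M (\<lambda>x. cmod (T g x) powr \<tau>)"
    and f_add: "\<And>g h. g \<in> V \<Longrightarrow> h \<in> V \<Longrightarrow> f (\<lambda>y. g y + h y) = f g + f h"
    and f_scale: "\<And>c g. g \<in> V \<Longrightarrow> f (\<lambda>y. c * g y) = cnj c * f g"
    and f_bound: "\<And>g. g \<in> V \<Longrightarrow> cmod (f g) \<le> C * (\<integral>x. cmod (T g x) powr \<tau> \<partial>M) powr (1 / \<tau>)"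
  obtains G :: "nat \<Rightarrow> 'x \<Rightarrow> complex" and B where
    "\<And>n. G n \<in> borel_measurable M"
    "\<And>n. integrable M (\<lambda>x. cmod (G n x) powr (\<tau> / (\<tau> - 1)))"
    "\<And>n. (\<integral>x. cmod (G n x) powr (\<tau> / (\<tau> - 1)) \<partial>M) \<le> B"
    "\<And>g. g \<in> V \<Longrightarrow> (\<lambda>n. \<integral>x. G n x * cnj (T g x) \<partial>M) \<longlonglongrightarrow> f g"
proof -
  define N where "N g = (\<integral>x. cmod (T g x) powr \<tau> \<partial>M)" for g
  define J where "J g = N g - \<tau> * Re (f g)" for g
  define D where "D = max C 0"
  define \<kappa> where "\<kappa> = \<tau> * (2 * D) powr (\<tau> / (\<tau> - 1))"
  have N0: "N g \<ge> 0" for g unfolding N_def by simp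
  \<comment> \<open>Coercivity: it makes the infimum finite and bounds the minimising sequence.
    Young is applied to the product of n/2 and 2D, so that the power term carries the factor
    2^(-\<tau>) \<le> 1/2 and can be absorbed.\<close>
  have coer: "N g \<le> 2 * \<tau> * (J g + \<kappa>)" if g: "g \<in> V" for g
  proof -
    define n where "n = N g powr (1 / \<tau>)"
    have n: "n \<ge> 0" "n powr \<tau> = N g" using N0[of g] t by (auto simp: n_def powr_powr)
    have "Re (f g) \<le> D * n"
    proof -
      have "Re (f g) \<le> cmod (f g)" by (rule complex_Re_le_cmod)
      also have "\<dots> \<le> C * n" using f_bound[OF g] by (simp add: n_def N_def)
      also have "\<dots> \<le> D * n" using n by (intro mult_right_mono) (auto simp: D_def)
      finally show ?thesis .
    qed
    also have "D * n = (n / 2) * (2 * D)" by simp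
    also have "\<dots> \<le> (n / 2) powr \<tau> / \<tau> + (2 * D) powr (\<tau> / (\<tau> - 1)) / (\<tau> / (\<tau> - 1))"
      using t n by (intro Youngs_inequality) (auto simp: D_def field_simps)
    also have "(n / 2) powr \<tau> / \<tau> = N g / (2 powr \<tau>) / \<tau>"
      using n by (simp add: powr_divide)
    also have "(2 * D) powr (\<tau> / (\<tau> - 1)) / (\<tau> / (\<tau> - 1)) \<le> (2 * D) powr (\<tau> / (\<tau> - 1)) / 1"
      using t by (intro divide_left_mono) auto
    finally have "\<tau> * Re (f g) \<le> \<tau> * (N g / (2 powr \<tau>) / \<tau> + (2 * D) powr (\<tau> / (\<tau> - 1)))"
      using t by (intro mult_left_mono) auto
    also have "\<dots> = N g / (2 powr \<tau>) + \<kappa>"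
      unfolding \<kappa>_def distrib_left using t by simp
    also have "N g / (2 powr \<tau>) \<le> N g / 2"
      using N0[of g] t powr_mono[of 1 \<tau> 2] by (intro divide_left_mono) auto
    finally have "N g / 2 \<le> J g + \<kappa>" unfolding J_def by simp
    then have J0: "J g + \<kappa> \<ge> 0" using N0[of g] by auto
    have "N g \<le> 2 * (J g + \<kappa>)" using \<open>N g / 2 \<le> J g + \<kappa>\<close> by simp
    also have "2 * (J g + \<kappa>) \<le> 2 * \<tau> * (J g + \<kappa>)" using J0(1) t by (intro mult_right_mono) auto
    finally show ?thesis .
  qed
  have bdd: "bdd_below (J ` V)"
  proof
    fix j assume "j \<in> J ` V"
    then obtain g where g: "g \<in> V" "j = J g" by auto
    have "0 \<le> 2 * \<tau> * (J g + \<kappa>)" using coer[OF g(1)] N0[of g] by linarith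
    then show "- \<kappa> \<le> j" using t g by (simp add: zero_le_mult_iff)
  qed
  define I where "I = Inf (J ` V)"
  define \<epsilon> :: "nat \<Rightarrow> real" where "\<epsilon> n = 1 / real (Suc n)" for n
  have \<epsilon>: "\<epsilon> n > 0" "\<epsilon> n \<le> 1" for n by (auto simp: \<epsilon>_def)
  \<comment> \<open>The defect \<epsilon>^\<tau> matches the remainder of the expansion for a
    perturbation of size \<epsilon>. After division by \<epsilon> both leave \<epsilon>^(\<tau>-1),
    which tends to 0 because \<tau> > 1.\<close>
  have "\<exists>g. g \<in> V \<and> J g < I + \<epsilon> n powr \<tau>" for n
  proof -
    have "I < I + \<epsilon> n powr \<tau>" using \<epsilon>(1)[of n] by simp
    then show ?thesis using V unfolding I_def by (subst (asm) cInf_less_iff) (auto intro: bdd)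
  qed
  then obtain u where u: "\<And>n. u n \<in> V" "\<And>n. J (u n) < I + \<epsilon> n powr \<tau>" by metis
  \<comment> \<open>The duality map of L_\<tau> at \<open>T (u n)\<close>: the modulus of
    \<open>G n\<close> to the dual exponent is the modulus of \<open>T (u n)\<close> to the exponent
    \<tau>.\<close>
  define G where "G n x = of_real (cmod (T (u n) x) powr (\<tau> - 2)) * T (u n) x" for n x
  have G_meas: "G n \<in> borel_measurable M" for n
  proof -
    have [measurable]: "T (u n) \<in> borel_measurable M" using T_meas u by auto
    show ?thesis unfolding G_def by measurable
  qed
  have norm_G: "cmod (G n x) powr (\<tau> / (\<tau> - 1)) = cmod (T (u n) x) powr \<tau>" for n x
  proof (cases "T (u n) x = 0")
    case False
    then have "cmod (G n x) = cmod (T (u n) x) powr (\<tau> - 1)"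
      using powr_add[of "cmod (T (u n) x)" "\<tau> - 2" 1] by (simp add: G_def norm_mult)
    then show ?thesis using t by (simp add: powr_powr)
  qed (simp add: G_def)
  have G_int: "integrable M (\<lambda>x. cmod (G n x) powr (\<tau> / (\<tau> - 1)))" for n
    unfolding norm_G using T_int u by auto
  have G_bound: "(\<integral>x. cmod (G n x) powr (\<tau> / (\<tau> - 1)) \<partial>M) \<le> 2 * \<tau> * (I + 1 + \<kappa>)" for n
  proof -
    have "\<epsilon> n powr \<tau> \<le> 1" using \<epsilon>[of n] t powr_mono2[of \<tau> "\<epsilon> n" 1] by simp
    then have "J (u n) + \<kappa> \<le> I + 1 + \<kappa>" using u(2)[of n] by simp
    then have "2 * \<tau> * (J (u n) + \<kappa>) \<le> 2 * \<tau> * (I + 1 + \<kappa>)" using t by (intro mult_left_mono) auto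
    then show ?thesis unfolding norm_G using coer[OF u(1)[of n]] unfolding N_def by linarith
  qed
  define A where "A n h = (\<integral>x. G n x * cnj (T h x) \<partial>M)" for n h
  have GT: "integrable M (\<lambda>x. G n x * cnj (T h x))" if h: "h \<in> V" for n h
  proof -
    have "integrable M (\<lambda>x. cnj (T h x) * G n x)"
      using T_int[OF h] T_meas[OF h] by (intro integrable_mult_conj_powr[OF t(1) _ G_meas _ G_int]) auto
    then show ?thesis by (simp add: mult.commute)
  qed
  \<comment> \<open>An approximate Euler-Lagrange inequality, from comparing the near-minimal value
    at \<open>u n\<close> with the value at \<open>u n\<close> + \<epsilon> \<open>h\<close> and
    dividing by \<tau> \<epsilon>.\<close>
  have key: "Re (f h - A n h) \<le> (1 + 6 * N h) / \<tau> * \<epsilon> n powr (\<tau> - 1)" if h: "h \<in> V" for h n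
  proof -
    let ?w = "\<lambda>y. u n y + of_real (\<epsilon> n) * h y"
    have sh: "(\<lambda>y. of_real (\<epsilon> n) * h y) \<in> V" using V_scale h by auto
    have w: "?w \<in> V" using V_add[OF u(1) sh] .
    have I_le: "I \<le> J ?w" unfolding I_def using w bdd by (intro cInf_lower) auto
    have Tw: "T ?w x = T (u n) x + of_real (\<epsilon> n) * T h x" if "x \<in> space M" for x
      using T_add[OF u(1) sh that] T_scale[OF h that] by simp
    have "N ?w \<le> (\<integral>x. cmod (T (u n) x) powr \<tau> + \<tau> * \<epsilon> n * Re (G n x * cnj (T h x)) +
        6 * \<epsilon> n powr \<tau> * cmod (T h x) powr \<tau> \<partial>M)"
      unfolding N_def
    proof (rule integral_mono)
      show "integrable M (\<lambda>x. cmod (T ?w x) powr \<tau>)" by (rule T_int[OF w])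
      show "integrable M (\<lambda>x. cmod (T (u n) x) powr \<tau> + \<tau> * \<epsilon> n * Re (G n x * cnj (T h x)) +
        6 * \<epsilon> n powr \<tau> * cmod (T h x) powr \<tau>)"
        using T_int[OF u(1)[of n]] T_int[OF h] GT[OF h]
        by (intro Bochner_Integration.integrable_add integrable_mult_right integrable_Re)
      fix x assume x: "x \<in> space M"
      show "cmod (T ?w x) powr \<tau> \<le> cmod (T (u n) x) powr \<tau> + \<tau> * \<epsilon> n * Re (G n x * cnj (T h x)) +
        6 * \<epsilon> n powr \<tau> * cmod (T h x) powr \<tau>"
        using powr_norm_add_le[OF t, of "T (u n) x" "of_real (\<epsilon> n) * T h x"] \<epsilon>(1)[of n]
        unfolding Tw[OF x] by (simp add: G_def norm_mult powr_mult algebra_simps)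
    qed
    also have "\<dots> = N (u n) + \<tau> * \<epsilon> n * Re (A n h) + 6 * \<epsilon> n powr \<tau> * N h"
    proof -
      have "(\<integral>x. Re (G n x * cnj (T h x)) \<partial>M) = Re (A n h)"
        unfolding A_def using GT[OF h] by (intro integral_Re)
      then show ?thesis
        using T_int[OF u(1)[of n]] T_int[OF h] integrable_Re[OF GT[OF h], of n]
        by (simp add: N_def)
    qed
    finally have 1: "N ?w \<le> N (u n) + \<tau> * \<epsilon> n * Re (A n h) + 6 * \<epsilon> n powr \<tau> * N h" .
    have fw: "f ?w = f (u n) + of_real (\<epsilon> n) * f h"
      using f_add[OF u(1) sh] f_scale[OF h] by simp
    have "J ?w \<le> J (u n) - \<tau> * \<epsilon> n * Re (f h - A n h) + 6 * \<epsilon> n powr \<tau> * N h"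
      using 1 unfolding J_def fw by (simp add: algebra_simps)
    with I_le u(2)[of n] have "\<tau> * \<epsilon> n * Re (f h - A n h) \<le> (1 + 6 * N h) * \<epsilon> n powr \<tau>"
      by (simp add: algebra_simps)
    then have "Re (f h - A n h) \<le> (1 + 6 * N h) * \<epsilon> n powr \<tau> / (\<tau> * \<epsilon> n)"
      using t \<epsilon>(1)[of n] by (simp add: pos_le_divide_eq mult_ac)
    also have "\<dots> = (1 + 6 * N h) / \<tau> * \<epsilon> n powr (\<tau> - 1)"
      using \<epsilon>(1)[of n] by (simp add: powr_diff)
    finally show ?thesis .
  qed
  have N_scale: "N (\<lambda>y. c * h y) = N h" and A_scale: "A n (\<lambda>y. c * h y) = cnj c * A n h"
    if "h \<in> V" "cmod c = 1" for c h n
  proof -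
    show "N (\<lambda>y. c * h y) = N h"
      unfolding N_def by (intro Bochner_Integration.integral_cong) (simp_all add: T_scale that norm_mult)
    have "A n (\<lambda>y. c * h y) = (\<integral>x. cnj c * (G n x * cnj (T h x)) \<partial>M)"
      unfolding A_def by (intro Bochner_Integration.integral_cong) (simp_all add: T_scale that)
    then show "A n (\<lambda>y. c * h y) = cnj c * A n h" unfolding A_def by simp
  qed
  have lim: "(\<lambda>n. A n h) \<longlonglongrightarrow> f h" if h: "h \<in> V" for h
  proof -
    define e where "e n = (1 + 6 * N h) / \<tau> * \<epsilon> n powr (\<tau> - 1)" for n
    \<comment> \<open>The inequality controls a real part from one side only. Multiplying
      \<open>h\<close> by 1, -1, i and -i bounds the real and the imaginary part from both
      sides.\<close>
    have key': "Re (cnj c * (f h - A n h)) \<le> e n" if c: "cmod c = 1" for c n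
      using key[OF V_scale[OF h, of c], of n] f_scale[OF h, of c] A_scale[OF h c, of n] N_scale[OF h c]
      by (simp add: e_def algebra_simps)
    have b: "cmod (A n h - f h) \<le> 2 * e n" for n
    proof -
      have "\<bar>Re (f h - A n h)\<bar> \<le> e n" using key'[of 1 n] key'[of "-1" n] by auto
      moreover have "\<bar>Im (f h - A n h)\<bar> \<le> e n" using key'[of "\<i>" n] key'[of "-\<i>" n] by auto
      ultimately have "cmod (f h - A n h) \<le> 2 * e n" using cmod_le[of "f h - A n h"] by linarith
      then show ?thesis by (simp add: norm_minus_commute)
    qed
    have "\<epsilon> \<longlonglongrightarrow> 0" unfolding \<epsilon>_def by (rule LIMSEQ_Suc[OF lim_1_over_n])
    then have "(\<lambda>n. \<epsilon> n powr (\<tau> - 1)) \<longlonglongrightarrow> 0"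
      using t \<epsilon>(1) by (intro tendsto_zero_powrI[of _ _ _ "\<tau> - 1"]) (auto intro!: always_eventually less_imp_le)
    from tendsto_mult_right_zero[OF this, of "2 * ((1 + 6 * N h) / \<tau>)"] have "(\<lambda>n. 2 * e n) \<longlonglongrightarrow> 0"
      unfolding e_def by (simp only: mult.assoc)
    then have "(\<lambda>n. A n h - f h) \<longlonglongrightarrow> 0"
      by (rule Lim_null_comparison[rotated]) (use b in auto)
    then show ?thesis by (simp add: LIM_zero_iff)
  qed
  show ?thesis
    by (rule that[of G "2 * \<tau> * (I + 1 + \<kappa>)"]) (use G_meas G_int G_bound lim in \<open>auto simp: A_def\<close>)
qed

section \<open>Reproducing kernels whose rows are bounded in L_q for every q > 1\<close>

lemma powr_mult_powr_le:
  fixes a b s t :: real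
  assumes "a \<ge> 0" "b \<ge> 0" "s \<ge> 0" "t \<ge> 0" "s + t > 0"
  shows "a powr s * b powr t \<le> a powr (s + t) + b powr (s + t)"
proof -
  have "a powr s * b powr t \<le> max a b powr s * max a b powr t"
    using assms by (intro mult_mono powr_mono2) auto
  also have "\<dots> = max a b powr (s + t)" by (simp add: powr_add)
  also have "\<dots> \<le> a powr (s + t) + b powr (s + t)" by (auto simp: max_def)
  finally show ?thesis .
qed

text \<open>The rows are controlled for exponents q > 1 only, since integrability of |K| itself is
  not at hand; the uniform bound \<open>C0\<close> takes over when p = 1. Weights are compared only
  where the kernel does not vanish, which is what makes a constant \<open>c\<close> independent of
  the two points possible.\<close>

locale reproducing_kernel = sigma_finite_measure M
  for M :: "'x measure" +
  fixes K :: "'x \<Rightarrow> 'x \<Rightarrow> complex" and v :: "'x \<Rightarrow> real" and c C0 :: real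
  assumes K_measurable: "(\<lambda>(x, y). K x y) \<in> borel_measurable (M \<Otimes>\<^sub>M M)"
    and K_hermitian: "\<And>x y. x \<in> space M \<Longrightarrow> y \<in> space M \<Longrightarrow> K y x = cnj (K x y)"
    and K_bounded: "\<And>x y. x \<in> space M \<Longrightarrow> y \<in> space M \<Longrightarrow> cmod (K x y) \<le> C0"
    and K_powr: "\<And>q. q > 1 \<Longrightarrow>
      \<exists>C\<ge>0. \<forall>x\<in>space M. (\<integral>\<^sup>+y. ennreal (cmod (K x y) powr q) \<partial>M) \<le> ennreal C"
    and K_reproducing: "\<And>x z. x \<in> space M \<Longrightarrow> z \<in> space M \<Longrightarrow> (\<integral>y. K x y * K y z \<partial>M) = K x z"
    and v_measurable: "v \<in> borel_measurable M"
    and v_ge_1: "\<And>x. x \<in> space M \<Longrightarrow> 1 \<le> v x"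
    and v_moderate: "\<And>x y. x \<in> space M \<Longrightarrow> y \<in> space M \<Longrightarrow> K x y \<noteq> 0 \<Longrightarrow> v y \<le> c * v x"
    and c_nonneg: "c \<ge> 0" and C0_nonneg: "C0 \<ge> 0"
begin

lemma K_meas2 [measurable]:
  assumes "f \<in> N \<rightarrow>\<^sub>M M" "g \<in> N \<rightarrow>\<^sub>M M"
  shows "(\<lambda>x. K (f x) (g x)) \<in> borel_measurable N"
  using measurable_compose[OF measurable_Pair[OF assms] K_measurable] by simp

lemma K_meas1 [measurable]: "x \<in> space M \<Longrightarrow> (\<lambda>y. K x y) \<in> borel_measurable M"
  by (rule K_meas2) auto

lemma K_meas1' [measurable]: "x \<in> space M \<Longrightarrow> (\<lambda>y. K y x) \<in> borel_measurable M"
  by (rule K_meas2) auto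

lemma norm_K_commute: "x \<in> space M \<Longrightarrow> y \<in> space M \<Longrightarrow> cmod (K y x) = cmod (K x y)"
  using K_hermitian[of x y] by simp

lemma v_moderate_norm:
  assumes "x \<in> space M" "y \<in> space M"
  shows "v y * cmod (K x y) \<le> c * v x * cmod (K x y)"
  using v_moderate[OF assms] by (cases "K x y = 0") (auto intro!: mult_right_mono)

lemma K_powr_integrable:
  assumes "q > 1" "x \<in> space M"
  shows "integrable M (\<lambda>y. cmod (K x y) powr q)"
proof (rule integrableI_bounded)
  show "(\<lambda>y. cmod (K x y) powr q) \<in> borel_measurable M" using assms by measurable
  obtain C where "\<forall>x\<in>space M. (\<integral>\<^sup>+y. ennreal (cmod (K x y) powr q) \<partial>M) \<le> ennreal C"
    using K_powr[OF assms(1)] by blast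
  then have "(\<integral>\<^sup>+y. ennreal (cmod (K x y) powr q) \<partial>M) \<le> ennreal C" using assms by blast
  then show "(\<integral>\<^sup>+y. ennreal (norm (cmod (K x y) powr q)) \<partial>M) < \<infinity>"
    by (simp add: le_less_trans[OF _ ennreal_less_top])
qed

text \<open>Two kernel factors together have a power to spare. Young with \<tau> and its dual
  exponent splits r^(1-\<theta>) s g into r^(a-\<theta>) s^a and r^(1-a) s^(1-a) g. The value of
  \<open>a\<close> makes the \<tau>-th power of the first equal to r^\<beta> s^\<alpha> with
  \<alpha>, \<beta> > 1, and leaves exponent 3/4 on both kernel factors in the dual power of the
  second. The missing power \<theta> of |K x y| is the gain that later controls the part where the
  kernel is small.\<close>

lemma iterated_kernel_bound:
  assumes t: "1 < \<tau>"
  obtains \<theta> D1 D2 where "0 < \<theta>" "\<theta> < 1" "D1 \<ge> 0" "D2 \<ge> 0"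
    "\<And>x G. x \<in> space M \<Longrightarrow> G \<in> borel_measurable M \<Longrightarrow>
      (\<integral>\<^sup>+y. (\<integral>\<^sup>+z. ennreal (cmod (K x y) powr (1 - \<theta>) * cmod (K y z) * cmod (G z)) \<partial>M) \<partial>M)
        \<le> ennreal D1 + ennreal D2 * (\<integral>\<^sup>+z. ennreal (cmod (G z) powr (\<tau> / (\<tau> - 1))) \<partial>M)"
proof -
  let ?\<tau>' = "\<tau> / (\<tau> - 1)"
  define \<alpha> where "\<alpha> = 1 + (\<tau> - 1) / 4"
  define \<beta> where "\<beta> = 1 + (\<tau> - 1) / 8"
  define a where "a = \<alpha> / \<tau>"
  define \<theta> where "\<theta> = (\<tau> - 1) / (8 * \<tau>)"
  have \<alpha>: "\<alpha> > 1" and \<beta>: "\<beta> > 1" using t by (auto simp: \<alpha>_def \<beta>_def)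
  have \<theta>: "0 < \<theta>" "\<theta> < 1" using t by (auto simp: \<theta>_def field_simps)
  have a\<theta>: "(a - \<theta>) * \<tau> = \<beta>" "a * \<tau> = \<alpha>" using t by (auto simp: a_def \<theta>_def \<alpha>_def \<beta>_def field_simps)
  have a1: "(1 - a) * ?\<tau>' = 3 / 4" using t by (auto simp: a_def \<alpha>_def field_simps)
  have a0: "a - \<theta> > 0" using a\<theta>(1) \<beta> t by (metis less_trans mult_pos_pos zero_less_mult_pos2 zero_less_one)
  obtain C\<alpha> where C\<alpha>: "C\<alpha> \<ge> 0" "\<And>x. x \<in> space M \<Longrightarrow> (\<integral>\<^sup>+y. ennreal (cmod (K x y) powr \<alpha>) \<partial>M) \<le> ennreal C\<alpha>"
    using K_powr[OF \<alpha>] by auto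
  obtain C\<beta> where C\<beta>: "C\<beta> \<ge> 0" "\<And>x. x \<in> space M \<Longrightarrow> (\<integral>\<^sup>+y. ennreal (cmod (K x y) powr \<beta>) \<partial>M) \<le> ennreal C\<beta>"
    using K_powr[OF \<beta>] by auto
  obtain C where C: "C \<ge> 0" "\<And>x. x \<in> space M \<Longrightarrow> (\<integral>\<^sup>+y. ennreal (cmod (K x y) powr (3/2)) \<partial>M) \<le> ennreal C"
    using K_powr[of "3/2"] by auto
  have pt: "r powr (1 - \<theta>) * s * g \<le> r powr \<beta> * s powr \<alpha> + (r powr (3/2) * g powr ?\<tau>' + s powr (3/2) * g powr ?\<tau>')"
    if nn: "r \<ge> 0" "s \<ge> 0" "g \<ge> 0" for r s g :: real
  proof -
    have e: "r powr (1 - \<theta>) * s * g = (r powr (a - \<theta>) * s powr a) * (r powr (1 - a) * s powr (1 - a) * g)"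
    proof (cases "s = 0")
      case False
      then have "s powr a * s powr (1 - a) = s" using nn powr_add[of s a "1 - a"] by simp
      moreover have "r powr (a - \<theta>) * r powr (1 - a) = r powr (1 - \<theta>)"
        using powr_add[of r "a - \<theta>" "1 - a"] by simp
      ultimately show ?thesis by (metis mult.assoc mult.left_commute)
    qed simp
    have p1: "(r powr (a - \<theta>) * s powr a) powr \<tau> = r powr \<beta> * s powr \<alpha>"
      using nn by (simp add: powr_mult powr_powr a\<theta>)
    have p2: "(r powr (1 - a) * s powr (1 - a) * g) powr ?\<tau>' = r powr (3/4) * s powr (3/4) * g powr ?\<tau>'"
      using nn by (simp add: powr_mult powr_powr a1 del: times_divide_eq_right)
    have "r powr (1 - \<theta>) * s * g \<le> r powr \<beta> * s powr \<alpha> + r powr (3/4) * s powr (3/4) * g powr ?\<tau>'"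
      unfolding e p1[symmetric] p2[symmetric]
      by (rule mult_le_powr_conj[OF t]) (use nn in auto)
    \<comment> \<open>After this every summand with \<open>g\<close> contains a single kernel factor
      with exponent 3/2 > 1 and can be integrated in y for fixed z.\<close>
    also have "r powr (3/4) * s powr (3/4) * g powr ?\<tau>' \<le> (r powr (3/2) + s powr (3/2)) * g powr ?\<tau>'"
      using powr_mult_powr_le[of r s "3/4" "3/4"] nn by (intro mult_right_mono) auto
    finally show ?thesis by (simp add: distrib_right)
  qed
  show ?thesis
  proof (rule that[OF \<theta>, of "C\<beta> * C\<alpha>" "C + C"])
    fix x and G :: "'x \<Rightarrow> complex" assume x: "x \<in> space M" and G [measurable]: "G \<in> borel_measurable M"
    note K_meas1[OF x, measurable]
    define E where "E = (\<integral>\<^sup>+z. ennreal (cmod (G z) powr ?\<tau>') \<partial>M)"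
    let ?k = "\<lambda>y q. ennreal (cmod (K x y) powr q)" and ?l = "\<lambda>y z q. ennreal (cmod (K y z) powr q)"
    let ?g = "\<lambda>z. ennreal (cmod (G z) powr ?\<tau>')"
    have "(\<integral>\<^sup>+y. (\<integral>\<^sup>+z. ennreal (cmod (K x y) powr (1 - \<theta>) * cmod (K y z) * cmod (G z)) \<partial>M) \<partial>M)
        \<le> (\<integral>\<^sup>+y. (\<integral>\<^sup>+z. ?k y \<beta> * ?l y z \<alpha> + (?k y (3/2) * ?g z + ?l y z (3/2) * ?g z) \<partial>M) \<partial>M)"
    proof (intro nn_integral_mono)
      fix y z
      have "ennreal (cmod (K x y) powr (1 - \<theta>) * cmod (K y z) * cmod (G z)) \<le>
          ennreal (cmod (K x y) powr \<beta> * cmod (K y z) powr \<alpha> + (cmod (K x y) powr (3/2) * cmod (G z) powr ?\<tau>' +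
            cmod (K y z) powr (3/2) * cmod (G z) powr ?\<tau>'))"
        by (intro ennreal_leI pt) auto
      then show "ennreal (cmod (K x y) powr (1 - \<theta>) * cmod (K y z) * cmod (G z)) \<le>
          ?k y \<beta> * ?l y z \<alpha> + (?k y (3/2) * ?g z + ?l y z (3/2) * ?g z)"
        by (simp add: ennreal_mult ennreal_plus)
    qed
    also have "\<dots> = (\<integral>\<^sup>+y. ?k y \<beta> * (\<integral>\<^sup>+z. ?l y z \<alpha> \<partial>M) + (?k y (3/2) * E + (\<integral>\<^sup>+z. ?l y z (3/2) * ?g z \<partial>M)) \<partial>M)"
      unfolding E_def by (intro nn_integral_cong) (simp add: nn_integral_add nn_integral_cmult)
    also have "\<dots> = (\<integral>\<^sup>+y. ?k y \<beta> * (\<integral>\<^sup>+z. ?l y z \<alpha> \<partial>M) \<partial>M) + ((\<integral>\<^sup>+y. ?k y (3/2) * E \<partial>M) +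
        (\<integral>\<^sup>+y. (\<integral>\<^sup>+z. ?l y z (3/2) * ?g z \<partial>M) \<partial>M))"
    proof -
      have [measurable]: "(\<lambda>y. \<integral>\<^sup>+z. ?l y z \<alpha> \<partial>M) \<in> borel_measurable M"
        "(\<lambda>y. \<integral>\<^sup>+z. ?l y z (3/2) * ?g z \<partial>M) \<in> borel_measurable M" by measurable
      show ?thesis by (simp add: nn_integral_add)
    qed
    also have "\<dots> \<le> ennreal (C\<beta> * C\<alpha>) + (ennreal C * E + ennreal C * E)"
    proof (intro add_mono)
      have "(\<integral>\<^sup>+y. ?k y \<beta> * (\<integral>\<^sup>+z. ?l y z \<alpha> \<partial>M) \<partial>M) \<le> (\<integral>\<^sup>+y. ?k y \<beta> * ennreal C\<alpha> \<partial>M)"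
        using C\<alpha> by (intro nn_integral_mono mult_left_mono) auto
      also have "\<dots> = (\<integral>\<^sup>+y. ?k y \<beta> \<partial>M) * ennreal C\<alpha>" by (simp add: nn_integral_multc)
      also have "\<dots> \<le> ennreal C\<beta> * ennreal C\<alpha>" using C\<beta> x by (intro mult_right_mono) auto
      finally show "(\<integral>\<^sup>+y. ?k y \<beta> * (\<integral>\<^sup>+z. ?l y z \<alpha> \<partial>M) \<partial>M) \<le> ennreal (C\<beta> * C\<alpha>)"
        using C\<alpha> C\<beta> by (simp add: ennreal_mult)
      show "(\<integral>\<^sup>+y. ?k y (3/2) * E \<partial>M) \<le> ennreal C * E"
        using C x by (simp add: nn_integral_multc mult_right_mono)
      interpret P: pair_sigma_finite M M ..
      have "(\<integral>\<^sup>+y. (\<integral>\<^sup>+z. ?l y z (3/2) * ?g z \<partial>M) \<partial>M) = (\<integral>\<^sup>+z. (\<integral>\<^sup>+y. ?l y z (3/2) * ?g z \<partial>M) \<partial>M)"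
        by (intro P.Fubini'[symmetric]) measurable
      also have "\<dots> \<le> (\<integral>\<^sup>+z. ennreal C * ?g z \<partial>M)"
      proof (rule nn_integral_mono)
        \<comment> \<open>Hermitian symmetry turns the integral over the first argument into a row
          integral.\<close>
        fix z assume z: "z \<in> space M"
        note K_meas1'[OF z, measurable]
        have "(\<integral>\<^sup>+y. ?l y z (3/2) * ?g z \<partial>M) = (\<integral>\<^sup>+y. ?l z y (3/2) \<partial>M) * ?g z"
          using z by (simp add: nn_integral_multc norm_K_commute cong: nn_integral_cong)
        also have "\<dots> \<le> ennreal C * ?g z" using C z by (intro mult_right_mono) auto
        finally show "(\<integral>\<^sup>+y. ?l y z (3/2) * ?g z \<partial>M) \<le> ennreal C * ?g z" .
      qed
      also have "\<dots> = ennreal C * E" unfolding E_def by (simp add: nn_integral_cmult)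
      finally show "(\<integral>\<^sup>+y. (\<integral>\<^sup>+z. ?l y z (3/2) * ?g z \<partial>M) \<partial>M) \<le> ennreal C * E" .
    qed
    also have "\<dots> = ennreal (C\<beta> * C\<alpha>) + ennreal (C + C) * E"
      unfolding ennreal_plus[OF C(1) C(1)] by (simp add: distrib_right)
    finally show "(\<integral>\<^sup>+y. (\<integral>\<^sup>+z. ennreal (cmod (K x y) powr (1 - \<theta>) * cmod (K y z) * cmod (G z)) \<partial>M) \<partial>M)
        \<le> ennreal (C\<beta> * C\<alpha>) + ennreal (C + C) * (\<integral>\<^sup>+z. ?g z \<partial>M)"
      unfolding E_def .
  qed (use C C\<alpha> C\<beta> in auto)
qed

text \<open>For p = 1 the kernel is bounded; for p > 1 the dual exponent exceeds 1, so the rows are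
  bounded in the dual space. Young gives a dominating function whose integral has a bound
  independent of x.\<close>

lemma Lp_times_kernel:
  assumes p: "p \<ge> 1" and F [measurable]: "F \<in> borel_measurable M"
    and Fp: "integrable M (\<lambda>x. cmod (F x) powr p)"
  obtains B where "\<And>x. x \<in> space M \<Longrightarrow> integrable M (\<lambda>y. F y * K y x)"
    "\<And>x. x \<in> space M \<Longrightarrow> cmod (\<integral>y. F y * K y x \<partial>M) \<le> B"
proof -
  have "\<exists>B. \<forall>x\<in>space M. \<exists>h. integrable M h \<and> (\<forall>y\<in>space M. cmod (F y * K y x) \<le> h y) \<and> integral\<^sup>L M h \<le> B"
  proof (cases "p = 1")
    case True
    show ?thesis
    proof (intro exI ballI conjI)
      fix x assume x: "x \<in> space M"
      show "integrable M (\<lambda>y. C0 * cmod (F y) powr p)" using Fp by simp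
      show "integral\<^sup>L M (\<lambda>y. C0 * cmod (F y) powr p) \<le> C0 * integral\<^sup>L M (\<lambda>y. cmod (F y) powr p)" by simp
      fix y assume "y \<in> space M"
      then have "cmod (F y) * cmod (K y x) \<le> cmod (F y) * C0" using x K_bounded by (intro mult_left_mono) auto
      then show "cmod (F y * K y x) \<le> C0 * cmod (F y) powr p" using True by (simp add: norm_mult mult.commute)
    qed
  next
    case False
    then have p: "1 < p" "1 < p / (p - 1)" using p by auto
    obtain C where C: "C \<ge> 0" "\<And>x. x \<in> space M \<Longrightarrow> (\<integral>\<^sup>+y. ennreal (cmod (K x y) powr (p/(p-1))) \<partial>M) \<le> ennreal C"
      using K_powr[OF p(2)] by auto
    show ?thesis
    proof (intro exI ballI conjI)
      fix x assume x: "x \<in> space M"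
      have i: "integrable M (\<lambda>y. cmod (K x y) powr (p / (p - 1)))" by (rule K_powr_integrable[OF p(2) x])
      show "integrable M (\<lambda>y. cmod (F y) powr p + cmod (K x y) powr (p / (p - 1)))"
        using Fp i by (rule Bochner_Integration.integrable_add)
      have "ennreal (\<integral>y. cmod (K x y) powr (p / (p - 1)) \<partial>M) \<le> ennreal C"
        using nn_integral_eq_integral[OF i] C(2)[OF x] by simp
      then have "(\<integral>y. cmod (K x y) powr (p / (p - 1)) \<partial>M) \<le> C" using C(1) by simp
      then show "integral\<^sup>L M (\<lambda>y. cmod (F y) powr p + cmod (K x y) powr (p / (p - 1)))
          \<le> integral\<^sup>L M (\<lambda>y. cmod (F y) powr p) + C" using Fp i by simp
      fix y assume "y \<in> space M"
      then show "cmod (F y * K y x) \<le> cmod (F y) powr p + cmod (K x y) powr (p / (p - 1))"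
        using mult_le_powr_conj[OF p(1), of "cmod (F y)" "cmod (K y x)"] x by (simp add: norm_mult norm_K_commute)
    qed
  qed
  then obtain B where B: "\<And>x. x \<in> space M \<Longrightarrow>
      \<exists>h. integrable M h \<and> (\<forall>y\<in>space M. cmod (F y * K y x) \<le> h y) \<and> integral\<^sup>L M h \<le> B" by blast
  show ?thesis
  proof (rule that)
    fix x assume x: "x \<in> space M"
    then obtain h where h: "integrable M h" "\<And>y. y \<in> space M \<Longrightarrow> cmod (F y * K y x) \<le> h y" "integral\<^sup>L M h \<le> B"
      using B by blast
    note K_meas1'[OF x, measurable]
    show i: "integrable M (\<lambda>y. F y * K y x)"
    proof (rule Bochner_Integration.integrable_bound[OF h(1)])
      show "AE y in M. norm (F y * K y x) \<le> norm (h y)"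
        using h(2) by (intro AE_I2) (simp add: order_trans[OF _ abs_ge_self])
    qed measurable
    have "cmod (\<integral>y. F y * K y x \<partial>M) \<le> integral\<^sup>L M h"
      using h i by (intro order_trans[OF integral_norm_bound] integral_mono) auto
    then show "cmod (\<integral>y. F y * K y x \<partial>M) \<le> B" using h(3) by simp
  qed
qed

text \<open>Each \<open>Fn n\<close> is reproduced by Fubini; the work lies in the limit, since no
  multiple of |K x y| may serve as integrable majorant. The domain is split at |K x y| = \<epsilon>.
  Above this level |K| \<le> \<epsilon>^(-1/2) |K|^(3/2) is integrable and dominated convergence
  applies. Below it the surplus power \<theta> bounds the contribution by \<epsilon>^\<theta> D,
  uniformly in n. Then \<epsilon> tends to 0, with integrability of \<open>F y * K y x\<close> as
  hypothesis.\<close>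

lemma reproducing_limit:
  assumes t: "1 < \<tau>"
    and G [measurable]: "\<And>n. G n \<in> borel_measurable M"
    and GB: "\<And>n. (\<integral>\<^sup>+z. ennreal (cmod (G n z) powr (\<tau> / (\<tau> - 1))) \<partial>M) \<le> ennreal B"
    and lim: "\<And>x. x \<in> space M \<Longrightarrow> (\<lambda>n. \<integral>z. G n z * (v z * K z x) \<partial>M) \<longlonglongrightarrow> F x"
    and x: "x \<in> space M" and FK: "integrable M (\<lambda>y. F y * K y x)"
  shows "F x = (\<integral>y. F y * K y x \<partial>M)"
proof -
  let ?\<tau>' = "\<tau> / (\<tau> - 1)"
  interpret P: pair_sigma_finite M M ..
  note v_measurable[measurable] K_meas1[OF x, measurable] K_meas1'[OF x, measurable]
  obtain \<theta> D1 D2 where \<theta>: "0 < \<theta>" "\<theta> < 1" and D: "D1 \<ge> 0" "D2 \<ge> 0"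
    and it: "\<And>x G. x \<in> space M \<Longrightarrow> G \<in> borel_measurable M \<Longrightarrow>
      (\<integral>\<^sup>+y. (\<integral>\<^sup>+z. ennreal (cmod (K x y) powr (1 - \<theta>) * cmod (K y z) * cmod (G z)) \<partial>M) \<partial>M)
        \<le> ennreal D1 + ennreal D2 * (\<integral>\<^sup>+z. ennreal (cmod (G z) powr ?\<tau>') \<partial>M)"
    using iterated_kernel_bound[OF t] by blast
  \<comment> \<open>A negative \<open>B\<close> reads as 0 in \<open>ennreal\<close>; the maximum
    keeps the real products below nonnegative.\<close>
  define B' where "B' = max B 0"
  have B': "B' \<ge> 0" "\<And>n. (\<integral>\<^sup>+z. ennreal (cmod (G n z) powr ?\<tau>') \<partial>M) \<le> ennreal B'"
    by (simp add: B'_def, rule order_trans[OF GB], simp add: B'_def ennreal_leI)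
  define D where "D = c * c * v x * (D1 + D2 * B')"
  have vx: "v x \<ge> 0" using v_ge_1[OF x] by simp
  have D0: "D \<ge> 0" unfolding D_def using D B' c_nonneg vx by auto
  define Fn where "Fn n y = (\<integral>z. G n z * (v z * K z y) \<partial>M)" for n y
  have Fn_meas [measurable]: "Fn n \<in> borel_measurable M" for n
    unfolding Fn_def by measurable
  \<comment> \<open>The weight travels from z to y to x, at the price of one factor \<open>c\<close>
    for each kernel factor it crosses.\<close>
  have dom: "v z * cmod (K z y) * cmod (K y x) \<le> c * c * v x * (cmod (K x y) * cmod (K y z))"
    if "y \<in> space M" "z \<in> space M" for y z
  proof -
    have "v z * cmod (K y z) * cmod (K x y) \<le> c * v y * cmod (K y z) * cmod (K x y)"
      by (rule mult_right_mono[OF v_moderate_norm[OF that] norm_ge_zero])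
    also have "\<dots> = c * cmod (K y z) * (v y * cmod (K x y))" by simp
    also have "\<dots> \<le> c * cmod (K y z) * (c * v x * cmod (K x y))"
      using v_moderate_norm[OF x that(1)] c_nonneg by (intro mult_left_mono) auto
    finally show ?thesis using that x by (simp add: norm_K_commute mult_ac)
  qed
  have bound: "(\<integral>\<^sup>+y. (\<integral>\<^sup>+z. ennreal (indicator S y * cmod (G n z * (v z * K z y) * K y x)) \<partial>M) \<partial>M) \<le> ennreal (\<delta> powr \<theta> * D)"
    if \<delta>: "\<delta> \<ge> 0" "\<And>y. y \<in> S \<Longrightarrow> y \<in> space M \<Longrightarrow> cmod (K x y) \<le> \<delta>" and S: "S \<in> sets M" for S n \<delta>
  proof -
    have "(\<integral>\<^sup>+y. (\<integral>\<^sup>+z. ennreal (indicator S y * cmod (G n z * (v z * K z y) * K y x)) \<partial>M) \<partial>M)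
       \<le> (\<integral>\<^sup>+y. (\<integral>\<^sup>+z. ennreal (\<delta> powr \<theta> * (c * c * v x)) * ennreal (cmod (K x y) powr (1 - \<theta>) * cmod (K y z) * cmod (G n z)) \<partial>M) \<partial>M)"
    proof (intro nn_integral_mono)
      fix y z assume y: "y \<in> space M" and z: "z \<in> space M"
      have "indicator S y * cmod (G n z * (v z * K z y) * K y x) \<le>
          \<delta> powr \<theta> * (c * c * v x) * (cmod (K x y) powr (1 - \<theta>) * cmod (K y z) * cmod (G n z))"
      proof (cases "y \<in> S")
        case True
        have "cmod (K x y) = cmod (K x y) powr \<theta> * cmod (K x y) powr (1 - \<theta>)"
          by (cases "K x y = 0") (simp_all flip: powr_add)
        also have "\<dots> \<le> \<delta> powr \<theta> * cmod (K x y) powr (1 - \<theta>)"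
          using \<delta> True y \<theta> by (intro mult_right_mono powr_mono2) auto
        finally have k: "cmod (K x y) \<le> \<delta> powr \<theta> * cmod (K x y) powr (1 - \<theta>)" .
        have "cmod (G n z * (v z * K z y) * K y x) = cmod (G n z) * (v z * cmod (K z y) * cmod (K y x))"
          using v_ge_1[OF z] by (simp add: norm_mult)
        also have "\<dots> \<le> cmod (G n z) * (c * c * v x * (cmod (K x y) * cmod (K y z)))"
          using dom[OF y z] by (intro mult_left_mono) auto
        also have "\<dots> \<le> cmod (G n z) * (c * c * v x * ((\<delta> powr \<theta> * cmod (K x y) powr (1 - \<theta>)) * cmod (K y z)))"
          using k c_nonneg vx by (intro mult_left_mono mult_right_mono) auto
        finally show ?thesis using True by (simp add: mult_ac)
      qed (use c_nonneg vx in auto)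
      then show "ennreal (indicator S y * cmod (G n z * (v z * K z y) * K y x)) \<le>
          ennreal (\<delta> powr \<theta> * (c * c * v x)) * ennreal (cmod (K x y) powr (1 - \<theta>) * cmod (K y z) * cmod (G n z))"
        using c_nonneg vx by (subst ennreal_mult'[symmetric]) (auto intro!: ennreal_leI)
    qed
    also have "\<dots> = ennreal (\<delta> powr \<theta> * (c * c * v x)) *
        (\<integral>\<^sup>+y. (\<integral>\<^sup>+z. ennreal (cmod (K x y) powr (1 - \<theta>) * cmod (K y z) * cmod (G n z)) \<partial>M) \<partial>M)"
      by (subst nn_integral_cmult[symmetric], measurable) (intro nn_integral_cong nn_integral_cmult, measurable)
    also have "\<dots> \<le> ennreal (\<delta> powr \<theta> * (c * c * v x)) * (ennreal D1 + ennreal D2 * ennreal B')"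
      by (intro mult_left_mono order_trans[OF it[OF x G]] add_left_mono B') auto
    also have "\<dots> = ennreal (\<delta> powr \<theta> * D)"
      using D B' c_nonneg vx unfolding D_def
      by (simp flip: ennreal_mult ennreal_plus add: mult.assoc)
    finally show ?thesis .
  qed
  have pair_int: "integrable (M \<Otimes>\<^sub>M M) (\<lambda>(y, z). indicator S y * (G n z * (v z * K z y) * K y x))"
    and tail: "cmod (\<integral>y. indicator S y * (Fn n y * K y x) \<partial>M) \<le> \<delta> powr \<theta> * D"
    if \<delta>: "\<delta> \<ge> 0" "\<And>y. y \<in> S \<Longrightarrow> y \<in> space M \<Longrightarrow> cmod (K x y) \<le> \<delta>" and S[measurable]: "S \<in> sets M" for S n \<delta>
  proof -
    let ?h = "\<lambda>y z. indicator S y * (G n z * (v z * K z y) * K y x) :: complex"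
    have n: "ennreal (norm (?h y z)) = ennreal (indicator S y * cmod (G n z * (v z * K z y) * K y x))" for y z
      by (simp add: indicator_def norm_mult)
    have nn: "(\<integral>\<^sup>+y. (\<integral>\<^sup>+z. ennreal (norm (?h y z)) \<partial>M) \<partial>M) \<le> ennreal (\<delta> powr \<theta> * D)"
      unfolding n by (rule bound[OF \<delta> S])
    have hm: "(\<lambda>(y, z). ?h y z) \<in> borel_measurable (M \<Otimes>\<^sub>M M)" by measurable
    have e: "(\<integral>\<^sup>+yz. ennreal (norm (case yz of (y, z) \<Rightarrow> ?h y z)) \<partial>(M \<Otimes>\<^sub>M M)) = (\<integral>\<^sup>+y. (\<integral>\<^sup>+z. ennreal (norm (?h y z)) \<partial>M) \<partial>M)"
      using nn_integral_fst[of "\<lambda>yz. ennreal (norm (case yz of (y, z) \<Rightarrow> ?h y z))" M] hm by simp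
    show i: "integrable (M \<Otimes>\<^sub>M M) (\<lambda>(y, z). ?h y z)"
      by (rule integrableI_bounded[OF hm]) (use nn in \<open>simp add: e le_less_trans[OF _ ennreal_less_top]\<close>)
    have "(\<integral>y. indicator S y * (Fn n y * K y x) \<partial>M) = (\<integral>y. (\<integral>z. ?h y z \<partial>M) \<partial>M)"
      unfolding Fn_def by simp
    also have "\<dots> = (\<integral>yz. (case yz of (y, z) \<Rightarrow> ?h y z) \<partial>(M \<Otimes>\<^sub>M M))"
      using P.integral_fst[OF i] by simp
    finally have eq: "(\<integral>y. indicator S y * (Fn n y * K y x) \<partial>M) = (\<integral>yz. (case yz of (y, z) \<Rightarrow> ?h y z) \<partial>(M \<Otimes>\<^sub>M M))" .
    have "ennreal (cmod (\<integral>yz. (case yz of (y, z) \<Rightarrow> ?h y z) \<partial>(M \<Otimes>\<^sub>M M))) \<le> ennreal (\<delta> powr \<theta> * D)"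
      by (rule order_trans[OF integral_norm_bound_ennreal[OF i]]) (simp only: e nn)
    then show "cmod (\<integral>y. indicator S y * (Fn n y * K y x) \<partial>M) \<le> \<delta> powr \<theta> * D"
      unfolding eq using D0 by simp
  qed
  \<comment> \<open>With level \<open>C0\<close> on the whole space the tail estimate becomes the
    absolute integrability required by Fubini.\<close>
  have i0: "integrable (M \<Otimes>\<^sub>M M) (\<lambda>(y, z). G n z * (v z * K z y) * K y x)" for n
  proof -
    have "integrable (M \<Otimes>\<^sub>M M) (\<lambda>(y, z). indicator (space M) y * (G n z * (v z * K z y) * K y x))"
      by (rule pair_int[of C0]) (use C0_nonneg K_bounded x in auto)
    then show ?thesis
      by (rule Bochner_Integration.integrable_cong[THEN iffD1, rotated -1])
         (auto simp: space_pair_measure)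
  qed
  have rep: "(\<integral>y. Fn n y * K y x \<partial>M) = Fn n x" for n
  proof -
    have "(\<integral>y. Fn n y * K y x \<partial>M) = (\<integral>y. (\<integral>z. G n z * (v z * K z y) * K y x \<partial>M) \<partial>M)"
      unfolding Fn_def by simp
    also have "\<dots> = (\<integral>z. (\<integral>y. G n z * (v z * K z y) * K y x \<partial>M) \<partial>M)"
      by (rule P.Fubini_integral[OF i0, symmetric])
    also have "\<dots> = (\<integral>z. G n z * (v z * K z x) \<partial>M)"
    proof (intro Bochner_Integration.integral_cong refl)
      fix z assume "z \<in> space M"
      then show "(\<integral>y. G n z * (v z * K z y) * K y x \<partial>M) = G n z * (v z * K z x)"
        using K_reproducing[OF _ x] by (simp add: mult.assoc)
    qed
    finally show ?thesis unfolding Fn_def .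
  qed
  have iFK: "integrable M (\<lambda>y. Fn n y * K y x)" for n
    using P.integrable_fst[OF i0[of n]] unfolding Fn_def by simp
  obtain C where C: "C \<ge> 0" "\<And>x. x \<in> space M \<Longrightarrow> (\<integral>\<^sup>+y. ennreal (cmod (K x y) powr \<tau>) \<partial>M) \<le> ennreal C"
    using K_powr[OF t] by auto
  define L where "L = c * c * v x * (B' + C)"
  have L0: "L \<ge> 0" unfolding L_def using B' C c_nonneg vx by auto
  \<comment> \<open>Young bounds |Fn n y| by a multiple of v y that does not depend on n; next to
    the factor K y x the weight v y is exchanged for v x.\<close>
  have Fn_bound: "cmod (Fn n y * K y x) \<le> L * cmod (K x y)" if y: "y \<in> space M" for n y
  proof -
    note K_meas1[OF y, measurable]
    have "ennreal (cmod (Fn n y)) \<le> (\<integral>\<^sup>+z. ennreal (cmod (G n z * (v z * K z y))) \<partial>M)"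
    proof (cases "integrable M (\<lambda>z. G n z * (v z * K z y))")
      case True then show ?thesis unfolding Fn_def by (rule integral_norm_bound_ennreal)
    next
      case False then show ?thesis by (simp add: Fn_def not_integrable_integral_eq)
    qed
    also have "\<dots> \<le> (\<integral>\<^sup>+z. ennreal (c * v y) * (ennreal (cmod (K y z) powr \<tau>) + ennreal (cmod (G n z) powr ?\<tau>')) \<partial>M)"
    proof (rule nn_integral_mono)
      fix z assume z: "z \<in> space M"
      have "cmod (G n z * (v z * K z y)) = cmod (G n z) * (v z * cmod (K y z))"
        using v_ge_1[OF z] y z by (simp add: norm_mult norm_K_commute)
      also have "\<dots> \<le> cmod (G n z) * (c * v y * cmod (K y z))"
        using v_moderate_norm[OF y z] by (intro mult_left_mono) auto
      also have "\<dots> = c * v y * (cmod (K y z) * cmod (G n z))" by simp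
      also have "\<dots> \<le> c * v y * (cmod (K y z) powr \<tau> + cmod (G n z) powr ?\<tau>')"
        using mult_le_powr_conj[OF t] c_nonneg v_ge_1[OF y] by (intro mult_left_mono) auto
      finally show "ennreal (cmod (G n z * (v z * K z y))) \<le>
          ennreal (c * v y) * (ennreal (cmod (K y z) powr \<tau>) + ennreal (cmod (G n z) powr ?\<tau>'))"
        using c_nonneg v_ge_1[OF y] by (simp flip: ennreal_plus ennreal_mult' add: ennreal_leI)
    qed
    also have "\<dots> = ennreal (c * v y) * ((\<integral>\<^sup>+z. ennreal (cmod (K y z) powr \<tau>) \<partial>M) + (\<integral>\<^sup>+z. ennreal (cmod (G n z) powr ?\<tau>') \<partial>M))"
      by (simp add: nn_integral_cmult nn_integral_add)
    also have "\<dots> \<le> ennreal (c * v y) * (ennreal C + ennreal B')"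
      using C(2)[OF y] B'(2)[of n] by (intro mult_left_mono add_mono) auto
    also have "\<dots> = ennreal (c * v y * (C + B'))"
      using C B' c_nonneg v_ge_1[OF y] by (simp flip: ennreal_plus ennreal_mult)
    finally have F: "cmod (Fn n y) \<le> c * v y * (C + B')"
      using C B' c_nonneg v_ge_1[OF y] by (simp add: ennreal_le_iff)
    have "cmod (Fn n y * K y x) \<le> c * v y * (C + B') * cmod (K x y)"
      using F x y by (simp add: norm_mult norm_K_commute mult_right_mono)
    also have "\<dots> = c * (C + B') * (v y * cmod (K x y))" by simp
    also have "\<dots> \<le> c * (C + B') * (c * v x * cmod (K x y))"
      using v_moderate_norm[OF x y] c_nonneg C B' by (intro mult_left_mono) auto
    finally show ?thesis by (simp add: L_def mult_ac add.commute)
  qed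
  define \<epsilon> :: "nat \<Rightarrow> real" where "\<epsilon> m = 1 / real (Suc m)" for m
  have \<epsilon>: "\<epsilon> m > 0" for m by (auto simp: \<epsilon>_def)
  have \<epsilon>_lim: "\<epsilon> \<longlonglongrightarrow> 0" unfolding \<epsilon>_def by (rule LIMSEQ_Suc[OF lim_1_over_n])
  define S where "S m = {y\<in>space M. cmod (K x y) \<le> \<epsilon> m}" for m
  have S [measurable]: "S m \<in> sets M" for m unfolding S_def by measurable
  define A where "A m = space M - S m" for m
  have A [measurable]: "A m \<in> sets M" for m unfolding A_def by measurable
  have F_meas [measurable]: "F \<in> borel_measurable M"
    using lim Fn_meas unfolding Fn_def by (rule borel_measurable_LIMSEQ_metric[rotated])
  \<comment> \<open>The part below the level is estimated before n tends to infinity, so the limit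
    \<open>F\<close> is integrated here only where a majorant is known.\<close>
  have main: "cmod (F x - (\<integral>y. indicator (A m) y * (F y * K y x) \<partial>M)) \<le> \<epsilon> m powr \<theta> * D" for m
  proof -
    have KA: "integrable M (\<lambda>y. indicator (A m) y * cmod (K x y))"
    proof (rule Bochner_Integration.integrable_bound)
      show "integrable M (\<lambda>y. \<epsilon> m powr (- 1/2) * cmod (K x y) powr (3/2))"
        using K_powr_integrable[of "3/2" x] x by simp
      show "AE y in M. norm (indicator (A m) y * cmod (K x y)) \<le> norm (\<epsilon> m powr (- 1/2) * cmod (K x y) powr (3/2))"
      proof (rule AE_I2)
        fix y assume y: "y \<in> space M"
        show "norm (indicator (A m) y * cmod (K x y)) \<le> norm (\<epsilon> m powr (- 1/2) * cmod (K x y) powr (3/2))"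
        proof (cases "y \<in> A m")
          case True
          then have k: "cmod (K x y) > \<epsilon> m" using y by (auto simp: A_def S_def)
          then have k0: "cmod (K x y) > 0" using \<epsilon>[of m] by linarith
          have "cmod (K x y) = cmod (K x y) powr (-1/2) * cmod (K x y) powr (3/2)"
            using k0 by (simp flip: powr_add)
          also have "\<dots> \<le> \<epsilon> m powr (-1/2) * cmod (K x y) powr (3/2)"
            using k \<epsilon>[of m] by (intro mult_right_mono powr_mono2') auto
          finally show ?thesis using True by simp
        qed simp
      qed
    qed measurable
    have "(\<lambda>n. \<integral>y. indicator (A m) y * (Fn n y * K y x) \<partial>M) \<longlonglongrightarrow> (\<integral>y. indicator (A m) y * (F y * K y x) \<partial>M)"
    proof (rule integral_dominated_convergence[where w="\<lambda>y. L * (indicator (A m) y * cmod (K x y))"])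
      show "integrable M (\<lambda>y. L * (indicator (A m) y * cmod (K x y)))" using KA by simp
      show "AE y in M. (\<lambda>n. indicator (A m) y * (Fn n y * K y x)) \<longlonglongrightarrow> indicator (A m) y * (F y * K y x)"
        using lim unfolding Fn_def by (intro AE_I2 tendsto_mult tendsto_const) auto
      show "AE y in M. norm (indicator (A m) y * (Fn n y * K y x)) \<le> L * (indicator (A m) y * cmod (K x y))" for n
        using Fn_bound[of _ n] by (intro AE_I2) (auto simp: indicator_def)
    qed measurable
    moreover have "(\<lambda>n. Fn n x) \<longlonglongrightarrow> F x" using lim[OF x] unfolding Fn_def .
    ultimately have "(\<lambda>n. cmod (Fn n x - (\<integral>y. indicator (A m) y * (Fn n y * K y x) \<partial>M))) \<longlonglongrightarrow>
        cmod (F x - (\<integral>y. indicator (A m) y * (F y * K y x) \<partial>M))"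
      by (intro tendsto_norm tendsto_diff)
    moreover have "cmod (Fn n x - (\<integral>y. indicator (A m) y * (Fn n y * K y x) \<partial>M)) \<le> \<epsilon> m powr \<theta> * D" for n
    proof -
      have iA: "integrable M (\<lambda>y. indicator (A m) y * (Fn n y * K y x))"
        by (rule Bochner_Integration.integrable_bound[OF iFK[of n]]) (auto simp: indicator_def)
      have "Fn n x - (\<integral>y. indicator (A m) y * (Fn n y * K y x) \<partial>M) =
          (\<integral>y. Fn n y * K y x - indicator (A m) y * (Fn n y * K y x) \<partial>M)"
        using iFK[of n] iA rep[of n] by simp
      also have "\<dots> = (\<integral>y. indicator (S m) y * (Fn n y * K y x) \<partial>M)"
        by (intro Bochner_Integration.integral_cong) (auto simp: A_def indicator_def)
      finally show ?thesis using tail[of "\<epsilon> m" "S m" n] \<epsilon>[of m] S[of m] by (simp add: S_def)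
    qed
    ultimately show ?thesis by (intro LIMSEQ_le_const2) auto
  qed
  have "(\<lambda>m. \<integral>y. indicator (A m) y * (F y * K y x) \<partial>M) \<longlonglongrightarrow> (\<integral>y. F y * K y x \<partial>M)"
  proof (rule integral_dominated_convergence[where w="\<lambda>y. norm (F y * K y x)"])
    show "integrable M (\<lambda>y. norm (F y * K y x))" using FK by (rule integrable_norm)
    show "AE y in M. (\<lambda>m. indicator (A m) y * (F y * K y x)) \<longlonglongrightarrow> F y * K y x"
    proof (rule AE_I2)
      fix y assume y: "y \<in> space M"
      show "(\<lambda>m. indicator (A m) y * (F y * K y x)) \<longlonglongrightarrow> F y * K y x"
      proof (cases "K x y = 0")
        case True then show ?thesis using K_hermitian[OF x y] by simp
      next
        case False
        then have ev: "eventually (\<lambda>m. \<epsilon> m < cmod (K x y)) sequentially"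
          using order_tendstoD(2)[OF \<epsilon>_lim, of "cmod (K x y)"] by simp
        show ?thesis
        proof (intro tendsto_eventually)
          show "eventually (\<lambda>m. indicator (A m) y * (F y * K y x) = F y * K y x) sequentially"
            using ev
            by eventually_elim (simp add: A_def S_def y)
        qed
      qed
    qed
    show "AE y in M. norm (indicator (A m) y * (F y * K y x)) \<le> norm (F y * K y x)" for m
      by (auto simp: indicator_def)
  qed measurable
  then have "(\<lambda>m. cmod (F x - (\<integral>y. indicator (A m) y * (F y * K y x) \<partial>M))) \<longlonglongrightarrow> cmod (F x - (\<integral>y. F y * K y x \<partial>M))"
    by (intro tendsto_norm tendsto_diff tendsto_const)
  moreover have "(\<lambda>m. \<epsilon> m powr \<theta> * D) \<longlonglongrightarrow> 0"
  proof -
    have "(\<lambda>m. \<epsilon> m powr \<theta>) \<longlonglongrightarrow> 0"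
      using \<theta> \<epsilon> by (intro tendsto_zero_powrI[of _ _ _ \<theta>] \<epsilon>_lim) (auto intro!: always_eventually less_imp_le)
    then show ?thesis by (rule tendsto_mult_left_zero)
  qed
  ultimately have "cmod (F x - (\<integral>y. F y * K y x \<partial>M)) \<le> 0"
    using main by (intro LIMSEQ_le) auto
  then show ?thesis by simp
qed

end

section \<open>Correlations\<close>

text \<open>The frame kernel, as a function of the translation of its second argument, has this
  form; the conjugate sits on \<open>g\<close> to match the inner product.\<close>

definition correlation :: "('a::euclidean_space \<Rightarrow> complex) \<Rightarrow> ('a \<Rightarrow> complex) \<Rightarrow> 'a \<Rightarrow> complex" where
  "correlation f g t = (\<integral>x. f x * cnj (g (x - t)) \<partial>lborel)"

text \<open>All three claims are Fubini for the product of f(x) and the conjugate of g(x - t), whose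
  absolute integrability is \<open>integrable_shifted_product\<close>. For the transform, the
  character at t is split into those at x - t and at x.\<close>

lemma
  fixes f g :: "'a::euclidean_space \<Rightarrow> complex"
  assumes f: "integrable lborel f" and g: "integrable lborel g"
  shows integrable_correlation: "integrable lborel (correlation f g)"
    and correlation_norm_le: "(\<integral>t. cmod (correlation f g t) \<partial>lborel) \<le> (\<integral>x. cmod (f x) \<partial>lborel) * (\<integral>x. cmod (g x) \<partial>lborel)"
    and fourier_correlation: "fourier (correlation f g) \<omega> = fourier f \<omega> * cnj (fourier g \<omega>)"
proof -
  have [measurable]: "f \<in> borel_measurable borel" "g \<in> borel_measurable borel" using f g by auto
  have gc: "integrable lborel (\<lambda>x. cnj (g x))" using g by simp
  have i: "integrable (lborel \<Otimes>\<^sub>M lborel) (\<lambda>(x, t). f x * cnj (g (x - t)))"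
    by (rule integrable_shifted_product[OF f gc])
  show 1: "integrable lborel (correlation f g)"
    using lborel_pair.integrable_snd[OF i] unfolding correlation_def[abs_def] by simp
  have ni: "integrable (lborel \<Otimes>\<^sub>M lborel) (\<lambda>(x, t). cmod (f x * cnj (g (x - t))))"
    using integrable_norm[OF i] by (simp add: case_prod_unfold)
  have "(\<integral>t. cmod (correlation f g t) \<partial>lborel) \<le> (\<integral>t. (\<integral>x. cmod (f x * cnj (g (x - t))) \<partial>lborel) \<partial>lborel)"
    unfolding correlation_def
  proof (rule integral_mono)
    show "integrable lborel (\<lambda>t. cmod (\<integral>x. f x * cnj (g (x - t)) \<partial>lborel))"
      using integrable_norm[OF 1] by (simp add: correlation_def)
    show "integrable lborel (\<lambda>t. \<integral>x. cmod (f x * cnj (g (x - t))) \<partial>lborel)"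
      using lborel_pair.integrable_snd[OF ni] by simp
  qed (rule integral_norm_bound)
  also have "\<dots> = (\<integral>x. (\<integral>t. cmod (f x * cnj (g (x - t))) \<partial>lborel) \<partial>lborel)"
    by (rule lborel_pair.Fubini_integral[OF ni])
  also have "\<dots> = (\<integral>x. cmod (f x) * (\<integral>y. cmod (g y) \<partial>lborel) \<partial>lborel)"
  proof (intro Bochner_Integration.integral_cong refl)
    fix x
    have "complex_of_real (\<integral>t. cmod (g (x - t)) \<partial>lborel) = complex_of_real (\<integral>y. cmod (g y) \<partial>lborel)"
      using lborel_reflect(2)[of "\<lambda>y. complex_of_real (cmod (g y))" x] by (simp add: integral_complex_of_real)
    then have "(\<integral>t. cmod (g (x - t)) \<partial>lborel) = (\<integral>y. cmod (g y) \<partial>lborel)"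
      by (simp only: of_real_eq_iff)
    then show "(\<integral>t. cmod (f x * cnj (g (x - t))) \<partial>lborel) = cmod (f x) * (\<integral>y. cmod (g y) \<partial>lborel)"
      by (simp add: norm_mult)
  qed
  finally show "(\<integral>t. cmod (correlation f g t) \<partial>lborel) \<le> (\<integral>x. cmod (f x) \<partial>lborel) * (\<integral>x. cmod (g x) \<partial>lborel)"
    by simp
  have wi: "integrable (lborel \<Otimes>\<^sub>M lborel) (\<lambda>(x, t). f x * cnj (g (x - t)) * wave (- (\<omega> \<bullet> t)))"
  proof -
    have "integrable (lborel \<Otimes>\<^sub>M lborel) (\<lambda>z. (case z of (x, t) \<Rightarrow> f x * cnj (g (x - t))) * wave (- (\<omega> \<bullet> snd z)))"
      using i by (rule integrable_mult_wave) measurable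
    then show ?thesis by (simp add: case_prod_unfold)
  qed
  have "fourier (correlation f g) \<omega> = (\<integral>t. (\<integral>x. f x * cnj (g (x - t)) * wave (- (\<omega> \<bullet> t)) \<partial>lborel) \<partial>lborel)"
    unfolding fourier_wave correlation_def by simp
  also have "\<dots> = (\<integral>x. (\<integral>t. f x * cnj (g (x - t)) * wave (- (\<omega> \<bullet> t)) \<partial>lborel) \<partial>lborel)"
    by (rule lborel_pair.Fubini_integral[OF wi])
  also have "\<dots> = (\<integral>x. f x * wave (- (\<omega> \<bullet> x)) * cnj (fourier g \<omega>) \<partial>lborel)"
  proof (intro Bochner_Integration.integral_cong refl)
    fix x
    have e: "cnj (g (x - t)) * wave (- (\<omega> \<bullet> t)) = cnj (g (x - t) * wave (- (\<omega> \<bullet> (x - t)))) * wave (- (\<omega> \<bullet> x))" for t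
    proof -
      have "wave (- (\<omega> \<bullet> t)) = wave (\<omega> \<bullet> (x - t)) * wave (- (\<omega> \<bullet> x))"
        by (simp add: inner_diff_right flip: wave_add)
      moreover have "cnj (wave (- (\<omega> \<bullet> (x - t)))) = wave (\<omega> \<bullet> (x - t))" by (simp add: wave_minus)
      ultimately show ?thesis by (simp only: complex_cnj_mult mult.assoc)
    qed
    have "(\<integral>t. cnj (g (x - t)) * wave (- (\<omega> \<bullet> t)) \<partial>lborel) =
        (\<integral>t. cnj (g (x - t) * wave (- (\<omega> \<bullet> (x - t)))) * wave (- (\<omega> \<bullet> x)) \<partial>lborel)"
      by (simp only: e)
    also have "\<dots> = (\<integral>t. cnj (g t * wave (- (\<omega> \<bullet> t))) \<partial>lborel) * wave (- (\<omega> \<bullet> x))"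
      using lborel_reflect(2)[of "\<lambda>t. cnj (g t * wave (- (\<omega> \<bullet> t)))" x] by simp
    also have "\<dots> = cnj (fourier g \<omega>) * wave (- (\<omega> \<bullet> x))"
      unfolding fourier_wave by (simp only: Bochner_Integration.integral_cnj)
    finally show "(\<integral>t. f x * cnj (g (x - t)) * wave (- (\<omega> \<bullet> t)) \<partial>lborel) = f x * wave (- (\<omega> \<bullet> x)) * cnj (fourier g \<omega>)"
      by (simp add: mult_ac)
  qed
  finally show "fourier (correlation f g) \<omega> = fourier f \<omega> * cnj (fourier g \<omega>)"
    by (simp add: fourier_wave[of f])
qed

section \<open>Splitting off the first coordinate\<close>

lemma vcons_None [simp]: "vcons a v $ None = a" and vcons_Some [simp]: "vcons a v $ Some j = v $ j"
  by (simp_all add: vcons_def)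

lemma vtail_vcons [simp]: "vtail (vcons a v) = v"
  by (simp add: vtail_def vec_eq_iff)

lemma vcons_vtail [simp]: "vcons (x $ None) (vtail x) = x"
  by (simp add: vec_eq_iff vcons_def vtail_def split: option.split)

lemma vtail_nth [simp]: "vtail x $ j = x $ Some j"
  by (simp add: vtail_def)

lemma vec_option_eq_iff: "x = y \<longleftrightarrow> x $ None = y $ None \<and> vtail x = vtail y"
  by (metis vcons_vtail)

lemma sum_option: "(\<Sum>i\<in>UNIV. f i) = f None + (\<Sum>j\<in>UNIV. f (Some j))" for f :: "'n::finite option \<Rightarrow> 'b::comm_monoid_add"
  by (simp add: UNIV_option_conv sum.reindex)

lemma prod_option: "(\<Prod>i\<in>UNIV. f i) = f None * (\<Prod>j\<in>UNIV. f (Some j))" for f :: "'n::finite option \<Rightarrow> 'b::comm_monoid_mult"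
  by (simp add: UNIV_option_conv prod.reindex)

lemma inner_option: "x \<bullet> y = x $ None * y $ None + vtail x \<bullet> vtail y" for x y :: "real ^ 'n::finite option"
  by (simp add: inner_vec_def sum_option)

lemma vtail_add [simp]: "vtail (x + y) = vtail x + vtail y"
  and vtail_diff [simp]: "vtail (x - y) = vtail x - vtail y"
  and vtail_scaleR [simp]: "vtail (c *\<^sub>R x) = c *\<^sub>R vtail x"
  by (simp_all add: vec_eq_iff)

lemma continuous_on_vtail [continuous_intros]:
  "continuous_on A f \<Longrightarrow> continuous_on A (\<lambda>x. vtail (f x))"
  unfolding vtail_def by (intro continuous_intros)

lemma continuous_on_vcons [continuous_intros]:
  assumes "continuous_on A f" "continuous_on A g"
  shows "continuous_on A (\<lambda>x. vcons (f x) (g x))"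
  unfolding vcons_def
proof (intro continuous_on_vec_lambda)
  show "continuous_on A (\<lambda>x. case i of None \<Rightarrow> f x | Some j \<Rightarrow> g x $ j)" for i
    by (cases i) (auto intro!: continuous_intros assms)
qed

lemma borel_measurable_vtail [measurable]:
  "f \<in> borel_measurable M \<Longrightarrow> (\<lambda>x. vtail (f x)) \<in> borel_measurable M"
  by (rule measurable_compose[of f M borel]) (auto intro!: borel_measurable_continuous_onI continuous_intros)

lemma borel_measurable_vec_nth' [measurable]:
  fixes f :: "'a \<Rightarrow> real ^ 'm::finite"
  shows "f \<in> borel_measurable M \<Longrightarrow> (\<lambda>x. f x $ i) \<in> borel_measurable M"
  by (rule measurable_compose[of f M borel]) (auto intro!: borel_measurable_continuous_onI continuous_intros)

lemma borel_measurable_vcons [measurable]: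
  fixes g :: "'a \<Rightarrow> real ^ 'n::finite"
  assumes "f \<in> borel_measurable M" "g \<in> borel_measurable M"
  shows "(\<lambda>x. vcons (f x) (g x)) \<in> borel_measurable M"
proof -
  have "(\<lambda>z::real \<times> (real ^ 'n). vcons (fst z) (snd z)) \<in> borel_measurable borel"
    by (intro borel_measurable_continuous_onI continuous_intros)
  from measurable_compose[OF borel_measurable_Pair[OF assms] this] show ?thesis by simp
qed

lemma prod_Basis_vec: "(\<Prod>b\<in>(Basis :: (real ^ 'm::finite) set). f b) = (\<Prod>i\<in>UNIV. f (axis i 1))"
proof -
  have *: "(Basis :: (real ^ 'm) set) = (\<lambda>i. axis i 1) ` UNIV" by (auto simp: Basis_vec_def)
  have inj: "inj (\<lambda>i::'m. axis i (1::real))" by (auto simp: inj_on_def axis_eq_axis)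
  show ?thesis unfolding * prod.reindex[OF inj] o_def by (rule refl)
qed

text \<open>The two measures agree on boxes, which determines Lebesgue measure. This opens the way
  to Fubini between the distinguished coordinate and the others.\<close>

lemma lborel_vcons:
  "(lborel :: (real ^ 'n::finite option) measure) = distr (lborel \<Otimes>\<^sub>M lborel) borel (\<lambda>(a, v). vcons a v)"
proof (rule lborel_eqI)
  fix l u :: "real ^ 'n option" assume lu: "\<And>b. b \<in> Basis \<Longrightarrow> l \<bullet> b \<le> u \<bullet> b"
  have le: "l $ i \<le> u $ i" for i
    using lu[of "axis i 1"] by (auto simp: inner_axis Basis_vec_def)
  have m: "(\<lambda>(a, v). vcons a v) \<in> (lborel :: real measure) \<Otimes>\<^sub>M (lborel :: (real ^ 'n) measure) \<rightarrow>\<^sub>M borel"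
    by measurable
  have v: "(\<lambda>(a, v). vcons a v) -` box l u \<inter> space ((lborel :: real measure) \<Otimes>\<^sub>M (lborel :: (real ^ 'n) measure)) =
      box (l $ None) (u $ None) \<times> box (vtail l) (vtail u)"
  proof (intro set_eqI)
    fix z :: "real \<times> (real ^ 'n)"
    have "(\<forall>i. Q i) \<longleftrightarrow> Q None \<and> (\<forall>j. Q (Some j))" for Q :: "'n option \<Rightarrow> bool"
      by (metis option.exhaust)
    then show "z \<in> (\<lambda>(a, v). vcons a v) -` box l u \<inter> space (lborel \<Otimes>\<^sub>M lborel) \<longleftrightarrow>
        z \<in> box (l $ None) (u $ None) \<times> box (vtail l) (vtail u)"
      by (cases z) (auto simp: space_pair_measure mem_box_cart box_real)
  qed
  have le': "vtail l \<bullet> b \<le> vtail u \<bullet> b" if "b \<in> Basis" for b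
    using that le by (auto simp: Basis_vec_def inner_axis)
  have "emeasure (distr (lborel \<Otimes>\<^sub>M lborel) borel (\<lambda>(a, v). vcons a v)) (box l u) =
      emeasure lborel (box (l $ None) (u $ None)) * emeasure lborel (box (vtail l) (vtail u))"
    by (subst emeasure_distr[OF m]) (auto simp: v lborel.emeasure_pair_measure_Times)
  also have "emeasure lborel (box (l $ None) (u $ None)) = ennreal (u $ None - l $ None)"
    using le by simp
  also have "emeasure lborel (box (vtail l) (vtail u)) = ennreal (\<Prod>b\<in>Basis. (vtail u - vtail l) \<bullet> b)"
    using le' by (simp add: prod_ennreal inner_diff_left)
  also have "ennreal (u $ None - l $ None) * ennreal (\<Prod>b\<in>Basis. (vtail u - vtail l) \<bullet> b) = ennreal (\<Prod>b\<in>Basis. (u - l) \<bullet> b)"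
  proof -
    have "(\<Prod>b\<in>Basis. (u - l) \<bullet> b) = (u $ None - l $ None) * (\<Prod>b\<in>Basis. (vtail u - vtail l) \<bullet> b)"
      unfolding prod_Basis_vec prod_option by (simp add: inner_axis)
    then show ?thesis using le[of None] by (simp only: ennreal_mult' diff_ge_0_iff_ge)
  qed
  finally show "emeasure (distr (lborel \<Otimes>\<^sub>M lborel) borel (\<lambda>(a, v). vcons a v)) (box l u) = (\<Prod>b\<in>Basis. (u - l) \<bullet> b)" .
qed simp

lemma nn_integral_vcons:
  fixes f :: "real ^ 'n::finite option \<Rightarrow> ennreal"
  assumes [measurable]: "f \<in> borel_measurable borel"
  shows "(\<integral>\<^sup>+x. f x \<partial>lborel) = (\<integral>\<^sup>+a. \<integral>\<^sup>+v. f (vcons a v) \<partial>lborel \<partial>lborel)"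
    and "(\<integral>\<^sup>+x. f x \<partial>lborel) = (\<integral>\<^sup>+v. \<integral>\<^sup>+a. f (vcons a v) \<partial>lborel \<partial>lborel)"
proof -
  have "(\<integral>\<^sup>+x. f x \<partial>lborel) = (\<integral>\<^sup>+z. f (vcons (fst z) (snd z)) \<partial>(lborel \<Otimes>\<^sub>M lborel))"
    by (subst lborel_vcons, subst nn_integral_distr) (auto simp: case_prod_unfold)
  also have "\<dots> = (\<integral>\<^sup>+a. \<integral>\<^sup>+v. f (vcons a v) \<partial>lborel \<partial>lborel)"
    by (subst lborel.nn_integral_fst[symmetric]) auto
  finally show 1: "(\<integral>\<^sup>+x. f x \<partial>lborel) = (\<integral>\<^sup>+a. \<integral>\<^sup>+v. f (vcons a v) \<partial>lborel \<partial>lborel)" .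
  show "(\<integral>\<^sup>+x. f x \<partial>lborel) = (\<integral>\<^sup>+v. \<integral>\<^sup>+a. f (vcons a v) \<partial>lborel \<partial>lborel)"
    unfolding 1 by (intro lborel_pair.Fubini') measurable
qed

lemma
  fixes f :: "real ^ 'n::finite option \<Rightarrow> complex"
  assumes f: "integrable lborel f"
  shows integrable_vcons: "integrable (lborel \<Otimes>\<^sub>M lborel) (\<lambda>(a, v). f (vcons a v))"
    and integral_vcons: "(\<integral>x. f x \<partial>lborel) = (\<integral>z. f (vcons (fst z) (snd z)) \<partial>(lborel \<Otimes>\<^sub>M lborel))"
proof -
  have [measurable]: "f \<in> borel_measurable borel" using f by auto
  have m: "(\<lambda>(a, v). vcons a v) \<in> (lborel :: real measure) \<Otimes>\<^sub>M (lborel :: (real ^ 'n) measure) \<rightarrow>\<^sub>M borel"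
    by measurable
  show "integrable (lborel \<Otimes>\<^sub>M lborel) (\<lambda>(a, v). f (vcons a v))"
    using integrable_distr[OF m, of f, folded lborel_vcons] f by (simp add: case_prod_unfold)
  show "(\<integral>x. f x \<partial>lborel) = (\<integral>z. f (vcons (fst z) (snd z)) \<partial>(lborel \<Otimes>\<^sub>M lborel))"
    by (subst lborel_vcons, subst integral_distr[OF m]) (auto simp: case_prod_unfold)
qed

text \<open>The cylinder over a null set is null: its fibres have infinite measure, but zero times
  infinity is zero in \<open>ennreal\<close>. It lifts the normalisation, which holds for almost
  every first frequency, to almost every frequency.\<close>

lemma AE_lborel_first:
  assumes "AE y in (lborel :: real measure). P y"
  shows "AE \<omega> in (lborel :: (real ^ 'n::finite option) measure). P (\<omega> $ None)"
proof -
  obtain N where N: "N \<in> null_sets lborel" "{y \<in> space lborel. \<not> P y} \<subseteq> N"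
    using assms by (auto elim!: AE_E simp: null_sets_def)
  then have [measurable]: "N \<in> sets borel" by auto
  have N0: "emeasure lborel N = 0" using N by auto
  have "(\<integral>\<^sup>+(\<omega> :: real ^ 'n option). indicator N (\<omega> $ None) \<partial>lborel) = (\<integral>\<^sup>+a. (\<integral>\<^sup>+(v :: real ^ 'n). indicator N a \<partial>lborel) \<partial>lborel)"
    by (subst nn_integral_vcons(1)) auto
  also have "\<dots> = (\<integral>\<^sup>+a. indicator N a * emeasure lborel (UNIV :: (real ^ 'n) set) \<partial>lborel)"
    by simp
  also have "\<dots> = 0" using N0 by (simp add: nn_integral_multc)
  finally have "AE \<omega> in (lborel :: (real ^ 'n option) measure). (indicator N (\<omega> $ None) :: ennreal) = 0"
    by (subst (asm) nn_integral_0_iff_AE) auto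
  then show ?thesis
    by eventually_elim (use N(2) in \<open>auto simp: indicator_def split: if_splits\<close>)
qed

lemma nn_integral_lborel_affine:
  fixes f :: "'a::euclidean_space \<Rightarrow> ennreal" and t :: 'a
  assumes [measurable]: "f \<in> borel_measurable borel" and c: "c \<noteq> 0"
  shows "(\<integral>\<^sup>+x. f (t + c *\<^sub>R x) \<partial>lborel) = ennreal (1 / \<bar>c\<bar> ^ DIM('a)) * (\<integral>\<^sup>+x. f x \<partial>lborel)"
proof -
  have "(\<integral>\<^sup>+x. f x \<partial>lborel) = ennreal (\<bar>c\<bar> ^ DIM('a)) * (\<integral>\<^sup>+x. f (t + c *\<^sub>R x) \<partial>lborel)"
    by (subst lborel_affine[OF c, of t]) (simp add: nn_integral_density nn_integral_distr nn_integral_cmult)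
  then have "ennreal (1 / \<bar>c\<bar> ^ DIM('a)) * (\<integral>\<^sup>+x. f x \<partial>lborel) =
      ennreal (1 / \<bar>c\<bar> ^ DIM('a) * \<bar>c\<bar> ^ DIM('a)) * (\<integral>\<^sup>+x. f (t + c *\<^sub>R x) \<partial>lborel)"
    by (subst ennreal_mult) (auto simp: mult.assoc)
  then show ?thesis using c by simp
qed

text \<open>The linear map A_a^(-1) S_s^(-1) when \<alpha> = 1/a and \<beta> is the reciprocal of
  the signed root of a; \<alpha> = \<beta> = 1 gives the map of a low-pass element.\<close>

definition shear_scale :: "real \<Rightarrow> real \<Rightarrow> real ^ 'n \<Rightarrow> real ^ 'n option \<Rightarrow> real ^ 'n::finite option" where
  "shear_scale \<alpha> \<beta> s x = vcons (\<alpha> * (x $ None - s \<bullet> vtail x)) (\<beta> *\<^sub>R vtail x)"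

text \<open>The inverse transpose of \<open>shear_scale\<close>, as \<open>inner_shear_scale\<close>
  confirms: it carries a substitution in the argument over to the frequency.\<close>

definition shear_scale_dual :: "real \<Rightarrow> real \<Rightarrow> real ^ 'n \<Rightarrow> real ^ 'n option \<Rightarrow> real ^ 'n::finite option" where
  "shear_scale_dual \<alpha> \<beta> s \<omega> = vcons (\<omega> $ None / \<alpha>) ((1 / \<beta>) *\<^sub>R (vtail \<omega> + (\<omega> $ None) *\<^sub>R s))"

lemma borel_measurable_shear_scale [measurable]:
  assumes [measurable]: "\<alpha> \<in> borel_measurable M" "\<beta> \<in> borel_measurable M" "s \<in> borel_measurable M" "f \<in> borel_measurable M"
  shows "(\<lambda>x. shear_scale (\<alpha> x) (\<beta> x) (s x) (f x)) \<in> borel_measurable M"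
  unfolding shear_scale_def by measurable

lemma inner_shear_scale:
  "\<alpha> \<noteq> 0 \<Longrightarrow> \<beta> \<noteq> 0 \<Longrightarrow> shear_scale_dual \<alpha> \<beta> s \<omega> \<bullet> shear_scale \<alpha> \<beta> s x = \<omega> \<bullet> x"
  by (simp add: shear_scale_def shear_scale_dual_def inner_option inner_add_left algebra_simps)

text \<open>For a fixed tail the shear is a translation of the first coordinate, so Fubini leaves
  only the two scalings, in dimensions 1 and d - 1.\<close>

lemma distr_shear_scale:
  fixes s :: "real ^ 'n::finite"
  assumes \<alpha>: "\<alpha> \<noteq> 0" and \<beta>: "\<beta> \<noteq> 0"
  shows "distr lborel borel (shear_scale \<alpha> \<beta> s) = density lborel (\<lambda>_. ennreal (1 / (\<bar>\<alpha>\<bar> * \<bar>\<beta>\<bar> ^ CARD('n))))"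
proof (rule measure_eqI)
  fix A :: "(real ^ 'n option) set" assume "A \<in> sets (distr lborel borel (shear_scale \<alpha> \<beta> s))"
  then have [measurable]: "A \<in> sets borel" by simp
  let ?f = "indicator A :: real ^ 'n option \<Rightarrow> ennreal"
  have "emeasure (distr lborel borel (shear_scale \<alpha> \<beta> s)) A = (\<integral>\<^sup>+x. ?f (shear_scale \<alpha> \<beta> s x) \<partial>lborel)"
    by (subst nn_integral_indicator[symmetric], simp, subst nn_integral_distr) auto
  also have "\<dots> = (\<integral>\<^sup>+v. \<integral>\<^sup>+a. ?f (vcons (- \<alpha> * (s \<bullet> v) + \<alpha> *\<^sub>R a) (\<beta> *\<^sub>R v)) \<partial>lborel \<partial>lborel)"
    by (subst nn_integral_vcons(2)) (auto simp: shear_scale_def algebra_simps)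
  also have "\<dots> = (\<integral>\<^sup>+v. ennreal (1 / \<bar>\<alpha>\<bar>) * (\<integral>\<^sup>+a. ?f (vcons a (\<beta> *\<^sub>R v)) \<partial>lborel) \<partial>lborel)"
  proof (intro nn_integral_cong)
    fix v :: "real ^ 'n"
    show "(\<integral>\<^sup>+a. ?f (vcons (- \<alpha> * (s \<bullet> v) + \<alpha> *\<^sub>R a) (\<beta> *\<^sub>R v)) \<partial>lborel) = ennreal (1 / \<bar>\<alpha>\<bar>) * (\<integral>\<^sup>+a. ?f (vcons a (\<beta> *\<^sub>R v)) \<partial>lborel)"
      using nn_integral_lborel_affine[OF _ \<alpha>, of "\<lambda>a. ?f (vcons a (\<beta> *\<^sub>R v))" "- \<alpha> * (s \<bullet> v)"] by simp
  qed
  also have "\<dots> = ennreal (1 / \<bar>\<alpha>\<bar>) * (\<integral>\<^sup>+v. (\<integral>\<^sup>+a. ?f (vcons a (0 + \<beta> *\<^sub>R v)) \<partial>lborel) \<partial>lborel)"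
    by (subst nn_integral_cmult) auto
  also have "\<dots> = ennreal (1 / \<bar>\<alpha>\<bar>) * (ennreal (1 / \<bar>\<beta>\<bar> ^ CARD('n)) * (\<integral>\<^sup>+v. (\<integral>\<^sup>+a. ?f (vcons a v) \<partial>lborel) \<partial>lborel))"
    using nn_integral_lborel_affine[OF _ \<beta>, of "\<lambda>v. \<integral>\<^sup>+a. ?f (vcons a v) \<partial>lborel" 0] by simp
  also have "(\<integral>\<^sup>+v. (\<integral>\<^sup>+a. ?f (vcons a v) \<partial>lborel) \<partial>lborel) = emeasure lborel A"
    by (subst nn_integral_vcons(2)[symmetric]) auto
  also have "ennreal (1 / \<bar>\<alpha>\<bar>) * (ennreal (1 / \<bar>\<beta>\<bar> ^ CARD('n)) * emeasure lborel A) =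
      emeasure (density lborel (\<lambda>_. ennreal (1 / (\<bar>\<alpha>\<bar> * \<bar>\<beta>\<bar> ^ CARD('n))))) A"
    by (simp add: emeasure_density nn_integral_cmult mult.assoc[symmetric] flip: ennreal_mult)
  finally show "emeasure (distr lborel borel (shear_scale \<alpha> \<beta> s)) A =
      emeasure (density lborel (\<lambda>_. ennreal (1 / (\<bar>\<alpha>\<bar> * \<bar>\<beta>\<bar> ^ CARD('n))))) A" .
qed simp

lemma
  fixes f :: "real ^ 'n::finite option \<Rightarrow> complex"
  assumes \<alpha>: "\<alpha> \<noteq> 0" and \<beta>: "\<beta> \<noteq> 0" and f: "integrable lborel f"
  shows integrable_shear_scale: "integrable lborel (\<lambda>x. f (shear_scale \<alpha> \<beta> s (x - t)))"
    and integral_shear_scale: "(\<integral>x. f (shear_scale \<alpha> \<beta> s (x - t)) \<partial>lborel) = (\<integral>x. f x \<partial>lborel) / of_real (\<bar>\<alpha>\<bar> * \<bar>\<beta>\<bar> ^ CARD('n))"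
proof -
  have [measurable]: "f \<in> borel_measurable borel" using f by auto
  have m [measurable]: "shear_scale \<alpha> \<beta> s \<in> borel_measurable borel" by measurable
  have "integrable (distr lborel borel (shear_scale \<alpha> \<beta> s)) f"
    unfolding distr_shear_scale[OF \<alpha> \<beta>] using f by (simp add: integrable_density)
  then have 1: "integrable lborel (\<lambda>x. f (shear_scale \<alpha> \<beta> s x))"
    by (simp add: integrable_distr_eq)
  then show "integrable lborel (\<lambda>x. f (shear_scale \<alpha> \<beta> s (x - t)))"
    using lborel_translate(1)[of "\<lambda>x. f (shear_scale \<alpha> \<beta> s x)" t] by simp
  have "(\<integral>x. f (shear_scale \<alpha> \<beta> s (x - t)) \<partial>lborel) = (\<integral>x. f (shear_scale \<alpha> \<beta> s x) \<partial>lborel)"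
    using lborel_translate(2)[of "\<lambda>x. f (shear_scale \<alpha> \<beta> s x)" t] .
  also have "\<dots> = integral\<^sup>L (distr lborel borel (shear_scale \<alpha> \<beta> s)) f"
    by (simp add: integral_distr)
  also have "\<dots> = (\<integral>x. f x \<partial>lborel) / of_real (\<bar>\<alpha>\<bar> * \<bar>\<beta>\<bar> ^ CARD('n))"
    unfolding distr_shear_scale[OF \<alpha> \<beta>] by (simp add: integral_density scaleR_conv_of_real)
  finally show "(\<integral>x. f (shear_scale \<alpha> \<beta> s (x - t)) \<partial>lborel) = (\<integral>x. f x \<partial>lborel) / of_real (\<bar>\<alpha>\<bar> * \<bar>\<beta>\<bar> ^ CARD('n))" .
qed

lemma fourier_shear_scale:
  fixes f :: "real ^ 'n::finite option \<Rightarrow> complex"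
  assumes \<alpha>: "\<alpha> \<noteq> 0" and \<beta>: "\<beta> \<noteq> 0" and f: "integrable lborel f"
  shows "fourier (\<lambda>x. f (shear_scale \<alpha> \<beta> s (x - t))) \<omega> =
    wave (- (\<omega> \<bullet> t)) * fourier f (shear_scale_dual \<alpha> \<beta> s \<omega>) / of_real (\<bar>\<alpha>\<bar> * \<bar>\<beta>\<bar> ^ CARD('n))"
proof -
  let ?\<omega> = "shear_scale_dual \<alpha> \<beta> s \<omega>"
  have [measurable]: "f \<in> borel_measurable borel" using f by auto
  have e: "f (shear_scale \<alpha> \<beta> s (x - t)) * wave (- (\<omega> \<bullet> x)) =
      wave (- (\<omega> \<bullet> t)) * (f (shear_scale \<alpha> \<beta> s (x - t)) * wave (- (?\<omega> \<bullet> shear_scale \<alpha> \<beta> s (x - t))))" for x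
    unfolding inner_shear_scale[OF \<alpha> \<beta>]
    using wave_add[of "- (\<omega> \<bullet> t)" "- (\<omega> \<bullet> (x - t))"] by (simp add: inner_diff_right mult_ac)
  have "integrable lborel (\<lambda>x. f x * wave (- (?\<omega> \<bullet> x)))"
    using f by (rule integrable_mult_wave) measurable
  from integral_shear_scale[OF \<alpha> \<beta> this, of s t] show ?thesis
    unfolding fourier_wave e by simp
qed

section \<open>Shearlets and the parameter measure\<close>

text \<open>\<open>matrix_inv\<close> is defined by choice, hence it is identified through the
  uniqueness of a two-sided inverse.\<close>

lemma matrix_inv_mult_vec:
  fixes A B :: "real ^ 'm::finite ^ 'm"
  assumes "\<And>x. A *v (B *v x) = x" "\<And>x. B *v (A *v x) = x"
  shows "matrix_inv A = B"
proof -
  have 1: "A ** B = mat 1" and 2: "B ** A = mat 1"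
    using assms by (simp_all add: matrix_eq flip: matrix_vector_mul_assoc)
  then have "A ** matrix_inv A = mat 1 \<and> matrix_inv A ** A = mat 1"
    unfolding matrix_inv_def by (rule_tac someI[of _ B]) simp
  then show ?thesis using 2 by (metis matrix_mul_assoc matrix_mul_lid matrix_mul_rid)
qed

lemma shear_mult_vec: "shear s *v x = vcons (x $ None + s \<bullet> vtail x) (vtail x)" for s :: "real ^ 'n::finite"
proof -
  have "(shear s *v x) $ None = x $ None + s \<bullet> vtail x"
    by (simp add: matrix_vector_mult_def sum_option shear_def inner_vec_def)
  moreover have "(shear s *v x) $ Some j = x $ Some j" for j
  proof -
    have "shear s $ Some j $ None = 0"
      and "shear s $ Some j $ Some k * x $ Some k = (if k = j then x $ Some k else 0)" for k
      by (auto simp: shear_def)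
    then show ?thesis by (simp add: matrix_vector_mult_def sum_option)
  qed
  ultimately show ?thesis by (simp add: vec_option_eq_iff vec_eq_iff)
qed

text \<open>The signed d-th root on the diagonal of A_a. The type argument records the dimension,
  which the real number does not determine.\<close>

definition dilation_root :: "'n::finite itself \<Rightarrow> real \<Rightarrow> real" where
  "dilation_root _ a = sgn a * \<bar>a\<bar> powr (1 / real CARD('n option))"

lemma dilation_root_nonzero [simp]: "a \<noteq> 0 \<Longrightarrow> dilation_root T a \<noteq> 0"
  by (simp add: dilation_root_def sgn_if)

lemma abs_dilation_root: "a \<noteq> 0 \<Longrightarrow> \<bar>dilation_root TYPE('n::finite) a\<bar> = \<bar>a\<bar> powr (1 / real CARD('n option))"
  by (simp add: dilation_root_def abs_mult)

lemma dilation_root_1 [simp]: "dilation_root T 1 = 1"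
  by (simp add: dilation_root_def)

lemma borel_measurable_dilation_root [measurable]:
  assumes [measurable]: "f \<in> borel_measurable M"
  shows "(\<lambda>x. dilation_root T (f x)) \<in> borel_measurable M"
  unfolding dilation_root_def by measurable

lemma dilation_mult_vec:
  "dilation a *v x = vcons (a * x $ None) (dilation_root TYPE('n) a *\<^sub>R vtail x)" for x :: "real ^ 'n::finite option"
proof -
  have "(dilation a *v x) $ None = a * x $ None"
    by (simp add: matrix_vector_mult_def sum_option dilation_def)
  moreover have "(dilation a *v x) $ Some j = dilation_root TYPE('n) a * x $ Some j" for j
  proof -
    have "dilation a $ Some j $ (None :: 'n option) = 0"
      and "dilation a $ Some j $ Some k * x $ Some k = (if k = j then dilation_root TYPE('n) a * x $ Some k else 0)" for k
      by (auto simp: dilation_def dilation_root_def)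
    then show ?thesis by (simp add: matrix_vector_mult_def sum_option)
  qed
  ultimately show ?thesis by (simp add: vec_option_eq_iff vec_eq_iff)
qed

lemma matrix_inv_shear: "matrix_inv (shear s) = shear (- s)" for s :: "real ^ 'n::finite"
  by (rule matrix_inv_mult_vec) (simp_all add: shear_mult_vec)

lemma matrix_inv_dilation_mult:
  fixes x :: "real ^ 'n::finite option"
  assumes a: "a \<noteq> 0"
  shows "matrix_inv (dilation a) *v x = vcons (x $ None / a) ((1 / dilation_root TYPE('n) a) *\<^sub>R vtail x)"
proof -
  define B :: "real ^ 'n option ^ 'n option" where
    "B = (\<chi> i j. if i = j then (case i of None \<Rightarrow> 1 / a | Some _ \<Rightarrow> 1 / dilation_root TYPE('n) a) else 0)"
  have B: "B *v x = vcons (x $ None / a) ((1 / dilation_root TYPE('n) a) *\<^sub>R vtail x)" for x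
  proof -
    have "(B *v x) $ i = (case i of None \<Rightarrow> 1 / a | Some _ \<Rightarrow> 1 / dilation_root TYPE('n) a) * x $ i" for i
    proof -
      have "(B *v x) $ i = (\<Sum>k\<in>UNIV. if k = i then (case i of None \<Rightarrow> 1 / a | Some _ \<Rightarrow> 1 / dilation_root TYPE('n) a) * x $ i else 0)"
        unfolding matrix_vector_mult_def B_def vec_lambda_beta by (intro sum.cong) auto
      then show ?thesis by simp
    qed
    then show ?thesis by (simp add: vec_option_eq_iff vec_eq_iff)
  qed
  have "matrix_inv (dilation a) = B"
    by (rule matrix_inv_mult_vec) (use a in \<open>simp_all add: B dilation_mult_vec\<close>)
  then show ?thesis by (simp add: B)
qed

text \<open>The absolute determinant of A_a, equal to |a|^(2-1/d) for nonzero a. Its square root is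
  the factor by which shearlets scale both in L_1 and on the Fourier side.\<close>

definition dilation_det :: "'n::finite itself \<Rightarrow> real \<Rightarrow> real" where
  "dilation_det T a = \<bar>a\<bar> * \<bar>dilation_root T a\<bar> ^ CARD('n)"

lemma dilation_det_1 [simp]: "dilation_det T 1 = 1"
  by (simp add: dilation_det_def)

lemma dilation_det_pos: "a \<noteq> 0 \<Longrightarrow> dilation_det T a > 0"
  by (simp add: dilation_det_def)

lemma CARD_option: "CARD('n::finite option) = CARD('n) + 1"
  by simp

lemma dilation_det_powr:
  assumes "a \<noteq> 0"
  shows "dilation_det TYPE('n::finite) a = \<bar>a\<bar> powr (2 - 1 / real CARD('n option))"
proof -
  have "dilation_det TYPE('n) a = \<bar>a\<bar> powr 1 * \<bar>a\<bar> powr (1 / real CARD('n option) * CARD('n))"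
    using assms unfolding dilation_det_def abs_dilation_root[OF assms]
    by (simp add: powr_powr flip: powr_realpow)
  also have "\<dots> = \<bar>a\<bar> powr (1 + 1 / real CARD('n option) * CARD('n))" by (simp only: powr_add)
  also have "1 + 1 / real CARD('n option) * CARD('n) = 2 - 1 / real CARD('n option)"
    by (simp add: field_simps)
  finally show ?thesis .
qed

lemma abs_det_dilation: "\<bar>det (dilation a :: real ^ 'n::finite option ^ 'n option)\<bar> = dilation_det TYPE('n) a"
proof -
  have "det (dilation a :: real ^ 'n option ^ 'n option) = (\<Prod>i\<in>UNIV. (dilation a :: real ^ 'n option ^ 'n option) $ i $ i)"
    by (rule det_diagonal) (simp add: dilation_def)
  then show ?thesis
    by (simp add: prod_option dilation_def dilation_det_def dilation_root_def abs_mult power_abs)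
qed

definition scales :: "ereal set" where
  "scales = {\<infinity>} \<union> ereal ` ({-1..1} - {0})"

text \<open>The point \<infinity> receives the scale 1. As A_1 is the identity and powers of 1 are
  1, low-pass elements then obey the formulas for shearlets with \<Phi> in place of \<Psi>, and the
  weight has a single formula as well.\<close>

definition scale_of :: "ereal \<Rightarrow> real" where
  "scale_of \<alpha> = (if \<alpha> = \<infinity> then 1 else real_of_ereal \<alpha>)"

definition generator :: "('v \<Rightarrow> complex) \<Rightarrow> ('v \<Rightarrow> complex) \<Rightarrow> ereal \<Rightarrow> 'v \<Rightarrow> complex" where
  "generator \<Phi> \<Psi> \<alpha> = (if \<alpha> = \<infinity> then \<Phi> else \<Psi>)"

lemma param_space_scales: "param_space = scales \<times> UNIV \<times> UNIV"
  by (simp add: param_space_def scales_def)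

lemma scale_of_infty [simp]: "scale_of \<infinity> = 1" and scale_of_ereal [simp]: "scale_of (ereal a) = a"
  by (simp_all add: scale_of_def)

lemma generator_infty [simp]: "generator \<Phi> \<Psi> \<infinity> = \<Phi>" and generator_ereal [simp]: "generator \<Phi> \<Psi> (ereal a) = \<Psi>"
  by (simp_all add: generator_def)

lemma scalesE:
  assumes "\<alpha> \<in> scales"
  obtains "\<alpha> = \<infinity>" | a where "\<alpha> = ereal a" "a \<noteq> 0" "\<bar>a\<bar> \<le> 1"
  using assms unfolding scales_def by (fastforce simp: abs_le_iff)

lemma scale_of_nonzero: "\<alpha> \<in> scales \<Longrightarrow> scale_of \<alpha> \<noteq> 0"
  and abs_scale_of_le: "\<alpha> \<in> scales \<Longrightarrow> \<bar>scale_of \<alpha>\<bar> \<le> 1"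
  by (auto elim!: scalesE)

lemma scales_measurable [measurable]: "scales \<in> sets borel"
proof -
  \<comment> \<open>On this side the interval consists of extended reals, so that its measurability
    is immediate.\<close>
  have "scales = {\<infinity>} \<union> ({-1..1} - {0})"
    unfolding scales_def
  proof (intro set_eqI)
    fix x :: ereal
    show "x \<in> {\<infinity>} \<union> ereal ` ({-1..1} - {0}) \<longleftrightarrow> x \<in> {\<infinity>} \<union> ({-1..1} - {0})"
      by (cases x) (auto simp: image_iff one_ereal_def zero_ereal_def)
  qed
  moreover have "{\<infinity>} \<union> ({-1..1} - {0}) \<in> sets (borel :: ereal measure)" by measurable
  ultimately show ?thesis by (simp only:)
qed

lemma borel_measurable_scale_of [measurable]:
  assumes [measurable]: "f \<in> borel_measurable M"
  shows "(\<lambda>x. scale_of (f x)) \<in> borel_measurable M"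
  unfolding scale_of_def by measurable

lemma shearlet_eq:
  fixes \<Phi> \<Psi> :: "real ^ 'n::finite option \<Rightarrow> complex"
  assumes "\<alpha> \<in> scales"
  defines "a \<equiv> scale_of \<alpha>"
  shows "shearlet \<Phi> \<Psi> (\<alpha>, s, t) y = of_real (dilation_det TYPE('n) a powr (- (1 / 2))) *
    generator \<Phi> \<Psi> \<alpha> (shear_scale (1 / a) (1 / dilation_root TYPE('n) a) s (y - t))"
  using assms(1)
proof (cases rule: scalesE)
  case 1
  then show ?thesis
    by (simp add: a_def shearlet_def matrix_inv_shear shear_mult_vec shear_scale_def)
next
  case (2 b)
  then show ?thesis
    by (simp add: a_def shearlet_def matrix_inv_shear shear_mult_vec shear_scale_def abs_det_dilation
        matrix_inv_dilation_mult Let_def)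
qed

text \<open>The frequency A_a S_s^T \<omega>, which is the inverse transpose of A_a^(-1) S_s^(-1)
  applied to \<omega>.\<close>

definition shear_freq :: "ereal \<Rightarrow> real ^ 'n::finite \<Rightarrow> real ^ 'n option \<Rightarrow> real ^ 'n option" where
  "shear_freq \<alpha> s \<omega> = vcons (scale_of \<alpha> * \<omega> $ None)
     (dilation_root TYPE('n) (scale_of \<alpha>) *\<^sub>R (vtail \<omega> + (\<omega> $ None) *\<^sub>R s))"

lemma borel_measurable_shear_freq [measurable]:
  assumes [measurable]: "\<alpha> \<in> borel_measurable M" "s \<in> borel_measurable M" "f \<in> borel_measurable M"
  shows "(\<lambda>x. shear_freq (\<alpha> x) (s x) (f x)) \<in> borel_measurable M"
  unfolding shear_freq_def by measurable

lemma
  fixes \<Phi> \<Psi> :: "real ^ 'n::finite option \<Rightarrow> complex"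
  assumes \<alpha>: "\<alpha> \<in> scales" and g: "integrable lborel (generator \<Phi> \<Psi> \<alpha>)"
  shows integrable_shearlet: "integrable lborel (shearlet \<Phi> \<Psi> (\<alpha>, s, t))"
    and norm1_shearlet: "(\<integral>y. cmod (shearlet \<Phi> \<Psi> (\<alpha>, s, t) y) \<partial>lborel) =
      sqrt (dilation_det TYPE('n) (scale_of \<alpha>)) * (\<integral>y. cmod (generator \<Phi> \<Psi> \<alpha> y) \<partial>lborel)"
    and fourier_shearlet: "fourier (shearlet \<Phi> \<Psi> (\<alpha>, s, t)) \<omega> =
      of_real (sqrt (dilation_det TYPE('n) (scale_of \<alpha>))) * wave (- (\<omega> \<bullet> t)) * fourier (generator \<Phi> \<Psi> \<alpha>) (shear_freq \<alpha> s \<omega>)"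
proof -
  let ?a = "scale_of \<alpha>" and ?g = "generator \<Phi> \<Psi> \<alpha>" and ?r = "dilation_root TYPE('n) (scale_of \<alpha>)"
  let ?D = "dilation_det TYPE('n) ?a"
  have a: "1 / ?a \<noteq> 0" "1 / ?r \<noteq> 0" using scale_of_nonzero[OF \<alpha>] by auto
  have D: "?D > 0" using scale_of_nonzero[OF \<alpha>] by (rule dilation_det_pos)
  have eq: "shearlet \<Phi> \<Psi> (\<alpha>, s, t) = (\<lambda>y. of_real (?D powr (- (1 / 2))) * ?g (shear_scale (1 / ?a) (1 / ?r) s (y - t)))"
    by (simp add: fun_eq_iff shearlet_eq[OF \<alpha>])
  have Dinv: "\<bar>1 / ?a\<bar> * \<bar>1 / ?r\<bar> ^ CARD('n) = 1 / ?D"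
    by (simp add: dilation_det_def abs_divide power_divide)
  have Dm: "?D powr (- (1 / 2)) * ?D = sqrt ?D"
    using D by (simp add: powr_minus powr_half_sqrt field_simps)
  show "integrable lborel (shearlet \<Phi> \<Psi> (\<alpha>, s, t))"
    unfolding eq by (intro integrable_mult_right integrable_shear_scale a g)
  have "complex_of_real (\<integral>y. cmod (?g (shear_scale (1 / ?a) (1 / ?r) s (y - t))) \<partial>lborel) =
      complex_of_real ((\<integral>y. cmod (?g y) \<partial>lborel) * ?D)"
    using integral_shear_scale[OF a, of "\<lambda>y. complex_of_real (cmod (?g y))" s t] g
    unfolding Dinv by (simp add: integral_complex_of_real)
  then have "(\<integral>y. cmod (?g (shear_scale (1 / ?a) (1 / ?r) s (y - t))) \<partial>lborel) = (\<integral>y. cmod (?g y) \<partial>lborel) * ?D"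
    by (simp only: of_real_eq_iff)
  then show "(\<integral>y. cmod (shearlet \<Phi> \<Psi> (\<alpha>, s, t) y) \<partial>lborel) = sqrt ?D * (\<integral>y. cmod (?g y) \<partial>lborel)"
    unfolding eq using Dm by (simp add: norm_mult mult_ac)
  have "shear_scale_dual (1 / ?a) (1 / ?r) s \<omega> = shear_freq \<alpha> s \<omega>"
    by (simp add: shear_scale_dual_def shear_freq_def mult.commute)
  moreover have "fourier (\<lambda>y. c * h y) \<omega> = c * fourier h \<omega>" for c :: complex and h :: "real ^ 'n option \<Rightarrow> complex"
    by (simp add: fourier_wave mult.assoc)
  moreover have "of_real (?D powr (- (1 / 2))) * (wave w * z / of_real (1 / ?D)) = of_real (sqrt ?D) * wave w * z" for w z
    using Dm[symmetric] by (simp add: mult_ac)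
  ultimately show "fourier (shearlet \<Phi> \<Psi> (\<alpha>, s, t)) \<omega> = of_real (sqrt ?D) * wave (- (\<omega> \<bullet> t)) * fourier ?g (shear_freq \<alpha> s \<omega>)"
    unfolding eq by (simp only: fourier_shear_scale[OF a g] Dinv)
qed

lemma L2_fun_cmult_add:
  fixes f g :: "'a::euclidean_space \<Rightarrow> complex"
  assumes "f \<in> L2_fun" "g \<in> L2_fun"
  shows "(\<lambda>y. c * f y) \<in> L2_fun" and "(\<lambda>y. f y + g y) \<in> L2_fun"
    and "integrable lborel (\<lambda>y. f y * cnj (g y))"
proof -
  have [measurable]: "f \<in> borel_measurable borel" "g \<in> borel_measurable borel"
    and f: "integrable lborel (\<lambda>x. (cmod (f x))\<^sup>2)" and g: "integrable lborel (\<lambda>x. (cmod (g x))\<^sup>2)"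
    using assms by (auto simp: L2_fun_def)
  show "(\<lambda>y. c * f y) \<in> L2_fun"
    using f by (auto simp: L2_fun_def norm_mult power_mult_distrib)
  have "integrable lborel (\<lambda>x. (cmod (f x + g x))\<^sup>2)"
  proof (rule Bochner_Integration.integrable_bound)
    show "integrable lborel (\<lambda>x. 2 * (cmod (f x))\<^sup>2 + 2 * (cmod (g x))\<^sup>2)" using f g by simp
    show "AE x in lborel. norm ((cmod (f x + g x))\<^sup>2) \<le> norm (2 * (cmod (f x))\<^sup>2 + 2 * (cmod (g x))\<^sup>2)"
    proof (rule AE_I2)
      fix x
      have "(cmod (f x + g x))\<^sup>2 \<le> (cmod (f x) + cmod (g x))\<^sup>2"
        by (intro power_mono norm_triangle_ineq) auto
      also have "\<dots> \<le> 2 * (cmod (f x))\<^sup>2 + 2 * (cmod (g x))\<^sup>2"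
        using zero_le_power2[of "cmod (f x) - cmod (g x)"] by (simp add: power2_eq_square algebra_simps)
      finally show "norm ((cmod (f x + g x))\<^sup>2) \<le> norm (2 * (cmod (f x))\<^sup>2 + 2 * (cmod (g x))\<^sup>2)" by simp
    qed
  qed measurable
  then show "(\<lambda>y. f y + g y) \<in> L2_fun" by (simp add: L2_fun_def)
  show "integrable lborel (\<lambda>y. f y * cnj (g y))"
  proof (rule Bochner_Integration.integrable_bound)
    show "integrable lborel (\<lambda>x. (cmod (f x))\<^sup>2 + (cmod (g x))\<^sup>2)" using f g by simp
    show "AE x in lborel. norm (f x * cnj (g x)) \<le> norm ((cmod (f x))\<^sup>2 + (cmod (g x))\<^sup>2)"
    proof (rule AE_I2)
      fix x
      have "0 \<le> cmod (f x) * cmod (g x)" by simp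
      then have "cmod (f x) * cmod (g x) \<le> (cmod (f x))\<^sup>2 + (cmod (g x))\<^sup>2"
        using sum_squares_bound[of "cmod (f x)" "cmod (g x)"] by linarith
      then show "norm (f x * cnj (g x)) \<le> norm ((cmod (f x))\<^sup>2 + (cmod (g x))\<^sup>2)"
        by (simp add: norm_mult)
    qed
  qed measurable
qed

text \<open>The factor |det A|^(-1/2) cancels the Jacobian exactly, so every element has the L_2
  norm of its generator.\<close>

lemma L2_fun_shearlet:
  fixes \<Phi> \<Psi> :: "real ^ 'n::finite option \<Rightarrow> complex"
  assumes \<alpha>: "\<alpha> \<in> scales" and g: "generator \<Phi> \<Psi> \<alpha> \<in> L2_fun"
  shows "shearlet \<Phi> \<Psi> (\<alpha>, s, t) \<in> L2_fun"
    and "(\<integral>y. (cmod (shearlet \<Phi> \<Psi> (\<alpha>, s, t) y))\<^sup>2 \<partial>lborel) = (\<integral>y. (cmod (generator \<Phi> \<Psi> \<alpha> y))\<^sup>2 \<partial>lborel)"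
proof -
  let ?a = "scale_of \<alpha>" and ?g = "generator \<Phi> \<Psi> \<alpha>" and ?r = "dilation_root TYPE('n) (scale_of \<alpha>)"
  let ?D = "dilation_det TYPE('n) ?a"
  have [measurable]: "?g \<in> borel_measurable borel" using g by (simp add: L2_fun_def)
  have a: "1 / ?a \<noteq> 0" "1 / ?r \<noteq> 0" using scale_of_nonzero[OF \<alpha>] by auto
  have D: "?D > 0" using scale_of_nonzero[OF \<alpha>] by (rule dilation_det_pos)
  have eq: "shearlet \<Phi> \<Psi> (\<alpha>, s, t) = (\<lambda>y. of_real (?D powr (- (1 / 2))) * ?g (shear_scale (1 / ?a) (1 / ?r) s (y - t)))"
    by (simp add: fun_eq_iff shearlet_eq[OF \<alpha>])
  have Dinv: "\<bar>1 / ?a\<bar> * \<bar>1 / ?r\<bar> ^ CARD('n) = 1 / ?D"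
    by (simp add: dilation_det_def abs_divide power_divide)
  have D2: "(?D powr (- (1 / 2)))\<^sup>2 = 1 / ?D"
    using D by (simp add: powr_minus powr_half_sqrt field_simps power_divide)
  let ?h = "\<lambda>y. complex_of_real ((cmod (?g y))\<^sup>2)"
  have h: "integrable lborel ?h" using g unfolding L2_fun_def complex_of_real_integrable_eq by simp
  have "integrable lborel (\<lambda>y. ?h (shear_scale (1 / ?a) (1 / ?r) s (y - t)))"
    by (rule integrable_shear_scale[OF a h])
  then have i: "integrable lborel (\<lambda>y. (cmod (?g (shear_scale (1 / ?a) (1 / ?r) s (y - t))))\<^sup>2)"
    by (simp only: complex_of_real_integrable_eq)
  have n: "(cmod (shearlet \<Phi> \<Psi> (\<alpha>, s, t) y))\<^sup>2 = 1 / ?D * (cmod (?g (shear_scale (1 / ?a) (1 / ?r) s (y - t))))\<^sup>2" for y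
    unfolding eq by (simp add: norm_mult power_mult_distrib D2)
  have m: "shearlet \<Phi> \<Psi> (\<alpha>, s, t) \<in> borel_measurable borel" unfolding eq by measurable
  then show "shearlet \<Phi> \<Psi> (\<alpha>, s, t) \<in> L2_fun"
    unfolding L2_fun_def mem_Collect_eq n using i by simp
  have "complex_of_real (\<integral>y. (cmod (?g (shear_scale (1 / ?a) (1 / ?r) s (y - t))))\<^sup>2 \<partial>lborel) =
      complex_of_real ((\<integral>y. (cmod (?g y))\<^sup>2 \<partial>lborel) * ?D)"
    using integral_shear_scale[OF a h, of s t] unfolding Dinv integral_complex_of_real by simp
  then have "(\<integral>y. (cmod (?g (shear_scale (1 / ?a) (1 / ?r) s (y - t))))\<^sup>2 \<partial>lborel) = (\<integral>y. (cmod (?g y))\<^sup>2 \<partial>lborel) * ?D"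
    by (simp only: of_real_eq_iff)
  then show "(\<integral>y. (cmod (shearlet \<Phi> \<Psi> (\<alpha>, s, t) y))\<^sup>2 \<partial>lborel) = (\<integral>y. (cmod (?g y))\<^sup>2 \<partial>lborel)"
    unfolding n using D by simp
qed

text \<open>
  The scale measure is transported from the real line, where the interval \<open>[2,3]\<close> carries the
  unit mass of the point \<open>\<infinity>\<close>.
\<close>

definition scale_measure :: "nat \<Rightarrow> ereal measure" where
  "scale_measure k = distr (density lborel (\<lambda>a. if a \<in> {-1..1} - {0} then ennreal (1 / \<bar>a\<bar> ^ k) else indicator {2..3} a))
     borel (\<lambda>a. if a \<in> {-1..1} - {0} then ereal a else \<infinity>)"

lemma sets_scale_measure [measurable_cong, simp]: "sets (scale_measure k) = sets borel"
  and space_scale_measure [simp]: "space (scale_measure k) = UNIV"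
  by (simp_all add: scale_measure_def)

lemma nn_integral_scale_measure:
  assumes [measurable]: "F \<in> borel_measurable borel"
  shows "(\<integral>\<^sup>+\<alpha>. F \<alpha> \<partial>scale_measure k) = F \<infinity> +
    (\<integral>\<^sup>+a. F (ereal a) * ennreal (1 / \<bar>a\<bar> ^ k) * indicator ({-1..1} - {0}) a \<partial>lborel)"
proof -
  let ?h = "\<lambda>a::real. if a \<in> {-1..1} - {0} then ereal a else \<infinity>"
  let ?W = "\<lambda>a::real. if a \<in> {-1..1} - {0} then ennreal (1 / \<bar>a\<bar> ^ k) else indicator {2..3} a"
  have "(\<integral>\<^sup>+\<alpha>. F \<alpha> \<partial>scale_measure k) = (\<integral>\<^sup>+a. ?W a * F (?h a) \<partial>lborel)"
    unfolding scale_measure_def by (simp add: nn_integral_distr nn_integral_density)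
  also have "\<dots> = (\<integral>\<^sup>+a. F \<infinity> * indicator {2..3} a + F (ereal a) * ennreal (1 / \<bar>a\<bar> ^ k) * indicator ({-1..1} - {0}) a \<partial>lborel)"
    by (intro nn_integral_cong) (auto simp: indicator_def mult_ac)
  also have "\<dots> = F \<infinity> * emeasure lborel {2..3::real} + (\<integral>\<^sup>+a. F (ereal a) * ennreal (1 / \<bar>a\<bar> ^ k) * indicator ({-1..1} - {0}) a \<partial>lborel)"
    by (simp add: nn_integral_add nn_integral_cmult)
  finally show ?thesis by simp
qed

lemma sigma_finite_scale_measure: "sigma_finite_measure (scale_measure k)"
proof
  \<comment> \<open>Truncation away from 0, near which the density is not integrable in general; the
    uncharged point 0 is added so that the sets cover the whole type.\<close>
  define A where "A n = {\<alpha> :: ereal. \<alpha> = 0 \<or> 1 / ereal (real (Suc n)) \<le> \<bar>\<alpha>\<bar>}" for n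
  have [measurable]: "A n \<in> sets borel" for n unfolding A_def by measurable
  show "\<exists>A. countable A \<and> A \<subseteq> sets (scale_measure k) \<and> \<Union> A = space (scale_measure k) \<and> (\<forall>a\<in>A. emeasure (scale_measure k) a \<noteq> \<infinity>)"
  proof (intro exI[of _ "range A"] conjI ballI)
    show "\<Union> (range A) = space (scale_measure k)"
    proof -
      have "\<exists>n. \<alpha> \<in> A n" for \<alpha>
      proof (cases \<alpha>)
        case (real r)
        show ?thesis
        proof (cases "r = 0")
          case False
          then obtain n where "inverse (real (Suc n)) < \<bar>r\<bar>" using reals_Archimedean[of "\<bar>r\<bar>"] by auto
          then show ?thesis using real
            by (intro exI[of _ n]) (auto simp: A_def one_ereal_def inverse_eq_divide)
        qed (use real in \<open>auto simp: A_def zero_ereal_def\<close>)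
      qed (auto simp: A_def)
      then show ?thesis by auto
    qed
    fix B assume "B \<in> range A"
    then obtain n where B: "B = A n" by auto
    have "emeasure (scale_measure k) (A n) = (\<integral>\<^sup>+\<alpha>. indicator (A n) \<alpha> \<partial>scale_measure k)" by simp
    also have "\<dots> = 1 + (\<integral>\<^sup>+a. indicator (A n) (ereal a) * ennreal (1 / \<bar>a\<bar> ^ k) * indicator ({-1..1} - {0}) a \<partial>lborel)"
      by (subst nn_integral_scale_measure) (auto simp: A_def)
    also have "\<dots> \<le> 1 + (\<integral>\<^sup>+a. ennreal (real (Suc n) ^ k) * indicator {-1..1::real} a \<partial>lborel)"
    proof (intro add_left_mono nn_integral_mono)
      fix a :: real
      show "indicator (A n) (ereal a) * ennreal (1 / \<bar>a\<bar> ^ k) * indicator ({-1..1} - {0}) a \<le> ennreal (real (Suc n) ^ k) * indicator {-1..1} a"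
      proof (cases "ereal a \<in> A n \<and> a \<in> {-1..1} - {0}")
        case True
        then have a: "1 / real (Suc n) \<le> \<bar>a\<bar>" "a \<noteq> 0" by (auto simp: A_def one_ereal_def zero_ereal_def)
        then have "1 / \<bar>a\<bar> \<le> real (Suc n)" by (simp add: field_simps)
        then have "(1 / \<bar>a\<bar>) ^ k \<le> real (Suc n) ^ k" by (intro power_mono) auto
        then show ?thesis using True by (auto simp: power_divide intro!: ennreal_leI)
      qed auto
    qed
    also have "\<dots> = 1 + ennreal (real (Suc n) ^ k) * 2" by (simp add: nn_integral_cmult)
    also have "\<dots> < \<infinity>" by (simp add: ennreal_mult_less_top)
    finally show "emeasure (scale_measure k) B \<noteq> \<infinity>" unfolding B by simp
  qed auto
qed

lemma AE_scale_measure: "AE \<alpha> in scale_measure k. \<alpha> \<in> scales"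
proof (rule AE_I[of _ _ "- scales"])
  have "emeasure (scale_measure k) (- scales) = (\<integral>\<^sup>+\<alpha>. indicator (- scales) \<alpha> \<partial>scale_measure k)" by simp
  also have "\<dots> = (\<integral>\<^sup>+(a::real). 0 \<partial>lborel)"
  proof -
    have 1: "indicator (- scales) (ereal a) * ennreal (1 / \<bar>a\<bar> ^ k) * indicator ({-1..1} - {0}) a = 0" for a
      by (auto simp: scales_def indicator_def)
    have 2: "indicator (- scales) \<infinity> = (0 :: ennreal)" by (simp add: scales_def)
    show ?thesis by (subst nn_integral_scale_measure, measurable) (simp only: 1 2 add_0)
  qed
  finally show "emeasure (scale_measure k) (- scales) = 0" by simp
qed auto

text \<open>A product measure on the whole type, transported to the bracketing of
  \<open>param\<close>. Grouping scale and shear before the translation makes the innermost integral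
  one over translations, to which Parseval applies. \<open>param_measure\<close> is the restriction
  to a set of full measure, and in this way inherits Fubini and sigma-finiteness.\<close>

definition full_param_measure :: "'n::finite param measure" where
  "full_param_measure = distr ((scale_measure (CARD('n option) + 1) \<Otimes>\<^sub>M lborel) \<Otimes>\<^sub>M lborel) borel
     (\<lambda>((\<alpha>, s), t). (\<alpha>, s, t))"

abbreviation scale_shear_measure :: "(ereal \<times> (real ^ 'n::finite)) measure" where
  "scale_shear_measure \<equiv> scale_measure (CARD('n option) + 1) \<Otimes>\<^sub>M lborel"

lemma sigma_finite_scale_shear: "sigma_finite_measure (scale_shear_measure :: (ereal \<times> (real ^ 'n::finite)) measure)"
proof -
  interpret A: sigma_finite_measure "scale_measure (CARD('n option) + 1)" by (rule sigma_finite_scale_measure)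
  interpret pair_sigma_finite "scale_measure (CARD('n option) + 1)" "lborel :: (real ^ 'n) measure" ..
  show ?thesis by (rule sigma_finite_measure_axioms)
qed

lemma sets_full_param_measure [simp, measurable_cong]: "sets full_param_measure = sets borel"
  and space_full_param_measure [simp]: "space full_param_measure = UNIV"
  by (simp_all add: full_param_measure_def)

lemma assoc_measurable:
  "(\<lambda>((\<alpha>, s), t). (\<alpha>, s, t)) \<in>
     (scale_shear_measure :: (ereal \<times> (real ^ 'n::finite)) measure) \<Otimes>\<^sub>M (lborel :: (real ^ 'n option) measure) \<rightarrow>\<^sub>M borel"
proof -
  have "(\<lambda>((\<alpha>, s), t). (\<alpha>, s, t)) \<in> (scale_shear_measure :: (ereal \<times> (real ^ 'n::finite)) measure) \<Otimes>\<^sub>M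
      (lborel :: (real ^ 'n option) measure) \<rightarrow>\<^sub>M borel \<Otimes>\<^sub>M (borel \<Otimes>\<^sub>M borel)"
    unfolding case_prod_unfold by measurable
  then show ?thesis by (simp add: borel_prod)
qed

lemma nn_integral_full_param_measure:
  fixes F :: "'n::finite param \<Rightarrow> ennreal"
  assumes [measurable]: "F \<in> borel_measurable borel"
  shows "(\<integral>\<^sup>+x. F x \<partial>full_param_measure) = (\<integral>\<^sup>+q. \<integral>\<^sup>+t. F (fst q, snd q, t) \<partial>lborel \<partial>scale_shear_measure)"
    and "(\<integral>\<^sup>+x. F x \<partial>full_param_measure) =
      (\<integral>\<^sup>+\<alpha>. \<integral>\<^sup>+s. \<integral>\<^sup>+t. F (\<alpha>, s, t) \<partial>lborel \<partial>lborel \<partial>scale_measure (CARD('n option) + 1))"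
    and "(\<integral>\<^sup>+x. F x \<partial>full_param_measure) = param_integral F"
proof -
  let ?\<nu> = "scale_measure (CARD('n option) + 1)"
  interpret A: sigma_finite_measure ?\<nu> by (rule sigma_finite_scale_measure)
  interpret P: pair_sigma_finite ?\<nu> "lborel :: (real ^ 'n) measure" ..
  interpret P2: pair_sigma_finite "?\<nu> \<Otimes>\<^sub>M (lborel :: (real ^ 'n) measure)" "lborel :: (real ^ 'n option) measure" ..
  have Fm [measurable]: "F \<in> borel_measurable (borel \<Otimes>\<^sub>M (borel \<Otimes>\<^sub>M borel))" by (simp add: borel_prod)
  have m [measurable]: "(\<lambda>z. F (fst (fst z), snd (fst z), snd z)) \<in> borel_measurable (scale_shear_measure \<Otimes>\<^sub>M lborel)"
    using measurable_compose[OF assoc_measurable assms] by (simp add: case_prod_unfold)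
  show 1: "(\<integral>\<^sup>+x. F x \<partial>full_param_measure) = (\<integral>\<^sup>+q. \<integral>\<^sup>+t. F (fst q, snd q, t) \<partial>lborel \<partial>scale_shear_measure)"
  proof -
    have "(\<integral>\<^sup>+x. F x \<partial>full_param_measure) = (\<integral>\<^sup>+z. F (fst (fst z), snd (fst z), snd z) \<partial>(scale_shear_measure \<Otimes>\<^sub>M lborel))"
      unfolding full_param_measure_def
      by (subst nn_integral_distr[OF assoc_measurable]) (simp_all add: case_prod_unfold)
    also have "\<dots> = (\<integral>\<^sup>+q. \<integral>\<^sup>+t. F (fst q, snd q, t) \<partial>lborel \<partial>scale_shear_measure)"
      by (subst lborel.nn_integral_fst[symmetric]) auto
    finally show ?thesis .
  qed
  have m2 [measurable]: "(\<lambda>q. \<integral>\<^sup>+t. F (fst q, snd q, t) \<partial>lborel) \<in> borel_measurable scale_shear_measure"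
    by measurable
  show 2: "(\<integral>\<^sup>+x. F x \<partial>full_param_measure) = (\<integral>\<^sup>+\<alpha>. \<integral>\<^sup>+s. \<integral>\<^sup>+t. F (\<alpha>, s, t) \<partial>lborel \<partial>lborel \<partial>?\<nu>)"
    unfolding 1 by (subst lborel.nn_integral_fst[symmetric]) auto
  have "(\<integral>\<^sup>+x. F x \<partial>full_param_measure) = (\<integral>\<^sup>+\<alpha>. \<integral>\<^sup>+t. \<integral>\<^sup>+s. F (\<alpha>, s, t) \<partial>lborel \<partial>lborel \<partial>?\<nu>)"
    unfolding 2 by (intro nn_integral_cong lborel_pair.Fubini') measurable
  also have "\<dots> = (\<integral>\<^sup>+t. \<integral>\<^sup>+\<alpha>. \<integral>\<^sup>+s. F (\<alpha>, s, t) \<partial>lborel \<partial>?\<nu> \<partial>lborel)"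
  proof -
    interpret P3: pair_sigma_finite ?\<nu> "lborel :: (real ^ 'n option) measure" ..
    show ?thesis by (intro P3.Fubini'[symmetric]) measurable
  qed
  also have "\<dots> = (\<integral>\<^sup>+t. \<integral>\<^sup>+s. \<integral>\<^sup>+\<alpha>. F (\<alpha>, s, t) \<partial>?\<nu> \<partial>lborel \<partial>lborel)"
    by (intro nn_integral_cong P.Fubini'[symmetric]) measurable
  also have "\<dots> = (\<integral>\<^sup>+t. \<integral>\<^sup>+s. F (\<infinity>, s, t) +
      (\<integral>\<^sup>+a. F (ereal a, s, t) * ennreal (1 / \<bar>a\<bar> ^ (CARD('n option) + 1)) * indicator ({-1..1} - {0}) a \<partial>lborel) \<partial>lborel \<partial>lborel)"
    by (intro nn_integral_cong nn_integral_scale_measure) measurable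
  also have "\<dots> = param_integral F"
    unfolding param_integral_def by (simp add: nn_integral_add)
  finally show "(\<integral>\<^sup>+x. F x \<partial>full_param_measure) = param_integral F" .
qed

lemma param_space_measurable [measurable]: "(param_space :: 'n::finite param set) \<in> sets borel"
proof -
  have "(param_space :: 'n param set) \<in> sets (borel \<Otimes>\<^sub>M (borel \<Otimes>\<^sub>M borel))"
    unfolding param_space_scales by (intro pair_measureI) auto
  then show ?thesis unfolding borel_prod .
qed

text \<open>\<open>measure_of\<close> has the intended values only if the set function is countably
  additive on the sigma-algebra. Recognising it as the measure of a restricted space supplies
  this.\<close>

lemma param_measure_eq: "(param_measure :: 'n::finite param measure) = restrict_space full_param_measure param_space"
proof -
  let ?R = "restrict_space full_param_measure param_space :: 'n param measure"
  have sp: "space ?R = param_space" by (simp add: space_restrict_space)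
  have se: "sets ?R = sets (restrict_space borel param_space)" by (intro sets_restrict_space_cong) simp
  have "(param_measure :: 'n param measure) = measure_of (space ?R) (sets ?R) (\<lambda>E. param_integral (indicator E))"
    unfolding param_measure_def sp se ..
  also have "\<dots> = measure_of (space ?R) (sets ?R) (emeasure ?R)"
  proof (rule measure_of_eq)
    show "sets ?R \<subseteq> Pow (space ?R)" by (rule sets.space_closed)
    fix E assume "E \<in> sigma_sets (space ?R) (sets ?R)"
    then have "E \<in> sets ?R" by (simp only: sets.sigma_sets_eq)
    then have E: "E \<subseteq> param_space" and [measurable]: "E \<in> sets borel"
      by (auto simp: sets_restrict_space_iff)
    have "emeasure ?R E = (\<integral>\<^sup>+x. indicator E x \<partial>full_param_measure)"
      using E by (simp add: emeasure_restrict_space)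
    then show "param_integral (indicator E) = emeasure ?R E"
      using nn_integral_full_param_measure(3)[of "indicator E"] by simp
  qed
  also have "\<dots> = ?R" by (rule measure_of_of_measure)
  finally show ?thesis .
qed

lemma space_param_measure [simp]: "space param_measure = param_space"
  by (simp add: param_measure_eq space_restrict_space)

lemma AE_full_param_measure: "AE x in (full_param_measure :: 'n::finite param measure). x \<in> param_space"
proof (rule AE_I[of _ _ "- param_space"])
  have [measurable]: "(param_space :: 'n param set) \<in> sets borel" by (rule param_space_measurable)
  have "emeasure (full_param_measure :: 'n param measure) (- param_space) = (\<integral>\<^sup>+x. indicator (- param_space) (x :: 'n param) \<partial>full_param_measure)"
    by simp
  also have "\<dots> = (\<integral>\<^sup>+\<alpha>. \<integral>\<^sup>+s. \<integral>\<^sup>+t. indicator (- param_space) (\<alpha>, s :: real ^ 'n, t) \<partial>lborel \<partial>lborel \<partial>scale_measure (CARD('n option) + 1))"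
    by (rule nn_integral_full_param_measure(2)) measurable
  also have "\<dots> = (\<integral>\<^sup>+\<alpha>. 0 \<partial>scale_measure (CARD('n option) + 1))"
    using AE_scale_measure[of "CARD('n option) + 1"]
    by (intro nn_integral_cong_AE) (auto simp: param_space_scales)
  finally show "emeasure (full_param_measure :: 'n param measure) (- param_space) = 0" by simp
qed auto

lemma nn_integral_param_measure:
  fixes F :: "'n::finite param \<Rightarrow> ennreal"
  assumes [measurable]: "F \<in> borel_measurable borel"
  shows "(\<integral>\<^sup>+x. F x \<partial>param_measure) = (\<integral>\<^sup>+x. F x \<partial>full_param_measure)"
proof -
  have "(\<integral>\<^sup>+x. F x \<partial>param_measure) = (\<integral>\<^sup>+x. F x * indicator param_space x \<partial>full_param_measure)"
    unfolding param_measure_eq by (rule nn_integral_restrict_space) simp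
  also have "\<dots> = (\<integral>\<^sup>+x. F x \<partial>full_param_measure)"
    using AE_full_param_measure by (intro nn_integral_cong_AE) (auto elim!: eventually_mono)
  finally show ?thesis .
qed

lemma sigma_finite_full_param_measure: "sigma_finite_measure (full_param_measure :: 'n::finite param measure)"
proof -
  let ?Q = "scale_shear_measure :: (ereal \<times> (real ^ 'n)) measure" and ?L = "lborel :: (real ^ 'n option) measure"
  interpret A: sigma_finite_measure ?Q by (rule sigma_finite_scale_shear)
  interpret P: pair_sigma_finite ?Q ?L ..
  obtain B where B: "countable B" "B \<subseteq> sets (?Q \<Otimes>\<^sub>M ?L)" "\<Union> B = space (?Q \<Otimes>\<^sub>M ?L)" "\<And>a. a \<in> B \<Longrightarrow> emeasure (?Q \<Otimes>\<^sub>M ?L) a \<noteq> \<infinity>"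
    using P.sigma_finite_countable by blast
  have u: "(\<lambda>(\<alpha>, s, t). ((\<alpha>, s), t)) \<in> (borel :: 'n param measure) \<rightarrow>\<^sub>M ?Q \<Otimes>\<^sub>M ?L"
  proof -
    have "(\<lambda>(\<alpha>, s, t). ((\<alpha>, s), t)) \<in> (borel \<Otimes>\<^sub>M (borel \<Otimes>\<^sub>M borel) :: 'n param measure) \<rightarrow>\<^sub>M ?Q \<Otimes>\<^sub>M ?L"
      by measurable
    then show ?thesis by (simp add: borel_prod)
  qed
  define C where "C = (\<lambda>b. (\<lambda>(\<alpha>, s, t). ((\<alpha>, s), t)) -` b :: 'n param set) ` B"
  show ?thesis
  proof
    show "\<exists>A. countable A \<and> A \<subseteq> sets (full_param_measure :: 'n param measure) \<and> \<Union> A = space full_param_measure \<and> (\<forall>a\<in>A. emeasure full_param_measure a \<noteq> \<infinity>)"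
    proof (intro exI[of _ C] conjI ballI)
      show "countable C" using B by (simp add: C_def)
      show C: "C \<subseteq> sets full_param_measure"
        using B(2) measurable_sets[OF u] by (auto simp: C_def)
      show "\<Union> C = space full_param_measure"
        using B(3) by (auto simp: C_def space_pair_measure set_eq_iff)
      fix c assume c: "c \<in> C"
      then obtain b where b: "b \<in> B" "c = (\<lambda>(\<alpha>, s, t). ((\<alpha>, s), t)) -` b" by (auto simp: C_def)
      have cb: "c \<in> sets borel" using C c by auto
      have v: "(\<lambda>((\<alpha>, s), t). (\<alpha>, s, t)) -` c \<inter> space (?Q \<Otimes>\<^sub>M ?L) = b"
        using b sets.sets_into_space[of b "?Q \<Otimes>\<^sub>M ?L"] B(2) by (auto simp: space_pair_measure)
      have "emeasure full_param_measure c = emeasure (?Q \<Otimes>\<^sub>M ?L) b"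
        unfolding full_param_measure_def emeasure_distr[OF assoc_measurable cb] v ..
      then show "emeasure full_param_measure c \<noteq> \<infinity>" using B(4) b by simp
    qed
  qed
qed

lemma sigma_finite_param_measure: "sigma_finite_measure (param_measure :: 'n::finite param measure)"
  unfolding param_measure_eq
  by (rule sigma_finite_measure_restrict_space[OF sigma_finite_full_param_measure]) simp

section \<open>Auxiliary integral estimates\<close>

text \<open>By inversion a correlation is determined almost everywhere by the product of the two
  transforms. Its L_1 norm can therefore be estimated through any other pair with the same product,
  in particular one with smaller L_1 norms.\<close>

lemma correlation_L1_transfer:
  fixes f g f' g' :: "'a::euclidean_space \<Rightarrow> complex"
  assumes i: "integrable lborel f" "integrable lborel g" "integrable lborel f'" "integrable lborel g'"
    and eq: "\<And>\<omega>. fourier f \<omega> * cnj (fourier g \<omega>) = fourier f' \<omega> * cnj (fourier g' \<omega>)"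
    and h: "integrable lborel (\<lambda>\<omega>. fourier f \<omega> * cnj (fourier g \<omega>))"
  shows "(\<integral>t. cmod (correlation f g t) \<partial>lborel) \<le> (\<integral>x. cmod (f' x) \<partial>lborel) * (\<integral>x. cmod (g' x) \<partial>lborel)"
proof -
  have c: "integrable lborel (correlation f g)" "integrable lborel (correlation f' g')"
    using i by (simp_all add: integrable_correlation)
  then have [measurable]: "correlation f g \<in> borel_measurable borel" "correlation f' g' \<in> borel_measurable borel"
    by auto
  have F: "fourier (correlation f g) = (\<lambda>\<omega>. fourier f \<omega> * cnj (fourier g \<omega>))"
    "fourier (correlation f' g') = (\<lambda>\<omega>. fourier f \<omega> * cnj (fourier g \<omega>))"
    using i eq by (simp_all add: fourier_correlation fun_eq_iff)
  have "AE t in lborel. correlation f g t = inv_fourier (\<lambda>\<omega>. fourier f \<omega> * cnj (fourier g \<omega>)) t"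
    using fourier_inversion[OF c(1)] h unfolding F by simp
  moreover have "AE t in lborel. correlation f' g' t = inv_fourier (\<lambda>\<omega>. fourier f \<omega> * cnj (fourier g \<omega>)) t"
    using fourier_inversion[OF c(2)] h unfolding F by simp
  ultimately have "AE t in lborel. cmod (correlation f g t) = cmod (correlation f' g' t)"
    by eventually_elim simp
  then have "(\<integral>t. cmod (correlation f g t) \<partial>lborel) = (\<integral>t. cmod (correlation f' g' t) \<partial>lborel)"
    by (intro integral_cong_AE) auto
  then show ?thesis using correlation_norm_le[OF i(3,4)] by simp
qed

section \<open>Tensor products, slices and dilations under the Fourier transform\<close>

lemma
  fixes f :: "real \<Rightarrow> complex" and g :: "real ^ 'n::finite \<Rightarrow> complex"
  assumes f: "integrable lborel f" and g: "integrable lborel g"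
  shows integrable_tensor_option: "integrable lborel (\<lambda>x :: real ^ 'n option. f (x $ None) * g (vtail x))"
    and integral_tensor_option: "(\<integral>x. f (x $ None) * g (vtail x) \<partial>(lborel :: (real ^ 'n option) measure)) =
      (\<integral>a. f a \<partial>lborel) * (\<integral>v. g v \<partial>lborel)"
proof -
  have [measurable]: "f \<in> borel_measurable borel" "g \<in> borel_measurable borel" using f g by auto
  have m: "(\<lambda>(a, v). vcons a v) \<in> (lborel :: real measure) \<Otimes>\<^sub>M (lborel :: (real ^ 'n) measure) \<rightarrow>\<^sub>M borel"
    by measurable
  have hm: "(\<lambda>x :: real ^ 'n option. f (x $ None) * g (vtail x)) \<in> borel_measurable borel" by measurable
  have i: "integrable (lborel \<Otimes>\<^sub>M lborel) (\<lambda>(a, v). f a * g v)"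
    by (rule lborel_pair.integrable_tensor[OF f g])
  then show "integrable lborel (\<lambda>x :: real ^ 'n option. f (x $ None) * g (vtail x))"
    by (subst lborel_vcons, subst integrable_distr_eq[OF m hm]) (simp add: case_prod_unfold)
  have "(\<integral>x. f (x $ None) * g (vtail x) \<partial>(lborel :: (real ^ 'n option) measure)) = (\<integral>z. (case z of (a, v) \<Rightarrow> f a * g v) \<partial>(lborel \<Otimes>\<^sub>M lborel))"
    by (subst lborel_vcons, subst integral_distr[OF m hm]) (simp add: case_prod_unfold)
  also have "\<dots> = (\<integral>a. (\<integral>v. f a * g v \<partial>lborel) \<partial>lborel)"
    using lborel_pair.integral_fst[OF i] by simp
  finally show "(\<integral>x. f (x $ None) * g (vtail x) \<partial>(lborel :: (real ^ 'n option) measure)) =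
      (\<integral>a. f a \<partial>lborel) * (\<integral>v. g v \<partial>lborel)" by simp
qed

lemma integrable_norm_tensor_option:
  fixes f :: "real \<Rightarrow> complex" and g :: "real ^ 'n::finite \<Rightarrow> complex"
  assumes f: "integrable lborel f" and g: "integrable lborel g"
  shows "(\<integral>x. cmod (f (x $ None) * g (vtail x)) \<partial>(lborel :: (real ^ 'n option) measure)) =
      (\<integral>a. cmod (f a) \<partial>lborel) * (\<integral>v. cmod (g v) \<partial>lborel)"
proof -
  have "complex_of_real (\<integral>x. cmod (f (x $ None) * g (vtail x)) \<partial>(lborel :: (real ^ 'n option) measure)) =
      complex_of_real ((\<integral>a. cmod (f a) \<partial>lborel) * (\<integral>v. cmod (g v) \<partial>lborel))"
  proof -
    have "complex_of_real (\<integral>x. cmod (f (x $ None) * g (vtail x)) \<partial>(lborel :: (real ^ 'n option) measure)) =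
        (\<integral>x. complex_of_real (cmod (f (x $ None))) * complex_of_real (cmod (g (vtail x))) \<partial>(lborel :: (real ^ 'n option) measure))"
      unfolding norm_mult of_real_mult[symmetric] by (rule integral_complex_of_real[symmetric])
    also have "\<dots> = (\<integral>a. complex_of_real (cmod (f a)) \<partial>lborel) * (\<integral>v. complex_of_real (cmod (g v)) \<partial>lborel)"
      using f g by (intro integral_tensor_option) auto
    finally show ?thesis by (simp only: integral_complex_of_real of_real_mult)
  qed
  then show ?thesis by (simp only: of_real_eq_iff)
qed

lemma fourier_tensor_option:
  fixes f :: "real \<Rightarrow> complex" and g :: "real ^ 'n::finite \<Rightarrow> complex"
  assumes f: "integrable lborel f" and g: "integrable lborel g"
  shows "fourier (\<lambda>x :: real ^ 'n option. f (x $ None) * g (vtail x)) \<omega> = fourier f (\<omega> $ None) * fourier g (vtail \<omega>)"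
proof -
  have e: "f (x $ None) * g (vtail x) * wave (- (\<omega> \<bullet> x)) =
      (f (x $ None) * wave (- (\<omega> $ None * x $ None))) * (g (vtail x) * wave (- (vtail \<omega> \<bullet> vtail x)))" for x
    by (simp add: inner_option wave_minus wave_add wave_diff)
  have "integrable lborel (\<lambda>a. f a * wave (- (\<omega> $ None * a)))" "integrable lborel (\<lambda>v. g v * wave (- (vtail \<omega> \<bullet> v)))"
    using f g by (auto intro!: integrable_mult_wave)
  from integral_tensor_option[OF this] show ?thesis
    unfolding fourier_wave e by simp
qed

text \<open>The partial Fourier transform in the first variable, at the fixed frequency
  \<open>c\<close>, is integrable in the tail by Fubini. Thus a slice of a transform is again the
  transform of an integrable function.\<close>

lemma fourier_slice_tail:
  fixes f :: "real ^ 'n::finite option \<Rightarrow> complex"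
  assumes f: "integrable lborel f"
  obtains X :: "real ^ 'n \<Rightarrow> complex" where "integrable lborel X" "\<And>\<eta>. fourier X \<eta> = fourier f (vcons c \<eta>)"
proof
  let ?X = "\<lambda>v. \<integral>a. f (vcons a v) * wave (- (c * a)) \<partial>lborel"
  have i0: "integrable (lborel \<Otimes>\<^sub>M lborel) (\<lambda>z. (case z of (a, v) \<Rightarrow> f (vcons a v)) * wave (g z))"
    if "g \<in> borel_measurable (lborel \<Otimes>\<^sub>M lborel)" for g
    using integrable_vcons[OF f] that by (rule integrable_mult_wave)
  have i1: "integrable (lborel \<Otimes>\<^sub>M lborel) (\<lambda>(a, v). f (vcons a v) * wave (- (c * a)))"
    using i0[of "\<lambda>z. - (c * fst z)"] by (simp add: case_prod_unfold)
  show "integrable lborel ?X"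
    using lborel_pair.integrable_snd[OF i1] by simp
  fix \<eta>
  have i2: "integrable (lborel \<Otimes>\<^sub>M lborel) (\<lambda>(a, v). f (vcons a v) * wave (- (c * a)) * wave (- (\<eta> \<bullet> v)))"
    using i0[of "\<lambda>z. - (c * fst z) + - (\<eta> \<bullet> snd z)"] by (simp only: wave_add) (simp add: case_prod_unfold mult.assoc)
  have e: "f x * wave (- (vcons c \<eta> \<bullet> x)) = f x * wave (- (c * x $ None)) * wave (- (\<eta> \<bullet> vtail x))" for x
    by (simp add: inner_option wave_minus wave_add wave_diff)
  have "fourier f (vcons c \<eta>) = (\<integral>z. f (vcons (fst z) (snd z)) * wave (- (c * fst z)) * wave (- (\<eta> \<bullet> snd z)) \<partial>(lborel \<Otimes>\<^sub>M lborel))"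
  proof -
    have "integrable lborel (\<lambda>x. f x * wave (- (c * x $ None)) * wave (- (\<eta> \<bullet> vtail x)))"
      using f by (intro integrable_mult_wave) measurable
    from integral_vcons[OF this] show ?thesis unfolding fourier_wave e by simp
  qed
  also have "\<dots> = (\<integral>v. (\<integral>a. f (vcons a v) * wave (- (c * a)) * wave (- (\<eta> \<bullet> v)) \<partial>lborel) \<partial>lborel)"
    using lborel_pair.integral_snd[OF i2] by (simp add: case_prod_unfold)
  finally show "fourier ?X \<eta> = fourier f (vcons c \<eta>)" by (simp add: fourier_wave[of ?X])
qed

lemma fourier_slice_first:
  fixes f :: "real ^ 'n::finite option \<Rightarrow> complex"
  assumes f: "integrable lborel f"
  obtains Y :: "real \<Rightarrow> complex" where "integrable lborel Y" "\<And>\<omega>. fourier Y \<omega> = fourier f (vcons \<omega> \<eta>)"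
proof
  let ?Y = "\<lambda>a. \<integral>v. f (vcons a v) * wave (- (\<eta> \<bullet> v)) \<partial>lborel"
  have i0: "integrable (lborel \<Otimes>\<^sub>M lborel) (\<lambda>z. (case z of (a, v) \<Rightarrow> f (vcons a v)) * wave (g z))"
    if "g \<in> borel_measurable (lborel \<Otimes>\<^sub>M lborel)" for g
    using integrable_vcons[OF f] that by (rule integrable_mult_wave)
  have i1: "integrable (lborel \<Otimes>\<^sub>M lborel) (\<lambda>(a, v). f (vcons a v) * wave (- (\<eta> \<bullet> v)))"
    using i0[of "\<lambda>z. - (\<eta> \<bullet> snd z)"] by (simp add: case_prod_unfold)
  show "integrable lborel ?Y"
    using lborel_pair.integrable_fst[OF i1] by simp
  fix \<omega>
  have i2: "integrable (lborel \<Otimes>\<^sub>M lborel) (\<lambda>(a, v). f (vcons a v) * wave (- (\<eta> \<bullet> v)) * wave (- (\<omega> * a)))"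
    using i0[of "\<lambda>z. - (\<eta> \<bullet> snd z) + - (\<omega> * fst z)"] by (simp only: wave_add) (simp add: case_prod_unfold mult.assoc)
  have e: "f x * wave (- (vcons \<omega> \<eta> \<bullet> x)) = f x * wave (- (\<eta> \<bullet> vtail x)) * wave (- (\<omega> * x $ None))" for x
    by (simp add: inner_option wave_minus wave_add wave_diff)
  have "fourier f (vcons \<omega> \<eta>) = (\<integral>z. f (vcons (fst z) (snd z)) * wave (- (\<eta> \<bullet> snd z)) * wave (- (\<omega> * fst z)) \<partial>(lborel \<Otimes>\<^sub>M lborel))"
  proof -
    have "integrable lborel (\<lambda>x. f x * wave (- (\<eta> \<bullet> vtail x)) * wave (- (\<omega> * x $ None)))"
      using f by (intro integrable_mult_wave) measurable
    from integral_vcons[OF this] show ?thesis unfolding fourier_wave e by simp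
  qed
  also have "\<dots> = (\<integral>a. (\<integral>v. f (vcons a v) * wave (- (\<eta> \<bullet> v)) * wave (- (\<omega> * a)) \<partial>lborel) \<partial>lborel)"
    using lborel_pair.integral_fst[OF i2] by (simp add: case_prod_unfold)
  finally show "fourier ?Y \<omega> = fourier f (vcons \<omega> \<eta>)" by (simp add: fourier_wave[of ?Y])
qed

text \<open>The factor \<open>l\<close> keeps the L_1 norm fixed however strongly the transform is
  compressed, so a narrow frequency slab costs nothing in L_1.\<close>

lemma
  fixes Y :: "real \<Rightarrow> complex"
  assumes Y: "integrable lborel Y" and l: "l > 0"
  shows integrable_dilate: "integrable lborel (\<lambda>x. of_real l * Y (l * x))"
    and norm1_dilate: "(\<integral>x. cmod (of_real l * Y (l * x)) \<partial>lborel) = (\<integral>x. cmod (Y x) \<partial>lborel)"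
    and fourier_dilate: "fourier (\<lambda>x. of_real l * Y (l * x)) \<omega> = fourier Y (\<omega> / l)"
proof -
  have l0: "l \<noteq> 0" using l by simp
  show "integrable lborel (\<lambda>x. of_real l * Y (l * x))"
    using lborel_integral_affine(1)[OF l0, of Y 0] Y by simp
  have "complex_of_real (\<integral>x. cmod (of_real l * Y (l * x)) \<partial>lborel) = complex_of_real (\<integral>x. cmod (Y x) \<partial>lborel)"
    using lborel_integral_affine(2)[OF l0, of "\<lambda>x. complex_of_real (cmod (Y x))" 0] l
    by (simp add: norm_mult integral_complex_of_real)
  then show "(\<integral>x. cmod (of_real l * Y (l * x)) \<partial>lborel) = (\<integral>x. cmod (Y x) \<partial>lborel)"
    by (simp only: of_real_eq_iff)
  show "fourier (\<lambda>x. of_real l * Y (l * x)) \<omega> = fourier Y (\<omega> / l)"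
    using lborel_integral_affine(2)[OF l0, of "\<lambda>x. Y x * wave (- (\<omega> / l * x))" 0] l
    by (simp add: fourier_wave mult.assoc)
qed

text \<open>Dyadic decomposition: a point that first fits into the ball of radius 2^k contributes at
  most 2^(-(k-1)e), with e the sum of the dimension and \<delta>. Against the volume growth of the
  balls a geometric series of ratio 2^(-\<delta>) remains.\<close>

lemma nn_integral_polynomial_decay:
  fixes \<delta> :: real
  assumes \<delta>: "\<delta> > 0"
  shows "(\<integral>\<^sup>+(u::'a::euclidean_space). ennreal ((1 + norm u) powr (- (DIM('a) + \<delta>))) \<partial>lborel) < \<infinity>"
proof -
  let ?e = "real DIM('a) + \<delta>" and ?v = "unit_ball_vol (real DIM('a))"
  let ?f = "\<lambda>k (u::'a). ennreal (2 powr (- (real k - 1) * ?e)) * indicator (cball 0 (2 ^ k)) u"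
  have pt: "ennreal ((1 + norm u) powr (- ?e)) \<le> (\<Sum>k. ?f k u)" for u :: 'a
  proof -
    \<comment> \<open>Minimality yields the lower bound 2^(k-1) \<le> 1 + |u| too; it also holds at
      k = 0, where the left side is 1/2.\<close>
    define k where "k = (LEAST k::nat. 1 + norm u \<le> 2 ^ k)"
    obtain k0 :: nat where k0: "1 + norm u < 2 ^ k0" using real_arch_pow[of 2 "1 + norm u"] by auto
    have k: "1 + norm u \<le> 2 ^ k"
      unfolding k_def by (rule LeastI[of "\<lambda>k. 1 + norm u \<le> 2 ^ k" k0, OF less_imp_le[OF k0]])
    have "2 powr (real k - 1) \<le> 1 + norm u"
    proof (cases k)
      case (Suc j)
      then have "\<not> 1 + norm u \<le> 2 ^ j" using not_less_Least[of j "\<lambda>k. 1 + norm u \<le> 2 ^ k"] by (simp add: k_def)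
      then show ?thesis using Suc by (simp add: powr_realpow)
    qed (simp add: powr_minus)
    then have "(1 + norm u) powr (- ?e) \<le> (2 powr (real k - 1)) powr (- ?e)"
      using \<delta> by (intro powr_mono2') auto
    also have "(2 powr (real k - 1)) powr (- ?e) = 2 powr (- (real k - 1) * ?e)"
      by (simp only: powr_powr mult_minus_left mult_minus_right)
    finally have 1: "ennreal ((1 + norm u) powr (- ?e)) \<le> ?f k u"
      using k by (simp add: ennreal_leI del: minus_add_distrib)
    have "F k \<le> suminf F" for F :: "nat \<Rightarrow> ennreal" using sum_le_suminf[of F "{k}"] by simp
    with 1 show ?thesis by (rule order_trans)
  qed
  have t: "(\<integral>\<^sup>+u. ?f k u \<partial>lborel) = ennreal (?v * 2 powr ?e * (2 powr (- \<delta>)) ^ k)" for k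
  proof -
    have e1: "2 powr (- (real k - 1) * ?e) * (2 ^ k) ^ DIM('a) = 2 powr ?e * (2 powr (- \<delta>)) ^ k"
    proof -
      have a: "((2::real) ^ k) ^ DIM('a) = 2 powr (real k * DIM('a))"
        by (simp add: powr_realpow[symmetric] powr_powr)
      have b: "(2 powr (- \<delta>)) ^ k = 2 powr (- \<delta> * real k)"
        by (simp add: powr_powr flip: powr_realpow)
      show ?thesis unfolding a b by (simp flip: powr_add add: algebra_simps)
    qed
    have e2: "(\<integral>\<^sup>+u. ?f k u \<partial>lborel) = ennreal (2 powr (- (real k - 1) * ?e)) * ennreal (?v * (2 ^ k) ^ DIM('a))"
      by (subst nn_integral_cmult_indicator) (auto simp: emeasure_cball)
    also have "\<dots> = ennreal (2 powr (- (real k - 1) * ?e) * (?v * (2 ^ k) ^ DIM('a)))"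
      by (rule ennreal_mult[symmetric]) auto
    also have "2 powr (- (real k - 1) * ?e) * (?v * (2 ^ k) ^ DIM('a)) = ?v * (2 powr ?e * (2 powr (- \<delta>)) ^ k)"
      unfolding e1[symmetric] by (rule mult.left_commute)
    finally show ?thesis by (simp only: mult.assoc)
  qed
  have "(\<integral>\<^sup>+(u::'a). ennreal ((1 + norm u) powr (- ?e)) \<partial>lborel) \<le> (\<integral>\<^sup>+u. (\<Sum>k. ?f k u) \<partial>lborel)"
    by (intro nn_integral_mono pt)
  also have "\<dots> = (\<Sum>k. \<integral>\<^sup>+u. ?f k u \<partial>lborel)"
  proof (rule nn_integral_suminf)
    fix k
    have "cball 0 (2 ^ k) \<in> sets (lborel :: 'a measure)" by simp
    then have "(indicator (cball 0 (2 ^ k)) :: 'a \<Rightarrow> ennreal) \<in> borel_measurable lborel"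
      by (rule borel_measurable_indicator)
    then show "?f k \<in> borel_measurable lborel"
      by (intro borel_measurable_times_ennreal borel_measurable_const)
  qed
  also have "\<dots> = ennreal (\<Sum>k. ?v * 2 powr ?e * (2 powr (- \<delta>)) ^ k)"
  proof -
    have "(2::real) powr (- \<delta>) < 1" using \<delta> powr_less_mono[of "- \<delta>" 0 2] by simp
    then have "summable (\<lambda>k. ?v * 2 powr ?e * (2 powr (- \<delta>)) ^ k)"
      by (intro summable_mult summable_geometric) simp
    then show ?thesis unfolding t by (intro suminf_ennreal2) auto
  qed
  also have "\<dots> < \<infinity>" by simp
  finally show ?thesis .
qed

text \<open>The point is uniformity: \<open>B\<close> depends on \<delta> and \<open>u0\<close> but
  not on the centre \<open>s\<close>. Near the centre the constant bound is used, far away 1 + |u -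
  s| \<le> 2 |u - s|, and \<open>A\<close> is the larger of the two losses.\<close>

lemma nn_integral_bounded_decay:
  fixes \<delta> u0 :: real
  assumes \<delta>: "\<delta> > 0" and u0: "u0 \<ge> 1"
  obtains B where "B \<ge> 0"
    "\<And>f s C. C \<ge> 0 \<Longrightarrow> f \<in> borel_measurable borel \<Longrightarrow> (\<And>u. f u \<le> ennreal C) \<Longrightarrow>
      (\<And>u. norm (u - s) \<ge> u0 \<Longrightarrow> f u \<le> ennreal (C * norm (u - s) powr (- (DIM('a) + \<delta>)))) \<Longrightarrow>
      (\<integral>\<^sup>+(u::'a::euclidean_space). f u \<partial>lborel) \<le> ennreal (C * B)"
proof -
  let ?e = "real DIM('a) + \<delta>"
  define I where "I = (\<integral>\<^sup>+(u::'a). ennreal ((1 + norm u) powr (- ?e)) \<partial>lborel)"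
  have I: "I < \<infinity>" unfolding I_def by (rule nn_integral_polynomial_decay[OF \<delta>])
  define A where "A = max ((1 + u0) powr ?e) (2 powr ?e)"
  have A: "A \<ge> 0" unfolding A_def by (simp add: le_max_iff_disj)
  show ?thesis
  proof (rule that[of "A * enn2real I"])
    show "0 \<le> A * enn2real I" using A by simp
    fix f :: "'a \<Rightarrow> ennreal" and s C
    assume C: "C \<ge> 0" and [measurable]: "f \<in> borel_measurable borel"
      and f1: "\<And>u. f u \<le> ennreal C"
      and f2: "\<And>u. norm (u - s) \<ge> u0 \<Longrightarrow> f u \<le> ennreal (C * norm (u - s) powr (- ?e))"
    have pt: "f u \<le> ennreal (C * A) * ennreal ((1 + norm (u - s)) powr (- ?e))" for u
    proof (cases "norm (u - s) \<ge> u0")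
      case True
      then have n: "norm (u - s) \<ge> 1" using u0 by simp
      have "norm (u - s) powr (- ?e) \<le> ((1 + norm (u - s)) / 2) powr (- ?e)"
        using n \<delta> by (intro powr_mono2') auto
      also have "\<dots> = 2 powr ?e * (1 + norm (u - s)) powr (- ?e)"
      proof -
        have "2 powr (- ?e) = 1 / 2 powr ?e" by (rule powr_minus_divide)
        moreover have "((1 + norm (u - s)) / 2) powr (- ?e) = (1 + norm (u - s)) powr (- ?e) / 2 powr (- ?e)"
          by (rule powr_divide)
        ultimately show ?thesis by (simp only: divide_divide_eq_right div_by_1 mult.commute)
      qed
      also have "\<dots> \<le> A * (1 + norm (u - s)) powr (- ?e)"
        by (intro mult_right_mono) (auto simp: A_def)
      finally have "C * norm (u - s) powr (- ?e) \<le> C * (A * (1 + norm (u - s)) powr (- ?e))"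
        using C by (rule mult_left_mono)
      then have "ennreal (C * norm (u - s) powr (- ?e)) \<le> ennreal (C * A) * ennreal ((1 + norm (u - s)) powr (- ?e))"
        using C A by (simp flip: ennreal_mult add: ennreal_leI mult.assoc)
      then show ?thesis using f2[OF True] by (rule order_trans[rotated])
    next
      case False
      then have "(1 + u0) powr (- ?e) \<le> (1 + norm (u - s)) powr (- ?e)"
        using \<delta> by (intro powr_mono2') (auto intro: add_pos_nonneg)
      then have "(1 + u0) powr ?e * (1 + u0) powr (- ?e) \<le> A * (1 + norm (u - s)) powr (- ?e)"
        using A by (intro mult_mono) (auto simp: A_def)
      moreover have "(1 + u0) powr ?e * (1 + u0) powr (- ?e) = 1"
        using u0 by (simp flip: powr_add)
      ultimately have "C * 1 \<le> C * (A * (1 + norm (u - s)) powr (- ?e))"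
        using C by (intro mult_left_mono) auto
      then have "ennreal C \<le> ennreal (C * A) * ennreal ((1 + norm (u - s)) powr (- ?e))"
        using C A by (simp flip: ennreal_mult add: ennreal_leI mult.assoc)
      then show ?thesis using f1 by (rule order_trans[rotated])
    qed
    have "(\<integral>\<^sup>+u. f u \<partial>lborel) \<le> (\<integral>\<^sup>+u. ennreal (C * A) * ennreal ((1 + norm (u - s)) powr (- ?e)) \<partial>lborel)"
      by (intro nn_integral_mono pt)
    also have "\<dots> = ennreal (C * A) * (\<integral>\<^sup>+u. ennreal ((1 + norm (- s + 1 *\<^sub>R u)) powr (- ?e)) \<partial>lborel)"
      by (simp add: nn_integral_cmult)
    also have "\<dots> = ennreal (C * A) * I"
      unfolding I_def by (subst nn_integral_lborel_affine) auto
    also have "\<dots> = ennreal (C * (A * enn2real I))"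
      using I C A by (simp add: ennreal_mult mult.assoc)
    finally show "(\<integral>\<^sup>+u. f u \<partial>lborel) \<le> ennreal (C * (A * enn2real I))" .
  qed
qed

section \<open>The kernel of the shearlet frame\<close>

lemma integrable_bounded_support:
  fixes f :: "'a::euclidean_space \<Rightarrow> 'b::{banach, second_countable_topology}"
  assumes "f \<in> borel_measurable borel" "\<And>x. norm (f x) \<le> B" "\<And>x. f x \<noteq> 0 \<Longrightarrow> x \<in> cbox l u"
  shows "integrable lborel f"
proof (rule integrableI_bounded_set[where A="cbox l u" and B=B])
  show "AE x\<in>cbox l u in lborel. norm (f x) \<le> B" using assms(2) by simp
  show "AE x in lborel. x \<notin> cbox l u \<longrightarrow> f x = 0" using assms(3) by blast
  show "emeasure lborel (cbox l u) < \<infinity>" using emeasure_lborel_cbox_finite by auto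
qed (use assms in auto)

locale shearlet_generators =
  fixes \<Phi> \<Psi> :: "real ^ 'n::finite option \<Rightarrow> complex" and a0 a1 :: real and b :: "real ^ 'n"
  assumes dim_ge_3: "CARD('n option) \<ge> 3" and dim_odd: "odd CARD('n option)"
    and a0_pos: "0 < a0" and a0_less: "a0 < a1"
    and b_pos: "\<And>i. 0 < b $ i"
    and \<Psi>_L1: "integrable lborel \<Psi>" and \<Psi>_L2: "\<Psi> \<in> L2_fun"
    and \<Phi>_L1: "integrable lborel \<Phi>" and \<Phi>_L2: "\<Phi> \<in> L2_fun"
    and \<Psi>_supp: "\<And>\<xi>. fourier \<Psi> \<xi> \<noteq> 0 \<Longrightarrow>
      \<xi> $ None \<in> {-a1..-a0} \<union> {a0..a1} \<and> (\<forall>i. vtail \<xi> $ i \<in> {- (b $ i)..b $ i})"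
    and fourier_\<Phi>: "\<And>\<xi>. fourier \<Phi> \<xi> = complex_of_real ((\<xi> $ None) ^ ((CARD('n option) - 1) div 2) *
           sqrt (LINT \<omega>1:(- {- \<bar>\<xi> $ None\<bar>..\<bar>\<xi> $ None\<bar>})|lborel.
                   (cmod (fourier \<Psi> (vcons \<omega>1 (vtail \<xi>))))\<^sup>2 / \<bar>\<omega>1\<bar> ^ CARD('n option)))"
    and normalisation: "AE y in (lborel :: real measure).
           (LINT \<eta>|lborel. (cmod (fourier \<Phi> (vcons y \<eta>)))\<^sup>2 / \<bar>y\<bar> ^ (CARD('n option) - 1)) +
           (LINT \<eta>|lborel. (LINT \<xi>1:{- \<bar>y\<bar>..\<bar>y\<bar>}|lborel.
              (cmod (fourier \<Psi> (vcons \<xi>1 \<eta>)))\<^sup>2 / \<bar>\<xi>1\<bar> ^ CARD('n option))) = 1"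
begin

text \<open>The exponent of the first frequency in the transform of \<Phi>. Since d is odd, 2m is
  exactly the number of shear parameters; the low-pass estimates rest on this equality.\<close>

definition m :: nat where "m = (CARD('n option) - 1) div 2"

lemma CARD_n: "CARD('n) = 2 * m" and m_pos: "m > 0"
  using dim_ge_3 dim_odd unfolding m_def by (auto simp: even_two_times_div_two)

lemma a1_pos: "a1 > 0" using a0_pos a0_less by linarith

lemma \<Psi>_support:
  assumes "fourier \<Psi> \<xi> \<noteq> 0"
  shows "a0 \<le> \<bar>\<xi> $ None\<bar>" "\<bar>\<xi> $ None\<bar> \<le> a1" "\<bar>\<xi> $ Some i\<bar> \<le> b $ i"
proof -
  have 1: "\<xi> $ None \<in> {-a1..-a0} \<union> {a0..a1}" and 2: "- (b $ i) \<le> \<xi> $ Some i \<and> \<xi> $ Some i \<le> b $ i"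
    using \<Psi>_supp[OF assms] by auto
  show "a0 \<le> \<bar>\<xi> $ None\<bar>" "\<bar>\<xi> $ None\<bar> \<le> a1" using 1 a0_pos by auto
  show "\<bar>\<xi> $ Some i\<bar> \<le> b $ i" using 2 by linarith
qed

text \<open>A nonzero value requires a point of the support of the transform of \<Psi> with the same
  tail and a first frequency of at least the same modulus, so the box is inherited. A lower bound on
  the first frequency is not inherited.\<close>

lemma \<Phi>_support:
  assumes "fourier \<Phi> \<xi> \<noteq> 0"
  shows "\<bar>\<xi> $ None\<bar> \<le> a1" "\<bar>\<xi> $ Some i\<bar> \<le> b $ i"
proof -
  let ?f = "\<lambda>\<omega>1. indicator (- {- \<bar>\<xi> $ None\<bar>..\<bar>\<xi> $ None\<bar>}) \<omega>1 *\<^sub>R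
      ((cmod (fourier \<Psi> (vcons \<omega>1 (vtail \<xi>))))\<^sup>2 / \<bar>\<omega>1\<bar> ^ CARD('n option))"
  have "\<not> (\<forall>\<omega>1. ?f \<omega>1 = 0)"
  proof
    assume "\<forall>\<omega>1. ?f \<omega>1 = 0"
    then have "(\<integral>\<omega>1. ?f \<omega>1 \<partial>lborel) = (\<integral>\<omega>1. 0 \<partial>(lborel :: real measure))" by (simp only:)
    then have "fourier \<Phi> \<xi> = 0"
      unfolding fourier_\<Phi> set_lebesgue_integral_def by (simp only:) simp
    then show False using assms by simp
  qed
  then obtain \<omega>1 where w: "?f \<omega>1 \<noteq> 0" by blast
  then have 1: "fourier \<Psi> (vcons \<omega>1 (vtail \<xi>)) \<noteq> 0" and 2: "\<bar>\<xi> $ None\<bar> \<le> \<bar>\<omega>1\<bar>"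
    by (auto simp: indicator_def split: if_splits)
  show "\<bar>\<xi> $ None\<bar> \<le> a1" using 2 \<Psi>_support(2)[OF 1] by simp
  show "\<bar>\<xi> $ Some i\<bar> \<le> b $ i" using \<Psi>_support(3)[OF 1, of i] by simp
qed

text \<open>One constant for both generators: it dominates their L_1 norms and hence the suprema of
  their transforms.\<close>

definition G1 :: real where
  "G1 = (\<integral>x. cmod (\<Phi> x) \<partial>lborel) + (\<integral>x. cmod (\<Psi> x) \<partial>lborel)"

lemma G1_nonneg: "G1 \<ge> 0" by (simp add: G1_def)

lemma generator_L1: "integrable lborel (generator \<Phi> \<Psi> \<alpha>)"
  and generator_L2: "generator \<Phi> \<Psi> \<alpha> \<in> L2_fun"
  and generator_norm1: "(\<integral>x. cmod (generator \<Phi> \<Psi> \<alpha> x) \<partial>lborel) \<le> G1"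
  using \<Phi>_L1 \<Psi>_L1 \<Phi>_L2 \<Psi>_L2 by (auto simp: generator_def G1_def)

lemma fourier_generator_le: "cmod (fourier (generator \<Phi> \<Psi> \<alpha>) \<omega>) \<le> G1"
  by (rule order_trans[OF norm_fourier_le generator_norm1])

lemma measurable_\<Phi> [measurable]: "\<Phi> \<in> borel_measurable borel" and measurable_\<Psi> [measurable]: "\<Psi> \<in> borel_measurable borel"
  using \<Phi>_L1 \<Psi>_L1 by auto

lemma generator_support:
  assumes "fourier (generator \<Phi> \<Psi> \<alpha>) \<xi> \<noteq> 0"
  shows "\<bar>\<xi> $ None\<bar> \<le> a1" "\<bar>\<xi> $ Some i\<bar> \<le> b $ i" "\<alpha> \<noteq> \<infinity> \<Longrightarrow> a0 \<le> \<bar>\<xi> $ None\<bar>"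
  using assms \<Phi>_support \<Psi>_support by (auto simp: generator_def split: if_splits)

abbreviation \<psi> :: "'n param \<Rightarrow> real ^ 'n option \<Rightarrow> complex" where "\<psi> \<equiv> shearlet \<Phi> \<Psi>"

definition K :: "'n param \<Rightarrow> 'n param \<Rightarrow> complex" where
  "K x y = shearlet_transform \<psi> (\<psi> x) y"

lemma K_eq: "K x y = (\<integral>z. \<psi> x z * cnj (\<psi> y z) \<partial>lborel)"
  by (simp add: K_def shearlet_transform_def L2_inner_def)

lemma param_cases:
  assumes "x \<in> param_space"
  obtains \<alpha> s t where "x = (\<alpha>, s, t)" "\<alpha> \<in> scales"
  using assms by (auto simp: param_space_scales)

lemma \<psi>_L1: "x \<in> param_space \<Longrightarrow> integrable lborel (\<psi> x)"
  by (auto elim!: param_cases intro!: integrable_shearlet generator_L1)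

lemma \<psi>_L2: "x \<in> param_space \<Longrightarrow> \<psi> x \<in> L2_fun"
  by (auto elim!: param_cases intro!: L2_fun_shearlet generator_L2)

lemma \<psi>_translate:
  assumes "\<alpha> \<in> scales"
  shows "\<psi> (\<alpha>, s, t) y = \<psi> (\<alpha>, s, 0) (y - t)"
  by (simp add: shearlet_eq[OF assms])

lemma fourier_\<psi>:
  assumes "\<alpha> \<in> scales"
  shows "fourier (\<psi> (\<alpha>, s, t)) \<omega> = of_real (sqrt (dilation_det TYPE('n) (scale_of \<alpha>))) * wave (- (\<omega> \<bullet> t)) *
    fourier (generator \<Phi> \<Psi> \<alpha>) (shear_freq \<alpha> s \<omega>)"
  by (rule fourier_shearlet[OF assms generator_L1])

text \<open>The support box of the generator, pulled back by \<open>shear_freq\<close>. At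
  \<infinity> the upper bounds hold with scale 1, whereas the lower bound on the first frequency is
  confined to finite scales.\<close>

lemma fourier_\<psi>_support:
  assumes \<alpha>: "\<alpha> \<in> scales" and nz: "fourier (\<psi> (\<alpha>, s, t)) \<omega> \<noteq> 0"
  shows "\<bar>scale_of \<alpha>\<bar> * \<bar>\<omega> $ None\<bar> \<le> a1" "\<alpha> \<noteq> \<infinity> \<Longrightarrow> a0 \<le> \<bar>scale_of \<alpha>\<bar> * \<bar>\<omega> $ None\<bar>"
    "\<bar>\<omega> $ Some i + \<omega> $ None * s $ i\<bar> \<le> b $ i * \<bar>scale_of \<alpha>\<bar> powr (- (1 / CARD('n option)))"
proof -
  have g: "fourier (generator \<Phi> \<Psi> \<alpha>) (shear_freq \<alpha> s \<omega>) \<noteq> 0"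
    using nz by (auto simp: fourier_\<psi>[OF \<alpha>])
  note G = generator_support[OF g]
  show "\<bar>scale_of \<alpha>\<bar> * \<bar>\<omega> $ None\<bar> \<le> a1" using G(1) by (simp add: shear_freq_def abs_mult)
  show "\<alpha> \<noteq> \<infinity> \<Longrightarrow> a0 \<le> \<bar>scale_of \<alpha>\<bar> * \<bar>\<omega> $ None\<bar>" using G(3) by (simp add: shear_freq_def abs_mult)
  have a: "scale_of \<alpha> \<noteq> 0" using \<alpha> by (rule scale_of_nonzero)
  have "\<bar>scale_of \<alpha>\<bar> powr (1 / CARD('n option)) * \<bar>\<omega> $ Some i + \<omega> $ None * s $ i\<bar> \<le> b $ i"
    using G(2)[of i] unfolding abs_dilation_root[OF a, symmetric] by (simp add: shear_freq_def abs_mult)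
  then have "\<bar>\<omega> $ Some i + \<omega> $ None * s $ i\<bar> \<le> b $ i / \<bar>scale_of \<alpha>\<bar> powr (1 / CARD('n option))"
    using a by (subst pos_le_divide_eq) (auto simp: mult.commute)
  then show "\<bar>\<omega> $ Some i + \<omega> $ None * s $ i\<bar> \<le> b $ i * \<bar>scale_of \<alpha>\<bar> powr (- (1 / CARD('n option)))"
    by (simp only: powr_minus_divide times_divide_eq_right mult_1_right)
qed

lemma fourier_\<psi>_le:
  assumes "\<alpha> \<in> scales"
  shows "cmod (fourier (\<psi> (\<alpha>, s, t)) \<omega>) \<le> sqrt (dilation_det TYPE('n) (scale_of \<alpha>)) * G1"
  unfolding fourier_\<psi>[OF assms] using dilation_det_pos[OF scale_of_nonzero[OF assms], of "TYPE('n)"]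
  by (simp add: norm_mult mult_left_mono fourier_generator_le)

lemma fourier_\<psi>_integrable:
  assumes x: "x \<in> param_space"
  shows "integrable lborel (fourier (\<psi> x))"
proof -
  obtain \<alpha> s t where x: "x = (\<alpha>, s, t)" and \<alpha>: "\<alpha> \<in> scales" using x by (rule param_cases)
  let ?a = "\<bar>scale_of \<alpha>\<bar>"
  have a: "?a > 0" using scale_of_nonzero[OF \<alpha>] by simp
  have pm: "\<psi> x \<in> borel_measurable borel"
    using \<psi>_L2[OF assms] by (simp add: L2_fun_def)
  \<comment> \<open>A box enclosing the sheared support: a tail frequency is at most its sheared
    value plus the shear times the bound on the first frequency.\<close>
  define U :: "real ^ 'n option" where "U = vcons (a1 / ?a) (\<chi> i. b $ i * ?a powr (- (1 / CARD('n option))) + a1 / ?a * \<bar>s $ i\<bar>)"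
  show ?thesis
  proof (rule integrable_bounded_support[where l="- U" and u=U])
    show "fourier (\<psi> x) \<in> borel_measurable borel" using pm by (rule borel_measurable_fourier)
    show "cmod (fourier (\<psi> x) \<omega>) \<le> sqrt (dilation_det TYPE('n) (scale_of \<alpha>)) * G1" for \<omega>
      unfolding x by (rule fourier_\<psi>_le[OF \<alpha>])
    fix \<omega> assume nz: "fourier (\<psi> x) \<omega> \<noteq> 0"
    note S = fourier_\<psi>_support[OF \<alpha> nz[unfolded x]]
    have w: "\<bar>\<omega> $ None\<bar> \<le> a1 / ?a" using S(1) a by (simp add: field_simps)
    have "\<bar>\<omega> $ i\<bar> \<le> U $ i" for i
    proof (cases i)
      case None then show ?thesis using w by (simp add: U_def)
    next
      case (Some j)
      have "\<bar>\<omega> $ None * s $ j\<bar> \<le> a1 / ?a * \<bar>s $ j\<bar>"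
        unfolding abs_mult using w by (rule mult_right_mono) simp
      then have "\<bar>\<omega> $ Some j\<bar> \<le> b $ j * ?a powr (- (1 / CARD('n option))) + a1 / ?a * \<bar>s $ j\<bar>"
        using S(3)[of j] by linarith
      then show ?thesis unfolding Some U_def vcons_Some vec_lambda_beta .
    qed
    then show "\<omega> \<in> cbox (- U) U" by (auto simp: mem_box_cart abs_le_iff minus_le_iff)
  qed
qed

lemma K_parseval:
  assumes "x \<in> param_space" "y \<in> param_space"
  shows "K x y = (\<integral>\<omega>. fourier (\<psi> x) \<omega> * cnj (fourier (\<psi> y) \<omega>) \<partial>lborel)"
  unfolding K_eq by (rule parseval[OF \<psi>_L1[OF assms(1)] fourier_\<psi>_integrable[OF assms(1)] \<psi>_L1[OF assms(2)]])

lemma K_correlation: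
  assumes "\<beta> \<in> scales"
  shows "K x (\<beta>, s, t) = correlation (\<psi> x) (\<psi> (\<beta>, s, 0)) t"
  unfolding K_eq correlation_def by (simp add: \<psi>_translate[OF assms, of s t])

lemma K_hermitian: "K y x = cnj (K x y)"
  unfolding K_eq by (subst Bochner_Integration.integral_cnj[symmetric]) (simp add: mult.commute)

definition G2 :: real where
  "G2 = (\<integral>x. (cmod (\<Phi> x))\<^sup>2 \<partial>lborel) + (\<integral>x. (cmod (\<Psi> x))\<^sup>2 \<partial>lborel)"

lemma G2_nonneg: "G2 \<ge> 0" by (simp add: G2_def)

text \<open>Cauchy-Schwarz in the crude form |z w| \<le> |z|^2 + |w|^2, which explains the factor
  2.\<close>

lemma K_bounded:
  assumes x: "x \<in> param_space" and y: "y \<in> param_space"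
  shows "cmod (K x y) \<le> 2 * G2"
proof -
  have n: "(\<integral>z. (cmod (\<psi> x z))\<^sup>2 \<partial>lborel) \<le> G2" if x: "x \<in> param_space" for x
  proof -
    obtain \<alpha> s t where "x = (\<alpha>, s, t)" "\<alpha> \<in> scales" using x by (rule param_cases)
    then show ?thesis
      using L2_fun_shearlet(2)[OF _ generator_L2, of \<alpha> s t] by (auto simp: generator_def G2_def)
  qed
  have i: "integrable lborel (\<lambda>z. (cmod (\<psi> x z))\<^sup>2)" if "x \<in> param_space" for x
    using \<psi>_L2[OF that] by (simp add: L2_fun_def)
  have "cmod (K x y) \<le> (\<integral>z. cmod (\<psi> x z * cnj (\<psi> y z)) \<partial>lborel)"
    unfolding K_eq by (rule integral_norm_bound)
  also have "\<dots> \<le> (\<integral>z. (cmod (\<psi> x z))\<^sup>2 + (cmod (\<psi> y z))\<^sup>2 \<partial>lborel)"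
  proof (rule integral_mono)
    show "integrable lborel (\<lambda>z. cmod (\<psi> x z * cnj (\<psi> y z)))"
      by (intro integrable_norm L2_fun_cmult_add(3) \<psi>_L2 x y)
    show "integrable lborel (\<lambda>z. (cmod (\<psi> x z))\<^sup>2 + (cmod (\<psi> y z))\<^sup>2)" using i x y by simp
    fix z
    have "0 \<le> cmod (\<psi> x z) * cmod (\<psi> y z)" by simp
    then have "cmod (\<psi> x z) * cmod (\<psi> y z) \<le> (cmod (\<psi> x z))\<^sup>2 + (cmod (\<psi> y z))\<^sup>2"
      using sum_squares_bound[of "cmod (\<psi> x z)" "cmod (\<psi> y z)"] by linarith
    then show "cmod (\<psi> x z * cnj (\<psi> y z)) \<le> (cmod (\<psi> x z))\<^sup>2 + (cmod (\<psi> y z))\<^sup>2"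
      by (simp add: norm_mult)
  qed
  also have "\<dots> = (\<integral>z. (cmod (\<psi> x z))\<^sup>2 \<partial>lborel) + (\<integral>z. (cmod (\<psi> y z))\<^sup>2 \<partial>lborel)"
    using i x y by simp
  also have "\<dots> \<le> 2 * G2" using n[OF x] n[OF y] by simp
  finally show ?thesis .
qed

lemma shearlet_uniform:
  assumes "x \<in> param_space"
  shows "\<psi> x y = of_real (dilation_det TYPE('n) (scale_of (fst x)) powr (- (1 / 2))) *
    (if fst x = \<infinity> then \<Phi> (shear_scale (1 / scale_of (fst x)) (1 / dilation_root TYPE('n) (scale_of (fst x))) (fst (snd x)) (y - snd (snd x)))
     else \<Psi> (shear_scale (1 / scale_of (fst x)) (1 / dilation_root TYPE('n) (scale_of (fst x))) (fst (snd x)) (y - snd (snd x))))"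
proof -
  obtain \<alpha> s t where "x = (\<alpha>, s, t)" "\<alpha> \<in> scales" using assms by (rule param_cases)
  then show ?thesis by (simp add: shearlet_eq generator_def)
qed

text \<open>The uniform formula taken on the whole parameter type, where it is visibly jointly
  Borel. The kernel K' built from it agrees with \<open>K\<close> on \<open>param_space\<close>, and
  the measurability of \<open>K\<close> is obtained by restriction.\<close>

definition \<psi>' :: "'n param \<Rightarrow> real ^ 'n option \<Rightarrow> complex" where
  "\<psi>' x y = of_real (dilation_det TYPE('n) (scale_of (fst x)) powr (- (1 / 2))) *
    (if fst x = \<infinity> then \<Phi> (shear_scale (1 / scale_of (fst x)) (1 / dilation_root TYPE('n) (scale_of (fst x))) (fst (snd x)) (y - snd (snd x)))
     else \<Psi> (shear_scale (1 / scale_of (fst x)) (1 / dilation_root TYPE('n) (scale_of (fst x))) (fst (snd x)) (y - snd (snd x))))"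

lemma \<psi>'_measurable: "(\<lambda>(x, y). \<psi>' x y) \<in> borel_measurable (borel \<Otimes>\<^sub>M borel)"
proof -
  have [measurable]: "(\<lambda>z :: 'n param \<times> (real ^ 'n option). fst (fst z)) \<in> borel \<Otimes>\<^sub>M borel \<rightarrow>\<^sub>M borel"
    "(\<lambda>z :: 'n param \<times> (real ^ 'n option). fst (snd (fst z))) \<in> borel \<Otimes>\<^sub>M borel \<rightarrow>\<^sub>M borel"
    "(\<lambda>z :: 'n param \<times> (real ^ 'n option). snd (snd (fst z))) \<in> borel \<Otimes>\<^sub>M borel \<rightarrow>\<^sub>M borel"
    by (auto simp: borel_prod intro!: borel_measurable_continuous_onI continuous_intros)
  show ?thesis
    unfolding \<psi>'_def case_prod_unfold dilation_det_def by measurable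
qed

definition K' :: "'n param \<Rightarrow> 'n param \<Rightarrow> complex" where
  "K' x y = (\<integral>z. \<psi>' x z * cnj (\<psi>' y z) \<partial>lborel)"

lemma K'_measurable: "(\<lambda>(x, y). K' x y) \<in> borel_measurable (borel \<Otimes>\<^sub>M borel)"
proof -
  note [measurable] = \<psi>'_measurable
  have "(\<lambda>(q, z). \<psi>' (fst q) z * cnj (\<psi>' (snd q) z)) \<in> borel_measurable ((borel \<Otimes>\<^sub>M borel) \<Otimes>\<^sub>M lborel)"
    unfolding case_prod_unfold
    by (intro borel_measurable_times borel_measurable_cnj
        measurable_compose[OF _ \<psi>'_measurable, unfolded case_prod_unfold, of "\<lambda>z. (fst (fst z), snd z)", simplified]
        measurable_compose[OF _ \<psi>'_measurable, unfolded case_prod_unfold, of "\<lambda>z. (snd (fst z), snd z)", simplified]) measurable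
  then have "(\<lambda>q. \<integral>z. \<psi>' (fst q) z * cnj (\<psi>' (snd q) z) \<partial>lborel) \<in> borel_measurable (borel \<Otimes>\<^sub>M borel)"
    by (rule lborel.borel_measurable_lebesgue_integral)
  then show ?thesis by (simp add: K'_def case_prod_unfold)
qed

lemma K'_eq: "x \<in> param_space \<Longrightarrow> y \<in> param_space \<Longrightarrow> K' x y = K x y"
  unfolding K'_def K_eq by (simp add: shearlet_uniform \<psi>'_def)

section \<open>Interactions in which at least one scale is finite\<close>

definition \<rho> :: real where "\<rho> = a0 / a1"

lemma \<rho>: "0 < \<rho>" "\<rho> < 1"
  using a0_pos a0_less by (auto simp: \<rho>_def)

text \<open>The two tail boxes have widths of order b |\<alpha>|^(-1/d) and b |\<beta>|^(-1/d) with
  |\<beta>| \<ge> \<rho> |\<alpha>|. Adding them and dividing by the first frequency, which is at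
  least a0 / |\<alpha>|, produces this constant.\<close>

definition Lc :: real where "Lc = (\<Sum>i\<in>UNIV. b $ i) * (1 + \<rho> powr (- (1 / real CARD('n option)))) / a0"

lemma b_le_sum: "b $ j \<le> (\<Sum>i\<in>UNIV. b $ i)"
  by (rule member_le_sum) (use b_pos in \<open>auto intro: less_imp_le\<close>)

lemma sum_b_pos: "(\<Sum>i\<in>UNIV. b $ i) > 0"
  using b_pos by (intro sum_pos) auto

lemma Lc_nonneg: "Lc \<ge> 0"
  unfolding Lc_def using sum_b_pos a0_pos by (intro divide_nonneg_pos mult_nonneg_nonneg add_nonneg_nonneg) auto

text \<open>At a common frequency the product of scale and first frequency lies between a0 and a1 in
  modulus for both elements, which makes the scales comparable; the two tail boxes must meet, which
  makes the shears close.\<close>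

lemma interaction_geometry:
  assumes \<alpha>: "\<alpha> \<in> scales" and \<beta>: "\<beta> \<in> scales" and fin: "\<alpha> \<noteq> \<infinity> \<or> \<beta> \<noteq> \<infinity>"
    and nz: "fourier (\<psi> (\<alpha>, s, t)) \<omega> \<noteq> 0" "fourier (\<psi> (\<beta>, s', t')) \<omega> \<noteq> 0"
  shows "\<rho> * \<bar>scale_of \<alpha>\<bar> \<le> \<bar>scale_of \<beta>\<bar>" "\<rho> * \<bar>scale_of \<beta>\<bar> \<le> \<bar>scale_of \<alpha>\<bar>"
    "\<bar>s $ j - s' $ j\<bar> \<le> Lc * \<bar>scale_of \<alpha>\<bar> powr (1 - (1 / real CARD('n option)))"
proof -
  let ?a = "\<bar>scale_of \<alpha>\<bar>" and ?b = "\<bar>scale_of \<beta>\<bar>" and ?w = "\<bar>\<omega> $ None\<bar>"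
  note A = fourier_\<psi>_support[OF \<alpha> nz(1)] and B = fourier_\<psi>_support[OF \<beta> nz(2)]
  have a: "?a > 0" "?a \<le> 1" and b: "?b > 0" "?b \<le> 1"
    using scale_of_nonzero[OF \<alpha>] scale_of_nonzero[OF \<beta>] abs_scale_of_le[OF \<alpha>] abs_scale_of_le[OF \<beta>] by auto
  \<comment> \<open>A low-pass element has scale 1 and borrows the lower bound from its partner,
    whose scale is at most 1. This step uses that one of the two scales is finite.\<close>
  have wa: "a0 \<le> ?a * ?w"
  proof (cases "\<alpha> = \<infinity>")
    case True
    then have "a0 \<le> ?b * ?w" using fin B(2) by auto
    also have "\<dots> \<le> 1 * ?w" using b by (intro mult_right_mono) auto
    finally show ?thesis using True by simp
  qed (use A(2) in auto)
  have wb: "a0 \<le> ?b * ?w"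
  proof (cases "\<beta> = \<infinity>")
    case True
    then have "a0 \<le> ?a * ?w" using fin A(2) by auto
    also have "\<dots> \<le> 1 * ?w" using a by (intro mult_right_mono) auto
    finally show ?thesis using True by simp
  qed (use B(2) in auto)
  have w0: "?w > 0" using wa a0_pos by (cases "?w = 0") auto
  have r: "\<rho> * x \<le> y" if "x * ?w \<le> a1" "a0 \<le> y * ?w" for x y
  proof -
    have "\<rho> * (x * ?w) \<le> \<rho> * a1" using that(1) \<rho> by (intro mult_left_mono) auto
    also have "\<rho> * a1 = a0" using a1_pos by (simp add: \<rho>_def)
    finally have "(\<rho> * x) * ?w \<le> y * ?w" using that(2) by (simp add: mult.assoc)
    then show ?thesis using w0 by simp
  qed
  show 1: "\<rho> * ?a \<le> ?b" by (rule r[OF A(1) wb])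
  show "\<rho> * ?b \<le> ?a" by (rule r[OF B(1) wa])
  have "?w * \<bar>s $ j - s' $ j\<bar> = \<bar>(\<omega> $ Some j + \<omega> $ None * s $ j) - (\<omega> $ Some j + \<omega> $ None * s' $ j)\<bar>"
    unfolding abs_mult[symmetric] by (simp add: algebra_simps)
  also have "\<dots> \<le> \<bar>\<omega> $ Some j + \<omega> $ None * s $ j\<bar> + \<bar>\<omega> $ Some j + \<omega> $ None * s' $ j\<bar>"
    by (rule abs_triangle_ineq4)
  also have "\<dots> \<le> b $ j * ?a powr (- (1 / real CARD('n option))) + b $ j * ?b powr (- (1 / real CARD('n option)))"
    using A(3)[of j] B(3)[of j] by (rule add_mono)
  also have "?b powr (- (1 / real CARD('n option))) \<le> (\<rho> * ?a) powr (- (1 / real CARD('n option)))"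
    using 1 \<rho> a by (intro powr_mono2') auto
  also have "(\<rho> * ?a) powr (- (1 / real CARD('n option))) = \<rho> powr (- (1 / real CARD('n option))) * ?a powr (- (1 / real CARD('n option)))"
    by (rule powr_mult)
  finally have "?w * \<bar>s $ j - s' $ j\<bar> \<le> b $ j * ((1 + \<rho> powr (- (1 / real CARD('n option)))) * ?a powr (- (1 / real CARD('n option))))"
    using b_pos[of j] by (simp add: algebra_simps)
  also have "\<dots> \<le> (\<Sum>i\<in>UNIV. b $ i) * ((1 + \<rho> powr (- (1 / real CARD('n option)))) * ?a powr (- (1 / real CARD('n option))))"
    by (intro mult_right_mono b_le_sum mult_nonneg_nonneg add_nonneg_nonneg) auto
  also have "\<dots> = a0 * (Lc * ?a powr (- (1 / real CARD('n option))))"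
    using a0_pos by (simp add: Lc_def)
  finally have 2: "?w * \<bar>s $ j - s' $ j\<bar> \<le> a0 * (Lc * ?a powr (- (1 / real CARD('n option))))" .
  have "a0 * \<bar>s $ j - s' $ j\<bar> \<le> (?a * ?w) * \<bar>s $ j - s' $ j\<bar>"
    using wa by (rule mult_right_mono) simp
  also have "\<dots> = ?a * (?w * \<bar>s $ j - s' $ j\<bar>)" by simp
  also have "\<dots> \<le> ?a * (a0 * (Lc * ?a powr (- (1 / real CARD('n option)))))"
    using 2 by (rule mult_left_mono) simp
  also have "\<dots> = a0 * (Lc * (?a powr 1 * ?a powr (- (1 / real CARD('n option)))))" using a by simp
  also have "?a powr 1 * ?a powr (- (1 / real CARD('n option))) = ?a powr (1 - (1 / real CARD('n option)))"
    by (simp only: powr_add[symmetric] add_uminus_conv_diff)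
  finally show "\<bar>s $ j - s' $ j\<bar> \<le> Lc * ?a powr (1 - (1 / real CARD('n option)))" using a0_pos by simp
qed

text \<open>By Parseval a kernel value is the integral of the product of the transforms, so elements
  with disjoint frequency supports are orthogonal.\<close>

lemma K_nonzero_frequency:
  assumes x: "x \<in> param_space" and y: "y \<in> param_space" and nz: "K x y \<noteq> 0"
  obtains \<omega> where "fourier (\<psi> x) \<omega> \<noteq> 0" "fourier (\<psi> y) \<omega> \<noteq> 0"
proof -
  have "\<exists>\<omega>. fourier (\<psi> x) \<omega> * cnj (fourier (\<psi> y) \<omega>) \<noteq> 0"
  proof (rule ccontr)
    assume "\<not> ?thesis"
    then have "(\<lambda>\<omega>. fourier (\<psi> x) \<omega> * cnj (fourier (\<psi> y) \<omega>)) = (\<lambda>\<omega>. 0)" by auto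
    then show False using nz unfolding K_parseval[OF x y] by simp
  qed
  then show ?thesis using that by auto
qed

lemma weight_eq: "x \<in> param_space \<Longrightarrow> weight r x = \<bar>scale_of (fst x)\<bar> powr (- r)"
  by (auto simp: weight_def param_space_scales scales_def)

text \<open>A nonzero kernel value forces comparable scales, up to the factor \<rho>; two low-pass
  elements have the same scale, and \<rho> < 1 covers them.\<close>

lemma weight_moderate:
  assumes r: "r \<ge> 0" and x: "x \<in> param_space" and y: "y \<in> param_space" and nz: "K x y \<noteq> 0"
  shows "weight r y \<le> \<rho> powr (- r) * weight r x"
proof -
  obtain \<alpha> s t where X: "x = (\<alpha>, s, t)" "\<alpha> \<in> scales" using x by (rule param_cases)
  obtain \<beta> s' t' where Y: "y = (\<beta>, s', t')" "\<beta> \<in> scales" using y by (rule param_cases)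
  obtain \<omega> where w: "fourier (\<psi> x) \<omega> \<noteq> 0" "fourier (\<psi> y) \<omega> \<noteq> 0"
    using x y nz by (rule K_nonzero_frequency)
  have a: "\<bar>scale_of \<alpha>\<bar> > 0" using scale_of_nonzero[OF X(2)] by simp
  have "\<rho> * \<bar>scale_of \<alpha>\<bar> \<le> \<bar>scale_of \<beta>\<bar>"
  proof (cases "\<alpha> \<noteq> \<infinity> \<or> \<beta> \<noteq> \<infinity>")
    case True
    then show ?thesis using interaction_geometry(1)[OF X(2) Y(2)] w unfolding X Y by blast
  next
    case False then show ?thesis using \<rho> by auto
  qed
  then have "\<bar>scale_of \<beta>\<bar> powr (- r) \<le> (\<rho> * \<bar>scale_of \<alpha>\<bar>) powr (- r)"
    using r \<rho> a by (intro powr_mono2') auto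
  also have "\<dots> = \<rho> powr (- r) * \<bar>scale_of \<alpha>\<bar> powr (- r)" by (rule powr_mult)
  finally show ?thesis unfolding weight_eq[OF x] weight_eq[OF y] by (simp add: X Y)
qed

lemma weight_ge_1: "r \<ge> 0 \<Longrightarrow> x \<in> param_space \<Longrightarrow> 1 \<le> weight r x"
proof -
  assume r: "r \<ge> 0" and x: "x \<in> param_space"
  obtain \<alpha> s t where X: "x = (\<alpha>, s, t)" "\<alpha> \<in> scales" using x by (rule param_cases)
  have "1 powr (- r) \<le> \<bar>scale_of \<alpha>\<bar> powr (- r)"
    using r scale_of_nonzero[OF X(2)] abs_scale_of_le[OF X(2)] by (intro powr_mono2') auto
  then show ?thesis unfolding weight_eq[OF x] by (simp add: X)
qed

lemma K_measurable_t:
  assumes x: "x \<in> param_space" and \<beta>: "\<beta> \<in> scales"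
  shows "(\<lambda>t. K x (\<beta>, s, t)) \<in> borel_measurable borel"
proof -
  have y: "(\<beta>, s, 0) \<in> param_space" using \<beta> by (simp add: param_space_scales)
  show ?thesis unfolding K_correlation[OF \<beta>]
    using integrable_correlation[OF \<psi>_L1[OF x] \<psi>_L1[OF y]] by (auto simp: fun_eq_iff)
qed

text \<open>Interpolation between supremum and L_1 norm: |K|^q = |K|^(q-1) |K|.\<close>

lemma translation_integral_le:
  assumes x: "x \<in> param_space" and \<beta>: "\<beta> \<in> scales" and q: "q > 1"
    and S: "S \<ge> 0" "\<And>t. cmod (K x (\<beta>, s, t)) \<le> S"
    and T: "(\<integral>t. cmod (K x (\<beta>, s, t)) \<partial>lborel) \<le> T"
  shows "(\<integral>\<^sup>+t. ennreal (cmod (K x (\<beta>, s, t)) powr q) \<partial>lborel) \<le> ennreal (S powr (q - 1) * T)"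
proof -
  have y: "(\<beta>, s, 0) \<in> param_space" using \<beta> by (simp add: param_space_scales)
  have i: "integrable lborel (\<lambda>t. cmod (K x (\<beta>, s, t)))"
    unfolding K_correlation[OF \<beta>] by (intro integrable_norm integrable_correlation \<psi>_L1 x y)
  have [measurable]: "(\<lambda>t. K x (\<beta>, s, t)) \<in> borel_measurable borel" by (rule K_measurable_t[OF x \<beta>])
  have "(\<integral>\<^sup>+t. ennreal (cmod (K x (\<beta>, s, t)) powr q) \<partial>lborel) \<le> (\<integral>\<^sup>+t. ennreal (S powr (q - 1)) * ennreal (cmod (K x (\<beta>, s, t))) \<partial>lborel)"
  proof (rule nn_integral_mono)
    fix t
    have "cmod (K x (\<beta>, s, t)) powr q = cmod (K x (\<beta>, s, t)) powr (q - 1) * cmod (K x (\<beta>, s, t))"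
      using powr_add[of "cmod (K x (\<beta>, s, t))" "q - 1" 1] by (cases "K x (\<beta>, s, t) = 0") auto
    also have "\<dots> \<le> S powr (q - 1) * cmod (K x (\<beta>, s, t))"
      using S q by (intro mult_right_mono powr_mono2) auto
    finally show "ennreal (cmod (K x (\<beta>, s, t)) powr q) \<le> ennreal (S powr (q - 1)) * ennreal (cmod (K x (\<beta>, s, t)))"
      by (simp flip: ennreal_mult add: ennreal_leI)
  qed
  also have "\<dots> = ennreal (S powr (q - 1)) * (\<integral>\<^sup>+t. ennreal (cmod (K x (\<beta>, s, t))) \<partial>lborel)"
    by (rule nn_integral_cmult) measurable
  also have "\<dots> = ennreal (S powr (q - 1) * (\<integral>t. cmod (K x (\<beta>, s, t)) \<partial>lborel))"
    using nn_integral_eq_integral[OF i] by (simp add: ennreal_mult)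
  also have "\<dots> \<le> ennreal (S powr (q - 1) * T)"
    using T by (intro ennreal_leI mult_left_mono) auto
  finally show ?thesis .
qed

lemma K_norm1_le:
  assumes x: "x = (\<alpha>, s, t)" "\<alpha> \<in> scales" and \<beta>: "\<beta> \<in> scales"
  shows "(\<integral>t'. cmod (K x (\<beta>, s', t')) \<partial>lborel) \<le>
    sqrt (dilation_det TYPE('n) (scale_of \<alpha>)) * sqrt (dilation_det TYPE('n) (scale_of \<beta>)) * G1\<^sup>2"
proof -
  have X: "x \<in> param_space" and y: "(\<beta>, s', 0) \<in> param_space" using x \<beta> by (auto simp: param_space_scales)
  have "(\<integral>t'. cmod (K x (\<beta>, s', t')) \<partial>lborel) \<le> (\<integral>z. cmod (\<psi> x z) \<partial>lborel) * (\<integral>z. cmod (\<psi> (\<beta>, s', 0) z) \<partial>lborel)"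
    unfolding K_correlation[OF \<beta>] by (intro correlation_norm_le \<psi>_L1 X y)
  also have "\<dots> \<le> (sqrt (dilation_det TYPE('n) (scale_of \<alpha>)) * G1) * (sqrt (dilation_det TYPE('n) (scale_of \<beta>)) * G1)"
    unfolding x(1) norm1_shearlet[OF x(2) generator_L1] norm1_shearlet[OF \<beta> generator_L1]
    using dilation_det_pos[OF scale_of_nonzero[OF x(2)], of "TYPE('n)"] dilation_det_pos[OF scale_of_nonzero[OF \<beta>], of "TYPE('n)"]
      G1_nonneg
    by (intro mult_mono mult_left_mono generator_norm1 mult_nonneg_nonneg) (auto intro!: integral_nonneg_AE)
  finally show ?thesis by (simp add: power2_eq_square mult_ac)
qed

definition "shear_vol = (2 * Lc) ^ CARD('n)"

text \<open>Counting powers of the scale: |\<alpha>|^(2-1/d) from the L_1 norms and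
  |\<alpha>|^((1-1/d)(d-1)) from the volume of the shears that interact add up to |\<alpha>|^d. The
  indicator records the comparable scales, to which da/|a|^(d+1) gives mass of order
  |\<alpha>|^(-d).\<close>

lemma local_kernel_bound:
  assumes q: "q > 1"
  obtains C where "C \<ge> 0"
    "\<And>\<alpha> s t \<beta>. \<alpha> \<in> scales \<Longrightarrow> \<beta> \<in> scales \<Longrightarrow> \<alpha> \<noteq> \<infinity> \<or> \<beta> \<noteq> \<infinity> \<Longrightarrow>
      (\<integral>\<^sup>+s'. \<integral>\<^sup>+t'. ennreal (cmod (K (\<alpha>, s, t) (\<beta>, s', t')) powr q) \<partial>lborel \<partial>lborel)
        \<le> ennreal (C * \<bar>scale_of \<alpha>\<bar> powr CARD('n option)) *
           indicator {\<beta>. \<rho> * \<bar>scale_of \<alpha>\<bar> \<le> \<bar>scale_of \<beta>\<bar> \<and> \<rho> * \<bar>scale_of \<beta>\<bar> \<le> \<bar>scale_of \<alpha>\<bar>} \<beta>"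
proof -
  let ?\<kappa> = "2 - (1 / real CARD('n option))"
  define C where "C = (2 * G2) powr (q - 1) * (\<rho> powr (- ?\<kappa> / 2) * G1\<^sup>2) * shear_vol"
  have sv: "shear_vol \<ge> 0" using Lc_nonneg by (simp add: shear_vol_def)
  show ?thesis
  proof (rule that[of C])
    show "C \<ge> 0" unfolding C_def using sv by (intro mult_nonneg_nonneg) auto
    fix \<alpha> :: ereal and s :: "real ^ 'n" and t :: "real ^ 'n option" and \<beta> :: ereal
    assume \<alpha>: "\<alpha> \<in> scales" and \<beta>: "\<beta> \<in> scales" and fin: "\<alpha> \<noteq> \<infinity> \<or> \<beta> \<noteq> \<infinity>"
    let ?a = "\<bar>scale_of \<alpha>\<bar>" and ?b = "\<bar>scale_of \<beta>\<bar>"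
    let ?x = "(\<alpha>, s, t)"
    have x: "?x \<in> param_space" using \<alpha> by (simp add: param_space_scales)
    have y: "(\<beta>, s', t') \<in> param_space" for s' t' using \<beta> by (simp add: param_space_scales)
    have a: "?a > 0" "?a \<le> 1" and b: "?b > 0"
      using scale_of_nonzero[OF \<alpha>] scale_of_nonzero[OF \<beta>] abs_scale_of_le[OF \<alpha>] by auto
    have zero: "K ?x (\<beta>, s', t') = 0"
      if "\<not> (\<rho> * ?a \<le> ?b \<and> \<rho> * ?b \<le> ?a \<and> (\<forall>j. \<bar>s $ j - s' $ j\<bar> \<le> Lc * ?a powr (1 - (1 / real CARD('n option)))))" for s' t'
    proof (rule ccontr)
      assume nz: "K ?x (\<beta>, s', t') \<noteq> 0"
      obtain \<omega> where "fourier (\<psi> ?x) \<omega> \<noteq> 0" "fourier (\<psi> (\<beta>, s', t')) \<omega> \<noteq> 0"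
        using x y nz by (rule K_nonzero_frequency)
      from interaction_geometry[OF \<alpha> \<beta> fin this] that show False by blast
    qed
    show "(\<integral>\<^sup>+s'. \<integral>\<^sup>+t'. ennreal (cmod (K ?x (\<beta>, s', t')) powr q) \<partial>lborel \<partial>lborel)
        \<le> ennreal (C * ?a powr CARD('n option)) *
           indicator {\<beta>. \<rho> * ?a \<le> \<bar>scale_of \<beta>\<bar> \<and> \<rho> * \<bar>scale_of \<beta>\<bar> \<le> ?a} \<beta>"
    proof (cases "\<rho> * ?a \<le> ?b \<and> \<rho> * ?b \<le> ?a")
      case False
      then have "K ?x (\<beta>, s', t') = 0" for s' t' using zero by blast
      then show ?thesis by simp
    next
      case True
      define l where "l = Lc * ?a powr (1 - (1 / real CARD('n option)))"
      have l0: "l \<ge> 0" using Lc_nonneg by (simp add: l_def)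
      define T where "T = sqrt (dilation_det TYPE('n) (scale_of \<alpha>)) * sqrt (dilation_det TYPE('n) (scale_of \<beta>)) * G1\<^sup>2"
      have T: "T \<le> \<rho> powr (- ?\<kappa> / 2) * ?a powr ?\<kappa> * G1\<^sup>2"
      proof -
        have "sqrt (dilation_det TYPE('n) (scale_of \<alpha>)) * sqrt (dilation_det TYPE('n) (scale_of \<beta>)) = ?a powr (?\<kappa> / 2) * ?b powr (?\<kappa> / 2)"
          unfolding dilation_det_powr[OF scale_of_nonzero[OF \<alpha>]] dilation_det_powr[OF scale_of_nonzero[OF \<beta>]]
          by (simp add: powr_powr flip: powr_half_sqrt)
        also have "\<dots> \<le> ?a powr (?\<kappa> / 2) * (?a / \<rho>) powr (?\<kappa> / 2)"
        proof (intro mult_left_mono powr_mono2)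
          show "?b \<le> ?a / \<rho>" using True \<rho> by (simp add: field_simps)
          show "0 \<le> ?\<kappa> / 2" using dim_ge_3 by (simp add: field_simps)
        qed auto
        also have "\<dots> = \<rho> powr (- ?\<kappa> / 2) * (?a powr (?\<kappa> / 2) * ?a powr (?\<kappa> / 2))"
          using \<rho> by (simp add: powr_divide powr_minus field_simps)
        also have "?a powr (?\<kappa> / 2) * ?a powr (?\<kappa> / 2) = ?a powr ?\<kappa>" by (simp only: powr_add[symmetric] field_sum_of_halves)
        finally show ?thesis unfolding T_def by (intro mult_right_mono) auto
      qed
      have inner: "(\<integral>\<^sup>+t'. ennreal (cmod (K ?x (\<beta>, s', t')) powr q) \<partial>lborel) \<le>
          ennreal ((2 * G2) powr (q - 1) * T) * indicator (cbox (s - (\<chi> i. l)) (s + (\<chi> i. l))) s'" for s'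
      proof (cases "s' \<in> cbox (s - (\<chi> i. l)) (s + (\<chi> i. l))")
        case True
        show ?thesis
          using translation_integral_le[OF x \<beta> q _ K_bounded[OF x y] K_norm1_le[OF refl \<alpha> \<beta>], of s'] True G2_nonneg
          by (simp add: T_def)
      next
        case False
        have "\<exists>j. \<not> (\<bar>s $ j - s' $ j\<bar> \<le> l)"
        proof (rule ccontr)
          assume "\<nexists>j. \<not> (\<bar>s $ j - s' $ j\<bar> \<le> l)"
          then have "\<bar>s $ j - s' $ j\<bar> \<le> l" for j by blast
          then have "s' \<in> cbox (s - (\<chi> i. l)) (s + (\<chi> i. l))"
            unfolding mem_box_cart abs_le_iff by (auto simp: algebra_simps)
          with False show False ..
        qed
        then obtain j where "\<not> (\<bar>s $ j - s' $ j\<bar> \<le> l)" by blast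
        then have "K ?x (\<beta>, s', t') = 0" for t' using zero unfolding l_def by blast
        then show ?thesis by simp
      qed
      have "(\<integral>\<^sup>+s'. \<integral>\<^sup>+t'. ennreal (cmod (K ?x (\<beta>, s', t')) powr q) \<partial>lborel \<partial>lborel) \<le>
          (\<integral>\<^sup>+s'. ennreal ((2 * G2) powr (q - 1) * T) * indicator (cbox (s - (\<chi> i. l)) (s + (\<chi> i. l))) s' \<partial>lborel)"
        by (intro nn_integral_mono inner)
      also have "\<dots> = ennreal ((2 * G2) powr (q - 1) * T) * emeasure lborel (cbox (s - (\<chi> i. l)) (s + (\<chi> i. l)))"
        by (rule nn_integral_cmult_indicator) simp
      also have "emeasure lborel (cbox (s - (\<chi> i. l)) (s + (\<chi> i. l))) = ennreal ((2 * l) ^ CARD('n))"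
      proof -
        have "(s - (\<chi> i. l)) \<bullet> e \<le> (s + (\<chi> i. l)) \<bullet> e" if "e \<in> Basis" for e
          using that l0 by (auto simp: Basis_vec_def inner_axis)
        then have "emeasure lborel (cbox (s - (\<chi> i. l)) (s + (\<chi> i. l))) = ennreal (\<Prod>e\<in>Basis. ((s + (\<chi> i. l)) - (s - (\<chi> i. l))) \<bullet> e)"
          by (rule emeasure_lborel_cbox)
        also have "(\<Prod>e\<in>Basis. ((s + (\<chi> i. l)) - (s - (\<chi> i. l))) \<bullet> e) = (2 * l) ^ CARD('n)"
          unfolding prod_Basis_vec by (simp add: inner_axis)
        finally show ?thesis .
      qed
      also have "ennreal ((2 * G2) powr (q - 1) * T) * ennreal ((2 * l) ^ CARD('n)) \<le>
          ennreal ((2 * G2) powr (q - 1) * (\<rho> powr (- ?\<kappa> / 2) * ?a powr ?\<kappa> * G1\<^sup>2) * (2 * l) ^ CARD('n))"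
        using l0 T by (subst ennreal_mult'' [symmetric]) (auto intro!: ennreal_leI mult_right_mono mult_left_mono)
      also have "(2 * G2) powr (q - 1) * (\<rho> powr (- ?\<kappa> / 2) * ?a powr ?\<kappa> * G1\<^sup>2) * (2 * l) ^ CARD('n) = C * (?a powr ?\<kappa> * (?a powr (1 - (1 / real CARD('n option)))) ^ CARD('n))"
        by (simp add: C_def shear_vol_def l_def power_mult_distrib)
      also have "?a powr ?\<kappa> * (?a powr (1 - (1 / real CARD('n option)))) ^ CARD('n) = ?a powr CARD('n option)"
      proof -
        have "(?a powr (1 - (1 / real CARD('n option)))) ^ CARD('n) = ?a powr ((1 - (1 / real CARD('n option))) * CARD('n))"
          using a by (simp add: powr_powr flip: powr_realpow)
        moreover have "?\<kappa> + (1 - (1 / real CARD('n option))) * CARD('n) = CARD('n option)"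
        proof -
          have "(2 - 1 / D) + (1 - 1 / D) * (D - 1) = D" if "D \<noteq> 0" for D :: real
            using that by (simp add: algebra_simps diff_divide_distrib)
          from this[of "real CARD('n option)"] show ?thesis by simp
        qed
        ultimately show ?thesis by (simp only: powr_add[symmetric])
      qed
      finally show ?thesis using True by simp
    qed
  qed
qed

section \<open>Interactions of two low-pass elements\<close>

definition \<chi>\<^sub>0 :: "real ^ 'n \<Rightarrow> real" where
  "\<chi>\<^sub>0 \<eta> = sqrt (\<integral>\<omega>. (cmod (fourier \<Psi> (vcons \<omega> \<eta>)))\<^sup>2 / \<bar>\<omega>\<bar> ^ CARD('n option) \<partial>lborel)"

text \<open>Here the integral defining \<open>\<Phi>\<close> extends over the whole support of the Fourier transform of \<open>\<Psi>\<close>.\<close>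

lemma \<Phi>_low_frequency:
  assumes "\<bar>\<xi> $ None\<bar> < a0"
  shows "fourier \<Phi> \<xi> = of_real ((\<xi> $ None) ^ m * \<chi>\<^sub>0 (vtail \<xi>))"
proof -
  have "(indicator (- {- \<bar>\<xi> $ None\<bar>..\<bar>\<xi> $ None\<bar>}) \<omega>1 *\<^sub>R ((cmod (fourier \<Psi> (vcons \<omega>1 (vtail \<xi>))))\<^sup>2 / \<bar>\<omega>1\<bar> ^ CARD('n option)) :: real) =
      (cmod (fourier \<Psi> (vcons \<omega>1 (vtail \<xi>))))\<^sup>2 / \<bar>\<omega>1\<bar> ^ CARD('n option)" for \<omega>1
  proof (cases "fourier \<Psi> (vcons \<omega>1 (vtail \<xi>)) = 0")
    case False
    then have "\<bar>\<omega>1\<bar> \<ge> a0" using \<Psi>_support(1) by force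
    then have "\<omega>1 \<notin> {- \<bar>\<xi> $ None\<bar>..\<bar>\<xi> $ None\<bar>}" using assms by auto
    then show ?thesis by simp
  qed simp
  then show ?thesis
    unfolding fourier_\<Phi> \<chi>\<^sub>0_def m_def set_lebesgue_integral_def by (simp only:)
qed

text \<open>The integral under the root stays bounded because the transform of \<Psi> is bounded and
  vanishes unless a0 \<le> |\<omega>1| \<le> a1. The prefactor then gives a bound of order m at all
  frequencies at once.\<close>

lemma \<Phi>_bound:
  obtains M where "M \<ge> 0" "\<And>\<xi>. cmod (fourier \<Phi> \<xi>) \<le> M * \<bar>\<xi> $ None\<bar> ^ m"
proof -
  define c where "c = G1\<^sup>2 / a0 ^ CARD('n option)"
  have c: "c \<ge> 0" using a0_pos by (simp add: c_def)
  have pt: "(indicator (- {- \<bar>\<xi> $ None\<bar>..\<bar>\<xi> $ None\<bar>}) \<omega>1 *\<^sub>R ((cmod (fourier \<Psi> (vcons \<omega>1 (vtail \<xi>))))\<^sup>2 / \<bar>\<omega>1\<bar> ^ CARD('n option)) :: real)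
      \<le> c * indicator {-a1..a1} \<omega>1" for \<xi> \<omega>1
  proof (cases "fourier \<Psi> (vcons \<omega>1 (vtail \<xi>)) = 0")
    case True
    have "0 \<le> c * indicator {-a1..a1} \<omega>1" using c by simp
    then show ?thesis using True by simp
  next
    case False
    then have w: "a0 \<le> \<bar>\<omega>1\<bar>" "\<bar>\<omega>1\<bar> \<le> a1" using \<Psi>_support[OF False] by auto
    have "(cmod (fourier \<Psi> (vcons \<omega>1 (vtail \<xi>))))\<^sup>2 / \<bar>\<omega>1\<bar> ^ CARD('n option) \<le> c"
      unfolding c_def
    proof (intro frac_le power_mono)
      show "cmod (fourier \<Psi> (vcons \<omega>1 (vtail \<xi>))) \<le> G1"
        using fourier_generator_le[of 0] by (simp add: generator_def)
    qed (use a0_pos w in auto)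
    then show ?thesis using w c by (auto simp: indicator_def)
  qed
  show ?thesis
  proof (rule that[of "sqrt (c * (2 * a1))"])
    show "0 \<le> sqrt (c * (2 * a1))" using c a1_pos by simp
    fix \<xi> :: "real ^ 'n option"
    let ?I = "LINT \<omega>1:(- {- \<bar>\<xi> $ None\<bar>..\<bar>\<xi> $ None\<bar>})|lborel. (cmod (fourier \<Psi> (vcons \<omega>1 (vtail \<xi>))))\<^sup>2 / \<bar>\<omega>1\<bar> ^ CARD('n option)"
    have "?I \<le> (\<integral>\<omega>1. c * indicator {-a1..a1} \<omega>1 \<partial>lborel)"
      unfolding set_lebesgue_integral_def
    proof (rule integral_mono'[OF _ pt])
      show "integrable lborel (\<lambda>\<omega>1. c * indicator {- a1..a1} \<omega>1)"
        by (intro integrable_mult_right integrable_real_indicator) (auto simp: emeasure_lborel_Icc_eq)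
      show "0 \<le> c * indicator {- a1..a1} \<omega>1" for \<omega>1 using c by simp
    qed
    also have "\<dots> = c * (2 * a1)" using a1_pos by simp
    finally have I: "?I \<le> c * (2 * a1)" .
    have "0 \<le> ?I" unfolding set_lebesgue_integral_def by (intro integral_nonneg_AE AE_I2) auto
    then have "cmod (fourier \<Phi> \<xi>) = \<bar>\<xi> $ None\<bar> ^ m * sqrt ?I"
      unfolding fourier_\<Phi> m_def[symmetric] norm_of_real abs_mult by (simp add: power_abs)
    also have "\<dots> \<le> \<bar>\<xi> $ None\<bar> ^ m * sqrt (c * (2 * a1))"
      using I by (intro mult_left_mono real_sqrt_le_mono) auto
    finally show "cmod (fourier \<Phi> \<xi>) \<le> sqrt (c * (2 * a1)) * \<bar>\<xi> $ None\<bar> ^ m" by (simp add: mult.commute)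
  qed
qed

definition shear_cutoff :: real where "shear_cutoff = 2 * (\<Sum>i\<in>UNIV. b $ i)"

lemma shear_cutoff_pos: "shear_cutoff > 0" using sum_b_pos by (simp add: shear_cutoff_def)

lemma shear_freq_infty: "shear_freq \<infinity> s \<omega> = vcons (\<omega> $ None) (vtail \<omega> + (\<omega> $ None) *\<^sub>R s)"
  by (simp add: shear_freq_def)

lemma infty_scale: "\<infinity> \<in> scales" by (simp add: scales_def)

text \<open>The difference of the two sheared tail frequencies is the first frequency times s' - s,
  and each coordinate of it is at most twice the side of the box. The l_1 norm dominates the
  Euclidean one, hence the sum in \<open>shear_cutoff\<close>.\<close>

lemma frequency_le:
  assumes "\<And>j. \<bar>\<omega> $ Some j + \<omega> $ None * s $ j\<bar> \<le> b $ j" "\<And>j. \<bar>\<omega> $ Some j + \<omega> $ None * s' $ j\<bar> \<le> b $ j"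
  shows "\<bar>\<omega> $ None\<bar> * norm (s' - s) \<le> shear_cutoff"
proof -
  have "\<bar>\<omega> $ None\<bar> * norm (s' - s) \<le> \<bar>\<omega> $ None\<bar> * (\<Sum>j\<in>UNIV. \<bar>(s' - s) $ j\<bar>)"
    by (intro mult_left_mono norm_le_l1_cart) auto
  also have "\<dots> = (\<Sum>j\<in>UNIV. \<bar>\<omega> $ None * (s' - s) $ j\<bar>)" by (simp add: sum_distrib_left abs_mult)
  also have "\<dots> \<le> (\<Sum>j\<in>UNIV. 2 * b $ j)"
  proof (rule sum_mono)
    fix j
    have "\<omega> $ None * (s' - s) $ j = (\<omega> $ Some j + \<omega> $ None * s' $ j) - (\<omega> $ Some j + \<omega> $ None * s $ j)"
      by (simp add: algebra_simps)
    then show "\<bar>\<omega> $ None * (s' - s) $ j\<bar> \<le> 2 * b $ j" using assms(1)[of j] assms(2)[of j] by linarith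
  qed
  also have "\<dots> = shear_cutoff" by (simp add: shear_cutoff_def sum_distrib_left)
  finally show ?thesis .
qed

text \<open>A common frequency has |\<omega>_1| \<le> \<open>shear_cutoff\<close> / |s' - s|. Two
  zeros of order m contribute |s' - s|^(-2m) and the width of the slab one more power, while for
  fixed first frequency the tail stays in a translate of the box. As 2m + 1 = d, the decay is |s' -
  s|^(-d).\<close>

lemma low_pass_sup:
  obtains C where "C \<ge> 0"
    "\<And>s t s' t'. s' \<noteq> s \<Longrightarrow> cmod (K (\<infinity>, s, t) (\<infinity>, s', t')) \<le> C * norm (s' - s) powr (- real CARD('n option))"
proof -
  obtain M where M: "M \<ge> 0" "\<And>\<xi>. cmod (fourier \<Phi> \<xi>) \<le> M * \<bar>\<xi> $ None\<bar> ^ m" using \<Phi>_bound by blast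
  define V where "V = (\<Prod>e\<in>Basis. (2 *\<^sub>R b) \<bullet> e)"
  have be: "- b \<bullet> e \<le> b \<bullet> e" if "e \<in> Basis" for e
    using that b_pos by (auto simp: Basis_vec_def inner_axis intro: less_imp_le)
  have V: "emeasure lborel (cbox (- b) b) = ennreal V"
    using emeasure_lborel_cbox[OF be] by (simp add: V_def scaleR_2)
  have V0: "V \<ge> 0" unfolding V_def using b_pos
    by (intro prod_nonneg) (auto simp: Basis_vec_def inner_axis intro: less_imp_le)
  show ?thesis
  proof (rule that[of "M\<^sup>2 * shear_cutoff ^ CARD('n) * V * (2 * shear_cutoff)"])
    show "0 \<le> M\<^sup>2 * shear_cutoff ^ CARD('n) * V * (2 * shear_cutoff)" using V0 shear_cutoff_pos by simp
    fix s s' :: "real ^ 'n" and t t' :: "real ^ 'n option"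
    assume ne: "s' \<noteq> s"
    let ?u = "norm (s' - s)"
    have u: "?u > 0" using ne by simp
    define h where "h \<omega> = fourier (\<psi> (\<infinity>, s, t)) \<omega> * cnj (fourier (\<psi> (\<infinity>, s', t')) \<omega>)" for \<omega>
    define Q where "Q = M\<^sup>2 * (shear_cutoff / ?u) ^ CARD('n)"
    have Q: "Q \<ge> 0" unfolding Q_def using shear_cutoff_pos by simp
    have xy: "(\<infinity>, s, t) \<in> param_space" "(\<infinity>, s', t') \<in> param_space" by (auto simp: param_space_scales infty_scale)
    have pt: "ennreal (cmod (h \<omega>)) \<le> ennreal Q * (indicator {- (shear_cutoff / ?u)..shear_cutoff / ?u} (\<omega> $ None) * indicator (cbox (- b) b) (vtail \<omega> + (\<omega> $ None) *\<^sub>R s))" for \<omega>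
    proof (cases "h \<omega> = 0")
      case False
      then have nz: "fourier (\<psi> (\<infinity>, s, t)) \<omega> \<noteq> 0" "fourier (\<psi> (\<infinity>, s', t')) \<omega> \<noteq> 0" by (auto simp: h_def)
      have 1: "\<bar>\<omega> $ Some j + \<omega> $ None * s $ j\<bar> \<le> b $ j" "\<bar>\<omega> $ Some j + \<omega> $ None * s' $ j\<bar> \<le> b $ j" for j
        using fourier_\<psi>_support(3)[OF infty_scale nz(1), of j] fourier_\<psi>_support(3)[OF infty_scale nz(2), of j] by auto
      have w: "\<bar>\<omega> $ None\<bar> \<le> shear_cutoff / ?u" using frequency_le[OF 1] u by (simp add: field_simps)
      have f: "cmod (fourier (\<psi> (\<infinity>, s, t)) \<omega>) \<le> M * (shear_cutoff / ?u) ^ m" for s t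
      proof -
        have "cmod (fourier (\<psi> (\<infinity>, s, t)) \<omega>) \<le> M * \<bar>\<omega> $ None\<bar> ^ m"
          using M(2)[of "shear_freq \<infinity> s \<omega>"] by (simp add: fourier_\<psi>[OF infty_scale] norm_mult shear_freq_infty)
        also have "\<dots> \<le> M * (shear_cutoff / ?u) ^ m" using w M(1) by (intro mult_left_mono power_mono) auto
        finally show ?thesis .
      qed
      have "cmod (h \<omega>) \<le> (M * (shear_cutoff / ?u) ^ m) * (M * (shear_cutoff / ?u) ^ m)"
        unfolding h_def norm_mult complex_mod_cnj using M(1) shear_cutoff_pos by (intro mult_mono f) auto
      also have "\<dots> = Q" unfolding Q_def CARD_n by (simp add: power2_eq_square power_mult flip: power_mult_distrib power_add mult_2)
      finally have "cmod (h \<omega>) \<le> Q" .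
      moreover have "vtail \<omega> + (\<omega> $ None) *\<^sub>R s \<in> cbox (- b) b"
      proof -
        have "- b $ j \<le> \<omega> $ Some j + \<omega> $ None * s $ j" "\<omega> $ Some j + \<omega> $ None * s $ j \<le> b $ j" for j
          using 1(1)[of j] unfolding abs_le_iff by linarith+
        then show ?thesis by (simp add: mem_box_cart)
      qed
      moreover have "\<omega> $ None \<in> {- (shear_cutoff / ?u)..shear_cutoff / ?u}" using w by (simp add: abs_le_iff minus_le_iff)
      ultimately show ?thesis by (simp add: ennreal_leI)
    qed simp
    have "ennreal (cmod (K (\<infinity>, s, t) (\<infinity>, s', t'))) \<le> (\<integral>\<^sup>+\<omega>. ennreal (cmod (h \<omega>)) \<partial>lborel)"
    proof (cases "integrable lborel h")
      case True
      then show ?thesis unfolding K_parseval[OF xy] h_def[symmetric] by (rule integral_norm_bound_ennreal)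
    next
      case False
      then show ?thesis unfolding K_parseval[OF xy] h_def[symmetric] by (simp add: not_integrable_integral_eq)
    qed
    also have "\<dots> \<le> (\<integral>\<^sup>+\<omega>. ennreal Q * (indicator {- (shear_cutoff / ?u)..shear_cutoff / ?u} (\<omega> $ None) * indicator (cbox (- b) b) (vtail \<omega> + (\<omega> $ None) *\<^sub>R s)) \<partial>lborel)"
      by (intro nn_integral_mono pt)
    also have "\<dots> = ennreal Q * (\<integral>\<^sup>+\<omega>. indicator {- (shear_cutoff / ?u)..shear_cutoff / ?u} (\<omega> $ None) * indicator (cbox (- b) b) (vtail \<omega> + (\<omega> $ None) *\<^sub>R s) \<partial>lborel)"
      by (rule nn_integral_cmult) measurable
    also have "(\<integral>\<^sup>+\<omega>. indicator {- (shear_cutoff / ?u)..shear_cutoff / ?u} (\<omega> $ None) * indicator (cbox (- b) b) (vtail \<omega> + (\<omega> $ None) *\<^sub>R s) \<partial>lborel) =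
        (\<integral>\<^sup>+a. \<integral>\<^sup>+v. indicator {- (shear_cutoff / ?u)..shear_cutoff / ?u} a * indicator (cbox (- b) b) (a *\<^sub>R s + 1 *\<^sub>R v) \<partial>lborel \<partial>lborel)"
      by (subst nn_integral_vcons(1)) (auto simp: add.commute)
    also have "\<dots> = (\<integral>\<^sup>+a. ennreal V * indicator {- (shear_cutoff / ?u)..shear_cutoff / ?u} a \<partial>lborel)"
    proof (intro nn_integral_cong)
      fix a :: real
      have "(\<integral>\<^sup>+v. indicator (cbox (- b) b) (a *\<^sub>R s + 1 *\<^sub>R v) \<partial>lborel) = ennreal V"
        by (subst nn_integral_lborel_affine) (auto simp: V)
      then show "(\<integral>\<^sup>+v. indicator {- (shear_cutoff / ?u)..shear_cutoff / ?u} a * indicator (cbox (- b) b) (a *\<^sub>R s + 1 *\<^sub>R v) \<partial>lborel) = ennreal V * indicator {- (shear_cutoff / ?u)..shear_cutoff / ?u} a"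
        by (subst nn_integral_cmult) (auto simp: mult.commute)
    qed
    also have "\<dots> = ennreal V * emeasure lborel {- (shear_cutoff / ?u)..shear_cutoff / ?u}" by (rule nn_integral_cmult_indicator) simp
    also have "emeasure lborel {- (shear_cutoff / ?u)..shear_cutoff / ?u} = ennreal (2 * (shear_cutoff / ?u))"
    proof -
      have "- (shear_cutoff / ?u) \<le> shear_cutoff / ?u" using shear_cutoff_pos by simp
      from emeasure_lborel_Icc[OF this] show ?thesis by (simp only: diff_minus_eq_add mult_2)
    qed
    also have "ennreal Q * (ennreal V * ennreal (2 * (shear_cutoff / ?u))) = ennreal (Q * (V * (2 * (shear_cutoff / ?u))))"
      using Q V0 shear_cutoff_pos by (simp flip: ennreal_mult)
    finally have "cmod (K (\<infinity>, s, t) (\<infinity>, s', t')) \<le> Q * (V * (2 * (shear_cutoff / ?u)))"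
      using Q V0 shear_cutoff_pos by (subst (asm) ennreal_le_iff) auto
    also have "\<dots> = M\<^sup>2 * shear_cutoff ^ CARD('n) * V * (2 * shear_cutoff) * ?u powr (- real CARD('n option))"
    proof -
      have "?u powr (- real CARD('n option)) = 1 / (?u ^ CARD('n) * ?u)"
        unfolding powr_minus_divide powr_realpow[OF u] CARD_option power_add power_one_right ..
      then show ?thesis unfolding Q_def by (simp add: power_divide)
    qed
    finally show "cmod (K (\<infinity>, s, t) (\<infinity>, s', t')) \<le> M\<^sup>2 * shear_cutoff ^ CARD('n) * V * (2 * shear_cutoff) * ?u powr (- real CARD('n option))" .
  qed
qed

text \<open>
  For distant shears only small first frequencies matter, where \<open>\<Phi>\<close> may be replaced by a
  tensor product of dilated slices of \<open>\<Phi>\<close>, whose \<open>L\<^sub>1\<close> norm is small.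
\<close>

lemma low_pass_norm1:
  obtains C u0 where "C \<ge> 0" "u0 > 0"
    "\<And>s t s'. norm (s' - s) \<ge> u0 \<Longrightarrow> (\<integral>t'. cmod (K (\<infinity>, s, t) (\<infinity>, s', t')) \<partial>lborel) \<le> C * norm (s' - s) powr (- real CARD('n))"
proof -
  \<comment> \<open>For shears at least this far apart a common frequency satisfies |\<omega>_1|
    \<le> a0 / 2, which lies in the range where the transform of \<Phi> is a product.\<close>
  define u0 where "u0 = 2 * shear_cutoff / a0"
  have u0: "u0 > 0" using shear_cutoff_pos a0_pos by (simp add: u0_def)
  define c where "c = a0 / 2"
  have c: "0 < c" "\<bar>c\<bar> < a0" using a0_pos by (auto simp: c_def)
  have xm: "(\<infinity>, s, t) \<in> param_space" for s and t :: "real ^ 'n option" by (simp add: param_space_scales infty_scale)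
  show ?thesis
  \<comment> \<open>If the profile vanishes identically, so does the transform of \<Phi> below a0,
    and distant low-pass elements are orthogonal. Otherwise a point with nonzero profile normalises
    the tensor product.\<close>
  proof (cases "\<forall>\<eta>. \<chi>\<^sub>0 \<eta> = 0")
    case True
    show ?thesis
    proof (rule that[of 0 u0])
      fix s s' :: "real ^ 'n" and t :: "real ^ 'n option"
      assume u: "norm (s' - s) \<ge> u0"
      have "K (\<infinity>, s, t) (\<infinity>, s', t') = 0" for t'
      proof (rule ccontr)
        assume "K (\<infinity>, s, t) (\<infinity>, s', t') \<noteq> 0"
        then obtain \<omega> where nz: "fourier (\<psi> (\<infinity>, s, t)) \<omega> \<noteq> 0" "fourier (\<psi> (\<infinity>, s', t')) \<omega> \<noteq> 0"
          using K_nonzero_frequency[OF xm xm] by blast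
        have 1: "\<bar>\<omega> $ Some j + \<omega> $ None * s $ j\<bar> \<le> b $ j" "\<bar>\<omega> $ Some j + \<omega> $ None * s' $ j\<bar> \<le> b $ j" for j
          using fourier_\<psi>_support(3)[OF infty_scale nz(1), of j] fourier_\<psi>_support(3)[OF infty_scale nz(2), of j] by auto
        have "\<bar>\<omega> $ None\<bar> * u0 \<le> \<bar>\<omega> $ None\<bar> * norm (s' - s)" using u by (rule mult_left_mono) simp
        also have "\<dots> \<le> shear_cutoff" by (rule frequency_le[OF 1])
        finally have "2 * \<bar>\<omega> $ None\<bar> \<le> a0" using shear_cutoff_pos a0_pos unfolding u0_def by (simp add: field_simps)
        then have "\<bar>shear_freq \<infinity> s \<omega> $ None\<bar> < a0" using a0_pos by (simp add: shear_freq_infty)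
        from \<Phi>_low_frequency[OF this] have "fourier (\<psi> (\<infinity>, s, t)) \<omega> = 0"
          using True by (simp add: fourier_\<psi>[OF infty_scale])
        then show False using nz by simp
      qed
      then show "(\<integral>t'. cmod (K (\<infinity>, s, t) (\<infinity>, s', t')) \<partial>lborel) \<le> 0 * norm (s' - s) powr (- real CARD('n))" by simp
    qed (use u0 in auto)
  next
    case False
    then obtain \<eta>0 where \<eta>0: "\<chi>\<^sub>0 \<eta>0 \<noteq> 0" by blast
    obtain X :: "real ^ 'n \<Rightarrow> complex" where X: "integrable lborel X" "\<And>\<eta>. fourier X \<eta> = fourier \<Phi> (vcons c \<eta>)"
      using fourier_slice_tail[OF \<Phi>_L1] by blast
    obtain Y :: "real \<Rightarrow> complex" where Y: "integrable lborel Y" "\<And>\<omega>. fourier Y \<omega> = fourier \<Phi> (vcons \<omega> \<eta>0)"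
      using fourier_slice_first[OF \<Phi>_L1] by blast
    define k0 where "k0 = c ^ m * \<chi>\<^sub>0 \<eta>0"
    have k0: "k0 \<noteq> 0" using c \<eta>0 by (simp add: k0_def)
    define P where "P = (\<integral>x. cmod (Y x) \<partial>lborel) * (\<integral>v. cmod (X v) \<partial>lborel)"
    have P: "P \<ge> 0" by (simp add: P_def)
    show ?thesis
    proof (rule that[of "u0 ^ CARD('n) * (P / \<bar>k0\<bar>)\<^sup>2" u0])
      fix s s' :: "real ^ 'n" and t :: "real ^ 'n option"
      assume u: "norm (s' - s) \<ge> u0"
      let ?u = "norm (s' - s)"
      have up: "?u > 0" using u u0 by linarith
      \<comment> \<open>The compression adapted to the distance of the shears: l a0 is twice the
        largest possible common first frequency.\<close>
      define l where "l = u0 / ?u"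
      have l: "0 < l" "l \<le> 1" using u u0 up by (auto simp: l_def field_simps)
      define E where "E x = (of_real l * Y (l * x $ None)) * X (vtail x)" for x :: "real ^ 'n option"
      have Ei: "integrable lborel E"
        unfolding E_def by (rule integrable_tensor_option[OF integrable_dilate[OF Y(1) l(1)] X(1)])
      have EN: "(\<integral>x. cmod (E x) \<partial>lborel) = P"
        unfolding E_def integrable_norm_tensor_option[OF integrable_dilate[OF Y(1) l(1)] X(1)] norm1_dilate[OF Y(1) l(1)] P_def ..
      have EF: "fourier E \<xi> = fourier \<Phi> (vcons (\<xi> $ None / l) \<eta>0) * fourier \<Phi> (vcons c (vtail \<xi>))" for \<xi>
        unfolding E_def fourier_tensor_option[OF integrable_dilate[OF Y(1) l(1)] X(1)] fourier_dilate[OF Y(1) l(1)] X(2) Y(2) ..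
      \<comment> \<open>In the slab the transform of \<open>E\<close> is (\<xi>_1 / l)^m c^m
        \<open>\<chi>\<^sub>0 \<eta>0\<close> times the profile of the tail. The factor l^m / k0
        restores the transform of \<Phi>, and its smallness is the decay gained in L_1.\<close>
      define k where "k = l ^ m / k0"
      have low: "of_real k * fourier E \<xi> = fourier \<Phi> \<xi>" if "\<bar>\<xi> $ None\<bar> < l * a0" for \<xi>
      proof -
        have "\<bar>\<xi> $ None / l\<bar> < a0" using that l by (simp add: field_simps)
        moreover have "\<bar>\<xi> $ None\<bar> < a0"
        proof -
          have "l * a0 \<le> 1 * a0" using l a0_pos by (intro mult_right_mono) auto
          then show ?thesis using that by simp
        qed
        ultimately show ?thesis
          unfolding EF using \<Phi>_low_frequency[of "vcons (\<xi> $ None / l) \<eta>0"] \<Phi>_low_frequency[of "vcons c (vtail \<xi>)"] \<Phi>_low_frequency[of \<xi>] c l \<eta>0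
          by (simp add: k_def k0_def power_divide)
      qed
      define F where "F s t x = of_real k * E (shear_scale 1 1 s (x - t))" for s :: "real ^ 'n" and t x
      have Fi: "integrable lborel (F s t)" for s t
        unfolding F_def using integrable_shear_scale[OF _ _ Ei, of 1 1 s t] by simp
      have FN: "(\<integral>x. cmod (F s t x) \<partial>lborel) = \<bar>k\<bar> * P" for s t
      proof -
        have "integrable lborel (\<lambda>x. complex_of_real (cmod (E x)))" using Ei by simp
        from integral_shear_scale[OF _ _ this, of 1 1 s t]
        have "complex_of_real (\<integral>x. cmod (E (shear_scale 1 1 s (x - t))) \<partial>lborel) = complex_of_real P"
          by (simp add: integral_complex_of_real EN)
        then have "(\<integral>x. cmod (E (shear_scale 1 1 s (x - t))) \<partial>lborel) = P" by (simp only: of_real_eq_iff)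
        then show ?thesis by (simp add: F_def norm_mult)
      qed
      have FF: "fourier (F s t) \<omega> = wave (- (\<omega> \<bullet> t)) * (of_real k * fourier E (shear_freq \<infinity> s \<omega>))" for s t \<omega>
      proof -
        have "fourier (F s t) \<omega> = of_real k * fourier (\<lambda>x. E (shear_scale 1 1 s (x - t))) \<omega>"
          unfolding F_def fourier_wave by (simp add: mult.assoc)
        also have "\<dots> = of_real k * (wave (- (\<omega> \<bullet> t)) * fourier E (shear_scale_dual 1 1 s \<omega>))"
          using fourier_shear_scale[OF _ _ Ei, of 1 1 s t \<omega>] by simp
        also have "shear_scale_dual 1 1 s \<omega> = shear_freq \<infinity> s \<omega>"
          by (simp add: shear_scale_dual_def shear_freq_infty)
        finally show ?thesis by (simp add: mult_ac)
      qed
      have psiF: "fourier (\<psi> (\<infinity>, s, t)) \<omega> = wave (- (\<omega> \<bullet> t)) * fourier \<Phi> (shear_freq \<infinity> s \<omega>)" for s t \<omega>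
        by (simp add: fourier_\<psi>[OF infty_scale])
      \<comment> \<open>Inside the slab the factors agree one by one. Outside it both products
        vanish: \<open>E\<close> has the same tail box as \<Phi>, and the two sheared boxes cannot
        meet there.\<close>
      have eq: "fourier (\<psi> (\<infinity>, s, t)) \<omega> * cnj (fourier (\<psi> (\<infinity>, s', 0)) \<omega>) = fourier (F s t) \<omega> * cnj (fourier (F s' 0) \<omega>)" for \<omega>
      proof (cases "\<bar>\<omega> $ None\<bar> < l * a0")
        case True
        then show ?thesis unfolding FF psiF by (simp add: low shear_freq_infty)
      next
        case False
        have zero: "z (shear_freq \<infinity> s \<omega>) = 0 \<or> z (shear_freq \<infinity> s' \<omega>) = 0"
          if z: "\<And>\<xi> j. z \<xi> \<noteq> 0 \<Longrightarrow> \<bar>\<xi> $ Some j\<bar> \<le> b $ j" for z :: "real ^ 'n option \<Rightarrow> complex"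
        proof (rule ccontr)
          assume "\<not> ?thesis"
          then have "\<bar>\<omega> $ Some j + \<omega> $ None * s $ j\<bar> \<le> b $ j" "\<bar>\<omega> $ Some j + \<omega> $ None * s' $ j\<bar> \<le> b $ j" for j
            using z[of "shear_freq \<infinity> s \<omega>" j] z[of "shear_freq \<infinity> s' \<omega>" j] by (auto simp: shear_freq_infty)
          then have "\<bar>\<omega> $ None\<bar> * ?u \<le> shear_cutoff" by (rule frequency_le)
          moreover have "(l * a0) * ?u \<le> \<bar>\<omega> $ None\<bar> * ?u" using False by (intro mult_right_mono) auto
          moreover have "(l * a0) * ?u = 2 * shear_cutoff" using up a0_pos by (simp add: l_def u0_def)
          ultimately show False using shear_cutoff_pos by linarith
        qed
        have zE: "fourier E (shear_freq \<infinity> s \<omega>) = 0 \<or> fourier E (shear_freq \<infinity> s' \<omega>) = 0"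
        proof (rule zero)
          fix \<xi> j assume "fourier E \<xi> \<noteq> 0"
          then have "fourier \<Phi> (vcons c (vtail \<xi>)) \<noteq> 0" unfolding EF by auto
          from \<Phi>_support(2)[OF this, of j] show "\<bar>\<xi> $ Some j\<bar> \<le> b $ j" by simp
        qed
        have zP: "fourier \<Phi> (shear_freq \<infinity> s \<omega>) = 0 \<or> fourier \<Phi> (shear_freq \<infinity> s' \<omega>) = 0"
          by (rule zero) (rule \<Phi>_support(2))
        show ?thesis unfolding FF psiF using zE zP by auto
      qed
      have hi: "integrable lborel (\<lambda>\<omega>. fourier (\<psi> (\<infinity>, s, t)) \<omega> * cnj (fourier (\<psi> (\<infinity>, s', 0)) \<omega>))"
      proof (rule integrable_mult_bounded[OF fourier_\<psi>_integrable[OF xm]])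
        have "fourier (\<psi> (\<infinity>, s', 0)) \<in> borel_measurable borel"
          using fourier_\<psi>_integrable[OF xm] by auto
        then show "(\<lambda>\<omega>. cnj (fourier (\<psi> (\<infinity>, s', 0)) \<omega>)) \<in> borel_measurable lborel" by measurable
        show "cmod (cnj (fourier (\<psi> (\<infinity>, s', 0)) \<omega>)) \<le> sqrt (dilation_det TYPE('n) (scale_of \<infinity>)) * G1" for \<omega>
          using fourier_\<psi>_le[OF infty_scale] by simp
      qed
      have "(\<integral>t'. cmod (K (\<infinity>, s, t) (\<infinity>, s', t')) \<partial>lborel) \<le> (\<bar>k\<bar> * P) * (\<bar>k\<bar> * P)"
        unfolding K_correlation[OF infty_scale]
        using correlation_L1_transfer[OF \<psi>_L1[OF xm] \<psi>_L1[OF xm] Fi Fi eq hi] unfolding FN .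
      \<comment> \<open>Both factors contribute l^m, and 2m is the number of shear
        parameters.\<close>
      also have "\<dots> = l ^ CARD('n) * (P / \<bar>k0\<bar>)\<^sup>2"
      proof -
        have "\<bar>k\<bar> = l ^ m / \<bar>k0\<bar>" using l by (simp add: k_def)
        moreover have "l ^ CARD('n) = l ^ m * l ^ m" unfolding CARD_n by (simp add: mult_2 power_add)
        ultimately show ?thesis by (simp add: power2_eq_square)
      qed
      also have "l ^ CARD('n) = u0 ^ CARD('n) * ?u powr (- real CARD('n))"
        using up by (simp add: l_def power_divide powr_minus_divide powr_realpow)
      finally show "(\<integral>t'. cmod (K (\<infinity>, s, t) (\<infinity>, s', t')) \<partial>lborel) \<le> u0 ^ CARD('n) * (P / \<bar>k0\<bar>)\<^sup>2 * ?u powr (- real CARD('n))"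
        by (simp add: mult_ac)
    qed (use u0 in auto)
  qed
qed

lemma pair_borel_id: "(\<lambda>y. (x :: 'n param, y :: 'n param)) \<in> borel \<rightarrow>\<^sub>M borel \<Otimes>\<^sub>M borel"
  by measurable

lemma K'_measurable1 [measurable]: "K' x \<in> borel_measurable borel"
  using measurable_compose[OF pair_borel_id K'_measurable] by simp

lemma K'_measurable2 [measurable]: "(\<lambda>y. K' y x) \<in> borel_measurable borel"
proof -
  have "(\<lambda>y. (y :: 'n param, x)) \<in> borel \<rightarrow>\<^sub>M borel \<Otimes>\<^sub>M borel" by measurable
  from measurable_compose[OF this K'_measurable] show ?thesis by simp
qed

text \<open>The supremum to the power q - 1 times the L_1 norm decays like |s' - s|^(-d(q-1)-(d-1));
  the surplus \<delta> = d(q - 1) over the dimension d - 1 is positive because q > 1. Close shears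
  are covered by the uniform bounds.\<close>

lemma low_pass_kernel_bound:
  assumes q: "q > 1"
  obtains C where "C \<ge> 0"
    "\<And>s t. (\<integral>\<^sup>+s'. \<integral>\<^sup>+t'. ennreal (cmod (K (\<infinity>, s, t) (\<infinity>, s', t')) powr q) \<partial>lborel \<partial>lborel) \<le> ennreal C"
proof -
  obtain CS where CS: "CS \<ge> 0" "\<And>s t s' t'. s' \<noteq> s \<Longrightarrow> cmod (K (\<infinity>, s, t) (\<infinity>, s', t')) \<le> CS * norm (s' - s) powr (- real CARD('n option))"
    using low_pass_sup by blast
  obtain CT u0 where CT: "CT \<ge> 0" "u0 > 0"
    "\<And>s t s'. norm (s' - s) \<ge> u0 \<Longrightarrow> (\<integral>t'. cmod (K (\<infinity>, s, t) (\<infinity>, s', t')) \<partial>lborel) \<le> CT * norm (s' - s) powr (- real CARD('n))"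
    using low_pass_norm1 by blast
  define \<delta> where "\<delta> = CARD('n option) * (q - 1)"
  have \<delta>: "\<delta> > 0" using q by (simp add: \<delta>_def)
  define u1 where "u1 = max 1 u0"
  have u1: "u1 \<ge> 1" "u1 \<ge> u0" by (auto simp: u1_def)
  obtain B where B: "B \<ge> 0" "\<And>f s C. C \<ge> 0 \<Longrightarrow> f \<in> borel_measurable borel \<Longrightarrow> (\<And>u. f u \<le> ennreal C) \<Longrightarrow>
      (\<And>u. norm (u - s) \<ge> u1 \<Longrightarrow> f u \<le> ennreal (C * norm (u - s) powr (- (DIM(real ^ 'n) + \<delta>)))) \<Longrightarrow>
      (\<integral>\<^sup>+(u :: real ^ 'n). f u \<partial>lborel) \<le> ennreal (C * B)"
    using nn_integral_bounded_decay[OF \<delta> u1(1), where ?'a="real ^ 'n"] by blast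
  define C where "C = max ((2 * G2) powr (q - 1) * G1\<^sup>2) (CS powr (q - 1) * CT)"
  have C: "C \<ge> 0" "(2 * G2) powr (q - 1) * G1\<^sup>2 \<le> C" "CS powr (q - 1) * CT \<le> C"
    by (auto simp: C_def le_max_iff_disj)
  show ?thesis
  proof (rule that[of "C * B"])
    show "0 \<le> C * B" using C B by simp
    fix s :: "real ^ 'n" and t :: "real ^ 'n option"
    have x: "(\<infinity>, s, t) \<in> param_space" for s :: "real ^ 'n" and t :: "real ^ 'n option"
      by (simp add: param_space_scales infty_scale)
    let ?f = "\<lambda>s'. \<integral>\<^sup>+t'. ennreal (cmod (K (\<infinity>, s, t) (\<infinity>, s', t')) powr q) \<partial>lborel"
    show "(\<integral>\<^sup>+s'. ?f s' \<partial>lborel) \<le> ennreal (C * B)"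
    proof (rule B(2)[OF C(1)])
      have "(\<lambda>s'. \<integral>\<^sup>+t'. ennreal (cmod (K' (\<infinity>, s, t) (\<infinity>, fst (s', t'), snd (s', t'))) powr q) \<partial>lborel) \<in> borel_measurable borel"
        by measurable
      then show "?f \<in> borel_measurable borel" by (simp add: K'_eq x)
      fix s' :: "real ^ 'n"
      have "?f s' \<le> ennreal ((2 * G2) powr (q - 1) *
          (sqrt (dilation_det TYPE('n) (scale_of \<infinity>)) * sqrt (dilation_det TYPE('n) (scale_of \<infinity>)) * G1\<^sup>2))"
        by (rule translation_integral_le[OF x infty_scale q _ K_bounded[OF x x] K_norm1_le[OF refl infty_scale infty_scale]])
           (use G2_nonneg in simp)
      then have "?f s' \<le> ennreal ((2 * G2) powr (q - 1) * G1\<^sup>2)" by simp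
      also have "\<dots> \<le> ennreal C" using C by (intro ennreal_leI)
      finally show "?f s' \<le> ennreal C" .
      assume u: "norm (s' - s) \<ge> u1"
      let ?u = "norm (s' - s)"
      have up: "?u > 0" "?u \<ge> u0" using u u1 by auto
      then have ne: "s' \<noteq> s" by auto
      have "?f s' \<le> ennreal ((CS * ?u powr (- real CARD('n option))) powr (q - 1) * (CT * ?u powr (- real CARD('n))))"
        using CS(1) by (intro translation_integral_le[OF x infty_scale q _ CS(2)[OF ne] CT(3)[OF up(2)]]) auto
      also have "(CS * ?u powr (- real CARD('n option))) powr (q - 1) * (CT * ?u powr (- real CARD('n))) = CS powr (q - 1) * CT * ?u powr (- (DIM(real ^ 'n) + \<delta>))"
      proof -
        have "(?u powr (- real CARD('n option))) powr (q - 1) * ?u powr (- real CARD('n)) = ?u powr (- (DIM(real ^ 'n) + \<delta>))"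
          by (simp add: powr_powr \<delta>_def algebra_simps flip: powr_add)
        then show ?thesis by (simp only: powr_mult mult_ac)
      qed
      also have "ennreal \<dots> \<le> ennreal (C * ?u powr (- (DIM(real ^ 'n) + \<delta>)))"
        using C(3) by (intro ennreal_leI mult_right_mono) auto
      finally show "?f s' \<le> ennreal (C * ?u powr (- (DIM(real ^ 'n) + \<delta>)))" .
    qed
  qed
qed

lemma nn_integral_K_powr:
  assumes x: "x \<in> param_space"
  shows "(\<integral>\<^sup>+y. ennreal (cmod (K x y) powr q) \<partial>param_measure) = (\<integral>\<^sup>+y. ennreal (cmod (K' x y) powr q) \<partial>full_param_measure)"
proof -
  have "(\<integral>\<^sup>+y. ennreal (cmod (K x y) powr q) \<partial>param_measure) = (\<integral>\<^sup>+y. ennreal (cmod (K' x y) powr q) \<partial>param_measure)"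
    by (intro nn_integral_cong) (simp add: K'_eq x)
  also have "\<dots> = (\<integral>\<^sup>+y. ennreal (cmod (K' x y) powr q) \<partial>full_param_measure)"
    by (rule nn_integral_param_measure) measurable
  finally show ?thesis .
qed

text \<open>The scale integral consists of the atom at \<infinity> and a finite part. In the latter
  |\<alpha>|^d from the local bound meets at most (\<rho> |\<alpha>|)^(-(d+1)) from the density and
  an interval of length 2 |\<alpha>| / \<rho>; the scale cancels and \<open>E\<close>
  remains.\<close>

lemma K_powr_bound:
  assumes q: "q > 1"
  shows "\<exists>C\<ge>0. \<forall>x\<in>param_space. (\<integral>\<^sup>+y. ennreal (cmod (K x y) powr q) \<partial>param_measure) \<le> ennreal C"
proof -
  let ?D = "CARD('n option)"
  obtain C where C: "C \<ge> 0" "\<And>\<alpha> s t \<beta>. \<alpha> \<in> scales \<Longrightarrow> \<beta> \<in> scales \<Longrightarrow> \<alpha> \<noteq> \<infinity> \<or> \<beta> \<noteq> \<infinity> \<Longrightarrow>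
      (\<integral>\<^sup>+s'. \<integral>\<^sup>+t'. ennreal (cmod (K (\<alpha>, s, t) (\<beta>, s', t')) powr q) \<partial>lborel \<partial>lborel)
        \<le> ennreal (C * \<bar>scale_of \<alpha>\<bar> powr ?D) *
           indicator {\<beta>. \<rho> * \<bar>scale_of \<alpha>\<bar> \<le> \<bar>scale_of \<beta>\<bar> \<and> \<rho> * \<bar>scale_of \<beta>\<bar> \<le> \<bar>scale_of \<alpha>\<bar>} \<beta>"
    using local_kernel_bound[OF q] by blast
  obtain Ci where Ci: "Ci \<ge> 0"
    "\<And>s t. (\<integral>\<^sup>+s'. \<integral>\<^sup>+t'. ennreal (cmod (K (\<infinity>, s, t) (\<infinity>, s', t')) powr q) \<partial>lborel \<partial>lborel) \<le> ennreal Ci"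
    using low_pass_kernel_bound[OF q] by blast
  define E where "E = C * (1 / \<rho>) ^ (?D + 1) * (2 / \<rho>)"
  have E: "E \<ge> 0" unfolding E_def using C \<rho> by simp
  show ?thesis
  proof (intro exI[of _ "(C + Ci) + E"] conjI ballI)
    show "0 \<le> C + Ci + E" using C Ci E by simp
    fix x :: "'n param" assume x: "x \<in> param_space"
    obtain \<alpha> s t where X: "x = (\<alpha>, s, t)" and \<alpha>: "\<alpha> \<in> scales" using x by (rule param_cases)
    let ?a = "\<bar>scale_of \<alpha>\<bar>"
    have a: "?a > 0" "?a \<le> 1" using scale_of_nonzero[OF \<alpha>] abs_scale_of_le[OF \<alpha>] by auto
    define P where "P \<beta> = (\<integral>\<^sup>+s'. \<integral>\<^sup>+t'. ennreal (cmod (K' x (\<beta>, s', t')) powr q) \<partial>lborel \<partial>lborel)" for \<beta>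
    have Pm [measurable]: "P \<in> borel_measurable borel"
    proof -
      have m: "(\<lambda>z. K' x (fst (fst z), snd (fst z), snd z)) \<in> borel_measurable ((borel \<Otimes>\<^sub>M borel) \<Otimes>\<^sub>M borel)"
      proof -
        have "(\<lambda>z. (fst (fst z), snd (fst z), snd z) :: 'n param) \<in> (borel \<Otimes>\<^sub>M borel) \<Otimes>\<^sub>M borel \<rightarrow>\<^sub>M borel"
          unfolding borel_prod by (intro borel_measurable_continuous_onI continuous_intros)
        from measurable_compose[OF this K'_measurable1] show ?thesis .
      qed
      note [measurable] = m
      have "(\<lambda>\<beta>. \<integral>\<^sup>+s'. \<integral>\<^sup>+t'. ennreal (cmod (K' x (fst (fst ((\<beta>, s'), t')), snd (fst ((\<beta>, s'), t')), snd ((\<beta>, s'), t'))) powr q) \<partial>lborel \<partial>lborel) \<in> borel_measurable borel"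
        by measurable
      then show ?thesis by (simp add: P_def[abs_def])
    qed
    have P: "P \<beta> = (\<integral>\<^sup>+s'. \<integral>\<^sup>+t'. ennreal (cmod (K (\<alpha>, s, t) (\<beta>, s', t')) powr q) \<partial>lborel \<partial>lborel)" if "\<beta> \<in> scales" for \<beta>
      unfolding P_def X using \<alpha> that by (simp add: K'_eq param_space_scales)
    have "(\<integral>\<^sup>+y. ennreal (cmod (K x y) powr q) \<partial>param_measure) = (\<integral>\<^sup>+\<beta>. P \<beta> \<partial>scale_measure (?D + 1))"
      unfolding nn_integral_K_powr[OF x] P_def by (rule nn_integral_full_param_measure(2)) measurable
    also have "\<dots> = P \<infinity> + (\<integral>\<^sup>+a. P (ereal a) * ennreal (1 / \<bar>a\<bar> ^ (?D + 1)) * indicator ({-1..1} - {0}) a \<partial>lborel)"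
      by (rule nn_integral_scale_measure) measurable
    also have "\<dots> \<le> ennreal (C + Ci) + ennreal E"
    proof (rule add_mono)
      show "P \<infinity> \<le> ennreal (C + Ci)"
      proof (cases "\<alpha> = \<infinity>")
        case True
        have "P \<infinity> \<le> ennreal Ci" unfolding P[OF infty_scale] True by (rule Ci(2))
        also have "\<dots> \<le> ennreal (C + Ci)" using C by (intro ennreal_leI) simp
        finally show ?thesis .
      next
        case False
        have "P \<infinity> \<le> ennreal (C * ?a powr ?D) * indicator {\<beta>. \<rho> * ?a \<le> \<bar>scale_of \<beta>\<bar> \<and> \<rho> * \<bar>scale_of \<beta>\<bar> \<le> ?a} \<infinity>"
          unfolding P[OF infty_scale] using False by (intro C(2) \<alpha> infty_scale) auto
        also have "\<dots> \<le> ennreal (C * ?a powr ?D) * 1" by (intro mult_left_mono) (auto simp: indicator_def)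
        also have "\<dots> \<le> ennreal (C + Ci)"
        proof -
          have "C * ?a powr ?D \<le> C * 1" using C a powr_mono2[of "?D" ?a 1] by (intro mult_left_mono) auto
          then show ?thesis using Ci by (simp add: ennreal_leI)
        qed
        finally show ?thesis .
      qed
      have "(\<integral>\<^sup>+a. P (ereal a) * ennreal (1 / \<bar>a\<bar> ^ (?D + 1)) * indicator ({-1..1} - {0}) a \<partial>lborel) \<le>
          (\<integral>\<^sup>+a. ennreal (C * ?a ^ ?D * (1 / (\<rho> * ?a)) ^ (?D + 1)) * indicator {- (?a / \<rho>)..?a / \<rho>} a \<partial>lborel)"
      proof (rule nn_integral_mono)
        fix a' :: real
        show "P (ereal a') * ennreal (1 / \<bar>a'\<bar> ^ (?D + 1)) * indicator ({-1..1} - {0}) a' \<le>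
            ennreal (C * ?a ^ ?D * (1 / (\<rho> * ?a)) ^ (?D + 1)) * indicator {- (?a / \<rho>)..?a / \<rho>} a'"
        proof (cases "a' \<in> {-1..1} - {0}")
          case True
          then have s: "ereal a' \<in> scales" by (auto simp: scales_def)
          have Pb: "P (ereal a') \<le> ennreal (C * ?a powr ?D) * indicator {\<beta>. \<rho> * ?a \<le> \<bar>scale_of \<beta>\<bar> \<and> \<rho> * \<bar>scale_of \<beta>\<bar> \<le> ?a} (ereal a')"
            unfolding P[OF s] by (intro C(2) \<alpha> s) auto
          show ?thesis
          proof (cases "\<rho> * ?a \<le> \<bar>a'\<bar> \<and> \<rho> * \<bar>a'\<bar> \<le> ?a")
            case ge: True
            have ra: "\<rho> * ?a > 0" using \<rho> a by simp
            have "1 / \<bar>a'\<bar> ^ (?D + 1) \<le> (1 / (\<rho> * ?a)) ^ (?D + 1)"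
              unfolding power_one_over[symmetric] using ge ra by (intro power_mono divide_left_mono) auto
            then have "C * ?a ^ ?D * (1 / \<bar>a'\<bar> ^ (?D + 1)) \<le> C * ?a ^ ?D * (1 / (\<rho> * ?a)) ^ (?D + 1)"
              using C by (intro mult_left_mono) auto
            then have b1: "ennreal (C * ?a ^ ?D) * ennreal (1 / \<bar>a'\<bar> ^ (?D + 1)) \<le> ennreal (C * ?a ^ ?D * (1 / (\<rho> * ?a)) ^ (?D + 1))"
              by (subst ennreal_mult''[symmetric]) (auto intro!: ennreal_leI)
            have "P (ereal a') \<le> ennreal (C * ?a powr ?D)" using Pb ge by simp
            then have "P (ereal a') \<le> ennreal (C * ?a ^ ?D)" unfolding powr_realpow[OF a(1)] .
            then have "P (ereal a') * ennreal (1 / \<bar>a'\<bar> ^ (?D + 1)) \<le> ennreal (C * ?a ^ ?D) * ennreal (1 / \<bar>a'\<bar> ^ (?D + 1))"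
              by (rule mult_right_mono) simp
            from this b1 have b2: "P (ereal a') * ennreal (1 / \<bar>a'\<bar> ^ (?D + 1)) \<le> ennreal (C * ?a ^ ?D * (1 / (\<rho> * ?a)) ^ (?D + 1))"
              by (rule order_trans)
            have b3: "a' \<in> {- (?a / \<rho>)..?a / \<rho>}"
            proof -
              have "\<bar>a'\<bar> \<le> ?a / \<rho>" using ge \<rho> by (simp add: pos_le_divide_eq mult.commute)
              then show ?thesis by (simp add: abs_le_iff minus_le_iff)
            qed
            show ?thesis unfolding indicator_simps(1)[OF True] indicator_simps(1)[OF b3] mult_1_right by (rule b2)
          next
            case False
            then have "P (ereal a') = 0" using Pb by (auto simp: indicator_def)
            then show ?thesis by simp
          qed
        qed simp
      qed
      also have "\<dots> = ennreal (C * ?a ^ ?D * (1 / (\<rho> * ?a)) ^ (?D + 1)) * emeasure lborel {- (?a / \<rho>)..?a / \<rho>}"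
        by (rule nn_integral_cmult_indicator) simp
      also have "emeasure lborel {- (?a / \<rho>)..?a / \<rho>} = ennreal (2 * (?a / \<rho>))"
      proof -
        have "- (?a / \<rho>) \<le> ?a / \<rho>" using \<rho> by simp
        from emeasure_lborel_Icc[OF this] show ?thesis by (simp only: diff_minus_eq_add mult_2)
      qed
      also have "ennreal (C * ?a ^ ?D * (1 / (\<rho> * ?a)) ^ (?D + 1)) * ennreal (2 * (?a / \<rho>)) =
          ennreal (C * ?a ^ ?D * (1 / (\<rho> * ?a)) ^ (?D + 1) * (2 * (?a / \<rho>)))"
        using \<rho> by (intro ennreal_mult''[symmetric]) auto
      also have "C * ?a ^ ?D * (1 / (\<rho> * ?a)) ^ (?D + 1) * (2 * (?a / \<rho>)) = E"
        unfolding E_def using a \<rho> by (simp add: power_divide power_mult_distrib field_simps del: CARD_option card_option)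
      finally show "(\<integral>\<^sup>+a. P (ereal a) * ennreal (1 / \<bar>a\<bar> ^ (?D + 1)) * indicator ({-1..1} - {0}) a \<partial>lborel) \<le> ennreal E" .
    qed
    also have "\<dots> = ennreal (C + Ci + E)" using C Ci E by (intro ennreal_plus[symmetric]) auto
    finally show "(\<integral>\<^sup>+y. ennreal (cmod (K x y) powr q) \<partial>param_measure) \<le> ennreal (C + Ci + E)" .
  qed
qed

section \<open>The normalisation and the reproducing identity\<close>

lemma \<Phi>_in_box: "fourier \<Phi> (vcons y \<eta>) \<noteq> 0 \<Longrightarrow> \<eta> \<in> cbox (- b) b"
  and \<Psi>_in_box: "fourier \<Psi> (vcons y \<eta>) \<noteq> 0 \<Longrightarrow> \<eta> \<in> cbox (- b) b"
proof -
  assume *: "fourier \<Phi> (vcons y \<eta>) \<noteq> 0"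
  have "- b $ j \<le> \<eta> $ j" "\<eta> $ j \<le> b $ j" for j
    using \<Phi>_support(2)[OF *, of j] unfolding abs_le_iff by auto
  then show "\<eta> \<in> cbox (- b) b" by (simp add: mem_box_cart)
next
  assume *: "fourier \<Psi> (vcons y \<eta>) \<noteq> 0"
  have "- b $ j \<le> \<eta> $ j" "\<eta> $ j \<le> b $ j" for j
    using \<Psi>_support(3)[OF *, of j] unfolding abs_le_iff by auto
  then show "\<eta> \<in> cbox (- b) b" by (simp add: mem_box_cart)
qed

lemma fourier_sq_le: "(cmod (fourier \<Phi> \<xi>))\<^sup>2 \<le> G1\<^sup>2" "(cmod (fourier \<Psi> \<xi>))\<^sup>2 \<le> G1\<^sup>2"
  using fourier_generator_le[of \<infinity> \<xi>] fourier_generator_le[of 0 \<xi>]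
  by (auto simp: generator_def intro!: power_mono)

text \<open>A Bochner integral is 0 by default for a nonintegrable function, so the hypothesis
  becomes one on nonnegative integrals only after integrability is checked. All integrands are
  bounded with bounded support; the gap a0 keeps \<xi> away from the singularity at 0.\<close>

lemma normalisation_nn:
  "AE y in (lborel :: real measure).
     (\<integral>\<^sup>+\<eta>. ennreal ((cmod (fourier \<Phi> (vcons y \<eta>)))\<^sup>2 / \<bar>y\<bar> ^ CARD('n)) \<partial>lborel) +
     (\<integral>\<^sup>+\<eta>. \<integral>\<^sup>+\<xi>. ennreal ((cmod (fourier \<Psi> (vcons \<xi> \<eta>)))\<^sup>2 / \<bar>\<xi>\<bar> ^ CARD('n option)) * indicator {- \<bar>y\<bar>..\<bar>y\<bar>} \<xi> \<partial>lborel \<partial>lborel) = 1"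
  using normalisation
proof eventually_elim
  case (elim y)
  let ?f = "\<lambda>\<eta>. (cmod (fourier \<Phi> (vcons y \<eta>)))\<^sup>2 / \<bar>y\<bar> ^ CARD('n)"
  let ?g = "\<lambda>\<eta> \<xi>. indicator {- \<bar>y\<bar>..\<bar>y\<bar>} \<xi> *\<^sub>R ((cmod (fourier \<Psi> (vcons \<xi> \<eta>)))\<^sup>2 / \<bar>\<xi>\<bar> ^ CARD('n option)) :: real"
  define c where "c = G1\<^sup>2 / a0 ^ CARD('n option)"
  have c: "c \<ge> 0" using a0_pos by (simp add: c_def)
  have f: "integrable lborel ?f"
  proof (rule integrable_bounded_support[where B="G1\<^sup>2 / \<bar>y\<bar> ^ CARD('n)"])
    show "norm (?f \<eta>) \<le> G1\<^sup>2 / \<bar>y\<bar> ^ CARD('n)" for \<eta>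
      using fourier_sq_le(1) by (auto intro!: divide_right_mono)
    show "?f \<eta> \<noteq> 0 \<Longrightarrow> \<eta> \<in> cbox (- b) b" for \<eta> using \<Phi>_in_box[of y \<eta>] by auto
  qed measurable
  have g_le: "?g \<eta> \<xi> \<le> c" "?g \<eta> \<xi> \<ge> 0" for \<eta> \<xi>
  proof -
    show "?g \<eta> \<xi> \<ge> 0" by simp
    show "?g \<eta> \<xi> \<le> c"
    proof (cases "fourier \<Psi> (vcons \<xi> \<eta>) = 0")
      case False
      then have "a0 \<le> \<bar>\<xi>\<bar>" using \<Psi>_support(1)[OF False] by simp
      then have "(cmod (fourier \<Psi> (vcons \<xi> \<eta>)))\<^sup>2 / \<bar>\<xi>\<bar> ^ CARD('n option) \<le> c"
        unfolding c_def using a0_pos by (intro frac_le fourier_sq_le(2) power_mono) auto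
      then show ?thesis using c by (auto simp: indicator_def)
    qed (use c in simp)
  qed
  have g: "integrable lborel (?g \<eta>)" for \<eta>
  proof (rule integrable_bounded_support[where B=c and l="-a1" and u=a1])
    show "norm (?g \<eta> \<xi>) \<le> c" for \<xi> using g_le by simp
    show "\<xi> \<in> cbox (- a1) a1" if "?g \<eta> \<xi> \<noteq> 0" for \<xi>
    proof -
      have "fourier \<Psi> (vcons \<xi> \<eta>) \<noteq> 0" using that by auto
      from \<Psi>_support(2)[OF this] show ?thesis by (auto simp: abs_le_iff)
    qed
  qed measurable
  define I where "I \<eta> = (\<integral>\<xi>. ?g \<eta> \<xi> \<partial>lborel)" for \<eta>
  have I0: "I \<eta> \<ge> 0" for \<eta> unfolding I_def using g_le by (intro integral_nonneg_AE) auto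
  have I_le: "I \<eta> \<le> c * (2 * a1)" for \<eta>
  proof -
    have "I \<eta> \<le> (\<integral>\<xi>. c * indicator {-a1..a1} \<xi> \<partial>lborel)"
      unfolding I_def
    proof (rule integral_mono')
      show "integrable lborel (\<lambda>\<xi>. c * indicator {-a1..a1} \<xi>)"
        by (intro integrable_mult_right integrable_real_indicator) (auto simp: emeasure_lborel_Icc_eq)
      show "?g \<eta> \<xi> \<le> c * indicator {-a1..a1} \<xi>" for \<xi>
      proof (cases "\<xi> \<in> {-a1..a1}")
        case True then show ?thesis using g_le(1)[of \<xi> \<eta>] by simp
      next
        case False
        then have "\<not> \<bar>vcons \<xi> \<eta> $ None\<bar> \<le> a1" by auto
        then have "fourier \<Psi> (vcons \<xi> \<eta>) = 0" using \<Psi>_support(2)[of "vcons \<xi> \<eta>"] by blast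
        then show ?thesis using False by simp
      qed
      show "0 \<le> c * indicator {-a1..a1} \<xi>" for \<xi> using c by simp
    qed
    also have "\<dots> = c * (2 * a1)" using a1_pos by simp
    finally show ?thesis .
  qed
  have Ii: "integrable lborel I"
  proof (rule integrable_bounded_support[where B="c * (2 * a1)"])
    have "(\<lambda>\<eta>. \<integral>\<xi>. ?g \<eta> \<xi> \<partial>lborel) \<in> borel_measurable borel" by measurable
    then show "I \<in> borel_measurable borel" by (simp only: I_def[abs_def])
    show "norm (I \<eta>) \<le> c * (2 * a1)" for \<eta> using I0 I_le by simp
    show "\<eta> \<in> cbox (- b) b" if "I \<eta> \<noteq> 0" for \<eta>
    proof (rule ccontr)
      assume "\<eta> \<notin> cbox (- b) b"
      then have "fourier \<Psi> (vcons \<xi> \<eta>) = 0" for \<xi> using \<Psi>_in_box by blast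
      then show False using that by (simp add: I_def)
    qed
  qed
  have e1: "(\<integral>\<^sup>+\<eta>. ennreal (?f \<eta>) \<partial>lborel) = ennreal (\<integral>\<eta>. ?f \<eta> \<partial>lborel)"
    using f by (intro nn_integral_eq_integral) auto
  have "(\<integral>\<^sup>+\<eta>. \<integral>\<^sup>+\<xi>. ennreal ((cmod (fourier \<Psi> (vcons \<xi> \<eta>)))\<^sup>2 / \<bar>\<xi>\<bar> ^ CARD('n option)) * indicator {- \<bar>y\<bar>..\<bar>y\<bar>} \<xi> \<partial>lborel \<partial>lborel) =
      (\<integral>\<^sup>+\<eta>. \<integral>\<^sup>+\<xi>. ennreal (?g \<eta> \<xi>) \<partial>lborel \<partial>lborel)"
    by (intro nn_integral_cong) (auto simp: indicator_def)
  also have "\<dots> = (\<integral>\<^sup>+\<eta>. ennreal (I \<eta>) \<partial>lborel)"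
    unfolding I_def using g g_le by (intro nn_integral_cong nn_integral_eq_integral) auto
  also have "\<dots> = ennreal (\<integral>\<eta>. I \<eta> \<partial>lborel)"
    using Ii I0 by (intro nn_integral_eq_integral) auto
  finally have e2: "(\<integral>\<^sup>+\<eta>. \<integral>\<^sup>+\<xi>. ennreal ((cmod (fourier \<Psi> (vcons \<xi> \<eta>)))\<^sup>2 / \<bar>\<xi>\<bar> ^ CARD('n option)) * indicator {- \<bar>y\<bar>..\<bar>y\<bar>} \<xi> \<partial>lborel \<partial>lborel) =
      ennreal (\<integral>\<eta>. I \<eta> \<partial>lborel)" .
  have "(\<integral>\<eta>. ?f \<eta> \<partial>lborel) + (\<integral>\<eta>. I \<eta> \<partial>lborel) = 1"
    using elim unfolding I_def set_lebesgue_integral_def by simp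
  moreover have "(\<integral>\<eta>. ?f \<eta> \<partial>lborel) \<ge> 0" "(\<integral>\<eta>. I \<eta> \<partial>lborel) \<ge> 0"
    using I0 by (auto intro!: integral_nonneg_AE)
  ultimately show ?case
    unfolding e1 e2 by (simp flip: ennreal_plus)
qed

text \<open>The squared modulus of the transform of an untranslated element, spelled out and
  extended by 0 off the scales so that it is jointly measurable in parameter and frequency.\<close>

definition freq_weight :: "ereal \<times> (real ^ 'n) \<Rightarrow> real ^ 'n option \<Rightarrow> real" where
  "freq_weight q \<omega> = (if fst q \<in> scales then dilation_det TYPE('n) (scale_of (fst q)) *
     (if fst q = \<infinity> then (cmod (fourier \<Phi> (shear_freq (fst q) (snd q) \<omega>)))\<^sup>2
      else (cmod (fourier \<Psi> (shear_freq (fst q) (snd q) \<omega>)))\<^sup>2) else 0)"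

lemma freq_weight_nonneg: "freq_weight q \<omega> \<ge> 0"
  by (auto simp: freq_weight_def intro!: mult_nonneg_nonneg less_imp_le[OF dilation_det_pos] scale_of_nonzero)

lemma freq_weight_measurable: "(\<lambda>(q, \<omega>). freq_weight q \<omega>) \<in> borel_measurable (scale_shear_measure \<Otimes>\<^sub>M lborel)"
  unfolding freq_weight_def case_prod_unfold dilation_det_def by measurable

lemma freq_weight_eq:
  assumes "\<beta> \<in> scales"
  shows "freq_weight (\<beta>, s) \<omega> = (cmod (fourier (\<psi> (\<beta>, s, 0)) \<omega>))\<^sup>2"
proof -
  have "dilation_det TYPE('n) (scale_of \<beta>) > 0" by (rule dilation_det_pos[OF scale_of_nonzero[OF assms]])
  then show ?thesis using assms
    by (auto simp: freq_weight_def fourier_\<psi>[OF assms] norm_mult power_mult_distrib generator_def)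
qed

text \<open>The Calderon condition of the frame. An affine substitution in the shear produces the
  integral over the tail frequency, and \<xi> = a \<omega>_1 turns the scales |a| \<le> 1 into
  |\<xi>| \<le> |\<omega>_1|; the result is the normalisation at y = \<omega>_1.\<close>

lemma freq_weight_integral: "AE \<omega> in lborel. (\<integral>\<^sup>+q. ennreal (freq_weight q \<omega>) \<partial>scale_shear_measure) = 1"
proof -
  have ne: "AE \<omega> in (lborel :: (real ^ 'n option) measure). \<omega> $ None \<noteq> 0"
    by (rule AE_lborel_first) (rule AE_lborel_singleton)
  show ?thesis
    using AE_lborel_first[OF normalisation_nn] ne
  proof eventually_elim
    case (elim \<omega>)
    let ?w = "\<omega> $ None" and ?n = "CARD('n)" and ?D = "CARD('n option)"
    have w: "?w \<noteq> 0" using elim by simp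
    note freq_weight_measurable[measurable]
    have m1 [measurable]: "(\<lambda>q. freq_weight q \<omega>) \<in> borel_measurable scale_shear_measure"
    proof -
      have "(\<lambda>q. (q, \<omega>)) \<in> scale_shear_measure \<rightarrow>\<^sub>M scale_shear_measure \<Otimes>\<^sub>M lborel" by measurable
      from measurable_compose[OF this freq_weight_measurable] show ?thesis by simp
    qed
    define W where "W \<beta> = (\<integral>\<^sup>+s. ennreal (freq_weight (\<beta>, s) \<omega>) \<partial>lborel)" for \<beta>
    have Wm [measurable]: "W \<in> borel_measurable borel"
    proof -
      have "(\<lambda>\<beta>. \<integral>\<^sup>+s. ennreal (freq_weight (\<beta>, s) \<omega>) \<partial>lborel) \<in> borel_measurable (scale_measure (?D + 1))"
        using m1 by measurable
      then show ?thesis by (simp add: W_def[abs_def] cong: measurable_cong_sets)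
    qed
    define J where "J \<xi> = (\<integral>\<^sup>+\<eta>. ennreal ((cmod (fourier \<Psi> (vcons \<xi> \<eta>)))\<^sup>2) \<partial>lborel)" for \<xi>
    have Jm [measurable]: "J \<in> borel_measurable borel" unfolding J_def[abs_def] by measurable
    have Winf: "W \<infinity> = (\<integral>\<^sup>+\<eta>. ennreal ((cmod (fourier \<Phi> (vcons ?w \<eta>)))\<^sup>2 / \<bar>?w\<bar> ^ ?n) \<partial>lborel)"
    proof -
      have "W \<infinity> = (\<integral>\<^sup>+s. ennreal ((cmod (fourier \<Phi> (vcons ?w (vtail \<omega> + ?w *\<^sub>R s))))\<^sup>2) \<partial>lborel)"
        unfolding W_def by (simp add: freq_weight_def infty_scale shear_freq_infty)
      also have "\<dots> = ennreal (1 / \<bar>?w\<bar> ^ ?n) * (\<integral>\<^sup>+\<eta>. ennreal ((cmod (fourier \<Phi> (vcons ?w \<eta>)))\<^sup>2) \<partial>lborel)"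
        using nn_integral_lborel_affine[OF _ w, of "\<lambda>\<eta>. ennreal ((cmod (fourier \<Phi> (vcons ?w \<eta>)))\<^sup>2)" "vtail \<omega>"] by simp
      also have "\<dots> = (\<integral>\<^sup>+\<eta>. ennreal (1 / \<bar>?w\<bar> ^ ?n) * ennreal ((cmod (fourier \<Phi> (vcons ?w \<eta>)))\<^sup>2) \<partial>lborel)"
        by (rule nn_integral_cmult[symmetric]) measurable
      finally show ?thesis by (simp flip: ennreal_mult)
    qed
    \<comment> \<open>The determinant |a| |root|^(d-1) loses its root to the Jacobian of the shear
      substitution, so |a| / |\<omega>_1|^(d-1) remains.\<close>
    have Wfin: "W (ereal a) = ennreal (\<bar>a\<bar> / \<bar>?w\<bar> ^ ?n) * J (a * ?w)" if a: "a \<noteq> 0" "ereal a \<in> scales" for a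
    proof -
      let ?r = "dilation_root TYPE('n) a"
      have r: "?r * ?w \<noteq> 0" using w a by simp
      have "W (ereal a) = (\<integral>\<^sup>+s. ennreal (dilation_det TYPE('n) a) * ennreal ((cmod (fourier \<Psi> (vcons (a * ?w) (?r *\<^sub>R vtail \<omega> + (?r * ?w) *\<^sub>R s))))\<^sup>2) \<partial>lborel)"
        unfolding W_def using a dilation_det_pos[OF a(1), of "TYPE('n)"]
        by (simp add: freq_weight_def shear_freq_def scaleR_add_right flip: ennreal_mult)
      also have "\<dots> = ennreal (dilation_det TYPE('n) a) * (\<integral>\<^sup>+s. ennreal ((cmod (fourier \<Psi> (vcons (a * ?w) (?r *\<^sub>R vtail \<omega> + (?r * ?w) *\<^sub>R s))))\<^sup>2) \<partial>lborel)"
        by (rule nn_integral_cmult) measurable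
      also have "(\<integral>\<^sup>+s. ennreal ((cmod (fourier \<Psi> (vcons (a * ?w) (?r *\<^sub>R vtail \<omega> + (?r * ?w) *\<^sub>R s))))\<^sup>2) \<partial>lborel) = ennreal (1 / \<bar>?r * ?w\<bar> ^ ?n) * J (a * ?w)"
        unfolding J_def
        using nn_integral_lborel_affine[OF _ r, of "\<lambda>\<eta>. ennreal ((cmod (fourier \<Psi> (vcons (a * ?w) \<eta>)))\<^sup>2)" "?r *\<^sub>R vtail \<omega>"] by simp
      also have "ennreal (dilation_det TYPE('n) a) * (ennreal (1 / \<bar>?r * ?w\<bar> ^ ?n) * J (a * ?w)) = ennreal (dilation_det TYPE('n) a * (1 / \<bar>?r * ?w\<bar> ^ ?n)) * J (a * ?w)"
        using dilation_det_pos[OF a(1), of "TYPE('n)"] by (subst ennreal_mult) (auto simp: mult.assoc)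
      also have "dilation_det TYPE('n) a * (1 / \<bar>?r * ?w\<bar> ^ ?n) = \<bar>a\<bar> / \<bar>?w\<bar> ^ ?n"
        using a by (simp add: dilation_det_def abs_mult power_mult_distrib)
      finally show ?thesis .
    qed
    define H where "H \<xi> = J \<xi> * ennreal (1 / \<bar>\<xi>\<bar> ^ ?D) * indicator {- \<bar>?w\<bar>..\<bar>?w\<bar>} \<xi>" for \<xi>
    have Hm [measurable]: "H \<in> borel_measurable borel" unfolding H_def[abs_def] by measurable
    have "(\<integral>\<^sup>+a. W (ereal a) * ennreal (1 / \<bar>a\<bar> ^ (?D + 1)) * indicator ({-1..1} - {0}) a \<partial>lborel) = (\<integral>\<^sup>+a. ennreal \<bar>?w\<bar> * H (0 + ?w *\<^sub>R a) \<partial>lborel)"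
    proof (intro nn_integral_cong)
      fix a :: real
      show "W (ereal a) * ennreal (1 / \<bar>a\<bar> ^ (?D + 1)) * indicator ({-1..1} - {0}) a = ennreal \<bar>?w\<bar> * H (0 + ?w *\<^sub>R a)"
      proof (cases "a \<in> {-1..1} - {0}")
        case True
        then have a: "a \<noteq> 0" "ereal a \<in> scales" and a1: "\<bar>a\<bar> \<le> 1" by (auto simp: scales_def)
        have i: "?w * a \<in> {- \<bar>?w\<bar>..\<bar>?w\<bar>}"
        proof -
          have "\<bar>?w * a\<bar> \<le> \<bar>?w\<bar>" using a1 by (simp add: abs_mult mult_left_le)
          then show ?thesis by (auto simp: abs_le_iff)
        qed
        have e: "\<bar>a\<bar> / \<bar>?w\<bar> ^ ?n * (1 / \<bar>a\<bar> ^ (?D + 1)) = \<bar>?w\<bar> * (1 / \<bar>?w * a\<bar> ^ ?D)"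
          using a w by (simp add: CARD_option abs_mult power_mult_distrib field_simps)
        have "W (ereal a) * ennreal (1 / \<bar>a\<bar> ^ (?D + 1)) = ennreal (\<bar>a\<bar> / \<bar>?w\<bar> ^ ?n * (1 / \<bar>a\<bar> ^ (?D + 1))) * J (a * ?w)"
          unfolding Wfin[OF a] by (subst ennreal_mult) (auto simp: mult_ac)
        also have "\<dots> = ennreal \<bar>?w\<bar> * (J (?w * a) * ennreal (1 / \<bar>?w * a\<bar> ^ ?D))"
          unfolding e by (subst ennreal_mult) (auto simp: mult_ac)
        finally show ?thesis using True i by (simp add: H_def)
      next
        case False
        \<comment> \<open>At a = 0 the transform of \<Psi> vanishes by the gap a0; for |a| > 1 the
          argument leaves the interval, as \<omega>_1 is nonzero.\<close>
        have "H (?w * a) = 0"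
        proof (cases "a = 0")
          case True
          have "fourier \<Psi> (vcons 0 \<eta>) = 0" for \<eta> using \<Psi>_support(1)[of "vcons 0 \<eta>"] a0_pos by auto
          then show ?thesis using True by (simp add: H_def J_def)
        next
          case nz: False
          with False have "\<bar>a\<bar> > 1" by auto
          then have "\<bar>?w * a\<bar> > \<bar>?w\<bar>" using w by (simp add: abs_mult)
          then have "?w * a \<notin> {- \<bar>?w\<bar>..\<bar>?w\<bar>}" by (auto simp: abs_le_iff not_le)
          then show ?thesis by (simp add: H_def)
        qed
        then show ?thesis using False by simp
      qed
    qed
    also have "\<dots> = ennreal \<bar>?w\<bar> * (\<integral>\<^sup>+a. H (0 + ?w *\<^sub>R a) \<partial>lborel)"
      by (rule nn_integral_cmult) measurable
    also have "\<dots> = ennreal \<bar>?w\<bar> * (ennreal (1 / \<bar>?w\<bar>) * (\<integral>\<^sup>+\<xi>. H \<xi> \<partial>lborel))"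
      using nn_integral_lborel_affine[OF Hm w, of 0] by simp
    also have "\<dots> = (\<integral>\<^sup>+\<xi>. H \<xi> \<partial>lborel)"
      using w by (simp add: mult.assoc[symmetric] flip: ennreal_mult)
    also have "\<dots> = (\<integral>\<^sup>+\<xi>. \<integral>\<^sup>+\<eta>. ennreal ((cmod (fourier \<Psi> (vcons \<xi> \<eta>)))\<^sup>2 / \<bar>\<xi>\<bar> ^ ?D) * indicator {- \<bar>?w\<bar>..\<bar>?w\<bar>} \<xi> \<partial>lborel \<partial>lborel)"
    proof (intro nn_integral_cong)
      fix \<xi>
      have "H \<xi> = (\<integral>\<^sup>+\<eta>. ennreal ((cmod (fourier \<Psi> (vcons \<xi> \<eta>)))\<^sup>2) * (ennreal (1 / \<bar>\<xi>\<bar> ^ ?D) * indicator {- \<bar>?w\<bar>..\<bar>?w\<bar>} \<xi>) \<partial>lborel)"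
        unfolding H_def J_def mult.assoc by (rule nn_integral_multc[symmetric]) measurable
      then show "H \<xi> = (\<integral>\<^sup>+\<eta>. ennreal ((cmod (fourier \<Psi> (vcons \<xi> \<eta>)))\<^sup>2 / \<bar>\<xi>\<bar> ^ ?D) * indicator {- \<bar>?w\<bar>..\<bar>?w\<bar>} \<xi> \<partial>lborel)"
        by (simp add: mult.assoc[symmetric] flip: ennreal_mult)
    qed
    also have "\<dots> = (\<integral>\<^sup>+\<eta>. \<integral>\<^sup>+\<xi>. ennreal ((cmod (fourier \<Psi> (vcons \<xi> \<eta>)))\<^sup>2 / \<bar>\<xi>\<bar> ^ ?D) * indicator {- \<bar>?w\<bar>..\<bar>?w\<bar>} \<xi> \<partial>lborel \<partial>lborel)"
      by (intro lborel_pair.Fubini'[symmetric]) measurable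
    finally have Wint: "(\<integral>\<^sup>+a. W (ereal a) * ennreal (1 / \<bar>a\<bar> ^ (?D + 1)) * indicator ({-1..1} - {0}) a \<partial>lborel) =
        (\<integral>\<^sup>+\<eta>. \<integral>\<^sup>+\<xi>. ennreal ((cmod (fourier \<Psi> (vcons \<xi> \<eta>)))\<^sup>2 / \<bar>\<xi>\<bar> ^ ?D) * indicator {- \<bar>?w\<bar>..\<bar>?w\<bar>} \<xi> \<partial>lborel \<partial>lborel)" .
    have "(\<integral>\<^sup>+q. ennreal (freq_weight q \<omega>) \<partial>scale_shear_measure) = (\<integral>\<^sup>+\<beta>. W \<beta> \<partial>scale_measure (?D + 1))"
      unfolding W_def by (rule lborel.nn_integral_fst[symmetric]) measurable
    also have "\<dots> = W \<infinity> + (\<integral>\<^sup>+a. W (ereal a) * ennreal (1 / \<bar>a\<bar> ^ (?D + 1)) * indicator ({-1..1} - {0}) a \<partial>lborel)"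
      by (rule nn_integral_scale_measure[OF Wm])
    also have "\<dots> = 1" unfolding Winf Wint using elim by simp
    finally show ?case .
  qed
qed

text \<open>Parseval in the translation variable turns the inner integral into one of
  \<open>h\<close> times the squared transform of the middle element. Fubini over scale and shear
  meets the Calderon condition, and Parseval for x and z closes the circle.\<close>

lemma K_reproducing:
  assumes x: "x \<in> param_space" and z: "z \<in> param_space"
  shows "(\<integral>y. K x y * K y z \<partial>param_measure) = K x z"
proof -
  let ?Q = "scale_shear_measure :: (ereal \<times> (real ^ 'n)) measure" and ?L = "lborel :: (real ^ 'n option) measure"
  interpret Q: sigma_finite_measure ?Q by (rule sigma_finite_scale_shear)
  interpret P: pair_sigma_finite ?Q ?L ..
  define h where "h \<omega> = fourier (\<psi> x) \<omega> * cnj (fourier (\<psi> z) \<omega>)" for \<omega>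
  have fm: "fourier (\<psi> y) \<in> borel_measurable borel" if "y \<in> param_space" for y
    using fourier_\<psi>_integrable[OF that] by auto
  have fb: "\<exists>B. \<forall>\<omega>. cmod (fourier (\<psi> y) \<omega>) \<le> B" if "y \<in> param_space" for y
    using norm_fourier_le[of "\<psi> y"] by blast
  have prod_int: "integrable lborel (\<lambda>\<omega>. fourier (\<psi> y) \<omega> * cnj (fourier (\<psi> y') \<omega>))"
    if y: "y \<in> param_space" and y': "y' \<in> param_space" for y y'
  proof -
    obtain B where "\<And>\<omega>. cmod (fourier (\<psi> y') \<omega>) \<le> B" using fb[OF y'] by blast
    then show ?thesis
      using fm[OF y'] by (intro integrable_mult_bounded[OF fourier_\<psi>_integrable[OF y], where B=B]) auto
  qed
  have hi: "integrable lborel h" unfolding h_def by (rule prod_int[OF x z])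
  then have [measurable]: "h \<in> borel_measurable borel" by auto
  have inner: "(\<integral>t. K x (\<beta>, s, t) * K (\<beta>, s, t) z \<partial>lborel) = (\<integral>\<omega>. h \<omega> * of_real (freq_weight (\<beta>, s) \<omega>) \<partial>lborel)"
    if \<beta>: "\<beta> \<in> scales" for \<beta> s
  proof -
    have y: "(\<beta>, s, 0) \<in> param_space" using \<beta> by (simp add: param_space_scales)
    let ?g = "\<psi> (\<beta>, s, 0)"
    \<comment> \<open>Only the second kernel factor is flipped by symmetry, so that both become
      correlations with the same untranslated element.\<close>
    have "(\<integral>t. K x (\<beta>, s, t) * K (\<beta>, s, t) z \<partial>lborel) = (\<integral>t. correlation (\<psi> x) ?g t * cnj (correlation (\<psi> z) ?g t) \<partial>lborel)"
      by (intro Bochner_Integration.integral_cong refl) (subst (2) K_hermitian, simp only: K_correlation[OF \<beta>])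
    also have "\<dots> = (\<integral>\<omega>. fourier (correlation (\<psi> x) ?g) \<omega> * cnj (fourier (correlation (\<psi> z) ?g) \<omega>) \<partial>lborel)"
    proof (rule parseval)
      show "integrable lborel (correlation (\<psi> x) ?g)" "integrable lborel (correlation (\<psi> z) ?g)"
        by (intro integrable_correlation \<psi>_L1 x y z)+
      have "fourier (correlation (\<psi> x) ?g) = (\<lambda>\<omega>. fourier (\<psi> x) \<omega> * cnj (fourier ?g \<omega>))"
        by (intro ext fourier_correlation \<psi>_L1 x y)
      then show "integrable lborel (fourier (correlation (\<psi> x) ?g))" using prod_int[OF x y] by simp
    qed
    also have "\<dots> = (\<integral>\<omega>. h \<omega> * of_real (freq_weight (\<beta>, s) \<omega>) \<partial>lborel)"
    proof (intro Bochner_Integration.integral_cong refl)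
      fix \<omega>
      have "cnj (fourier ?g \<omega>) * fourier ?g \<omega> = of_real (freq_weight (\<beta>, s) \<omega>)"
        unfolding freq_weight_eq[OF \<beta>] using complex_norm_square[of "fourier ?g \<omega>"] by (simp add: mult.commute)
      then show "fourier (correlation (\<psi> x) ?g) \<omega> * cnj (fourier (correlation (\<psi> z) ?g) \<omega>) = h \<omega> * of_real (freq_weight (\<beta>, s) \<omega>)"
        unfolding h_def fourier_correlation[OF \<psi>_L1[OF x] \<psi>_L1[OF y]] fourier_correlation[OF \<psi>_L1[OF z] \<psi>_L1[OF y]]
        by (simp add: mult_ac)
    qed
    finally show ?thesis .
  qed
  \<comment> \<open>Extension by 0 to the whole type, where the product structure of the measure is
    available. Its integrability comes from the row bounds with q = 2.\<close>
  define G where "G y = indicator param_space y *\<^sub>R (K' x y * K' y z)" for y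
  have Gm [measurable]: "G \<in> borel_measurable borel" unfolding G_def[abs_def] by measurable
  have GK: "G y = K x y * K y z" if "y \<in> param_space" for y
    using that by (simp add: G_def K'_eq x z)
  have G0: "G y = 0" if "y \<notin> param_space" for y using that by (simp add: G_def)
  have Gi: "integrable full_param_measure G"
  proof (rule integrableI_bounded)
    show "G \<in> borel_measurable full_param_measure" by (simp cong: measurable_cong_sets)
    obtain C where C: "\<And>x. x \<in> param_space \<Longrightarrow> (\<integral>\<^sup>+y. ennreal (cmod (K x y) powr 2) \<partial>param_measure) \<le> ennreal C"
      using K_powr_bound[of 2] by auto
    have C': "(\<integral>\<^sup>+y. ennreal ((cmod (K' x y))\<^sup>2) \<partial>full_param_measure) \<le> ennreal C" if "x \<in> param_space" for x
      using C[OF that] unfolding nn_integral_K_powr[OF that] by simp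
    have "(\<integral>\<^sup>+y. ennreal (norm (G y)) \<partial>full_param_measure) \<le> (\<integral>\<^sup>+y. ennreal ((cmod (K' x y))\<^sup>2) + ennreal ((cmod (K' z y))\<^sup>2) \<partial>full_param_measure)"
    proof (rule nn_integral_mono)
      fix y
      show "ennreal (norm (G y)) \<le> ennreal ((cmod (K' x y))\<^sup>2) + ennreal ((cmod (K' z y))\<^sup>2)"
      proof (cases "y \<in> param_space")
        case True
        have "0 \<le> cmod (K x y) * cmod (K z y)" by simp
        then have "cmod (K x y) * cmod (K z y) \<le> (cmod (K x y))\<^sup>2 + (cmod (K z y))\<^sup>2"
          using sum_squares_bound[of "cmod (K x y)" "cmod (K z y)"] by linarith
        moreover have "norm (G y) = cmod (K x y) * cmod (K z y)"
          unfolding GK[OF True] K_hermitian[of y z] by (simp add: norm_mult)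
        ultimately show ?thesis using True x z by (simp add: K'_eq ennreal_leI flip: ennreal_plus)
      qed (simp add: G0)
    qed
    also have "\<dots> = (\<integral>\<^sup>+y. ennreal ((cmod (K' x y))\<^sup>2) \<partial>full_param_measure) + (\<integral>\<^sup>+y. ennreal ((cmod (K' z y))\<^sup>2) \<partial>full_param_measure)"
      by (rule nn_integral_add) (auto cong: measurable_cong_sets)
    also have "\<dots> \<le> ennreal C + ennreal C" by (intro add_mono C' x z)
    also have "\<dots> < \<infinity>" by simp
    finally show "(\<integral>\<^sup>+y. ennreal (norm (G y)) \<partial>full_param_measure) < \<infinity>" .
  qed
  have "(\<integral>y. K x y * K y z \<partial>param_measure) = (\<integral>y. G y \<partial>param_measure)"
    by (intro Bochner_Integration.integral_cong) (simp_all add: GK)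
  also have "\<dots> = (\<integral>y. indicator param_space y *\<^sub>R G y \<partial>full_param_measure)"
    unfolding param_measure_eq by (rule integral_restrict_space) simp
  also have "\<dots> = (\<integral>y. G y \<partial>full_param_measure)"
    by (intro Bochner_Integration.integral_cong) (auto simp: G0 indicator_def)
  also have "\<dots> = (\<integral>q. (\<integral>t. G (fst q, snd q, t) \<partial>lborel) \<partial>?Q)"
  proof -
    have i: "integrable (?Q \<Otimes>\<^sub>M ?L) (\<lambda>(q, t). G (fst q, snd q, t))"
      using Gi unfolding full_param_measure_def
      by (subst (asm) integrable_distr_eq[OF assoc_measurable]) (auto simp: case_prod_unfold)
    have "(\<integral>y. G y \<partial>full_param_measure) = (\<integral>w. (case w of (q, t) \<Rightarrow> G (fst q, snd q, t)) \<partial>(?Q \<Otimes>\<^sub>M ?L))"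
      unfolding full_param_measure_def
      by (subst integral_distr[OF assoc_measurable]) (auto simp: case_prod_unfold)
    then show ?thesis using P.integral_fst[OF i] by simp
  qed
  also have "\<dots> = (\<integral>q. (\<integral>\<omega>. h \<omega> * of_real (freq_weight q \<omega>) \<partial>lborel) \<partial>?Q)"
  proof (rule Bochner_Integration.integral_cong[OF refl])
    fix q :: "ereal \<times> (real ^ 'n)"
    show "(\<integral>t. G (fst q, snd q, t) \<partial>lborel) = (\<integral>\<omega>. h \<omega> * of_real (freq_weight q \<omega>) \<partial>lborel)"
    proof (cases "fst q \<in> scales")
      case True
      then have "G (fst q, snd q, t) = K x (fst q, snd q, t) * K (fst q, snd q, t) z" for t
        by (intro GK) (simp add: param_space_scales)
      then show ?thesis using inner[OF True, of "snd q"] by simp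
    next
      case False
      then have "G (fst q, snd q, t) = 0" for t by (intro G0) (simp add: param_space_scales)
      moreover have "freq_weight q \<omega> = 0" for \<omega> using False by (simp add: freq_weight_def)
      ultimately show ?thesis by simp
    qed
  qed
  also have "\<dots> = (\<integral>\<omega>. (\<integral>q. h \<omega> * of_real (freq_weight q \<omega>) \<partial>?Q) \<partial>lborel)"
  proof (rule P.Fubini_integral[symmetric])
    have wm: "(\<lambda>w. freq_weight (fst w) (snd w)) \<in> borel_measurable (?Q \<Otimes>\<^sub>M ?L)"
      using freq_weight_measurable by (simp add: case_prod_unfold)
    note wm [measurable]
    show "integrable (?Q \<Otimes>\<^sub>M ?L) (\<lambda>(q, \<omega>). h \<omega> * of_real (freq_weight q \<omega>))"
    proof (rule integrableI_bounded)
      show "(\<lambda>(q, \<omega>). h \<omega> * complex_of_real (freq_weight q \<omega>)) \<in> borel_measurable (?Q \<Otimes>\<^sub>M ?L)"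
        unfolding case_prod_unfold by measurable
      have "(\<integral>\<^sup>+w. ennreal (norm (case w of (q, \<omega>) \<Rightarrow> h \<omega> * complex_of_real (freq_weight q \<omega>))) \<partial>(?Q \<Otimes>\<^sub>M ?L)) =
          (\<integral>\<^sup>+w. ennreal (cmod (h (snd w))) * ennreal (freq_weight (fst w) (snd w)) \<partial>(?Q \<Otimes>\<^sub>M ?L))"
        by (intro nn_integral_cong) (simp add: case_prod_unfold norm_mult freq_weight_nonneg ennreal_mult)
      also have "\<dots> = (\<integral>\<^sup>+\<omega>. (\<integral>\<^sup>+q. ennreal (cmod (h \<omega>)) * ennreal (freq_weight q \<omega>) \<partial>?Q) \<partial>lborel)"
        by (subst P.nn_integral_snd[symmetric]) auto
      also have "\<dots> = (\<integral>\<^sup>+\<omega>. ennreal (cmod (h \<omega>)) * (\<integral>\<^sup>+q. ennreal (freq_weight q \<omega>) \<partial>?Q) \<partial>lborel)"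
      proof (intro nn_integral_cong nn_integral_cmult)
        fix \<omega>
        have "(\<lambda>q. (q, \<omega>)) \<in> ?Q \<rightarrow>\<^sub>M ?Q \<Otimes>\<^sub>M ?L" by measurable
        from measurable_compose[OF this freq_weight_measurable]
        show "(\<lambda>q. ennreal (freq_weight q \<omega>)) \<in> borel_measurable ?Q" by simp
      qed
      also have "\<dots> = (\<integral>\<^sup>+\<omega>. ennreal (cmod (h \<omega>)) \<partial>lborel)"
        using freq_weight_integral by (intro nn_integral_cong_AE) (auto elim!: eventually_mono)
      also have "\<dots> < \<infinity>" using hi by (simp add: integrable_iff_bounded)
      finally show "(\<integral>\<^sup>+w. ennreal (norm (case w of (q, \<omega>) \<Rightarrow> h \<omega> * complex_of_real (freq_weight q \<omega>))) \<partial>(?Q \<Otimes>\<^sub>M ?L)) < \<infinity>" .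
    qed
  qed
  also have "\<dots> = (\<integral>\<omega>. h \<omega> \<partial>lborel)"
  proof (rule integral_cong_AE)
    have wm: "(\<lambda>w. freq_weight (fst w) (snd w)) \<in> borel_measurable (?Q \<Otimes>\<^sub>M ?L)"
      using freq_weight_measurable by (simp add: case_prod_unfold)
    have wm' [measurable]: "(\<lambda>w. freq_weight (snd w) (fst w)) \<in> borel_measurable (?L \<Otimes>\<^sub>M ?Q)"
      using measurable_compose[OF measurable_pair_swap' wm] by (simp add: case_prod_unfold)
    have "(\<lambda>(\<omega>, q). h \<omega> * complex_of_real (freq_weight q \<omega>)) \<in> borel_measurable (lborel \<Otimes>\<^sub>M ?Q)"
      unfolding case_prod_unfold by measurable
    then show "(\<lambda>\<omega>. \<integral>q. h \<omega> * complex_of_real (freq_weight q \<omega>) \<partial>?Q) \<in> borel_measurable lborel"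
      by (rule Q.borel_measurable_lebesgue_integral)
    show "h \<in> borel_measurable lborel" by simp
    show "AE \<omega> in lborel. (\<integral>q. h \<omega> * complex_of_real (freq_weight q \<omega>) \<partial>?Q) = h \<omega>"
      using freq_weight_integral
    proof eventually_elim
      case (elim \<omega>)
      have "(\<lambda>q. (q, \<omega>)) \<in> ?Q \<rightarrow>\<^sub>M ?Q \<Otimes>\<^sub>M ?L" by measurable
      from measurable_compose[OF this freq_weight_measurable]
      have m: "(\<lambda>q. freq_weight q \<omega>) \<in> borel_measurable ?Q" by simp
      have "(\<integral>q. freq_weight q \<omega> \<partial>?Q) = 1"
        using integral_eq_nn_integral[OF m] freq_weight_nonneg elim by simp
      then show ?case by (simp add: integral_complex_of_real)
    qed
  qed
  also have "\<dots> = K x z" unfolding h_def K_parseval[OF x z] ..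
  finally show ?thesis .
qed

lemma borel_id_param: "(\<lambda>x. x) \<in> param_measure \<rightarrow>\<^sub>M (borel :: 'n param measure)"
  unfolding param_measure_eq by (rule measurable_restrict_space1) (simp cong: measurable_cong_sets)

lemma K_measurable_param: "(\<lambda>(x, y). K x y) \<in> borel_measurable (param_measure \<Otimes>\<^sub>M param_measure)"
proof -
  have "(\<lambda>w. (fst w, snd w)) \<in> param_measure \<Otimes>\<^sub>M param_measure \<rightarrow>\<^sub>M (borel \<Otimes>\<^sub>M borel :: ('n param \<times> 'n param) measure)"
    by (intro measurable_Pair measurable_compose[OF measurable_fst borel_id_param] measurable_compose[OF measurable_snd borel_id_param])
  from measurable_compose[OF this K'_measurable]
  have "(\<lambda>w. K' (fst w) (snd w)) \<in> borel_measurable (param_measure \<Otimes>\<^sub>M param_measure)" by simp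
  then show ?thesis
    by (rule measurable_cong[THEN iffD1, rotated]) (auto simp: space_pair_measure K'_eq)
qed

lemma weight_measurable: "weight r \<in> borel_measurable (param_measure :: 'n param measure)"
proof -
  have "(\<lambda>x :: 'n param. fst x) \<in> borel \<rightarrow>\<^sub>M borel"
    by (intro borel_measurable_continuous_onI continuous_intros)
  from measurable_compose[OF borel_id_param this]
  have [measurable]: "(\<lambda>x :: 'n param. fst x) \<in> param_measure \<rightarrow>\<^sub>M borel" .
  have "(\<lambda>x :: 'n param. \<bar>scale_of (fst x)\<bar> powr (- r)) \<in> borel_measurable param_measure" by measurable
  then show ?thesis
    by (rule measurable_cong[THEN iffD1, rotated]) (simp add: weight_eq)
qed

lemma shearlet_reproducing_kernel:
  assumes r: "r \<ge> 0"
  shows "reproducing_kernel (param_measure :: 'n param measure) K (weight r) (\<rho> powr (- r)) (2 * G2)"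
proof -
  interpret sigma_finite_measure "param_measure :: 'n param measure" by (rule sigma_finite_param_measure)
  show ?thesis
  proof
    show "(\<lambda>(x, y). K x y) \<in> borel_measurable (param_measure \<Otimes>\<^sub>M param_measure)" by (rule K_measurable_param)
    show "\<exists>C\<ge>0. \<forall>x\<in>space param_measure. (\<integral>\<^sup>+y. ennreal (cmod (K x y) powr q) \<partial>param_measure) \<le> ennreal C"
      if "1 < q" for q using K_powr_bound[OF that] by simp
    show "weight r \<in> borel_measurable (param_measure :: 'n param measure)" by (rule weight_measurable)
    show "K y x = cnj (K x y)" for x y by (rule K_hermitian)
    show "cmod (K x y) \<le> 2 * G2" if "x \<in> space param_measure" "y \<in> space param_measure" for x y
      using K_bounded that by simp
    show "(\<integral>y. K x y * K y z \<partial>param_measure) = K x z" if "x \<in> space param_measure" "z \<in> space param_measure" for x z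
      using K_reproducing that by simp
    show "1 \<le> weight r x" if "x \<in> space param_measure" for x
      using weight_ge_1[OF r] that by simp
    show "weight r y \<le> \<rho> powr (- r) * weight r x"
      if "x \<in> space param_measure" "y \<in> space param_measure" "K x y \<noteq> 0" for x y
      using weight_moderate[OF r] that by simp
    show "0 \<le> \<rho> powr (- r)" by simp
    show "0 \<le> 2 * G2" using G2_nonneg by simp
  qed
qed

end

section \<open>Independence of the coorbit spaces of the test space\<close>

text \<open>Hoelder up to the constant: normalising \<open>H\<close> and applying Young gives E + 1.
  Norm 0 cannot be normalised and is treated apart.\<close>

lemma Lp_functional_bound:
  fixes F :: "'x \<Rightarrow> complex"
  assumes t: "1 < t" and F [measurable]: "F \<in> borel_measurable M"
    and Fi: "integrable M (\<lambda>x. cmod (F x) powr (t / (t - 1)))"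
  obtains C where "C \<ge> 0" "\<And>H. H \<in> borel_measurable M \<Longrightarrow> integrable M (\<lambda>x. cmod (H x) powr t) \<Longrightarrow>
    cmod (\<integral>x. F x * cnj (H x) \<partial>M) \<le> C * (\<integral>x. cmod (H x) powr t \<partial>M) powr (1 / t)"
proof -
  define E where "E = (\<integral>x. cmod (F x) powr (t / (t - 1)) \<partial>M)"
  have E: "E \<ge> 0" by (simp add: E_def)
  show ?thesis
  proof (rule that[of "E + 1"])
    show "0 \<le> E + 1" using E by simp
    fix H :: "'x \<Rightarrow> complex" assume H [measurable]: "H \<in> borel_measurable M" and Hi: "integrable M (\<lambda>x. cmod (H x) powr t)"
    define A where "A = (\<integral>x. cmod (H x) powr t \<partial>M)"
    have A0: "A \<ge> 0" by (simp add: A_def)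
    show "cmod (\<integral>x. F x * cnj (H x) \<partial>M) \<le> (E + 1) * (\<integral>x. cmod (H x) powr t \<partial>M) powr (1 / t)"
    proof (cases "A = 0")
      case True
      then have "AE x in M. cmod (H x) powr t = 0"
        using integral_nonneg_eq_0_iff_AE[OF Hi] by (simp add: A_def)
      then have "AE x in M. F x * cnj (H x) = 0" by eventually_elim simp
      then have "(\<integral>x. F x * cnj (H x) \<partial>M) = 0" by (rule integral_eq_zero_AE)
      then show ?thesis using E by simp
    next
      case False
      define N where "N = A powr (1 / t)"
      have N: "N > 0" "N powr t = A" using False A0 t by (auto simp: N_def powr_powr)
      have FH: "integrable M (\<lambda>x. cnj (H x) * F x)"
        by (rule integrable_mult_conj_powr[OF t]) (use Hi Fi in auto)
      have "cmod (\<integral>x. F x * cnj (H x) \<partial>M) \<le> (\<integral>x. N * (cmod (H x) powr t / A + cmod (F x) powr (t / (t - 1))) \<partial>M)"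
      proof (rule order_trans[OF integral_norm_bound integral_mono])
        show "integrable M (\<lambda>x. cmod (F x * cnj (H x)))" using integrable_norm[OF FH] by (simp add: mult.commute)
        show "integrable M (\<lambda>x. N * (cmod (H x) powr t / A + cmod (F x) powr (t / (t - 1))))"
          using Fi Hi by simp
        fix x
        have "cmod (H x) / N * cmod (F x) \<le> (cmod (H x) / N) powr t + cmod (F x) powr (t / (t - 1))"
          by (rule mult_le_powr_conj[OF t]) (use N in auto)
        also have "(cmod (H x) / N) powr t = cmod (H x) powr t / A"
          unfolding powr_divide N(2) ..
        finally have "N * (cmod (H x) / N * cmod (F x)) \<le> N * (cmod (H x) powr t / A + cmod (F x) powr (t / (t - 1)))"
          using N by (intro mult_left_mono) auto
        then show "cmod (F x * cnj (H x)) \<le> N * (cmod (H x) powr t / A + cmod (F x) powr (t / (t - 1)))"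
          using N by (simp add: norm_mult mult.commute)
      qed
      also have "\<dots> = N * (A / A + E)"
        using Fi Hi by (simp add: E_def A_def)
      also have "\<dots> = (E + 1) * N" using False by simp
      finally show ?thesis by (simp add: N_def A_def)
    qed
  qed
qed

lemma Lpv_iff:
  fixes v :: "'n::finite param \<Rightarrow> real"
  assumes v: "v \<in> borel_measurable param_measure"
  shows "F \<in> Lpv p v \<longleftrightarrow> F \<in> borel_measurable param_measure \<and> integrable param_measure (\<lambda>x. (cmod (F x) * v x) powr p)"
  unfolding Lpv_def integrable_iff_bounded using v by auto

context shearlet_generators
begin

abbreviation "SH \<equiv> shearlet_transform \<psi>"

lemma SH_add:
  assumes "g \<in> L2_fun" "h \<in> L2_fun" "x \<in> param_space"
  shows "SH (\<lambda>y. g y + h y) x = SH g x + SH h x"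
  using L2_fun_cmult_add(3)[OF assms(1) \<psi>_L2[OF assms(3)]] L2_fun_cmult_add(3)[OF assms(2) \<psi>_L2[OF assms(3)]]
  by (simp add: shearlet_transform_def L2_inner_def distrib_right)

lemma SH_scale: "SH (\<lambda>y. c * g y) x = c * SH g x"
  by (simp add: shearlet_transform_def L2_inner_def mult.assoc)

context
  fixes r :: real
  assumes r: "r \<ge> 0"
begin

lemma test_space_iff: "g \<in> test_space \<psi> \<tau> (weight r) \<longleftrightarrow> g \<in> L2_fun \<and> SH g \<in> borel_measurable param_measure \<and>
    integrable param_measure (\<lambda>x. (cmod (SH g x) * weight r x) powr \<tau>)"
  by (simp add: test_space_def Lpv_iff[OF weight_measurable])

lemma test_space_scale: "g \<in> test_space \<psi> \<tau> (weight r) \<Longrightarrow> (\<lambda>y. c * g y) \<in> test_space \<psi> \<tau> (weight r)"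
proof -
  assume g: "g \<in> test_space \<psi> \<tau> (weight r)"
  have e: "SH (\<lambda>y. c * g y) = (\<lambda>x. c * SH g x)" by (intro ext SH_scale)
  have [measurable]: "SH g \<in> borel_measurable param_measure" using g by (simp add: test_space_iff)
  have "(cmod (c * SH g x) * weight r x) powr \<tau> = cmod c powr \<tau> * (cmod (SH g x) * weight r x) powr \<tau>" for x
    by (simp add: norm_mult powr_mult mult.assoc)
  then show ?thesis
    using g L2_fun_cmult_add(1)[of g g c] unfolding test_space_iff e by auto
qed

lemma test_space_add:
  assumes g: "g \<in> test_space \<psi> \<tau> (weight r)" and h: "h \<in> test_space \<psi> \<tau> (weight r)" and t: "\<tau> > 0"
  shows "(\<lambda>y. g y + h y) \<in> test_space \<psi> \<tau> (weight r)"
proof -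
  note weight_measurable[measurable]
  have [measurable]: "SH g \<in> borel_measurable param_measure" "SH h \<in> borel_measurable param_measure"
    using g h by (simp_all add: test_space_iff)
  have e: "SH (\<lambda>y. g y + h y) x = SH g x + SH h x" if "x \<in> param_space" for x
    using g h that by (intro SH_add) (auto simp: test_space_iff)
  have "(\<lambda>x. SH g x + SH h x) \<in> borel_measurable param_measure" by measurable
  then have m [measurable]: "SH (\<lambda>y. g y + h y) \<in> borel_measurable param_measure"
    by (rule measurable_cong[THEN iffD1, rotated]) (simp add: e)
  have "integrable param_measure (\<lambda>x. (cmod (SH (\<lambda>y. g y + h y) x) * weight r x) powr \<tau>)"
  proof (rule Bochner_Integration.integrable_bound)
    show "integrable param_measure (\<lambda>x. 2 powr \<tau> * ((cmod (SH g x) * weight r x) powr \<tau> + (cmod (SH h x) * weight r x) powr \<tau>))"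
      using g h by (simp add: test_space_iff)
    show "AE x in param_measure. norm ((cmod (SH (\<lambda>y. g y + h y) x) * weight r x) powr \<tau>)
        \<le> norm (2 powr \<tau> * ((cmod (SH g x) * weight r x) powr \<tau> + (cmod (SH h x) * weight r x) powr \<tau>))"
    proof (rule AE_I2)
      fix x assume "x \<in> space (param_measure :: 'n param measure)"
      then have x: "x \<in> param_space" by simp
      let ?a = "cmod (SH g x) * weight r x" and ?b = "cmod (SH h x) * weight r x"
      have v: "weight r x \<ge> 0" using weight_ge_1[OF r x] by simp
      have ab: "?a \<ge> 0" "?b \<ge> 0" using v by auto
      have "cmod (SH (\<lambda>y. g y + h y) x) * weight r x \<le> (cmod (SH g x) + cmod (SH h x)) * weight r x"
        unfolding e[OF x] using v by (intro mult_right_mono norm_triangle_ineq)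
      also have "\<dots> \<le> 2 * max ?a ?b"
        using max.cobounded1[of ?a ?b] max.cobounded2[of ?b ?a] unfolding distrib_right by linarith
      finally have "(cmod (SH (\<lambda>y. g y + h y) x) * weight r x) powr \<tau> \<le> (2 * max ?a ?b) powr \<tau>"
        using t v by (intro powr_mono2) auto
      also have "\<dots> = 2 powr \<tau> * max ?a ?b powr \<tau>" by (rule powr_mult)
      also have "\<dots> \<le> 2 powr \<tau> * (?a powr \<tau> + ?b powr \<tau>)"
        by (intro mult_left_mono) (auto simp: max_def)
      finally show "norm ((cmod (SH (\<lambda>y. g y + h y) x) * weight r x) powr \<tau>) \<le> norm (2 powr \<tau> * (?a powr \<tau> + ?b powr \<tau>))"
        by simp
    qed
  qed measurable
  then show ?thesis
    using g h m L2_fun_cmult_add(2)[of g h] by (simp add: test_space_iff)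
qed

text \<open>The transform of a frame element is a kernel row, which lies in L_\<tau> since \<tau> >
  1; moderateness trades the weight at y for the weight at x. Functionals on the test space may thus
  be evaluated at frame elements.\<close>

lemma \<psi>_in_test_space:
  assumes x: "x \<in> param_space" and t: "\<tau> > 1"
  shows "\<psi> x \<in> test_space \<psi> \<tau> (weight r)"
proof -
  interpret RK: reproducing_kernel "param_measure :: 'n param measure" K "weight r" "\<rho> powr (- r)" "2 * G2"
    by (rule shearlet_reproducing_kernel[OF r])
  note weight_measurable[measurable]
  have SK: "SH (\<psi> x) = K x" by (simp add: K_def fun_eq_iff)
  have xs: "x \<in> space param_measure" using x by simp
  have m [measurable]: "K x \<in> borel_measurable param_measure" using RK.K_meas1[OF xs] by simp
  have "integrable param_measure (\<lambda>y. (cmod (K x y) * weight r y) powr \<tau>)"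
  proof (rule Bochner_Integration.integrable_bound)
    show "integrable param_measure (\<lambda>y. (\<rho> powr (- r) * weight r x) powr \<tau> * cmod (K x y) powr \<tau>)"
      using RK.K_powr_integrable[OF t xs] by simp
    show "AE y in param_measure. norm ((cmod (K x y) * weight r y) powr \<tau>) \<le> norm ((\<rho> powr (- r) * weight r x) powr \<tau> * cmod (K x y) powr \<tau>)"
    proof (rule AE_I2)
      fix y assume y: "y \<in> space (param_measure :: 'n param measure)"
      then have "weight r y \<ge> 1" using weight_ge_1[OF r] by simp
      moreover have "cmod (K x y) * weight r y \<le> \<rho> powr (- r) * weight r x * cmod (K x y)"
        using RK.v_moderate_norm[OF xs y] by (simp add: mult.commute)
      ultimately have "(cmod (K x y) * weight r y) powr \<tau> \<le> (\<rho> powr (- r) * weight r x * cmod (K x y)) powr \<tau>"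
        using t by (intro powr_mono2) auto
      then show "norm ((cmod (K x y) * weight r y) powr \<tau>) \<le> norm ((\<rho> powr (- r) * weight r x) powr \<tau> * cmod (K x y) powr \<tau>)"
        by (simp add: powr_mult)
    qed
  qed measurable
  then show ?thesis using \<psi>_L2[OF x] m by (simp add: test_space_iff SK)
qed

lemma test_norm_eq:
  assumes "g \<in> test_space \<psi> \<tau> (weight r)"
  shows "test_norm \<psi> \<tau> (weight r) g = (\<integral>x. (cmod (SH g x) * weight r x) powr \<tau> \<partial>param_measure) powr (1 / \<tau>)"
  unfolding test_norm_def Lpv_norm_def
  using assms by (subst integral_eq_nn_integral) (auto simp: test_space_iff)

text \<open>The bound is the decisive output: the right-hand side of the formula is bounded by
  \<open>Lp_times_kernel\<close>, so the transform is bounded, a property that no longer refers to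
  \<tau>.\<close>

lemma reproducing_formula:
  assumes p: "1 \<le> p" and t: "1 < \<tau>" "\<tau> \<le> 2" and f: "f \<in> coorbit \<psi> r \<tau> p"
  obtains B where "\<And>x. x \<in> param_space \<Longrightarrow> cmod (f (\<psi> x)) \<le> B"
    "\<And>x. x \<in> param_space \<Longrightarrow> f (\<psi> x) = (\<integral>y. dual_transform \<psi> f y * K y x \<partial>param_measure)"
    "integrable param_measure (\<lambda>x. cmod (dual_transform \<psi> f x) powr p)"
proof -
  interpret RK: reproducing_kernel "param_measure :: 'n param measure" K "weight r" "\<rho> powr (- r)" "2 * G2"
    by (rule shearlet_reproducing_kernel[OF r])
  note weight_measurable[measurable]
  let ?V = "test_space \<psi> \<tau> (weight r)" and ?M = "param_measure :: 'n param measure" and ?F = "dual_transform \<psi> f"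
  have fa: "f \<in> anti_dual \<psi> \<tau> (weight r)" and FL: "?F \<in> Lpv p (weight r)" using f by (auto simp: coorbit_def)
  have Fm [measurable]: "?F \<in> borel_measurable ?M" and Fvi: "integrable ?M (\<lambda>x. (cmod (?F x) * weight r x) powr p)"
    using FL by (auto simp: Lpv_iff[OF weight_measurable])
  have Fi: "integrable ?M (\<lambda>x. cmod (?F x) powr p)"
  proof (rule Bochner_Integration.integrable_bound[OF Fvi])
    show "AE x in ?M. norm (cmod (?F x) powr p) \<le> norm ((cmod (?F x) * weight r x) powr p)"
    proof (rule AE_I2)
      fix x assume "x \<in> space ?M"
      then have v: "weight r x \<ge> 1" using weight_ge_1[OF r] by simp
      have "cmod (?F x) * 1 \<le> cmod (?F x) * weight r x" using v by (intro mult_left_mono) auto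
      then show "norm (cmod (?F x) powr p) \<le> norm ((cmod (?F x) * weight r x) powr p)"
        using p by (auto intro!: powr_mono2)
    qed
  qed measurable
  obtain C where "\<forall>g\<in>?V. cmod (f g) \<le> C * test_norm \<psi> \<tau> (weight r) g"
    using fa unfolding anti_dual_def by blast
  then have C: "\<And>g. g \<in> ?V \<Longrightarrow> cmod (f g) \<le> C * test_norm \<psi> \<tau> (weight r) g" by blast
  \<comment> \<open>The weight is absorbed into the transform, so the representation takes place in
    unweighted L_\<tau>. Evaluated at frame elements it yields the factor v z K z x that
    \<open>reproducing_limit\<close> expects.\<close>
  define T where "T g x = SH g x * of_real (weight r x)" for g x
  have Tn: "cmod (T g x) powr \<tau> = (cmod (SH g x) * weight r x) powr \<tau>" if "x \<in> space ?M" for g x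
    using weight_ge_1[OF r, of x] that by (simp add: T_def norm_mult)
  have Ti: "(\<integral>x. cmod (T g x) powr \<tau> \<partial>?M) = (\<integral>x. (cmod (SH g x) * weight r x) powr \<tau> \<partial>?M)" for g
    by (intro Bochner_Integration.integral_cong refl Tn)
  obtain G B where G: "\<And>n. G n \<in> borel_measurable ?M"
      "\<And>n. integrable ?M (\<lambda>x. cmod (G n x) powr (\<tau> / (\<tau> - 1)))"
      "\<And>n. (\<integral>x. cmod (G n x) powr (\<tau> / (\<tau> - 1)) \<partial>?M) \<le> B"
      "\<And>g. g \<in> ?V \<Longrightarrow> (\<lambda>n. \<integral>x. G n x * cnj (T g x) \<partial>?M) \<longlonglongrightarrow> f g"
  proof (rule approximate_Riesz_representation[where M="?M" and T=T and f=f and V="?V" and C=C, OF t])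
    have "(\<infinity>, 0, 0) \<in> (param_space :: 'n param set)" by (simp add: param_space_scales infty_scale)
    then show "?V \<noteq> {}" using \<psi>_in_test_space t by blast
    show "(\<lambda>y. g y + h y) \<in> ?V" if "g \<in> ?V" "h \<in> ?V" for g h
      using that t by (intro test_space_add) auto
    show "(\<lambda>y. c * g y) \<in> ?V" if "g \<in> ?V" for c g using that by (rule test_space_scale)
    show "T (\<lambda>y. g y + h y) x = T g x + T h x" if "g \<in> ?V" "h \<in> ?V" "x \<in> space ?M" for g h x
      using that by (simp add: T_def SH_add test_space_iff distrib_right)
    show "T (\<lambda>y. c * g y) x = c * T g x" for c g x by (simp add: T_def SH_scale mult.assoc)
    show "T g \<in> borel_measurable ?M" if "g \<in> ?V" for g
    proof -
      have [measurable]: "SH g \<in> borel_measurable ?M" using that by (simp add: test_space_iff)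
      show ?thesis unfolding T_def by measurable
    qed
    show "integrable ?M (\<lambda>x. cmod (T g x) powr \<tau>)" if "g \<in> ?V" for g
    proof -
      have "integrable ?M (\<lambda>x. (cmod (SH g x) * weight r x) powr \<tau>)" using that by (simp add: test_space_iff)
      then show ?thesis by (rule Bochner_Integration.integrable_cong[THEN iffD1, rotated -1]) (auto simp: Tn)
    qed
    show "f (\<lambda>y. g y + h y) = f g + f h" if "g \<in> ?V" "h \<in> ?V" for g h
      using fa that by (simp add: anti_dual_def)
    show "f (\<lambda>y. c * g y) = cnj c * f g" if "g \<in> ?V" for c g
      using fa that by (simp add: anti_dual_def)
    show "cmod (f g) \<le> C * (\<integral>x. cmod (T g x) powr \<tau> \<partial>?M) powr (1 / \<tau>)" if "g \<in> ?V" for g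
      using C[OF that] unfolding test_norm_eq[OF that] Ti .
  qed (use that in blast)
  obtain B' where B': "\<And>x. x \<in> space ?M \<Longrightarrow> integrable ?M (\<lambda>y. ?F y * K y x)"
    "\<And>x. x \<in> space ?M \<Longrightarrow> cmod (\<integral>y. ?F y * K y x \<partial>?M) \<le> B'"
    using RK.Lp_times_kernel[OF p Fm Fi] by blast
  have Fx: "?F x = f (\<psi> x)" if "x \<in> param_space" for x using that by (simp add: dual_transform_def)
  have rep: "?F x = (\<integral>y. ?F y * K y x \<partial>?M)" if x: "x \<in> param_space" for x
  proof (rule RK.reproducing_limit[OF t(1) G(1)])
    show "(\<integral>\<^sup>+z. ennreal (cmod (G n z) powr (\<tau> / (\<tau> - 1))) \<partial>?M) \<le> ennreal B" for n
      using nn_integral_eq_integral[OF G(2)[of n]] G(3)[of n] by (simp add: ennreal_leI)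
    show "(\<lambda>n. \<integral>z. G n z * (weight r z * K z x) \<partial>?M) \<longlonglongrightarrow> ?F x" if "x \<in> space ?M" for x
    proof -
      have x: "x \<in> param_space" using that by simp
      have "cnj (T (\<psi> x) z) = weight r z * K z x" for z
        using K_hermitian[of z x] by (simp add: T_def K_def mult.commute)
      then show ?thesis using G(4)[OF \<psi>_in_test_space[OF x t(1)]] by (simp add: Fx[OF x])
    qed
    show "x \<in> space ?M" "integrable ?M (\<lambda>y. ?F y * K y x)" using x B'(1) by auto
  qed
  show ?thesis
  proof (rule that[of B'])
    fix x :: "'n param" assume x: "x \<in> param_space"
    show "f (\<psi> x) = (\<integral>y. ?F y * K y x \<partial>?M)" using rep[OF x] Fx[OF x] by simp
    then show "cmod (f (\<psi> x)) \<le> B'" using B'(2)[of x] x by simp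
  qed (rule Fi)
qed

text \<open>A preimage is explicit: integration against the transform \<open>F\<close> of
  \<open>f\<close>. The reproducing formula says that its value at \<open>\<psi> x\<close> is
  \<open>F x\<close>, so both functionals have the same transform.\<close>

lemma coorbit_transform_subset:
  assumes p: "1 \<le> p" and t: "1 < \<tau>" "\<tau> \<le> 2" and s: "1 < \<sigma>" and ps: "p < hoelder_dual \<sigma>"
  shows "dual_transform \<psi> ` coorbit \<psi> r \<tau> p \<subseteq> dual_transform \<psi> ` coorbit \<psi> r \<sigma> p"
proof (rule image_subsetI)
  fix f assume f: "f \<in> coorbit \<psi> r \<tau> p"
  note weight_measurable[measurable]
  let ?V = "test_space \<psi> \<sigma> (weight r)" and ?M = "param_measure :: 'n param measure"
  define F where "F = dual_transform \<psi> f"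
  obtain B where B: "\<And>x. x \<in> param_space \<Longrightarrow> cmod (f (\<psi> x)) \<le> B"
    and rep: "\<And>x. x \<in> param_space \<Longrightarrow> f (\<psi> x) = (\<integral>y. F y * K y x \<partial>?M)"
    and Fp: "integrable ?M (\<lambda>x. cmod (F x) powr p)"
    using reproducing_formula[OF p t f] unfolding F_def by blast
  have FL: "F \<in> Lpv p (weight r)" using f by (simp add: coorbit_def F_def)
  have Fm [measurable]: "F \<in> borel_measurable ?M" using FL by (simp add: Lpv_def)
  have Fx: "F x = f (\<psi> x)" if "x \<in> param_space" for x using that by (simp add: F_def dual_transform_def)
  let ?\<sigma>' = "\<sigma> / (\<sigma> - 1)"
  \<comment> \<open>Interpolation with the supremum; p < \<sigma>' makes the exponent of
    \<open>B\<close> positive.\<close>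
  have F\<sigma>: "integrable ?M (\<lambda>x. cmod (F x) powr ?\<sigma>')"
  proof (rule Bochner_Integration.integrable_bound)
    show "integrable ?M (\<lambda>x. B powr (?\<sigma>' - p) * cmod (F x) powr p)" using Fp by simp
    show "AE x in ?M. norm (cmod (F x) powr ?\<sigma>') \<le> norm (B powr (?\<sigma>' - p) * cmod (F x) powr p)"
    proof (rule AE_I2)
      fix x assume "x \<in> space ?M"
      then have "cmod (F x) \<le> B" using B Fx by simp
      then have "cmod (F x) powr (?\<sigma>' - p) * cmod (F x) powr p \<le> B powr (?\<sigma>' - p) * cmod (F x) powr p"
        using ps by (intro mult_right_mono powr_mono2) (auto simp: hoelder_dual_def)
      then show "norm (cmod (F x) powr ?\<sigma>') \<le> norm (B powr (?\<sigma>' - p) * cmod (F x) powr p)"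
        by (simp flip: powr_add)
    qed
  qed measurable
  obtain C where C: "C \<ge> 0" "\<And>H. H \<in> borel_measurable ?M \<Longrightarrow> integrable ?M (\<lambda>x. cmod (H x) powr \<sigma>) \<Longrightarrow>
      cmod (\<integral>x. F x * cnj (H x) \<partial>?M) \<le> C * (\<integral>x. cmod (H x) powr \<sigma> \<partial>?M) powr (1 / \<sigma>)"
    using Lp_functional_bound[OF s Fm F\<sigma>] by blast
  have SHm: "SH h \<in> borel_measurable ?M" and SHi: "integrable ?M (\<lambda>x. (cmod (SH h x) * weight r x) powr \<sigma>)"
    if "h \<in> ?V" for h using that by (simp_all add: test_space_iff)
  \<comment> \<open>As the weight is at least 1, the weighted test norm dominates the unweighted
    norm for which Hoelder is available.\<close>
  have le: "cmod (SH h x) powr \<sigma> \<le> (cmod (SH h x) * weight r x) powr \<sigma>" if "x \<in> space ?M" for h x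
  proof -
    have "cmod (SH h x) * 1 \<le> cmod (SH h x) * weight r x"
      using weight_ge_1[OF r, of x] that by (intro mult_left_mono) auto
    then show ?thesis using s by (intro powr_mono2) auto
  qed
  have SHi': "integrable ?M (\<lambda>x. cmod (SH h x) powr \<sigma>)" if h: "h \<in> ?V" for h
  proof (rule Bochner_Integration.integrable_bound[OF SHi[OF h]])
    show "(\<lambda>x. cmod (SH h x) powr \<sigma>) \<in> borel_measurable ?M" using SHm[OF h] by measurable
    show "AE x in ?M. norm (cmod (SH h x) powr \<sigma>) \<le> norm ((cmod (SH h x) * weight r x) powr \<sigma>)"
      using le by (intro AE_I2) simp
  qed
  have FSH: "integrable ?M (\<lambda>x. F x * cnj (SH h x))" if h: "h \<in> ?V" for h
  proof -
    have "integrable ?M (\<lambda>x. cnj (SH h x) * F x)"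
      using SHm[OF h] SHi'[OF h] by (intro integrable_mult_conj_powr[OF s _ Fm _ F\<sigma>]) auto
    then show ?thesis by (simp add: mult.commute)
  qed
  define g where "g = (\<lambda>h\<in>?V. \<integral>x. F x * cnj (SH h x) \<partial>?M)"
  have gx: "g (\<psi> x) = F x" if x: "x \<in> param_space" for x
  proof -
    have "g (\<psi> x) = (\<integral>y. F y * cnj (K x y) \<partial>?M)"
      using \<psi>_in_test_space[OF x s] by (simp add: g_def K_def)
    also have "\<dots> = F x" unfolding Fx[OF x] rep[OF x] by (simp only: K_hermitian[symmetric])
    finally show ?thesis .
  qed
  have dg: "dual_transform \<psi> g = F"
  proof
    fix x show "dual_transform \<psi> g x = F x"
      using gx[of x] by (cases "x \<in> param_space") (auto simp: dual_transform_def F_def)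
  qed
  have "g \<in> anti_dual \<psi> \<sigma> (weight r)"
    unfolding anti_dual_def mem_Collect_eq
  proof (intro conjI ballI allI)
    show "g \<in> extensional ?V" by (simp add: g_def)
    show "g (\<lambda>y. u y + w y) = g u + g w" if u: "u \<in> ?V" and w: "w \<in> ?V" for u w
    proof -
      have uw: "(\<lambda>y. u y + w y) \<in> ?V" using u w s by (intro test_space_add) auto
      have "(\<integral>x. F x * cnj (SH (\<lambda>y. u y + w y) x) \<partial>?M) = (\<integral>x. F x * cnj (SH u x) + F x * cnj (SH w x) \<partial>?M)"
        using u w by (intro Bochner_Integration.integral_cong) (auto simp: SH_add test_space_iff distrib_left)
      then show ?thesis using u w uw FSH by (simp add: g_def)
    qed
    show "g (\<lambda>y. c * u y) = cnj c * g u" if u: "u \<in> ?V" for c u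
    proof -
      have "F x * cnj (SH (\<lambda>y. c * u y) x) = cnj c * (F x * cnj (SH u x))" for x
        by (simp add: SH_scale mult_ac)
      moreover have "g (\<lambda>y. c * u y) = (\<integral>x. F x * cnj (SH (\<lambda>y. c * u y) x) \<partial>?M)"
        using test_space_scale[OF u] by (simp add: g_def)
      ultimately have "g (\<lambda>y. c * u y) = cnj c * (\<integral>x. F x * cnj (SH u x) \<partial>?M)" by (simp only: integral_mult_right_zero)
      then show ?thesis using u by (simp add: g_def)
    qed
    show "\<exists>C. \<forall>u\<in>?V. cmod (g u) \<le> C * test_norm \<psi> \<sigma> (weight r) u"
    proof (intro exI[of _ C] ballI)
      fix u assume u: "u \<in> ?V"
      have "cmod (g u) \<le> C * (\<integral>x. cmod (SH u x) powr \<sigma> \<partial>?M) powr (1 / \<sigma>)"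
        using C(2)[OF SHm[OF u] SHi'[OF u]] u by (simp add: g_def)
      also have "\<dots> \<le> C * (\<integral>x. (cmod (SH u x) * weight r x) powr \<sigma> \<partial>?M) powr (1 / \<sigma>)"
      proof (intro mult_left_mono powr_mono2)
        show "(\<integral>x. cmod (SH u x) powr \<sigma> \<partial>?M) \<le> (\<integral>x. (cmod (SH u x) * weight r x) powr \<sigma> \<partial>?M)"
          using integral_mono[OF SHi'[OF u] SHi[OF u]] le by blast
      qed (use C(1) s in \<open>auto intro!: Bochner_Integration.integral_nonneg\<close>)
      also have "\<dots> = C * test_norm \<psi> \<sigma> (weight r) u" unfolding test_norm_eq[OF u] ..
      finally show "cmod (g u) \<le> C * test_norm \<psi> \<sigma> (weight r) u" .
    qed
  qed
  then have "g \<in> coorbit \<psi> r \<sigma> p" using FL by (simp add: coorbit_def dg)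
  then show "dual_transform \<psi> f \<in> dual_transform \<psi> ` coorbit \<psi> r \<sigma> p"
    using dg by (auto simp: F_def intro!: image_eqI[of _ _ g])
qed

end

end

theorem proposition3p12:
  fixes a0 a1 r p \<sigma> \<tau> :: real
    and b :: "real ^ 'n::finite"
    and \<Phi> \<Psi> :: "real ^ 'n option \<Rightarrow> complex"
  assumes "CARD('n option) \<ge> 3" and "odd CARD('n option)"
    and "0 < a0" and "a0 < a1"
    and "\<And>i. 0 < b $ i"
    and "r \<ge> 0"
    and "\<Psi> \<in> L1_fun \<inter> L2_fun"
    and "admissible_shearlet \<Psi>"
    and "schwartz_fun \<Psi>"
    and "supp (fourier \<Psi>) \<subseteq>
           {\<xi>. \<xi> $ None \<in> {-a1..-a0} \<union> {a0..a1} \<and> (\<forall>i. vtail \<xi> $ i \<in> {- (b $ i)..b $ i})}"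
    and "\<Phi> \<in> L1_fun \<inter> L2_fun"
    and "\<And>\<xi>. fourier \<Phi> \<xi> = complex_of_real ((\<xi> $ None) ^ ((CARD('n option) - 1) div 2) *
           sqrt (LINT \<omega>1:(- {- \<bar>\<xi> $ None\<bar>..\<bar>\<xi> $ None\<bar>})|lborel.
                   (cmod (fourier \<Psi> (vcons \<omega>1 (vtail \<xi>))))\<^sup>2 / \<bar>\<omega>1\<bar> ^ CARD('n option)))"
    and "AE y in (lborel :: real measure).
           (LINT \<eta>|lborel. (cmod (fourier \<Phi> (vcons y \<eta>)))\<^sup>2 / \<bar>y\<bar> ^ (CARD('n option) - 1)) +
           (LINT \<eta>|lborel. (LINT \<xi>1:{- \<bar>y\<bar>..\<bar>y\<bar>}|lborel.
              (cmod (fourier \<Psi> (vcons \<xi>1 \<eta>)))\<^sup>2 / \<bar>\<xi>1\<bar> ^ CARD('n option))) = 1"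
    and "test_fun (fourier \<Phi>)"
    and "1 \<le> p" and "1 < \<sigma>" and "\<sigma> \<le> 2" and "1 < \<tau>" and "\<tau> \<le> 2"
    and "p < hoelder_dual \<sigma>" and "p < hoelder_dual \<tau>"
  shows "equal_under_transform (shearlet \<Phi> \<Psi>)
           (coorbit (shearlet \<Phi> \<Psi>) r \<tau> p) (coorbit (shearlet \<Phi> \<Psi>) r \<sigma> p)"
proof -
  interpret shearlet_generators \<Phi> \<Psi> a0 a1 b
  proof
    show "\<xi> $ None \<in> {-a1..-a0} \<union> {a0..a1} \<and> (\<forall>i. vtail \<xi> $ i \<in> {- (b $ i)..b $ i})"
      if "fourier \<Psi> \<xi> \<noteq> 0" for \<xi>
    proof -
      have "\<xi> \<in> supp (fourier \<Psi>)"
        unfolding supp_def using that closure_subset[of "{x. fourier \<Psi> x \<noteq> 0}"] by blast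
      then show ?thesis using assms(10) by blast
    qed
    show "integrable lborel \<Psi>" "\<Psi> \<in> L2_fun" "integrable lborel \<Phi>" "\<Phi> \<in> L2_fun"
      using assms(7,11) by (simp_all add: L1_fun_def)
  qed (fact assms)+
  show ?thesis
    unfolding equal_under_transform_def
    \<comment> \<open>The hypotheses are symmetric in \<sigma> and \<tau>, so the same inclusion is
      used in both directions.\<close>
    using coorbit_transform_subset assms by (intro subset_antisym) auto
qed

end
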